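(* Let $k$ be a field, let $\mathscr{C}\in\{\mathrm{FA},\mathrm{OA},\mathrm{CA},\mathrm{BA},\mathrm{SA}\}$, let $n\geq1$ and let $\lambda$ be an irreducible $kG_n$-module. If $\lambda$ is regular, then the $\mathscr{C}$-module $\overline{\Delta}_{n,\lambda}$ is irreducible. If $\lambda$ is singular, then $\overline{\Delta}_{n,\lambda}$ has length $2$.
   Context: For $n\geq1$ put $[n]=\{1,\dots,n\}$. All five categories have objects $[n]$, $n\in\mathbb{Z}_{+}=\{1,2,\dots\}$, and morphisms: $\mathrm{FA}$: all maps; $\mathrm{OA}$ (simplex category): weakly order-preserving maps; $\mathrm{CA}$: maps preserving the cyclic order, i.e. maps $\sigma\circ g\circ\rho$ with $\rho,\sigma$ rotations (powers of the standard cyclic permutation) of source and target and $g$ weakly order-preserving; $\mathrm{BA}$: maps preserving linear betweenness, i.e. weakly order-preserving or weakly order-reversing maps; $\mathrm{SA}$: maps preserving the separation relation, i.e. maps $f:[m]\to[n]$ such that $f$ or its composite with the reversal $i\mapsto n+1-i$ of $[n]$ lies in $\mathrm{CA}$. $G_n$ is the automorphism group of $[n]$ in $\mathscr{C}$, and $\mathrm{Irr}(G_n)$ is a complete set of non-isomorphic irreducible $kG_n$-modules. A $\mathscr{C}$-module is a covariant functor $\mathscr{C}\to k\text{-}\mathrm{Mod}$. The standard module $\Delta_n$ is the quotient of the representable functor $P_n=k\mathscr{C}(n,-)$ by the submodule spanned by all non-injective morphisms with source $[n]$; $G_n$ acts on it from the right by precomposition. For $\lambda\in\mathrm{Irr}(G_n)$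 let $e_\lambda\in kG_n$ be a primitive idempotent such that $kG_ne_\lambda$ is the projective cover of $\lambda$, and set $\Delta_{n,\lambda}=\Delta_n\otimes_{kG_n}kG_ne_\lambda$ and $\overline{\Delta}_{n,\lambda}=\Delta_n\otimes_{kG_n}\lambda$. Call $\lambda\in\mathrm{Irr}(G_n)$ singular if there exists a nonzero homomorphism $\Delta_{n+1}\to\Delta_{n,\lambda}$ of $\mathscr{C}$-modules, and regular otherwise. *)

theory Defs
  imports "HOL-Algebra.Module" "HOL-Algebra.AbelCoset"
begin

section \<open>The five categories\<close>

text \<open>
  Maps \<open>[m] \<rightarrow> [n]\<close> are represented as elements of \<open>{1..m} \<rightarrow>\<^sub>E {1..n}\<close>, i.e. they take the value
  \<open>undefined\<close> outside \<open>[m]\<close>, so that equality of functions is equality of maps.  The composite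
  \<open>g \<circ> f\<close> of \<open>f\<close> with source \<open>[m]\<close> and \<open>g\<close> is \<open>compose {1..m} g f\<close>.
\<close>

datatype cat = FA | OA | CA | BA | SA

definition all_maps :: "nat \<Rightarrow> nat \<Rightarrow> (nat \<Rightarrow> nat) set" where
  "all_maps m n = {1..m} \<rightarrow>\<^sub>E {1..n}"

definition idm :: "nat \<Rightarrow> nat \<Rightarrow> nat" where
  "idm n = (\<lambda>i\<in>{1..n}. i)"

definition cyc :: "nat \<Rightarrow> nat \<Rightarrow> nat" where
  "cyc n = (\<lambda>i\<in>{1..n}. if i = n then 1 else i + 1)"

definition rotations :: "nat \<Rightarrow> (nat \<Rightarrow> nat) set" where
  "rotations n = {restrict (cyc n ^^ j) {1..n} | j. True}"

definition reversal :: "nat \<Rightarrow> nat \<Rightarrow> nat" where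
  "reversal n = (\<lambda>i\<in>{1..n}. n + 1 - i)"

definition OA_maps :: "nat \<Rightarrow> nat \<Rightarrow> (nat \<Rightarrow> nat) set" where
  "OA_maps m n = {f \<in> all_maps m n. mono_on {1..m} f}"

definition CA_maps :: "nat \<Rightarrow> nat \<Rightarrow> (nat \<Rightarrow> nat) set" where
  "CA_maps m n = {compose {1..m} s (compose {1..m} g r) | s g r.
     s \<in> rotations n \<and> g \<in> OA_maps m n \<and> r \<in> rotations m}"

definition BA_maps :: "nat \<Rightarrow> nat \<Rightarrow> (nat \<Rightarrow> nat) set" where
  "BA_maps m n = {f \<in> all_maps m n. mono_on {1..m} f \<or> antimono_on {1..m} f}"

definition SA_maps :: "nat \<Rightarrow> nat \<Rightarrow> (nat \<Rightarrow> nat) set" where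
  "SA_maps m n = {f \<in> all_maps m n. f \<in> CA_maps m n \<or> compose {1..m} (reversal n) f \<in> CA_maps m n}"

fun Hom :: "cat \<Rightarrow> nat \<Rightarrow> nat \<Rightarrow> (nat \<Rightarrow> nat) set" where
  "Hom FA m n = all_maps m n"
| "Hom OA m n = OA_maps m n"
| "Hom CA m n = CA_maps m n"
| "Hom BA m n = BA_maps m n"
| "Hom SA m n = SA_maps m n"

definition End_monoid :: "cat \<Rightarrow> nat \<Rightarrow> (nat \<Rightarrow> nat) monoid" where
  "End_monoid C n = \<lparr>carrier = Hom C n n, mult = compose {1..n}, one = idm n\<rparr>"

definition Aut_grp :: "cat \<Rightarrow> nat \<Rightarrow> (nat \<Rightarrow> nat) monoid" where
  "Aut_grp C n = units_of (End_monoid C n)"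

section \<open>Left modules over a ring\<close>

text \<open>
  The library locale \<open>module\<close> requires a commutative ring; group algebras need not be commutative.
  The records \<open>module\<close> extend \<open>ring\<close>; their fields \<open>mult\<close> and \<open>one\<close> carry no information here.
  The library predicate \<open>submodule W R M\<close> makes sense over arbitrary \<open>R\<close>.
\<close>

locale lmodule = R?: ring R + M?: abelian_group M
  for R (structure) and M :: "('r, 'v, 'm) module_scheme" (structure) +
  assumes lsmult_closed: "\<lbrakk>a \<in> carrier R; x \<in> carrier M\<rbrakk> \<Longrightarrow> a \<odot>\<^bsub>M\<^esub> x \<in> carrier M"
    and lsmult_l_distr: "\<lbrakk>a \<in> carrier R; b \<in> carrier R; x \<in> carrier M\<rbrakk> \<Longrightarrow>
      (a \<oplus>\<^bsub>R\<^esub> b) \<odot>\<^bsub>M\<^esub> x = a \<odot>\<^bsub>M\<^esub> x \<oplus>\<^bsub>M\<^esub> b \<odot>\<^bsub>M\<^esub> x"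
    and lsmult_r_distr: "\<lbrakk>a \<in> carrier R; x \<in> carrier M; y \<in> carrier M\<rbrakk> \<Longrightarrow>
      a \<odot>\<^bsub>M\<^esub> (x \<oplus>\<^bsub>M\<^esub> y) = a \<odot>\<^bsub>M\<^esub> x \<oplus>\<^bsub>M\<^esub> a \<odot>\<^bsub>M\<^esub> y"
    and lsmult_assoc: "\<lbrakk>a \<in> carrier R; b \<in> carrier R; x \<in> carrier M\<rbrakk> \<Longrightarrow>
      (a \<otimes>\<^bsub>R\<^esub> b) \<odot>\<^bsub>M\<^esub> x = a \<odot>\<^bsub>M\<^esub> (b \<odot>\<^bsub>M\<^esub> x)"
    and lsmult_one: "x \<in> carrier M \<Longrightarrow> \<one>\<^bsub>R\<^esub> \<odot>\<^bsub>M\<^esub> x = x"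

definition irreducible_lmodule ::
  "('r, 'q) ring_scheme \<Rightarrow> ('r, 'v, 'm) module_scheme \<Rightarrow> bool" where
  "irreducible_lmodule R M \<longleftrightarrow> lmodule R M \<and> carrier M \<noteq> {\<zero>\<^bsub>M\<^esub>} \<and>
     (\<forall>W. submodule W R M \<longrightarrow> W = {\<zero>\<^bsub>M\<^esub>} \<or> W = carrier M)"

definition linear_maps ::
  "('r, 'q) ring_scheme \<Rightarrow> ('r, 'v, 'm) module_scheme \<Rightarrow> ('r, 'w, 'n) module_scheme \<Rightarrow> ('v \<Rightarrow> 'w) set"
  where
  "linear_maps R M N = {h \<in> carrier M \<rightarrow> carrier N.
     (\<forall>x\<in>carrier M. \<forall>y\<in>carrier M. h (x \<oplus>\<^bsub>M\<^esub> y) = h x \<oplus>\<^bsub>N\<^esub> h y) \<and>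
     (\<forall>a\<in>carrier R. \<forall>x\<in>carrier M. h (a \<odot>\<^bsub>M\<^esub> x) = a \<odot>\<^bsub>N\<^esub> h x)}"

definition mspan :: "('r, 'q) ring_scheme \<Rightarrow> ('r, 'v, 'm) module_scheme \<Rightarrow> 'v set \<Rightarrow> 'v set" where
  "mspan R M S = \<Inter>{W. submodule W R M \<and> S \<subseteq> W}"

definition quot_mod :: "('r, 'v, 'm) module_scheme \<Rightarrow> 'v set \<Rightarrow> ('r, 'v set) module" where
  "quot_mod M W = \<lparr>carrier = a_rcosets\<^bsub>M\<^esub> W, mult = undefined, one = undefined,
     zero = W, add = (\<lambda>X Y. X <+>\<^bsub>M\<^esub> Y), smult = (\<lambda>a X. \<Union>x\<in>X. W +>\<^bsub>M\<^esub> (a \<odot>\<^bsub>M\<^esub> x))\<rparr>"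

text \<open>
  The lifting property is tested on modules whose elements live in the (arbitrarily large)
  type \<open>'b\<close>.  If \<open>'b\<close> is infinite and at least as large as \<open>R\<close> and \<open>P\<close>, then the canonical surjection
  onto \<open>P\<close> from the free module on the set \<open>P\<close> is among the tests up to isomorphism, and the
  notion is the usual one.
\<close>

definition projective_lmodule ::
  "'b itself \<Rightarrow> ('r, 'q) ring_scheme \<Rightarrow> ('r, 'v, 'm) module_scheme \<Rightarrow> bool" where
  "projective_lmodule _ R P \<longleftrightarrow> lmodule R P \<and>
     (\<forall>(A :: ('r, 'b) module) (B :: ('r, 'b) module) p f.
        lmodule R A \<and> lmodule R B \<and> p \<in> linear_maps R A B \<and> p ` carrier A = carrier B \<and>
        f \<in> linear_maps R P B \<longrightarrow>
        (\<exists>h\<in>linear_maps R P A. \<forall>x\<in>carrier P. p (h x) = f x))"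

definition projective_cover ::
  "('r, 'q) ring_scheme \<Rightarrow> ('r, 'v, 'm) module_scheme \<Rightarrow> ('r, 'w, 'n) module_scheme \<Rightarrow>
   ('v \<Rightarrow> 'w) \<Rightarrow> bool" where
  "projective_cover R P L p \<longleftrightarrow> projective_lmodule TYPE('v) R P \<and>
     p \<in> linear_maps R P L \<and> p ` carrier P = carrier L \<and>
     (\<forall>U. submodule U R P \<and> U <+>\<^bsub>P\<^esub> a_kernel P L p = carrier P \<longrightarrow> U = carrier P)"

definition primitive_idempotent :: "('r, 'q) ring_scheme \<Rightarrow> 'r \<Rightarrow> bool" where
  "primitive_idempotent R e \<longleftrightarrow> e \<in> carrier R \<and> e \<noteq> \<zero>\<^bsub>R\<^esub> \<and> e \<otimes>\<^bsub>R\<^esub> e = e \<and>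
     \<not> (\<exists>a\<in>carrier R. \<exists>b\<in>carrier R. a \<noteq> \<zero>\<^bsub>R\<^esub> \<and> b \<noteq> \<zero>\<^bsub>R\<^esub> \<and>
          a \<otimes>\<^bsub>R\<^esub> a = a \<and> b \<otimes>\<^bsub>R\<^esub> b = b \<and> a \<otimes>\<^bsub>R\<^esub> b = \<zero>\<^bsub>R\<^esub> \<and> b \<otimes>\<^bsub>R\<^esub> a = \<zero>\<^bsub>R\<^esub> \<and>
          e = a \<oplus>\<^bsub>R\<^esub> b)"

definition left_ideal :: "('r, 'q) ring_scheme \<Rightarrow> 'r \<Rightarrow> ('r, 'r) module" where
  "left_ideal R e = \<lparr>carrier = {a \<otimes>\<^bsub>R\<^esub> e | a. a \<in> carrier R}, mult = undefined, one = undefined,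
     zero = \<zero>\<^bsub>R\<^esub>, add = (\<lambda>x y. x \<oplus>\<^bsub>R\<^esub> y), smult = (\<lambda>a x. a \<otimes>\<^bsub>R\<^esub> x)\<rparr>"

section \<open>Free modules and group algebras\<close>

text \<open>The free \<open>K\<close>-module on a set \<open>X\<close>: finitely supported functions vanishing outside \<open>X\<close>.\<close>

definition free_mod :: "('k, 'q) ring_scheme \<Rightarrow> 'x set \<Rightarrow> ('k, 'x \<Rightarrow> 'k) module" where
  "free_mod K X = \<lparr>carrier = {a. (\<forall>x. a x \<in> carrier K) \<and> finite {x. a x \<noteq> \<zero>\<^bsub>K\<^esub>} \<and>
                                (\<forall>x. x \<notin> X \<longrightarrow> a x = \<zero>\<^bsub>K\<^esub>)},
     mult = undefined, one = undefined, zero = (\<lambda>_. \<zero>\<^bsub>K\<^esub>),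
     add = (\<lambda>a b x. a x \<oplus>\<^bsub>K\<^esub> b x), smult = (\<lambda>c a x. c \<otimes>\<^bsub>K\<^esub> a x)\<rparr>"

definition basis :: "('k, 'q) ring_scheme \<Rightarrow> 'x \<Rightarrow> 'x \<Rightarrow> 'k" where
  "basis K x = (\<lambda>y. if y = x then \<one>\<^bsub>K\<^esub> else \<zero>\<^bsub>K\<^esub>)"

text \<open>The linear extension \<open>\<Sum> a\<^sub>x x \<mapsto> \<Sum> a\<^sub>x \<phi>(x)\<close> of a map \<open>\<phi>\<close> between bases.\<close>

definition free_map ::
  "('k, 'q) ring_scheme \<Rightarrow> ('x \<Rightarrow> 'y) \<Rightarrow> ('x \<Rightarrow> 'k) \<Rightarrow> 'y \<Rightarrow> 'k" where
  "free_map K \<phi> a = (\<lambda>y. \<Oplus>\<^bsub>K\<^esub>x\<in>{x. a x \<noteq> \<zero>\<^bsub>K\<^esub> \<and> \<phi> x = y}. a x)"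

text \<open>The bilinear extension \<open>(\<Sum> a\<^sub>x x, \<Sum> b\<^sub>y y) \<mapsto> \<Sum> a\<^sub>x b\<^sub>y \<psi>(x,y)\<close> of a map \<open>\<psi>\<close> between bases.\<close>

definition free_bimap ::
  "('k, 'q) ring_scheme \<Rightarrow> ('x \<Rightarrow> 'y \<Rightarrow> 'z) \<Rightarrow> ('x \<Rightarrow> 'k) \<Rightarrow> ('y \<Rightarrow> 'k) \<Rightarrow> 'z \<Rightarrow> 'k" where
  "free_bimap K \<psi> a b = (\<lambda>z.
     \<Oplus>\<^bsub>K\<^esub>p\<in>{(x, y). a x \<noteq> \<zero>\<^bsub>K\<^esub> \<and> b y \<noteq> \<zero>\<^bsub>K\<^esub> \<and> \<psi> x y = z}. a (fst p) \<otimes>\<^bsub>K\<^esub> b (snd p))"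

definition group_algebra ::
  "('k, 'q) ring_scheme \<Rightarrow> ('g, 'p) monoid_scheme \<Rightarrow> ('g \<Rightarrow> 'k) ring" where
  "group_algebra K G = \<lparr>carrier = carrier (free_mod K (carrier G)),
     mult = free_bimap K (\<lambda>g h. g \<otimes>\<^bsub>G\<^esub> h), one = basis K \<one>\<^bsub>G\<^esub>,
     zero = \<zero>\<^bsub>free_mod K (carrier G)\<^esub>, add = (\<lambda>a b. a \<oplus>\<^bsub>free_mod K (carrier G)\<^esub> b)\<rparr>"

abbreviation kG :: "('k, 'q) ring_scheme \<Rightarrow> cat \<Rightarrow> nat \<Rightarrow> ((nat \<Rightarrow> nat) \<Rightarrow> 'k) ring" where
  "kG K C n \<equiv> group_algebra K (Aut_grp C n)"

section \<open>Modules over the categories\<close>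

text \<open>
  A functor to \<open>K\<close>-modules: \<open>sp M m\<close> is its value at \<open>[m]\<close>, and \<open>act M m l f\<close> its value at
  \<open>f : [m] \<rightarrow> [l]\<close>.  The objects are the \<open>[m]\<close> with \<open>m \<ge> 1\<close>; values at \<open>m = 0\<close> are irrelevant.
\<close>

record ('k, 'v) cmod =
  sp :: "nat \<Rightarrow> ('k, 'v) module"
  act :: "nat \<Rightarrow> nat \<Rightarrow> (nat \<Rightarrow> nat) \<Rightarrow> 'v \<Rightarrow> 'v"

definition is_cmod :: "('k, 'q) ring_scheme \<Rightarrow> cat \<Rightarrow> ('k, 'v) cmod \<Rightarrow> bool" where
  "is_cmod K C M \<longleftrightarrow>
     (\<forall>m\<ge>1. module K (sp M m)) \<and>
     (\<forall>m\<ge>1. \<forall>l\<ge>1. \<forall>f\<in>Hom C m l. act M m l f \<in> linear_maps K (sp M m) (sp M l)) \<and>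
     (\<forall>m\<ge>1. \<forall>x\<in>carrier (sp M m). act M m m (idm m) x = x) \<and>
     (\<forall>m\<ge>1. \<forall>l\<ge>1. \<forall>p\<ge>1. \<forall>f\<in>Hom C m l. \<forall>g\<in>Hom C l p. \<forall>x\<in>carrier (sp M m).
        act M m p (compose {1..m} g f) x = act M l p g (act M m l f x))"

definition cmod_homs ::
  "('k, 'q) ring_scheme \<Rightarrow> cat \<Rightarrow> ('k, 'v) cmod \<Rightarrow> ('k, 'w) cmod \<Rightarrow> (nat \<Rightarrow> 'v \<Rightarrow> 'w) set" where
  "cmod_homs K C M N = {\<phi>.
     (\<forall>m\<ge>1. \<phi> m \<in> linear_maps K (sp M m) (sp N m)) \<and>
     (\<forall>m\<ge>1. \<forall>l\<ge>1. \<forall>f\<in>Hom C m l. \<forall>x\<in>carrier (sp M m).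
        \<phi> l (act M m l f x) = act N m l f (\<phi> m x))}"

definition subcmod ::
  "('k, 'q) ring_scheme \<Rightarrow> cat \<Rightarrow> (nat \<Rightarrow> 'v set) \<Rightarrow> ('k, 'v) cmod \<Rightarrow> bool" where
  "subcmod K C W M \<longleftrightarrow>
     (\<forall>m\<ge>1. submodule (W m) K (sp M m)) \<and>
     (\<forall>m\<ge>1. \<forall>l\<ge>1. \<forall>f\<in>Hom C m l. \<forall>x\<in>W m. act M m l f x \<in> W l)"

definition restrict_cmod :: "('k, 'v) cmod \<Rightarrow> (nat \<Rightarrow> 'v set) \<Rightarrow> ('k, 'v) cmod" where
  "restrict_cmod M W = \<lparr>sp = (\<lambda>m. (sp M m)\<lparr>carrier := W m\<rparr>), act = act M\<rparr>"

definition quot_cmod :: "('k, 'v) cmod \<Rightarrow> (nat \<Rightarrow> 'v set) \<Rightarrow> ('k, 'v set) cmod" where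
  "quot_cmod M W = \<lparr>sp = (\<lambda>m. quot_mod (sp M m) (W m)),
     act = (\<lambda>m l f X. \<Union>x\<in>X. W l +>\<^bsub>sp M l\<^esub> act M m l f x)\<rparr>"

definition irreducible_cmod :: "('k, 'q) ring_scheme \<Rightarrow> cat \<Rightarrow> ('k, 'v) cmod \<Rightarrow> bool" where
  "irreducible_cmod K C M \<longleftrightarrow> is_cmod K C M \<and>
     (\<exists>m\<ge>1. carrier (sp M m) \<noteq> {\<zero>\<^bsub>sp M m\<^esub>}) \<and>
     (\<forall>W. subcmod K C W M \<longrightarrow>
        (\<forall>m\<ge>1. W m = {\<zero>\<^bsub>sp M m\<^esub>}) \<or> (\<forall>m\<ge>1. W m = carrier (sp M m)))"

definition has_length :: "('k, 'q) ring_scheme \<Rightarrow> cat \<Rightarrow> ('k, 'v) cmod \<Rightarrow> nat \<Rightarrow> bool" where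
  "has_length K C M l \<longleftrightarrow> is_cmod K C M \<and>
     (\<exists>W :: nat \<Rightarrow> nat \<Rightarrow> 'v set.
        (\<forall>i\<le>l. subcmod K C (W i) M) \<and>
        (\<forall>m\<ge>1. W 0 m = {\<zero>\<^bsub>sp M m\<^esub>}) \<and> (\<forall>m\<ge>1. W l m = carrier (sp M m)) \<and>
        (\<forall>i<l. (\<forall>m\<ge>1. W i m \<subseteq> W (Suc i) m) \<and>
           irreducible_cmod K C (quot_cmod (restrict_cmod M (W (Suc i))) (W i))))"

section \<open>Standard modules\<close>

definition P_mod :: "('k, 'q) ring_scheme \<Rightarrow> cat \<Rightarrow> nat \<Rightarrow> ('k, (nat \<Rightarrow> nat) \<Rightarrow> 'k) cmod" where
  "P_mod K C n = \<lparr>sp = (\<lambda>m. free_mod K (Hom C n m)),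
     act = (\<lambda>m l f. free_map K (\<lambda>g. compose {1..n} f g))\<rparr>"

definition noninj_part ::
  "('k, 'q) ring_scheme \<Rightarrow> cat \<Rightarrow> nat \<Rightarrow> nat \<Rightarrow> ((nat \<Rightarrow> nat) \<Rightarrow> 'k) set" where
  "noninj_part K C n m = mspan K (free_mod K (Hom C n m))
     {basis K g | g. g \<in> Hom C n m \<and> \<not> inj_on g {1..n}}"

definition Delta ::
  "('k, 'q) ring_scheme \<Rightarrow> cat \<Rightarrow> nat \<Rightarrow> ('k, ((nat \<Rightarrow> nat) \<Rightarrow> 'k) set) cmod" where
  "Delta K C n = quot_cmod (P_mod K C n) (noninj_part K C n)"

text \<open>The right action of \<open>b \<in> kG\<^sub>n\<close> on \<open>\<Delta>\<^sub>n[m]\<close>, induced by precomposition.\<close>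

definition Delta_ract ::
  "('k, 'q) ring_scheme \<Rightarrow> cat \<Rightarrow> nat \<Rightarrow> nat \<Rightarrow> ((nat \<Rightarrow> nat) \<Rightarrow> 'k) set \<Rightarrow> ((nat \<Rightarrow> nat) \<Rightarrow> 'k) \<Rightarrow>
   ((nat \<Rightarrow> nat) \<Rightarrow> 'k) set" where
  "Delta_ract K C n m X b =
     (\<Union>a\<in>X. noninj_part K C n m +>\<^bsub>free_mod K (Hom C n m)\<^esub> free_bimap K (compose {1..n}) a b)"

text \<open>
  Tensor product over \<open>R\<close> of a \<open>K\<close>-module \<open>A\<close> with a right action \<open>\<rho>\<close> of the \<open>K\<close>-algebra \<open>R\<close>, and a left
  \<open>R\<close>-module \<open>L\<close>: the free \<open>K\<close>-module on \<open>A \<times> L\<close> modulo biadditivity, \<open>K\<close>-linearity in the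
  first argument and \<open>R\<close>-balancedness.  (The \<open>K\<close>-linearity in the second argument is a special
  case of balancedness, \<open>K\<close> acting on \<open>L\<close> through \<open>K \<rightarrow> R\<close>.)
\<close>

definition tensor_relators ::
  "('k, 'q) ring_scheme \<Rightarrow> ('r, 'p) ring_scheme \<Rightarrow> ('k, 'a, 'm) module_scheme \<Rightarrow> ('a \<Rightarrow> 'r \<Rightarrow> 'a) \<Rightarrow>
   ('r, 'v, 'n) module_scheme \<Rightarrow> ('a \<times> 'v \<Rightarrow> 'k) set" where
  "tensor_relators K R A \<rho> L =
   (let F = free_mod K (carrier A \<times> carrier L); d = (\<lambda>x v. basis K (x, v)) in
     {d (x \<oplus>\<^bsub>A\<^esub> y) v \<ominus>\<^bsub>F\<^esub> (d x v \<oplus>\<^bsub>F\<^esub> d y v) | x y v.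
        x \<in> carrier A \<and> y \<in> carrier A \<and> v \<in> carrier L} \<union>
     {d x (v \<oplus>\<^bsub>L\<^esub> w) \<ominus>\<^bsub>F\<^esub> (d x v \<oplus>\<^bsub>F\<^esub> d x w) | x v w.
        x \<in> carrier A \<and> v \<in> carrier L \<and> w \<in> carrier L} \<union>
     {d (c \<odot>\<^bsub>A\<^esub> x) v \<ominus>\<^bsub>F\<^esub> c \<odot>\<^bsub>F\<^esub> d x v | c x v.
        c \<in> carrier K \<and> x \<in> carrier A \<and> v \<in> carrier L} \<union>
     {d (\<rho> x b) v \<ominus>\<^bsub>F\<^esub> d x (b \<odot>\<^bsub>L\<^esub> v) | x b v.
        x \<in> carrier A \<and> b \<in> carrier R \<and> v \<in> carrier L})"

definition tensor_cmod ::
  "('k, 'q) ring_scheme \<Rightarrow> ('r, 'p) ring_scheme \<Rightarrow> ('k, 'a) cmod \<Rightarrow> (nat \<Rightarrow> 'a \<Rightarrow> 'r \<Rightarrow> 'a) \<Rightarrow>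
   ('r, 'v) module \<Rightarrow> ('k, ('a \<times> 'v \<Rightarrow> 'k) set) cmod" where
  "tensor_cmod K R M \<rho> L = quot_cmod
     \<lparr>sp = (\<lambda>m. free_mod K (carrier (sp M m) \<times> carrier L)),
      act = (\<lambda>m l f. free_map K (\<lambda>(x, v). (act M m l f x, v)))\<rparr>
     (\<lambda>m. mspan K (free_mod K (carrier (sp M m) \<times> carrier L))
            (tensor_relators K R (sp M m) (\<rho> m) L))"

definition Delta_tensor ::
  "('k, 'q) ring_scheme \<Rightarrow> cat \<Rightarrow> nat \<Rightarrow> ((nat \<Rightarrow> nat) \<Rightarrow> 'k, 'v) module \<Rightarrow>
   ('k, (((nat \<Rightarrow> nat) \<Rightarrow> 'k) set \<times> 'v \<Rightarrow> 'k) set) cmod" where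
  "Delta_tensor K C n L = tensor_cmod K (kG K C n) (Delta K C n) (Delta_ract K C n) L"

text \<open>
  For \<open>e = e\<^sub>\<lambda>\<close>, the module \<open>\<Delta>\<^sub>n\<^sub>,\<^sub>\<lambda>\<close> is \<open>Delta_tensor K C n (left_ideal (kG K C n) e)\<close>, and
  \<open>Delta_tensor K C n \<lambda>\<close> is \<open>\<Delta>\<^sub>n\<^sub>,\<^sub>\<lambda>\<close> with a bar.
\<close>

definition is_e_lambda ::
  "('k, 'q) ring_scheme \<Rightarrow> cat \<Rightarrow> nat \<Rightarrow> ((nat \<Rightarrow> nat) \<Rightarrow> 'k, 'v) module \<Rightarrow>
   ((nat \<Rightarrow> nat) \<Rightarrow> 'k) \<Rightarrow> bool" where
  "is_e_lambda K C n L e \<longleftrightarrow> primitive_idempotent (kG K C n) e \<and>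
     (\<exists>p. projective_cover (kG K C n) (left_ideal (kG K C n) e) L p)"

text \<open>Singularity of \<open>\<lambda>\<close>, in terms of the chosen idempotent \<open>e = e\<^sub>\<lambda>\<close>.\<close>

definition singular ::
  "('k, 'q) ring_scheme \<Rightarrow> cat \<Rightarrow> nat \<Rightarrow> ((nat \<Rightarrow> nat) \<Rightarrow> 'k) \<Rightarrow> bool" where
  "singular K C n e \<longleftrightarrow>
     (\<exists>\<phi> \<in> cmod_homs K C (Delta K C (n + 1)) (Delta_tensor K C n (left_ideal (kG K C n) e)).
        \<exists>m\<ge>1. \<exists>x\<in>carrier (sp (Delta K C (n + 1)) m).
          \<phi> m x \<noteq> \<zero>\<^bsub>sp (Delta_tensor K C n (left_ideal (kG K C n) e)) m\<^esub>)"

abbreviation regular ::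
  "('k, 'q) ring_scheme \<Rightarrow> cat \<Rightarrow> nat \<Rightarrow> ((nat \<Rightarrow> nat) \<Rightarrow> 'k) \<Rightarrow> bool" where
  "regular K C n e \<equiv> \<not> singular K C n e"

end

theory Submission
  imports Defs
begin

text \<open>
  Every map of one of the five categories is an order-preserving map after an automorphism of its
  source.  Hence an injective map \<open>[n] \<rightarrow> [m]\<close> is a strictly increasing map after an element of \<open>G\<^sub>n\<close>,
  and \<open>\<Delta>\<^sub>n \<otimes> L\<close> at \<open>[m]\<close> is a direct sum of copies of \<open>L\<close> indexed by the strictly increasing maps
  \<open>i : [n] \<rightarrow> [m]\<close>.

  Let \<open>L\<close> be irreducible.  A submodule of \<open>\<Delta>\<^sub>n \<otimes> L\<close> is everything if it is nonzero at \<open>[n]\<close>; otherwise it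
  lies in the radical, the set of elements killed by all maps to \<open>[n]\<close>.  An element of the radical is
  determined by its coordinates at the \<open>i\<close> with \<open>i(1) \<noteq> 1\<close>, and these are detected by order-preserving
  maps to \<open>[n+1]\<close>.  At \<open>[n+1]\<close> the radical consists of alternating sums \<open>D u\<close> of the elements
  \<open>[\<delta>\<^sub>i] \<otimes> u\<close>.  Writing \<open>g \<circ> \<delta>\<^sub>i = \<delta>\<^bsub>g(i)\<^esub> \<circ> g\<^sub>i\<close> for \<open>g \<in> G\<^bsub>n+1\<^esub>\<close>, the element \<open>D u\<close> lies in the radical if and
  only if, up to sign, \<open>g\<^sub>i u\<close> is independent of \<open>i\<close> for all \<open>g\<close>.  The vectors \<open>u\<close> with this property form a
  submodule \<open>Z(L)\<close>.  As every element of \<open>G\<^sub>n\<close> occurs among the \<open>g\<^sub>i\<close>, the radical is irreducible if \<open>Z(L)\<close>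
  is nonzero, and it is zero otherwise.

  Homomorphisms from \<open>\<Delta>\<^bsub>n+1\<^esub>\<close> to \<open>\<Delta>\<^sub>n \<otimes> L\<close> correspond to \<open>Z(L)\<close> for every \<open>L\<close>, so it remains to compare
  \<open>Z(kGe)\<close> and \<open>Z(\<lambda>)\<close>.  If \<open>x \<in> Z(kGe)\<close> is nonzero, the symmetry of the trace form of \<open>kG\<close> gives
  \<open>y \<in> kG x\<close> with \<open>e y \<noteq> 0\<close>.  The kernel of right multiplication by \<open>y\<close> on \<open>kGe\<close> is then a proper submodule,
  hence contained in the kernel of \<open>kGe \<rightarrow> \<lambda>\<close>, which shows \<open>Z(\<lambda>) = \<lambda>\<close>.  Conversely, if \<open>Z(\<lambda>) = \<lambda>\<close>, let \<open>N\<close> be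
  the group of elements acting on \<open>\<lambda>\<close> by scalars \<open>\<chi>\<close>.  For \<open>s = \<Sum>\<^sub>h \<chi>(h)\<^sup>-\<^sup>1 h\<close>, the sum over \<open>h \<in> N\<close>, the element
  \<open>s e\<close> lies in \<open>Z(kGe)\<close>, and it is nonzero because \<open>e\<close> does not annihilate \<open>\<lambda>\<close>.
\<close>

text \<open>The field is arbitrary, so \<open>kG\<close> need not be semisimple and \<lambda> need
  not be absolutely irreducible. Sending a module to its \<open>ZL\<close> is only left exact, so
  the values at \<lambda> and at its projective cover cannot be compared for formal reasons. Behind
  the comparison stands the fact that group algebras are symmetric, so that the projective cover of
  \<lambda> also has socle \<lambda>. Socles are avoided: a nonzero element of \<open>ZL\<close> of
  \<open>kGe\<close> yields an endomorphism of \<open>kGe\<close> whose image lies in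
  \<open>ZL\<close> and has top \<lambda>; conversely an element of \<open>ZL\<close> of
  \<open>kGe\<close> is written down explicitly. The signs come from the simplex category. An
  order-preserving map that glues \<open>i\<close> and \<open>i+1\<close> has the same composite
  with the cofaces omitting \<open>i\<close> and \<open>i+1\<close>, so a combination of cofaces
  that dies under all such maps must alternate. Nontrivial automorphisms disturb the signs and act
  on the vectors as well, and the conditions defining \<open>ZL\<close> measure this. For
  \<open>OA\<close> all groups are trivial and \<open>ZL\<close> is the whole module.\<close>

declare One_nat_def [simp del]

section \<open>Maps of the five categories\<close>

lemma all_mapsI: "\<lbrakk>\<And>i. i \<in> {1..m} \<Longrightarrow> f i \<in> {1..n}; f \<in> extensional {1..m}\<rbrakk> \<Longrightarrow> f \<in> all_maps m n"
  by (auto simp: all_maps_def PiE_def)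

lemma all_maps_mem: "f \<in> all_maps m n \<Longrightarrow> i \<in> {1..m} \<Longrightarrow> f i \<in> {1..n}"
  unfolding all_maps_def by (rule PiE_mem)

lemma all_maps_ext: "f \<in> all_maps m n \<Longrightarrow> f \<in> extensional {1..m}"
  by (simp add: all_maps_def PiE_def)

lemma all_maps_eqI:
  "\<lbrakk>f \<in> all_maps m n; g \<in> all_maps m l; \<And>i. i \<in> {1..m} \<Longrightarrow> f i = g i\<rbrakk> \<Longrightarrow> f = g"
  by (meson all_maps_ext extensionalityI)

lemma restrict_all_maps: "(\<And>i. i \<in> {1..m} \<Longrightarrow> f i \<in> {1..n}) \<Longrightarrow> restrict f {1..m} \<in> all_maps m n"
  by (rule all_mapsI) auto

lemma compose_all_maps:
  "\<lbrakk>f \<in> all_maps m l; g \<in> all_maps l p\<rbrakk> \<Longrightarrow> compose {1..m} g f \<in> all_maps m p"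
  by (rule all_mapsI) (auto simp: compose_eq dest!: all_maps_mem)

lemma finite_all_maps: "finite (all_maps m n)"
  unfolding all_maps_def by (rule finite_PiE) auto

lemma cyc_pow: "i \<in> {1..n} \<Longrightarrow> (cyc n ^^ j) i = (i - 1 + j) mod n + 1"
proof (induction j)
  case (Suc j)
  then have n: "n > 0" by auto
  have "(i - 1 + j) mod n + 1 \<in> {1..n}" using mod_less_divisor[OF n, of "i - 1 + j"] by simp
  moreover have "(i - 1 + Suc j) mod n = (if Suc ((i - 1 + j) mod n) = n then 0 else Suc ((i - 1 + j) mod n))"
    by (simp add: mod_Suc)
  ultimately show ?case using Suc by (simp add: cyc_def)
qed auto

lemma cyc_pow_mem: "i \<in> {1..n} \<Longrightarrow> (cyc n ^^ j) i \<in> {1..n}"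
proof -
  assume i: "i \<in> {1..n}"
  then have "(i - 1 + j) mod n < n" by auto
  then have "(i - 1 + j) mod n + 1 \<in> {1..n}" by simp
  then show ?thesis by (simp only: cyc_pow[OF i])
qed

lemma cyc_pow_inj: "inj_on (cyc n ^^ j) {1..n}"
proof (induction j)
  case (Suc j)
  have "inj_on (cyc n) {1..n}" by (auto simp: inj_on_def cyc_def split: if_splits)
  moreover have "(cyc n ^^ j) ` {1..n} \<subseteq> {1..n}" using cyc_pow_mem by blast
  ultimately have "inj_on (cyc n \<circ> (cyc n ^^ j)) {1..n}"
    using Suc by (blast intro: comp_inj_on inj_on_subset)
  then show ?case by (simp add: comp_def)
qed simp

lemma OA_all_maps: "f \<in> OA_maps m n \<Longrightarrow> f \<in> all_maps m n"
  by (simp add: OA_maps_def)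

lemma OA_mono: "\<lbrakk>f \<in> OA_maps m n; i \<in> {1..m}; j \<in> {1..m}; i \<le> j\<rbrakk> \<Longrightarrow> f i \<le> f j"
  by (auto simp: OA_maps_def mono_on_def)

lemma OA_restrictI:
  "\<lbrakk>\<And>i. i \<in> {1..m} \<Longrightarrow> f i \<in> {1..n}; \<And>i j. \<lbrakk>i \<in> {1..m}; j \<in> {1..m}; i \<le> j\<rbrakk> \<Longrightarrow> f i \<le> f j\<rbrakk> \<Longrightarrow>
   restrict f {1..m} \<in> OA_maps m n"
  using restrict_all_maps[of m f n] by (simp add: OA_maps_def mono_on_def)

lemma OA_compose:
  assumes f: "f \<in> OA_maps m l" and g: "g \<in> OA_maps l p"
  shows "compose {1..m} g f \<in> OA_maps m p"
proof -
  have "g (f i) \<le> g (f j)" if "i \<in> {1..m}" "j \<in> {1..m}" "i \<le> j" for i j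
    using that f g OA_mono[OF f] OA_mono[OF g] all_maps_mem[OF OA_all_maps[OF f]] by simp
  then show ?thesis
    using compose_all_maps[OF OA_all_maps[OF f] OA_all_maps[OF g]]
    by (auto simp: OA_maps_def mono_on_def compose_eq)
qed

lemma idm_OA: "idm n \<in> OA_maps n n"
  unfolding idm_def by (rule OA_restrictI)

text \<open>By monotonicity the points sent to \<open>n\<close> form a final segment of
  \<open>[m]\<close>; let \<open>b\<close> be its length. The cycle sends exactly these points to 1,
  and rotating the source by \<open>b\<close> brings them to the front, after which the other
  values, raised by one, follow in order.\<close>

lemma cyc_OA:
  assumes g: "g \<in> OA_maps m n"
  shows "\<exists>g'\<in>OA_maps m n. \<exists>k. \<forall>i\<in>{1..m}. cyc n (g i) = g' ((cyc m ^^ k) i)"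
proof -
  have gm: "g i \<in> {1..n}" if "i \<in> {1..m}" for i
    using g that OA_all_maps all_maps_mem by metis
  obtain b where b: "b \<le> m" "\<And>i. i \<in> {1..m} \<Longrightarrow> g i = n \<longleftrightarrow> i > m - b"
  proof (cases "{i\<in>{1..m}. g i = n} = {}")
    case True
    then show ?thesis by (intro that[of 0]) auto
  next
    case False
    define a where "a = Min {i\<in>{1..m}. g i = n}"
    have "a \<in> {i\<in>{1..m}. g i = n}" unfolding a_def using False by (intro Min_in) auto
    then have a: "a \<in> {1..m}" "g a = n" by auto
    show ?thesis
    proof (rule that[of "m + 1 - a"])
      fix i assume i: "i \<in> {1..m}"
      have "g i = n \<Longrightarrow> a \<le> i" unfolding a_def using i by (intro Min_le) auto
      moreover have "a \<le> i \<Longrightarrow> g i = n" using OA_mono[OF g a(1) i] gm[OF i] a by auto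
      ultimately show "g i = n \<longleftrightarrow> i > m - (m + 1 - a)" using a by auto
    qed (use a in auto)
  qed
  define g' where "g' = (\<lambda>i\<in>{1..m}. if i \<le> b then 1 else g (i - b) + 1)"
  have less: "g i < n" if "i \<in> {1..m}" "i \<le> m - b" for i
    using b(2)[OF that(1)] gm[OF that(1)] that(2) by (meson atLeastAtMost_iff nat_less_le not_le)
  have "g' \<in> OA_maps m n" unfolding g'_def
  proof (rule OA_restrictI)
    fix i assume i: "i \<in> {1..m}"
    then have "n \<ge> 1" using gm by fastforce
    moreover have "i > b \<Longrightarrow> i - b \<in> {1..m} \<and> i - b \<le> m - b" using i by auto
    ultimately show "(if i \<le> b then 1 else g (i - b) + 1) \<in> {1..n}" 
      using less[of "i - b"] by (auto simp: Suc_leI)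
  next
    fix i j assume ij: "i \<in> {1..m}" "j \<in> {1..m}" "i \<le> j"
    then have "i > b \<Longrightarrow> g (i - b) \<le> g (j - b)" by (intro OA_mono[OF g]) auto
    then show "(if i \<le> b then 1 else g (i - b) + 1) \<le> (if j \<le> b then 1 else g (j - b) + 1)"
      using ij by auto
  qed
  moreover have "cyc n (g i) = g' ((cyc m ^^ b) i)" if i: "i \<in> {1..m}" for i
  proof (cases "i \<le> m - b")
    case True
    then have "(i - 1 + b) mod m + 1 = i + b" using i b(1) by auto
    then have "(cyc m ^^ b) i = i + b" by (simp only: cyc_pow[OF i])
    moreover have "i + b \<le> m" using True b(1) by auto
    ultimately show ?thesis using True less[OF i True] gm[OF i] i b(1) by (simp add: cyc_def g'_def)
  next
    case False
    then have "g i = n" using b(2)[OF i] by auto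
    moreover have "(i - 1 + b) mod m + 1 = i + b - m"
    proof -
      have "(i - 1 + b) mod m = (i - 1 + b - m) mod m" using False i by (intro le_mod_geq) auto
      also have "\<dots> = i - 1 + b - m" using i b(1) False by (intro mod_less) auto
      finally show ?thesis using False i by auto
    qed
    moreover have "(cyc m ^^ b) i = (i - 1 + b) mod m + 1" by (rule cyc_pow[OF i])
    moreover have "i + b - m \<in> {1..m}" "i + b - m \<le> b" using False i b(1) by auto
    ultimately show ?thesis using i gm[OF i] by (simp add: cyc_def g'_def)
  qed
  ultimately show ?thesis by blast
qed

lemma cyc_pow_OA:
  assumes g: "g \<in> OA_maps m n"
  shows "\<exists>g'\<in>OA_maps m n. \<exists>k. \<forall>i\<in>{1..m}. (cyc n ^^ j) (g i) = g' ((cyc m ^^ k) i)"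
proof (induction j)
  case 0
  show ?case by (rule bexI[OF _ g], rule exI[of _ 0]) simp
next
  case (Suc j)
  then obtain g' k where g': "g' \<in> OA_maps m n" "\<forall>i\<in>{1..m}. (cyc n ^^ j) (g i) = g' ((cyc m ^^ k) i)"
    by blast
  obtain g'' k' where g'': "g'' \<in> OA_maps m n" "\<forall>i\<in>{1..m}. cyc n (g' i) = g'' ((cyc m ^^ k') i)"
    using cyc_OA[OF g'(1)] by blast
  have "(cyc n ^^ Suc j) (g i) = g'' ((cyc m ^^ (k' + k)) i)" if "i \<in> {1..m}" for i
    using g' g'' that cyc_pow_mem[OF that, of k] by (simp add: funpow_add)
  then show ?case using g''(1) by blast
qed

text \<open>Rotations of the target can be moved to the source.\<close>

lemma CA_iff:
  "f \<in> CA_maps m n \<longleftrightarrow>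
   f \<in> all_maps m n \<and> (\<exists>g\<in>OA_maps m n. \<exists>k. \<forall>i\<in>{1..m}. f i = g ((cyc m ^^ k) i))"
proof safe
  assume "f \<in> CA_maps m n"
  then obtain j k g where g: "g \<in> OA_maps m n"
    and f: "f = compose {1..m} (restrict (cyc n ^^ j) {1..n}) (compose {1..m} g (restrict (cyc m ^^ k) {1..m}))"
    unfolding CA_maps_def rotations_def by blast
  have gm: "g i \<in> {1..n}" if "i \<in> {1..m}" for i
    using g that OA_all_maps all_maps_mem by metis
  have fi: "f i = (cyc n ^^ j) (g ((cyc m ^^ k) i))" if "i \<in> {1..m}" for i
    using that gm[OF cyc_pow_mem[OF that]] by (simp add: f compose_eq cyc_pow_mem)
  show "f \<in> all_maps m n"
  proof (rule all_mapsI)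
    show "f \<in> extensional {1..m}" by (simp add: f)
    show "f i \<in> {1..n}" if "i \<in> {1..m}" for i
      using fi[OF that] cyc_pow_mem gm that by metis
  qed
  obtain g' k' where g': "g' \<in> OA_maps m n" "\<forall>i\<in>{1..m}. (cyc n ^^ j) (g i) = g' ((cyc m ^^ k') i)"
    using cyc_pow_OA[OF g] by blast
  have "f i = g' ((cyc m ^^ (k' + k)) i)" if "i \<in> {1..m}" for i
    using g' that fi cyc_pow_mem[OF that, of k] by (simp add: funpow_add)
  then show "\<exists>g\<in>OA_maps m n. \<exists>k. \<forall>i\<in>{1..m}. f i = g ((cyc m ^^ k) i)" using g' by blast
next
  fix g k assume f: "f \<in> all_maps m n" and g: "g \<in> OA_maps m n" "\<forall>i\<in>{1..m}. f i = g ((cyc m ^^ k) i)"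
  have gm: "g i \<in> {1..n}" if "i \<in> {1..m}" for i
    using g that OA_all_maps all_maps_mem by metis
  have "f = compose {1..m} (restrict (cyc n ^^ 0) {1..n}) (compose {1..m} g (restrict (cyc m ^^ k) {1..m}))"
  proof (rule extensionalityI[of _ "{1..m}"])
    fix i assume i: "i \<in> {1..m}"
    show "f i = compose {1..m} (restrict (cyc n ^^ 0) {1..n}) (compose {1..m} g (restrict (cyc m ^^ k) {1..m})) i"
      using i g(2) gm[OF cyc_pow_mem[OF i]] by (simp add: compose_eq)
  qed (use f all_maps_ext in auto)
  then show "f \<in> CA_maps m n" using g(1) unfolding CA_maps_def rotations_def by blast
qed

lemma CA_compose:
  assumes f: "f \<in> CA_maps m l" and g: "g \<in> CA_maps l p"
  shows "compose {1..m} g f \<in> CA_maps m p"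
proof -
  obtain f' j where f': "f \<in> all_maps m l" "f' \<in> OA_maps m l" "\<forall>i\<in>{1..m}. f i = f' ((cyc m ^^ j) i)"
    using f by (auto simp: CA_iff)
  obtain g' k where g': "g \<in> all_maps l p" "g' \<in> OA_maps l p" "\<forall>i\<in>{1..l}. g i = g' ((cyc l ^^ k) i)"
    using g by (auto simp: CA_iff)
  \<comment> \<open>The rotation of \<open>[l]\<close> standing between the two order-preserving
    parts moves to the source of \<open>f'\<close>.\<close>
  obtain h k' where h: "h \<in> OA_maps m l" "\<forall>i\<in>{1..m}. (cyc l ^^ k) (f' i) = h ((cyc m ^^ k') i)"
    using cyc_pow_OA[OF f'(2)] by blast
  have "compose {1..m} g f i = compose {1..m} g' h ((cyc m ^^ (k' + j)) i)" if i: "i \<in> {1..m}" for i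
    using i cyc_pow_mem[OF i, of j] cyc_pow_mem[OF i, of "k' + j"] f' g' h all_maps_mem[OF f'(1) i]
    by (simp add: compose_eq funpow_add)
  then show ?thesis
    using OA_compose[OF h(1) g'(2)] compose_all_maps[OF f'(1) g'(1)] unfolding CA_iff by blast
qed

section \<open>Reversals and maps preserving separation\<close>

lemma reversal_mem: "i \<in> {1..n} \<Longrightarrow> reversal n i \<in> {1..n}"
  by (auto simp: reversal_def)

lemma reversal_reversal: "i \<in> {1..n} \<Longrightarrow> reversal n (reversal n i) = i"
  by (auto simp: reversal_def)

lemma reversal_all_maps: "reversal n \<in> all_maps n n"
  unfolding reversal_def by (rule restrict_all_maps) auto

text \<open>Conjugation by the reversal inverts the cycle; the inverse of \<open>cyc m\<close> is
  written as its power with exponent \<open>m - 1\<close> to keep exponents natural.\<close>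

lemma reversal_cyc_pow:
  "\<exists>k. \<forall>i\<in>{1..m}. reversal m ((cyc m ^^ j) i) = (cyc m ^^ k) (reversal m i)"
proof (induction j)
  case 0
  show ?case by (rule exI[of _ 0]) simp
next
  case (Suc j)
  then obtain k where k: "\<forall>i\<in>{1..m}. reversal m ((cyc m ^^ j) i) = (cyc m ^^ k) (reversal m i)" by blast
  have *: "reversal m (cyc m i) = (cyc m ^^ (m - 1)) (reversal m i)" if i: "i \<in> {1..m}" for i
  proof (cases "i = m")
    case True
    then have "reversal m (cyc m i) = m" "reversal m i = 1" using i by (auto simp: reversal_def cyc_def)
    moreover have "1 \<in> {1..m}" using i by auto
    ultimately show ?thesis using i by (simp only: cyc_pow) auto
  next
    case False
    have "(reversal m i - 1 + (m - 1)) mod m = (m - i + (m - 1)) mod m" using i by (simp add: reversal_def)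
    also have "\<dots> = (m - i + (m - 1) - m) mod m" using i False by (intro le_mod_geq) auto
    also have "\<dots> = m - i - 1" using i False by auto
    finally show ?thesis
      using i False by (simp add: cyc_pow[OF reversal_mem[OF i]]) (auto simp: reversal_def cyc_def)
  qed
  have "reversal m ((cyc m ^^ Suc j) i) = (cyc m ^^ (m - 1 + k)) (reversal m i)" if i: "i \<in> {1..m}" for i
    using k i *[OF cyc_pow_mem[OF i, of j]] unfolding funpow_add by simp
  then show ?case by blast
qed

text \<open>Conjugating by reversals can be done on both factors of \<open>f\<close>: the
  order-preserving one stays so because the order is reversed twice, and the rotation stays a
  rotation by \<open>reversal_cyc_pow\<close>.\<close>

lemma CA_reversal:
  assumes f: "f \<in> CA_maps m n"
  shows "compose {1..m} (reversal n) (compose {1..m} f (reversal m)) \<in> CA_maps m n" (is "?r \<in> _")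
proof -
  obtain f' j where f': "f \<in> all_maps m n" "f' \<in> OA_maps m n" "\<forall>i\<in>{1..m}. f i = f' ((cyc m ^^ j) i)"
    using f by (auto simp: CA_iff)
  obtain k where k: "\<forall>i\<in>{1..m}. reversal m ((cyc m ^^ j) i) = (cyc m ^^ k) (reversal m i)"
    using reversal_cyc_pow by blast
  define h where "h = (\<lambda>i\<in>{1..m}. reversal n (f' (reversal m i)))"
  have f'm: "f' i \<in> {1..n}" if "i \<in> {1..m}" for i
    using f' that OA_all_maps all_maps_mem by metis
  have h: "h \<in> OA_maps m n" unfolding h_def
  proof (rule OA_restrictI)
    fix i j assume ij: "i \<in> {1..m}" "j \<in> {1..m}" "i \<le> j"
    have "reversal m j \<le> reversal m i" using ij by (auto simp: reversal_def)
    then have "f' (reversal m j) \<le> f' (reversal m i)"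
      by (intro OA_mono[OF f'(2)] reversal_mem ij)
    then show "reversal n (f' (reversal m i)) \<le> reversal n (f' (reversal m j))"
      using f'm[OF reversal_mem[OF ij(1)]] f'm[OF reversal_mem[OF ij(2)]] by (auto simp: reversal_def)
  qed (use f'm reversal_mem in blast)
  have "?r i = h ((cyc m ^^ k) i)" if i: "i \<in> {1..m}" for i
  proof -
    have "reversal m ((cyc m ^^ k) i) = (cyc m ^^ j) (reversal m i)"
      using k i reversal_mem[OF i] cyc_pow_mem[OF reversal_mem[OF i]] reversal_reversal[OF i]
        reversal_reversal[OF cyc_pow_mem[OF reversal_mem[OF i]]] by metis
    then show ?thesis using f'(3) i reversal_mem[OF i] cyc_pow_mem[OF i, of k]
      by (simp add: compose_eq h_def)
  qed
  then show ?thesis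
    unfolding CA_iff using h f'(1) by (blast intro: compose_all_maps reversal_all_maps)
qed

lemma SA_iff:
  "f \<in> SA_maps m n \<longleftrightarrow> f \<in> CA_maps m n \<or> (\<exists>f'\<in>CA_maps m n. f = compose {1..m} (reversal n) f')"
proof -
  have *: "compose {1..m} (reversal n) (compose {1..m} (reversal n) f) = f" if "f \<in> all_maps m n" for f
    using reversal_reversal[OF all_maps_mem[OF that]]
    by (intro extensionalityI[OF _ all_maps_ext[OF that]]) (auto simp: compose_eq)
  moreover have "compose {1..m} (reversal n) f' \<in> all_maps m n \<and> f' \<in> all_maps m n" if "f' \<in> CA_maps m n" for f'
    using that compose_all_maps[OF _ reversal_all_maps] by (simp add: CA_iff)
  moreover have "f \<in> all_maps m n" if "f \<in> CA_maps m n" using that by (simp add: CA_iff)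
  ultimately show ?thesis unfolding SA_maps_def by (smt (verit) mem_Collect_eq)
qed

lemma compose_assoc_maps:
  assumes "f \<in> all_maps m n"
  shows "compose {1..m} h (compose {1..m} g f) = compose {1..m} (compose {1..n} h g) f"
  using assms by (intro compose_assoc[of f "{1..m}" "{1..n}" h g]) (auto simp: all_maps_def)

lemma SA_compose:
  assumes f: "f \<in> SA_maps m l" and g: "g \<in> SA_maps l p"
  shows "compose {1..m} g f \<in> SA_maps m p"
proof -
  obtain f' where f': "f' \<in> CA_maps m l" "f = f' \<or> f = compose {1..m} (reversal l) f'"
    using f by (auto simp: SA_iff)
  obtain g' where g': "g' \<in> CA_maps l p" "g = g' \<or> g = compose {1..l} (reversal p) g'"
    using g by (auto simp: SA_iff)
  have f'a: "f' \<in> all_maps m l" and g'a: "g' \<in> all_maps l p" using f' g' by (auto simp: CA_iff)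
  \<comment> \<open>As the reversal is an involution, \<open>g'\<close> after a reversal equals a
    reversal after \<open>h\<close>. This moves a reversal from the middle object to the end, where
    two reversals cancel.\<close>
  define h where "h = compose {1..l} (reversal p) (compose {1..l} g' (reversal l))"
  have h: "h \<in> CA_maps l p" unfolding h_def using CA_reversal g' by blast
  have 1: "compose {1..m} (compose {1..l} (reversal p) g') f' = compose {1..m} (reversal p) (compose {1..m} g' f')"
    using compose_assoc_maps[OF f'a] by metis
  have 2: "compose {1..m} g' (compose {1..m} (reversal l) f') = compose {1..m} (reversal p) (compose {1..m} h f')"
  proof (rule extensionalityI[of _ "{1..m}"])
    fix i assume i: "i \<in> {1..m}"
    have "f' i \<in> {1..l}" using f'a i all_maps_mem by blast
    then show "compose {1..m} g' (compose {1..m} (reversal l) f') i = compose {1..m} (reversal p) (compose {1..m} h f') i"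
      using i all_maps_mem[OF g'a] reversal_mem by (auto simp: compose_eq h_def reversal_reversal)
  qed auto
  have 3: "compose {1..m} (compose {1..l} (reversal p) g') (compose {1..m} (reversal l) f') = compose {1..m} h f'"
  proof (rule extensionalityI[of _ "{1..m}"])
    fix i assume i: "i \<in> {1..m}"
    have "f' i \<in> {1..l}" using f'a i all_maps_mem by blast
    then show "compose {1..m} (compose {1..l} (reversal p) g') (compose {1..m} (reversal l) f') i = compose {1..m} h f' i"
      using i reversal_mem by (auto simp: compose_eq h_def)
  qed auto
  show ?thesis using f'(2) g'(2) 1 2 3 CA_compose[OF f'(1) g'(1)] CA_compose[OF f'(1) h]
    by (auto simp: SA_iff)
qed

lemma BA_compose:
  assumes f: "f \<in> BA_maps m l" and g: "g \<in> BA_maps l p"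
  shows "compose {1..m} g f \<in> BA_maps m p"
proof -
  have fa: "f \<in> all_maps m l" and ga: "g \<in> all_maps l p" using f g by (auto simp: BA_maps_def)
  have mem: "\<And>i. i \<in> {1..m} \<Longrightarrow> f i \<in> {1..l}" using fa all_maps_mem by blast
  have "mono_on {1..m} (\<lambda>i. g (f i)) \<or> antimono_on {1..m} (\<lambda>i. g (f i))"
    using f g mem unfolding BA_maps_def monotone_on_def by (simp del: atLeastAtMost_iff) metis
  then have "mono_on {1..m} (compose {1..m} g f) \<or> antimono_on {1..m} (compose {1..m} g f)"
    by (simp add: monotone_on_def compose_eq)
  then show ?thesis using compose_all_maps[OF fa ga] by (simp add: BA_maps_def)
qed

section \<open>Composition and factorization in the five categories\<close>

lemma Hom_all_maps: "f \<in> Hom C m n \<Longrightarrow> f \<in> all_maps m n"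
  by (cases C) (auto simp: OA_maps_def BA_maps_def SA_maps_def CA_iff)

lemma OA_Hom: "f \<in> OA_maps m n \<Longrightarrow> f \<in> Hom C m n"
proof -
  assume f: "f \<in> OA_maps m n"
  then have "f \<in> CA_maps m n" unfolding CA_iff by (auto intro!: bexI[of _ f] exI[of _ 0] simp: OA_all_maps)
  with f show ?thesis by (cases C) (auto simp: SA_iff, auto simp: OA_maps_def BA_maps_def)
qed

lemma Hom_compose:
  "\<lbrakk>f \<in> Hom C m l; g \<in> Hom C l p\<rbrakk> \<Longrightarrow> compose {1..m} g f \<in> Hom C m p"
  by (cases C) (auto simp: compose_all_maps OA_compose CA_compose BA_compose SA_compose)

lemma idm_Hom: "idm n \<in> Hom C n n"
  by (rule OA_Hom[OF idm_OA])

lemma finite_Hom: "finite (Hom C m n)"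
  using finite_all_maps Hom_all_maps by (metis finite_subset subsetI)

text \<open>A stable sort: \<open>s i\<close> is the rank of \<open>i\<close> when points are
  ordered by their value under \<open>f\<close> and ties are broken by position. Breaking ties makes
  \<open>s\<close> injective, and \<open>f\<close> read along the inverse of \<open>s\<close> is
  order-preserving.\<close>

lemma sort_maps:
  assumes f: "f \<in> all_maps m n"
  shows "\<exists>h\<in>OA_maps m n. \<exists>s\<in>all_maps m m. inj_on s {1..m} \<and> f = compose {1..m} h s"
proof -
  define le where "le i j \<longleftrightarrow> f i < f j \<or> f i = f j \<and> i \<le> j" for i j
  define s where "s = (\<lambda>i\<in>{1..m}. card {j\<in>{1..m}. le j i})"
  have less: "s i < s j" if ij: "i \<in> {1..m}" "j \<in> {1..m}" "\<not> le j i" for i j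
  proof -
    have "{k\<in>{1..m}. le k i} \<subset> {k\<in>{1..m}. le k j}"
      using ij unfolding le_def by fastforce
    then show ?thesis using ij unfolding s_def by (simp add: psubset_card_mono)
  qed
  have sa: "s \<in> all_maps m m" unfolding s_def
  proof (rule restrict_all_maps)
    fix i assume i: "i \<in> {1..m}"
    have "card {j\<in>{1..m}. le j i} \<le> card {1..m}" by (intro card_mono) auto
    moreover have "card {j\<in>{1..m}. le j i} > 0"
      using i by (auto simp: card_gt_0_iff le_def)
    ultimately show "card {j\<in>{1..m}. le j i} \<in> {1..m}" by auto
  qed
  have inj: "inj_on s {1..m}"
  proof (rule inj_onI)
    fix i j assume "i \<in> {1..m}" "j \<in> {1..m}" "s i = s j"
    then have "le i j" "le j i" using less[of i j] less[of j i] by auto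
    then show "i = j" by (auto simp: le_def)
  qed
  have img: "s ` {1..m} = {1..m}"
    using inj sa all_maps_mem[OF sa] by (intro endo_inj_surj) auto
  define t where "t = inv_into {1..m} s"
  have t: "t i \<in> {1..m}" "s (t i) = i" if "i \<in> {1..m}" for i
    using that img unfolding t_def by (auto intro: inv_into_into f_inv_into_f simp del: atLeastAtMost_iff)
  have "restrict (\<lambda>i. f (t i)) {1..m} \<in> OA_maps m n"
  proof (rule OA_restrictI)
    show "f (t i) \<in> {1..n}" if "i \<in> {1..m}" for i using all_maps_mem[OF f] t that by blast
    fix i j assume ij: "i \<in> {1..m}" "j \<in> {1..m}" "i \<le> j"
    then have "le (t i) (t j)" using less[of "t j" "t i"] t[of i] t[of j] by fastforce
    then show "f (t i) \<le> f (t j)" by (auto simp: le_def)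
  qed
  moreover have "f = compose {1..m} (restrict (\<lambda>i. f (t i)) {1..m}) s"
  proof (rule extensionalityI[of _ "{1..m}"])
    fix i assume i: "i \<in> {1..m}"
    have "t (s i) = i" unfolding t_def using inj i by simp
    then show "f i = compose {1..m} (restrict (\<lambda>i. f (t i)) {1..m}) s i"
      using i all_maps_mem[OF sa i] by (simp add: compose_eq)
  qed (use all_maps_ext[OF f] in auto)
  ultimately show ?thesis using sa inj by blast
qed

lemma CA_factor:
  assumes f: "f \<in> CA_maps m n"
  shows "\<exists>h\<in>OA_maps m n. \<exists>s\<in>CA_maps m m. inj_on s {1..m} \<and> f = compose {1..m} h s"
proof -
  obtain h k where h: "f \<in> all_maps m n" "h \<in> OA_maps m n" "\<forall>i\<in>{1..m}. f i = h ((cyc m ^^ k) i)"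
    using f by (auto simp: CA_iff)
  define s where "s = restrict (cyc m ^^ k) {1..m}"
  have "s \<in> all_maps m m" unfolding s_def using restrict_all_maps cyc_pow_mem by blast
  moreover have "\<forall>i\<in>{1..m}. s i = idm m ((cyc m ^^ k) i)"
    using cyc_pow_mem[of _ m k] by (auto simp: s_def idm_def)
  ultimately have "s \<in> CA_maps m m" unfolding CA_iff using idm_OA by blast
  moreover have "inj_on s {1..m}" unfolding s_def using cyc_pow_inj by (metis inj_on_restrict_eq)
  moreover have "f = compose {1..m} h s"
    using h by (intro extensionalityI[OF all_maps_ext[OF h(1)]]) (auto simp: compose_eq s_def)
  ultimately show ?thesis using h(2) by blast
qed

lemma Hom_factor:
  assumes "f \<in> Hom C m n"
  shows "\<exists>h\<in>OA_maps m n. \<exists>s\<in>Hom C m m. inj_on s {1..m} \<and> f = compose {1..m} h s"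
proof -
  have id: "inj_on (idm m) {1..m}" "idm m \<in> Hom C m m" by (simp_all add: inj_on_def idm_def idm_Hom[unfolded idm_def])
  have compid: "f = compose {1..m} f (idm m)"
    using Hom_all_maps[OF assms] 
    by (intro extensionalityI[OF all_maps_ext, of f m n]) (auto simp: compose_eq idm_def)
  have rinj: "inj_on (reversal m) {1..m}" using reversal_reversal by (rule inj_on_inverseI)
  show ?thesis
  proof (cases C)
    case FA then show ?thesis using sort_maps assms by simp
  next
    case OA then show ?thesis using assms id compid by auto
  next
    case CA then show ?thesis using assms CA_factor by simp
  next
    case BA
    then consider "f \<in> OA_maps m n" | "f \<in> all_maps m n" "antimono_on {1..m} f"
      using assms by (auto simp: BA_maps_def OA_maps_def)
    then show ?thesis
    proof cases
      case 1 then show ?thesis using id compid by blast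
    next
      case 2
      have "compose {1..m} f (reversal m) \<in> OA_maps m n"
      proof -
        have "f (reversal m x) \<le> f (reversal m y)" if "x \<in> {1..m}" "y \<in> {1..m}" "x \<le> y" for x y
          using 2(2) that reversal_mem[OF that(1)] reversal_mem[OF that(2)] 
          unfolding monotone_on_def by (simp add: reversal_def)
        then show ?thesis using compose_all_maps[OF reversal_all_maps 2(1)]
          by (simp add: OA_maps_def monotone_on_def compose_eq)
      qed
      moreover have "reversal m \<in> Hom C m m"
        using BA reversal_all_maps by (auto simp: BA_maps_def monotone_on_def reversal_def)
      moreover have "f = compose {1..m} (compose {1..m} f (reversal m)) (reversal m)"
        using 2(1) by (intro extensionalityI[OF all_maps_ext, of f m n])
          (auto simp: compose_eq reversal_reversal reversal_mem simp del: atLeastAtMost_iff)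
      ultimately show ?thesis using rinj by blast
    qed
  next
    case SA
    then obtain f' where f': "f' \<in> CA_maps m n" "f = f' \<or> f = compose {1..m} (reversal n) f'"
      using assms by (auto simp: SA_iff)
    from f'(2) show ?thesis
    proof
      assume "f = f'"
      moreover obtain h s where "h \<in> OA_maps m n" "s \<in> CA_maps m m" "inj_on s {1..m}"
        "f' = compose {1..m} h s" using CA_factor[OF f'(1)] by blast
      moreover have "s \<in> Hom C m m" using SA \<open>s \<in> CA_maps m m\<close> by (simp add: SA_iff)
      ultimately show ?thesis by blast
    next
      assume f: "f = compose {1..m} (reversal n) f'"
      obtain h s where h: "h \<in> OA_maps m n" and s: "s \<in> CA_maps m m" "inj_on s {1..m}"
        and f'_eq: "f' = compose {1..m} h s" using CA_factor[OF f'(1)] by blast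
      have sa: "s \<in> all_maps m m" using s by (simp add: CA_iff)
      \<comment> \<open>A reversal of the target is traded for one of the source: \<open>h'\<close>
        is \<open>h\<close> conjugated by reversals, hence again order-preserving.\<close>
      define h' where "h' = (\<lambda>i\<in>{1..m}. reversal n (h (reversal m i)))"
      have hm: "h i \<in> {1..n}" if "i \<in> {1..m}" for i
        using h that OA_all_maps all_maps_mem by metis
      have "h' \<in> OA_maps m n" unfolding h'_def
      proof (rule OA_restrictI)
        fix i j assume ij: "i \<in> {1..m}" "j \<in> {1..m}" "i \<le> j"
        have "reversal m j \<le> reversal m i" using ij by (auto simp: reversal_def)
        then have "h (reversal m j) \<le> h (reversal m i)" by (intro OA_mono[OF h] reversal_mem ij)
        then show "reversal n (h (reversal m i)) \<le> reversal n (h (reversal m j))"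
          using hm[OF reversal_mem[OF ij(1)]] hm[OF reversal_mem[OF ij(2)]] by (auto simp: reversal_def)
      qed (use hm reversal_mem in blast)
      moreover have "compose {1..m} (reversal m) s \<in> Hom C m m" using SA s by (auto simp: SA_iff)
      moreover have "inj_on (compose {1..m} (reversal m) s) {1..m}"
      proof (rule inj_onI)
        fix x y assume xy: "x \<in> {1..m}" "y \<in> {1..m}"
          and "compose {1..m} (reversal m) s x = compose {1..m} (reversal m) s y"
        then have "reversal m (s x) = reversal m (s y)" by (simp add: compose_eq)
        then have "s x = s y" using inj_onD[OF rinj] all_maps_mem[OF sa] xy by blast
        then show "x = y" using inj_onD[OF s(2)] xy by blast
      qed
      moreover have "f = compose {1..m} h' (compose {1..m} (reversal m) s)"
        unfolding f f'_eq
      proof (rule extensionalityI[of _ "{1..m}"])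
        fix i assume i: "i \<in> {1..m}"
        note si = all_maps_mem[OF sa i]
        show "compose {1..m} (reversal n) (compose {1..m} h s) i =
          compose {1..m} h' (compose {1..m} (reversal m) s) i"
          using reversal_mem[OF si] reversal_reversal[OF si] i by (simp add: compose_eq h'_def)
      qed auto
      ultimately show ?thesis by blast
    qed
  qed
qed

section \<open>Strictly increasing maps and automorphisms\<close>

definition SM :: "nat \<Rightarrow> nat \<Rightarrow> (nat \<Rightarrow> nat) set" where
  "SM n m = {f \<in> OA_maps n m. inj_on f {1..n}}"

lemma SM_OA: "f \<in> SM n m \<Longrightarrow> f \<in> OA_maps n m"
  by (simp add: SM_def)

lemma SM_inj: "f \<in> SM n m \<Longrightarrow> inj_on f {1..n}"
  by (simp add: SM_def)

lemma SM_all_maps: "f \<in> SM n m \<Longrightarrow> f \<in> all_maps n m"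
  by (simp add: SM_OA OA_all_maps)

lemma SM_mem: "\<lbrakk>f \<in> SM n m; i \<in> {1..n}\<rbrakk> \<Longrightarrow> f i \<in> {1..m}"
  using SM_all_maps all_maps_mem by blast

lemma SM_Hom: "f \<in> SM n m \<Longrightarrow> f \<in> Hom C n m"
  by (simp add: SM_OA OA_Hom)

lemma finite_SM: "finite (SM n m)"
  using finite_Hom[of OA n m] by (simp add: SM_def)

lemma SM_less_iff:
  assumes f: "f \<in> SM n m" and ij: "i \<in> {1..n}" "j \<in> {1..n}"
  shows "f i < f j \<longleftrightarrow> i < j"
  using OA_mono[OF SM_OA[OF f], of i j] OA_mono[OF SM_OA[OF f], of j i] inj_onD[OF SM_inj[OF f], of i j] ij
  by (metis leD le_less_linear nat_less_le order_less_le)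

lemma SM_le_iff:
  assumes f: "f \<in> SM n m" and ij: "i \<in> {1..n}" "j \<in> {1..n}"
  shows "f i \<le> f j \<longleftrightarrow> i \<le> j"
  using SM_less_iff[OF f ij(2,1)] by (simp add: not_less[symmetric])

lemma inj_on_compose:
  assumes f: "f \<in> all_maps m l" and "inj_on f {1..m}" "inj_on g {1..l}"
  shows "inj_on (compose {1..m} g f) {1..m}"
proof (rule inj_onI)
  fix x y assume xy: "x \<in> {1..m}" "y \<in> {1..m}" and "compose {1..m} g f x = compose {1..m} g f y"
  then have "g (f x) = g (f y)" by (simp add: compose_eq)
  then have "f x = f y" using inj_onD[OF assms(3)] all_maps_mem[OF f] xy by blast
  then show "x = y" using inj_onD[OF assms(2)] xy by blast
qed

lemma idm_SM: "idm n \<in> SM n n"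
  using idm_OA by (auto simp: SM_def inj_on_def idm_def)

lemma compose_idm: "f \<in> all_maps m n \<Longrightarrow> compose {1..m} f (idm m) = f"
  by (rule extensionalityI[of _ "{1..m}"]) (auto simp: compose_eq idm_def all_maps_ext)

lemma idm_compose: "f \<in> all_maps m n \<Longrightarrow> compose {1..m} (idm n) f = f"
proof (rule extensionalityI[of _ "{1..m}"])
  fix i assume "f \<in> all_maps m n" "i \<in> {1..m}"
  then have "f i \<in> {1..n}" "i \<in> {1..m}" using all_maps_mem by auto
  then show "compose {1..m} (idm n) f i = f i" by (simp add: compose_eq idm_def)
qed (auto simp: all_maps_ext)

text \<open>For strictly increasing \<open>f\<close> this is the upper adjoint of \<open>f\<close>,
  see \<open>le_cnt_iff\<close>. Below the first value of \<open>f\<close> it is 0, which lies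
  outside \<open>[n]\<close>.\<close>

definition cnt :: "nat \<Rightarrow> (nat \<Rightarrow> nat) \<Rightarrow> nat \<Rightarrow> nat" where
  "cnt n f y = card {k\<in>{1..n}. f k \<le> y}"

lemma cnt_le: "cnt n f y \<le> n"
proof -
  have "card {k\<in>{1..n}. f k \<le> y} \<le> card {1..n}" by (intro card_mono) auto
  then show ?thesis by (simp add: cnt_def)
qed

lemma cnt_mono: "y \<le> z \<Longrightarrow> cnt n f y \<le> cnt n f z"
  unfolding cnt_def by (intro card_mono) auto

text \<open>The points \<open>k\<close> with \<open>f k \<le> y\<close> form an initial segment of
  \<open>[n]\<close>, so their number is also the largest of them.\<close>

lemma le_cnt_iff:
  assumes f: "f \<in> SM n m" and j: "j \<in> {1..n}"
  shows "j \<le> cnt n f y \<longleftrightarrow> f j \<le> y"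
proof
  assume y: "f j \<le> y"
  have "{1..j} \<subseteq> {k\<in>{1..n}. f k \<le> y}"
  proof
    fix k assume "k \<in> {1..j}"
    then have k: "k \<in> {1..n}" "k \<le> j" using j by auto
    then have "f k \<le> f j" using SM_le_iff[OF f k(1) j] by blast
    then show "k \<in> {k\<in>{1..n}. f k \<le> y}" using k y by auto
  qed
  then have "card {1..j} \<le> card {k\<in>{1..n}. f k \<le> y}" by (intro card_mono) auto
  then show "j \<le> cnt n f y" by (simp add: cnt_def)
next
  assume c: "j \<le> cnt n f y"
  show "f j \<le> y"
  proof (rule ccontr)
    assume y: "\<not> f j \<le> y"
    have "k < j" if "k \<in> {1..n}" "f k \<le> y" for k
      using SM_le_iff[OF f j that(1)] y that by linarith
    then have "{k\<in>{1..n}. f k \<le> y} \<subseteq> {1..<j}" by auto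
    then have "card {k\<in>{1..n}. f k \<le> y} \<le> card {1..<j}" by (intro card_mono) auto
    then have "cnt n f y \<le> j - 1" by (simp add: cnt_def)
    then show False using c j by auto
  qed
qed

lemma cnt_image: 
  assumes "f \<in> SM n m"
  shows "cnt n f y = card {x \<in> f ` {1..n}. x \<le> y}"
proof -
  have "{x \<in> f ` {1..n}. x \<le> y} = f ` {k\<in>{1..n}. f k \<le> y}" by auto
  moreover have "inj_on f {k\<in>{1..n}. f k \<le> y}" using SM_inj[OF assms] by (rule inj_on_subset) auto
  ultimately show ?thesis by (simp add: cnt_def card_image)
qed

lemma cnt_self: "\<lbrakk>f \<in> SM n m; j \<in> {1..n}\<rbrakk> \<Longrightarrow> cnt n f (f j) = j"
proof -
  assume a: "f \<in> SM n m" "j \<in> {1..n}"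
  have "{k\<in>{1..n}. f k \<le> f j} = {1..j}" using a(2) SM_le_iff[OF a(1) _ a(2)] by auto
  then show ?thesis by (simp add: cnt_def)
qed

text \<open>The position of a value within the image is computed by \<open>cnt\<close> from the
  image alone, see \<open>cnt_image\<close>, and for a strictly increasing map this position is the
  argument.\<close>

lemma SM_image_eq:
  assumes f: "f \<in> SM n m" and g: "g \<in> SM n l" and eq: "f ` {1..n} = g ` {1..n}"
  shows "f = g"
proof (rule extensionalityI[of _ "{1..n}"])
  fix i assume i: "i \<in> {1..n}"
  then obtain j where j: "j \<in> {1..n}" "f i = g j" using eq by blast
  have "i = cnt n f (f i)" using cnt_self[OF f i] by simp
  also have "\<dots> = cnt n g (g j)" unfolding cnt_image[OF f] cnt_image[OF g] eq j(2) by simp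
  also have "\<dots> = j" using cnt_self[OF g j(1)] by simp
  finally show "f i = g i" using j by simp
qed (use all_maps_ext[OF SM_all_maps[OF f]] all_maps_ext[OF SM_all_maps[OF g]] in auto)

lemma inj_image_full:
  assumes f: "f \<in> all_maps n n" "inj_on f {1..n}"
  shows "f ` {1..n} = {1..n}"
  using f all_maps_mem by (intro endo_inj_surj) auto

lemma SM_self: 
  assumes f: "f \<in> SM n n"
  shows "f = idm n"
  using SM_image_eq[OF f idm_SM]
    inj_image_full[OF SM_all_maps[OF f] SM_inj[OF f]] inj_image_full[OF SM_all_maps SM_inj, OF idm_SM idm_SM]
  by simp

text \<open>Injectivity is the form in which the factorizations deliver automorphisms;
  \<open>aut_inverse\<close> and \<open>Aut_grp_simps\<close> identify these maps with the
  invertible ones.\<close>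

definition aut :: "cat \<Rightarrow> nat \<Rightarrow> (nat \<Rightarrow> nat) set" where
  "aut C n = {g \<in> Hom C n n. inj_on g {1..n}}"

lemma aut_Hom: "g \<in> aut C n \<Longrightarrow> g \<in> Hom C n n"
  by (simp add: aut_def)

lemma aut_all_maps: "g \<in> aut C n \<Longrightarrow> g \<in> all_maps n n"
  by (rule Hom_all_maps[OF aut_Hom])

lemma aut_mem: "\<lbrakk>g \<in> aut C n; i \<in> {1..n}\<rbrakk> \<Longrightarrow> g i \<in> {1..n}"
  using aut_all_maps all_maps_mem by blast

lemma aut_inj: "g \<in> aut C n \<Longrightarrow> inj_on g {1..n}"
  by (simp add: aut_def)

lemma finite_aut: "finite (aut C n)"
  using finite_Hom by (simp add: aut_def)

lemma aut_compose: "\<lbrakk>f \<in> aut C n; g \<in> aut C n\<rbrakk> \<Longrightarrow> compose {1..n} g f \<in> aut C n"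
  unfolding aut_def by (auto intro: Hom_compose inj_on_compose Hom_all_maps)

lemma idm_aut: "idm n \<in> aut C n"
  using idm_SM[of n] SM_Hom SM_inj by (auto simp: aut_def)

lemma aut_image: "g \<in> aut C n \<Longrightarrow> g ` {1..n} = {1..n}"
  by (rule inj_image_full[OF aut_all_maps aut_inj])

lemma aut_surj: "\<lbrakk>g \<in> aut C n; y \<in> {1..n}\<rbrakk> \<Longrightarrow> \<exists>x\<in>{1..n}. y = g x"
  using aut_image by blast

lemma compose_left_cancel:
  assumes "f \<in> all_maps m l" "f' \<in> all_maps m l" "inj_on g {1..l}"
    and eq: "compose {1..m} g f = compose {1..m} g f'"
  shows "f = f'"
proof (rule all_maps_eqI[OF assms(1,2)])
  fix i assume i: "i \<in> {1..m}"
  then have "g (f i) = g (f' i)" using fun_cong[OF eq, of i] by (simp add: compose_eq)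
  then show "f i = f' i" using inj_onD[OF assms(3)] all_maps_mem assms(1,2) i by blast
qed

text \<open>Uniform in the five categories: composing with \<open>g\<close> is an injective self-map
  of the finite set \<open>aut C n\<close>, hence hits the identity. Cancelling \<open>g\<close>
  shows that the right inverse so obtained is also a left inverse.\<close>

lemma aut_inverse:
  assumes g: "g \<in> aut C n"
  shows "\<exists>h\<in>aut C n. compose {1..n} g h = idm n \<and> compose {1..n} h g = idm n"
proof -
  have "inj_on (compose {1..n} g) (aut C n)"
    using compose_left_cancel[OF aut_all_maps aut_all_maps aut_inj[OF g]] by (auto intro: inj_onI)
  then have "compose {1..n} g ` aut C n = aut C n"
    using aut_compose[OF _ g] finite_aut by (intro endo_inj_surj) auto
  then obtain h where h: "h \<in> aut C n" "compose {1..n} g h = idm n" using idm_aut by (metis imageE)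
  have "compose {1..n} g (compose {1..n} h g) = compose {1..n} g (idm n)"
    using compose_assoc_maps[OF aut_all_maps[OF g]] h(2) idm_compose compose_idm aut_all_maps[OF g] by metis
  then have "compose {1..n} h g = idm n"
    using compose_left_cancel[OF aut_all_maps[OF aut_compose[OF g h(1)]] aut_all_maps[OF idm_aut] aut_inj[OF g]]
    by blast
  with h show ?thesis by blast
qed

lemma End_monoid_monoid: "monoid (End_monoid C n)"
proof (unfold_locales, goal_cases)
  case (2 x y z)
  then show ?case using compose_assoc_maps[OF Hom_all_maps, of z C n n x y] by (simp add: End_monoid_def)
qed (auto simp: End_monoid_def Hom_compose idm_Hom compose_idm idm_compose dest: Hom_all_maps)

lemma Aut_grp_group: "group (Aut_grp C n)"
  unfolding Aut_grp_def by (rule monoid.units_group[OF End_monoid_monoid])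

lemma Aut_grp_simps [simp]:
  shows "carrier (Aut_grp C n) = aut C n" "mult (Aut_grp C n) = compose {1..n}" "one (Aut_grp C n) = idm n"
proof -
  have "inj_on x {1..n}" if "x \<in> Hom C n n" "y \<in> Hom C n n" "compose {1..n} y x = idm n" for x y
  proof (rule inj_on_inverseI)
    fix i assume "i \<in> {1..n}"
    then show "y (x i) = i" using fun_cong[OF that(3), of i] by (simp add: compose_eq idm_def)
  qed
  then show "carrier (Aut_grp C n) = aut C n"
    using aut_inverse by (auto simp: Aut_grp_def units_of_def Units_def End_monoid_def aut_def) blast
qed (auto simp: Aut_grp_def units_of_def End_monoid_def)

section \<open>Unique factorization of injective maps\<close>

lemma injective_factor:
  assumes f: "f \<in> Hom C n m" "inj_on f {1..n}"
  shows "\<exists>i\<in>SM n m. \<exists>g\<in>aut C n. f = compose {1..n} i g"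
proof -
  obtain h s where h: "h \<in> OA_maps n m" and s: "s \<in> Hom C n n" "inj_on s {1..n}" and eq: "f = compose {1..n} h s"
    using Hom_factor[OF f(1)] by blast
  have s': "s \<in> aut C n" using s by (simp add: aut_def)
  have "inj_on h {1..n}"
  proof (rule inj_onI)
    fix x y assume xy: "x \<in> {1..n}" "y \<in> {1..n}" "h x = h y"
    then obtain x' y' where "x' \<in> {1..n}" "y' \<in> {1..n}" "x = s x'" "y = s y'"
      using aut_surj[OF s'] by metis
    moreover from this have "f x' = f y'" using xy(3) by (simp add: eq compose_eq)
    ultimately show "x = y" using inj_onD[OF f(2)] by blast
  qed
  then show ?thesis using h s' eq by (auto simp: SM_def)
qed

text \<open>Precomposing with a permutation keeps the image, and the image determines a strictly
  increasing map; the group part is then found by cancelling the injective \<open>i\<close>.\<close>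

lemma factor_unique:
  assumes i: "i \<in> SM n m" and g: "g \<in> aut C n" and i': "i' \<in> SM n m'" and g': "g' \<in> aut C n"
    and eq: "compose {1..n} i g = compose {1..n} i' g'"
  shows "i = i'" and "g = g'"
proof -
  have im: "(compose {1..n} j h) ` {1..n} = j ` {1..n}" if "h \<in> aut C n" for j h :: "nat \<Rightarrow> nat"
  proof -
    have "(compose {1..n} j h) ` {1..n} = j ` h ` {1..n}"
      by (simp add: compose_def image_image)
    then show ?thesis using aut_image[OF that] by simp
  qed
  show "i = i'" using SM_image_eq[OF i i'] im[OF g, of i] im[OF g', of i'] eq by simp
  then show "g = g'"
    using compose_left_cancel[OF aut_all_maps[OF g] aut_all_maps[OF g'] SM_inj[OF i]] eq by simp
qed

text \<open>For injective \<open>f\<close>, \<open>sm\<close> and \<open>gp\<close> are the two parts of its unique factorization into an automorphism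
  followed by a strictly increasing map; both are junk if \<open>f\<close> is not injective.\<close>

definition sm :: "cat \<Rightarrow> nat \<Rightarrow> (nat \<Rightarrow> nat) \<Rightarrow> (nat \<Rightarrow> nat)" where
  "sm C n f = (SOME i. \<exists>m. i \<in> SM n m \<and> (\<exists>g\<in>aut C n. f = compose {1..n} i g))"

definition gp :: "cat \<Rightarrow> nat \<Rightarrow> (nat \<Rightarrow> nat) \<Rightarrow> (nat \<Rightarrow> nat)" where
  "gp C n f = (SOME g. g \<in> aut C n \<and> f = compose {1..n} (sm C n f) g)"

lemma sm_gp_compose:
  assumes i: "i \<in> SM n m" and g: "g \<in> aut C n"
  shows "sm C n (compose {1..n} i g) = i" and "gp C n (compose {1..n} i g) = g"
proof -
  show *: "sm C n (compose {1..n} i g) = i"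
    unfolding sm_def
  proof (rule some_equality)
    show "\<exists>m. i \<in> SM n m \<and> (\<exists>ga\<in>aut C n. compose {1..n} i g = compose {1..n} i ga)"
      using i g by blast
    show "i' = i" if "\<exists>m. i' \<in> SM n m \<and> (\<exists>ga\<in>aut C n. compose {1..n} i g = compose {1..n} i' ga)" for i'
      using that factor_unique(1)[OF i g] by blast
  qed
  show "gp C n (compose {1..n} i g) = g"
    unfolding gp_def *
  proof (rule some_equality)
    show "g' = g" if "g' \<in> aut C n \<and> compose {1..n} i g = compose {1..n} i g'" for g'
      using that factor_unique(2)[OF i g i] by blast
  qed (use g in simp)
qed

lemma sm_gp:
  assumes "f \<in> Hom C n m" "inj_on f {1..n}"
  shows "sm C n f \<in> SM n m" "gp C n f \<in> aut C n" "compose {1..n} (sm C n f) (gp C n f) = f"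
proof -
  obtain i g where "i \<in> SM n m" "g \<in> aut C n" "f = compose {1..n} i g" using injective_factor[OF assms] by blast
  then show "sm C n f \<in> SM n m" "gp C n f \<in> aut C n" "compose {1..n} (sm C n f) (gp C n f) = f"
    using sm_gp_compose by auto
qed

lemma sm_gp_SM:
  assumes i: "i \<in> SM n m"
  shows "sm C n i = i" and "gp C n i = idm n"
  using sm_gp_compose[OF i idm_aut, where C=C] compose_idm[OF SM_all_maps[OF i]] by auto

text \<open>The coface maps of the simplex category, omitting the value \<open>i\<close>, for
  \<open>i\<close> from 1 to \<open>n + 1\<close>.\<close>

definition del :: "nat \<Rightarrow> nat \<Rightarrow> nat \<Rightarrow> nat" where
  "del n i = (\<lambda>j\<in>{1..n}. if j < i then j else j + 1)"

text \<open>The codegeneracies, taking the value \<open>i\<close> twice, for \<open>i\<close> from 1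
  to \<open>n\<close>.\<close>

definition sig :: "nat \<Rightarrow> nat \<Rightarrow> nat \<Rightarrow> nat" where
  "sig n i = (\<lambda>y\<in>{1..n+1}. if y \<le> i then y else y - 1)"

lemma del_SM: "del n i \<in> SM n (n+1)"
  unfolding SM_def del_def by (auto intro!: OA_restrictI simp: inj_on_def)

lemma sig_OA: "i \<in> {1..n} \<Longrightarrow> sig n i \<in> OA_maps (n+1) n"
  unfolding sig_def by (rule OA_restrictI) auto

lemma del_image:
  assumes "i \<in> {1..n+1}"
  shows "del n i ` {1..n} = {1..n+1} - {i}"
proof -
  have "x \<in> del n i ` {1..n}" if "x \<in> {1..n+1}" "x \<noteq> i" for x
  proof (cases "x < i")
    case True then show ?thesis using that assms by (intro image_eqI[of _ _ x]) (auto simp: del_def)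
  next
    case False then show ?thesis using that assms by (intro image_eqI[of _ _ "x - 1"]) (auto simp: del_def)
  qed
  moreover have "del n i ` {1..n} \<subseteq> {1..n+1} - {i}" by (auto simp: del_def)
  ultimately show ?thesis by blast
qed

lemma SM_eq_del:
  assumes f: "f \<in> SM n (n+1)" and i: "i \<in> {1..n+1}" "i \<notin> f ` {1..n}"
  shows "f = del n i"
proof (rule SM_image_eq[OF f del_SM])
  have "card (f ` {1..n}) = n" using SM_inj[OF f] by (simp add: card_image)
  moreover have "f ` {1..n} \<subseteq> {1..n+1} - {i}" using SM_mem[OF f] i by blast
  ultimately have "f ` {1..n} = {1..n+1} - {i}"
    using i by (intro card_subset_eq) auto
  then show "f ` {1..n} = del n i ` {1..n}" using del_image[OF i(1)] by simp
qed

lemma SM_Suc: "SM n (n+1) = del n ` {1..n+1}"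
proof -
  have "f \<in> del n ` {1..n+1}" if f: "f \<in> SM n (n+1)" for f
  proof -
    have "card (f ` {1..n}) < card {1..n+1}" using card_image[OF SM_inj[OF f]] by simp
    then have "\<not> {1..n+1} \<subseteq> f ` {1..n}"
      using card_mono[of "f ` {1..n}" "{1..n+1}"] by auto
    then obtain i where "i \<in> {1..n+1}" "i \<notin> f ` {1..n}" by blast
    then show ?thesis using SM_eq_del[OF f] by blast
  qed
  then show ?thesis using del_SM by blast
qed

lemma del_inj: "\<lbrakk>del n i = del n j; i \<in> {1..n+1}; j \<in> {1..n+1}\<rbrakk> \<Longrightarrow> i = j"
  using del_image[of i n] del_image[of j n] by (metis Diff_iff singletonD insertI1)

text \<open>A section of \<open>sig n i\<close> cannot take both \<open>i\<close> and
  \<open>i + 1\<close>, which have the same image, and a strictly increasing map to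
  \<open>[n+1]\<close> is determined by a value it omits.\<close>

lemma sig_compose_eq_idm:
  assumes i: "i \<in> {1..n}" and f: "f \<in> SM n (n+1)"
  shows "compose {1..n} (sig n i) f = idm n \<longleftrightarrow> f = del n i \<or> f = del n (i+1)"
proof
  assume eq: "compose {1..n} (sig n i) f = idm n"
  have s: "sig n i (f j) = j" if "j \<in> {1..n}" for j
    using fun_cong[OF eq, of j] that by (simp add: compose_eq idm_def)
  have "i \<notin> f ` {1..n} \<or> i + 1 \<notin> f ` {1..n}"
  proof (rule ccontr)
    assume "\<not> ?thesis"
    then obtain j k where jk: "j \<in> {1..n}" "k \<in> {1..n}" "f j = i" "f k = i + 1" by (metis imageE)
    then have "j = i" "k = i" using s[of j] s[of k] i by (auto simp: sig_def)
    then show False using jk by simp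
  qed
  then show "f = del n i \<or> f = del n (i+1)" using SM_eq_del[OF f] i by auto
next
  assume "f = del n i \<or> f = del n (i+1)"
  moreover have "sig n i (del n k x) = x" if "k = i \<or> k = i + 1" "x \<in> {1..n}" for k x
  proof -
    have "del n k x = (if x < k then x else x + 1)" using that by (simp add: del_def)
    then show ?thesis using that i by (cases "x < i"; cases "x = i") (auto simp: sig_def)
  qed
  ultimately show "compose {1..n} (sig n i) f = idm n"
    by (intro extensionalityI[of _ "{1..n}"]) (auto simp: compose_eq idm_def)
qed

text \<open>The automorphism \<open>k\<close> is obtained by factoring \<open>h \<circ> sig n 1\<close>.\<close>

lemma aut_extend:
  assumes n: "n \<ge> 1" and h: "h \<in> aut C n"
  shows "\<exists>k\<in>aut C (n+1). \<exists>i\<in>{1..n+1}. gp C n (compose {1..n} k (del n i)) = h"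
proof -
  have 1: "(1::nat) \<in> {1..n}" using n by simp
  have "compose {1..n+1} h (sig n 1) \<in> Hom C (n+1) n"
    by (rule Hom_compose[OF OA_Hom[OF sig_OA[OF 1]] aut_Hom[OF h]])
  then obtain h' k where h': "h' \<in> OA_maps (n+1) n" and k: "k \<in> Hom C (n+1) (n+1)" "inj_on k {1..n+1}"
    and eq: "compose {1..n+1} h (sig n 1) = compose {1..n+1} h' k" using Hom_factor by blast
  have da: "del n 1 \<in> all_maps n (n+1)" by (rule SM_all_maps[OF del_SM])
  have k': "k \<in> aut C (n+1)" using k by (simp add: aut_def)
  define f where "f = compose {1..n} k (del n 1)"
  have f: "f \<in> Hom C n (n+1)" "inj_on f {1..n}"
    unfolding f_def using Hom_compose[OF SM_Hom[OF del_SM] k(1)] inj_on_compose[OF da SM_inj[OF del_SM] k(2)]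
    by auto
  \<comment> \<open>As \<open>del n 1\<close> is a section of \<open>sig n 1\<close>, the map
    \<open>h\<close> equals \<open>h'\<close> after \<open>k\<close> after \<open>del n 1\<close>.
    Splitting the last two into \<open>sm\<close> and \<open>gp\<close> leaves an injective
    order-preserving endomorphism of \<open>[n]\<close> in front, which must be the
    identity.\<close>
  have "h = compose {1..n} h (compose {1..n} (sig n 1) (del n 1))"
    using sig_compose_eq_idm[OF 1 del_SM, of 1] compose_idm[OF aut_all_maps[OF h]] by simp
  also have "\<dots> = compose {1..n} (compose {1..n+1} h' k) (del n 1)"
    unfolding eq[symmetric] by (rule compose_assoc_maps[OF da])
  also have "\<dots> = compose {1..n} h' f" unfolding f_def by (rule compose_assoc_maps[OF da, symmetric])
  also have "\<dots> = compose {1..n} h' (compose {1..n} (sm C n f) (gp C n f))" using sm_gp(3)[OF f] by simp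
  also have "\<dots> = compose {1..n} (compose {1..n} h' (sm C n f)) (gp C n f)"
    by (rule compose_assoc_maps[OF aut_all_maps[OF sm_gp(2)[OF f]]])
  finally have h_eq: "h = compose {1..n} (compose {1..n} h' (sm C n f)) (gp C n f)" .
  have "compose {1..n} h' (sm C n f) = idm n"
  proof (rule SM_self)
    have "inj_on (compose {1..n} h' (sm C n f)) {1..n}"
    proof (rule inj_onI)
      fix x y assume xy: "x \<in> {1..n}" "y \<in> {1..n}" "compose {1..n} h' (sm C n f) x = compose {1..n} h' (sm C n f) y"
      then obtain x' y' where "x' \<in> {1..n}" "y' \<in> {1..n}" "x = gp C n f x'" "y = gp C n f y'"
        using aut_surj[OF sm_gp(2)[OF f]] by metis
      moreover from this have "h x' = h y'" using xy(3) fun_cong[OF h_eq] by (simp add: compose_eq)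
      ultimately show "x = y" using inj_onD[OF aut_inj[OF h]] by blast
    qed
    then show "compose {1..n} h' (sm C n f) \<in> SM n n"
      using OA_compose[OF SM_OA[OF sm_gp(1)[OF f]] h'] by (simp add: SM_def)
  qed
  then have "h = gp C n f" using h_eq idm_compose[OF aut_all_maps[OF sm_gp(2)[OF f]]] by simp
  then show ?thesis using k' f_def by (intro bexI[of _ k] bexI[of _ 1]) auto
qed

lemma OA_not_inj_adjacent:
  assumes f: "f \<in> OA_maps (n+1) l" and ni: "\<not> inj_on f {1..n+1}"
  shows "\<exists>i\<in>{1..n}. f i = f (i+1)"
proof -
  obtain a b where ab: "a \<in> {1..n+1}" "b \<in> {1..n+1}" "a < b" "f a = f b"
    using ni unfolding inj_on_def by (metis linorder_neqE_nat)
  then have "a + 1 \<in> {1..n+1}" "a \<le> a + 1" "a + 1 \<le> b" by auto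
  then have "f a \<le> f (a+1)" "f (a+1) \<le> f b" using OA_mono[OF f] ab by blast+
  then show ?thesis using ab by (intro bexI[of _ a]) auto
qed

lemma del_adjacent:
  assumes i: "i \<in> {1..n}" and eq: "f i = f (i+1)"
  shows "compose {1..n} f (del n i) = compose {1..n} f (del n (i+1))"
proof (rule extensionalityI[of _ "{1..n}"])
  fix x assume "x \<in> {1..n}"
  then show "compose {1..n} f (del n i) x = compose {1..n} f (del n (i+1)) x"
    using eq by (cases "x = i") (auto simp: compose_eq del_def)
qed auto

lemma inj_compose_adjacent:
  assumes i: "i \<in> {1..n}" and eq: "f i = f (i+1)" and g: "g \<in> SM n (n+1)" "inj_on (compose {1..n} f g) {1..n}"
  shows "g = del n i \<or> g = del n (i+1)"
proof -
  have "i \<notin> g ` {1..n} \<or> i + 1 \<notin> g ` {1..n}"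
  proof (rule ccontr)
    assume "\<not> ?thesis"
    then obtain j k where jk: "j \<in> {1..n}" "k \<in> {1..n}" "g j = i" "g k = i + 1" by (metis imageE)
    then have "compose {1..n} f g j = compose {1..n} f g k" using eq by (simp add: compose_eq)
    then have "j = k" using inj_onD[OF g(2)] jk by blast
    then show False using jk by simp
  qed
  then show ?thesis using SM_eq_del[OF g(1)] i by auto
qed

text \<open>The bijection \<open>g\<close> carries the complement of \<open>i\<close> to the
  complement of \<open>g i\<close>, and the omitted value \<open>g i\<close> pins down the
  increasing part of the composite.\<close>

lemma aut_del:
  assumes g: "g \<in> aut C (n+1)" and i: "i \<in> {1..n+1}"
  shows "compose {1..n} g (del n i) \<in> Hom C n (n+1)"
    and "inj_on (compose {1..n} g (del n i)) {1..n}"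
    and "sm C n (compose {1..n} g (del n i)) = del n (g i)"
    and "gp C n (compose {1..n} g (del n i)) \<in> aut C n"
    and "compose {1..n} g (del n i) = compose {1..n} (del n (g i)) (gp C n (compose {1..n} g (del n i)))"
proof -
  let ?f = "compose {1..n} g (del n i)"
  show f: "?f \<in> Hom C n (n+1)" "inj_on ?f {1..n}"
    using Hom_compose[OF SM_Hom[OF del_SM] aut_Hom[OF g]]
      inj_on_compose[OF SM_all_maps[OF del_SM] SM_inj[OF del_SM] aut_inj[OF g]] by auto
  show gpa: "gp C n ?f \<in> aut C n" by (rule sm_gp(2)[OF f])
  show "sm C n ?f = del n (g i)"
  proof (rule SM_eq_del[OF sm_gp(1)[OF f] aut_mem[OF g i]])
    show "g i \<notin> sm C n ?f ` {1..n}"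
    proof
      assume "g i \<in> sm C n ?f ` {1..n}"
      then obtain j where "j \<in> {1..n}" "g i = sm C n ?f (gp C n ?f j)"
        using aut_surj[OF gpa] by blast
      then have j: "j \<in> {1..n}" "g i = g (del n i j)"
        using fun_cong[OF sm_gp(3)[OF f], of j] by (auto simp: compose_eq)
      then have "i = del n i j" using inj_onD[OF aut_inj[OF g]] i SM_mem[OF del_SM] by blast
      then show False using del_image[OF i] j(1) by blast
    qed
  qed
  then show "?f = compose {1..n} (del n (g i)) (gp C n ?f)" using sm_gp(3)[OF f] by simp
qed

text \<open>The cocycle rule for the group parts, read off from two factorizations of the same map
  by uniqueness.\<close>

lemma gp_del_compose:
  assumes g: "g \<in> aut C (n+1)" and k: "k \<in> aut C (n+1)" and i: "i \<in> {1..n+1}"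
  shows "gp C n (compose {1..n} (compose {1..n+1} g k) (del n i)) =
    compose {1..n} (gp C n (compose {1..n} g (del n (k i)))) (gp C n (compose {1..n} k (del n i)))"
proof -
  note ki = aut_mem[OF k i]
  let ?a = "gp C n (compose {1..n} g (del n (k i)))" and ?b = "gp C n (compose {1..n} k (del n i))"
  have a: "?a \<in> aut C n" and b: "?b \<in> aut C n" using aut_del(4)[OF g ki] aut_del(4)[OF k i] by auto
  note ba = aut_all_maps[OF b]
  have "compose {1..n} (compose {1..n+1} g k) (del n i) = compose {1..n} g (compose {1..n} k (del n i))"
    by (rule compose_assoc_maps[OF SM_all_maps[OF del_SM], symmetric])
  also have "\<dots> = compose {1..n} g (compose {1..n} (del n (k i)) ?b)" using aut_del(5)[OF k i] by simp
  also have "\<dots> = compose {1..n} (compose {1..n} g (del n (k i))) ?b" by (rule compose_assoc_maps[OF ba])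
  also have "\<dots> = compose {1..n} (compose {1..n} (del n (g (k i))) ?a) ?b" using aut_del(5)[OF g ki] by simp
  also have "\<dots> = compose {1..n} (del n (g (k i))) (compose {1..n} ?a ?b)" by (rule compose_assoc_maps[OF ba, symmetric])
  finally show ?thesis using sm_gp_compose(2)[OF del_SM aut_compose[OF b a]] by simp
qed

section \<open>Linear maps and submodules\<close>

lemma linear_mapsI:
  assumes "\<And>x. x \<in> carrier M \<Longrightarrow> h x \<in> carrier N"
    and "\<And>x y. \<lbrakk>x \<in> carrier M; y \<in> carrier M\<rbrakk> \<Longrightarrow> h (x \<oplus>\<^bsub>M\<^esub> y) = h x \<oplus>\<^bsub>N\<^esub> h y"
    and "\<And>a x. \<lbrakk>a \<in> carrier K; x \<in> carrier M\<rbrakk> \<Longrightarrow> h (a \<odot>\<^bsub>M\<^esub> x) = a \<odot>\<^bsub>N\<^esub> h x"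
  shows "h \<in> linear_maps K M N"
  using assms by (simp add: linear_maps_def)

lemma linear_mapsD:
  assumes "h \<in> linear_maps K M N"
  shows "\<And>x. x \<in> carrier M \<Longrightarrow> h x \<in> carrier N"
    and "\<And>x y. \<lbrakk>x \<in> carrier M; y \<in> carrier M\<rbrakk> \<Longrightarrow> h (x \<oplus>\<^bsub>M\<^esub> y) = h x \<oplus>\<^bsub>N\<^esub> h y"
    and "\<And>a x. \<lbrakk>a \<in> carrier K; x \<in> carrier M\<rbrakk> \<Longrightarrow> h (a \<odot>\<^bsub>M\<^esub> x) = a \<odot>\<^bsub>N\<^esub> h x"
  using assms by (auto simp: linear_maps_def)

lemma linear_maps_comp:
  "\<lbrakk>f \<in> linear_maps K M N; g \<in> linear_maps K N P\<rbrakk> \<Longrightarrow> (\<lambda>x. g (f x)) \<in> linear_maps K M P"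
  by (intro linear_mapsI) (simp_all add: linear_mapsD)

lemma abelian_group_add_hom:
  assumes M: "abelian_group M" and N: "abelian_group N"
    and c: "\<And>x. x \<in> carrier M \<Longrightarrow> h x \<in> carrier N"
    and add: "\<And>x y. \<lbrakk>x \<in> carrier M; y \<in> carrier M\<rbrakk> \<Longrightarrow> h (x \<oplus>\<^bsub>M\<^esub> y) = h x \<oplus>\<^bsub>N\<^esub> h y"
  shows "h \<zero>\<^bsub>M\<^esub> = \<zero>\<^bsub>N\<^esub>"
    and "x \<in> carrier M \<Longrightarrow> h (\<ominus>\<^bsub>M\<^esub> x) = \<ominus>\<^bsub>N\<^esub> h x"
    and "\<lbrakk>x \<in> carrier M; y \<in> carrier M\<rbrakk> \<Longrightarrow> h (x \<ominus>\<^bsub>M\<^esub> y) = h x \<ominus>\<^bsub>N\<^esub> h y"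
    and "f \<in> A \<rightarrow> carrier M \<Longrightarrow> h (\<Oplus>\<^bsub>M\<^esub>i\<in>A. f i) = (\<Oplus>\<^bsub>N\<^esub>i\<in>A. h (f i))"
proof -
  interpret abelian_group_hom M N h
  proof (rule abelian_group_homI[OF M N])
    have "h \<in> hom (add_monoid M) (add_monoid N)" using c add by (simp add: hom_def)
    then show "group_hom (add_monoid M) (add_monoid N) h"
      using M N by (simp add: group_hom_def group_hom_axioms_def abelian_group.a_group)
  qed
  show z: "h \<zero>\<^bsub>M\<^esub> = \<zero>\<^bsub>N\<^esub>" by (rule hom_zero)
  show neg: "h (\<ominus>\<^bsub>M\<^esub> x) = \<ominus>\<^bsub>N\<^esub> h x" if "x \<in> carrier M" for x using that by (rule hom_a_inv)
  show "h (x \<ominus>\<^bsub>M\<^esub> y) = h x \<ominus>\<^bsub>N\<^esub> h y" if "x \<in> carrier M" "y \<in> carrier M"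
    using that neg by (simp add: a_minus_def)
  show "h (\<Oplus>\<^bsub>M\<^esub>i\<in>A. f i) = (\<Oplus>\<^bsub>N\<^esub>i\<in>A. h (f i))" if "f \<in> A \<rightarrow> carrier M"
    using that
  proof (induction A rule: infinite_finite_induct)
    case (insert x F)
    then have "(\<lambda>i. h (f i)) \<in> F \<rightarrow> carrier N" by (auto simp: Pi_def)
    with insert show ?case by (simp add: Pi_def)
  qed (simp_all add: z)
qed

lemma linear_maps_hom:
  assumes M: "abelian_group M" and N: "abelian_group N" and h: "h \<in> linear_maps K M N"
  shows "h \<zero>\<^bsub>M\<^esub> = \<zero>\<^bsub>N\<^esub>"
    and "x \<in> carrier M \<Longrightarrow> h (\<ominus>\<^bsub>M\<^esub> x) = \<ominus>\<^bsub>N\<^esub> h x"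
    and "\<lbrakk>x \<in> carrier M; y \<in> carrier M\<rbrakk> \<Longrightarrow> h (x \<ominus>\<^bsub>M\<^esub> y) = h x \<ominus>\<^bsub>N\<^esub> h y"
    and "f \<in> A \<rightarrow> carrier M \<Longrightarrow> h (\<Oplus>\<^bsub>M\<^esub>i\<in>A. f i) = (\<Oplus>\<^bsub>N\<^esub>i\<in>A. h (f i))"
  using abelian_group_add_hom[OF M N linear_mapsD(1)[OF h] linear_mapsD(2)[OF h]] by blast+

lemma module_abelian_group: "module K M \<Longrightarrow> abelian_group M"
  by (rule module.axioms(2))

lemma submoduleD:
  assumes "submodule W K M"
  shows "W \<subseteq> carrier M" "\<zero>\<^bsub>M\<^esub> \<in> W"
    "\<And>x y. \<lbrakk>x \<in> W; y \<in> W\<rbrakk> \<Longrightarrow> x \<oplus>\<^bsub>M\<^esub> y \<in> W"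
    "\<And>x. x \<in> W \<Longrightarrow> \<ominus>\<^bsub>M\<^esub> x \<in> W"
    "\<And>x y. \<lbrakk>x \<in> W; y \<in> W\<rbrakk> \<Longrightarrow> x \<ominus>\<^bsub>M\<^esub> y \<in> W"
    "\<And>a x. \<lbrakk>a \<in> carrier K; x \<in> W\<rbrakk> \<Longrightarrow> a \<odot>\<^bsub>M\<^esub> x \<in> W"
proof -
  interpret submodule W K M by (rule assms)
  show "W \<subseteq> carrier M" using subset by simp
  show "\<zero>\<^bsub>M\<^esub> \<in> W" using one_closed by simp
  show add: "x \<oplus>\<^bsub>M\<^esub> y \<in> W" if "x \<in> W" "y \<in> W" for x y using m_closed[OF that] by simp
  show neg: "\<ominus>\<^bsub>M\<^esub> x \<in> W" if "x \<in> W" for x using m_inv_closed[OF that] by (simp add: a_inv_def)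
  show "x \<ominus>\<^bsub>M\<^esub> y \<in> W" if "x \<in> W" "y \<in> W" for x y using that add neg by (simp add: a_minus_def)
  show "a \<odot>\<^bsub>M\<^esub> x \<in> W" if "a \<in> carrier K" "x \<in> W" for a x using that by simp
qed

lemma submodule_finsum:
  assumes M: "abelian_group M" and W: "submodule W K M" and f: "\<And>i. i \<in> A \<Longrightarrow> f i \<in> W"
  shows "(\<Oplus>\<^bsub>M\<^esub>i\<in>A. f i) \<in> W"
proof -
  interpret abelian_group M by (rule M)
  show ?thesis using f
  proof (induction A rule: infinite_finite_induct)
    case (insert x F)
    then have "f \<in> F \<rightarrow> carrier M" "f x \<in> carrier M" using submoduleD(1)[OF W] by auto
    then show ?case using insert submoduleD(3)[OF W] by (simp add: finsum_insert)
  qed (simp_all add: submoduleD(2)[OF W])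
qed

lemma submodule_zero: "module K M \<Longrightarrow> submodule {\<zero>\<^bsub>M\<^esub>} K M"
proof -
  assume "module K M"
  then interpret module K M .
  show ?thesis by (rule submoduleI) auto
qed

lemma submodule_preimage:
  assumes M: "module K M" and N: "module K N" and h: "h \<in> linear_maps K M N" and V: "submodule V K N"
  shows "submodule {x \<in> carrier M. h x \<in> V} K M"
proof -
  interpret M: module K M by (rule M)
  interpret N: module K N by (rule N)
  note hom = linear_maps_hom[OF M.abelian_group_axioms N.abelian_group_axioms h]
  show ?thesis
    by (rule M.submoduleI) (auto simp: hom linear_mapsD[OF h] submoduleD[OF V])
qed

lemma mspan_submodule:
  assumes "module K M" and S: "S \<subseteq> carrier M"
  shows "submodule (mspan K M S) K M"
proof -
  interpret module K M by (rule assms)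
  let ?F = "{W. submodule W K M \<and> S \<subseteq> W}"
  have c: "carrier M \<in> ?F" using carrier_is_submodule S by simp
  show ?thesis unfolding mspan_def
    using c by (intro submoduleI) (auto intro: submoduleD)
qed

lemma mspan_superset: "S \<subseteq> mspan K M S"
  by (auto simp: mspan_def)

lemma mspan_least: "\<lbrakk>submodule W K M; S \<subseteq> W\<rbrakk> \<Longrightarrow> mspan K M S \<subseteq> W"
  by (auto simp: mspan_def)

text \<open>The preimage of \<open>V\<close> is a submodule containing \<open>S\<close>, hence
  contains the span.\<close>

lemma mspan_map:
  assumes M: "module K M" and N: "module K N" and h: "h \<in> linear_maps K M N" and V: "submodule V K N"
    and S: "S \<subseteq> carrier M" "\<And>x. x \<in> S \<Longrightarrow> h x \<in> V" and x: "x \<in> mspan K M S"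
  shows "h x \<in> V"
  using mspan_least[OF submodule_preimage[OF M N h V], of S] S x by auto

section \<open>Free modules\<close>

lemma free_mod_carrierI:
  "\<lbrakk>\<And>x. a x \<in> carrier K; finite {x. a x \<noteq> \<zero>\<^bsub>K\<^esub>}; \<And>x. x \<notin> X \<Longrightarrow> a x = \<zero>\<^bsub>K\<^esub>\<rbrakk> \<Longrightarrow> a \<in> carrier (free_mod K X)"
  by (simp add: free_mod_def)

lemma free_mod_carrierD:
  assumes "a \<in> carrier (free_mod K X)"
  shows "a x \<in> carrier K" "finite {x. a x \<noteq> \<zero>\<^bsub>K\<^esub>}" "x \<notin> X \<Longrightarrow> a x = \<zero>\<^bsub>K\<^esub>"
  using assms by (auto simp: free_mod_def)

lemma free_mod_simps [simp]:
  "(a \<oplus>\<^bsub>free_mod K X\<^esub> b) = (\<lambda>x. a x \<oplus>\<^bsub>K\<^esub> b x)"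
  "\<zero>\<^bsub>free_mod K X\<^esub> = (\<lambda>_. \<zero>\<^bsub>K\<^esub>)"
  "(c \<odot>\<^bsub>free_mod K X\<^esub> a) = (\<lambda>x. c \<otimes>\<^bsub>K\<^esub> a x)"
  by (simp_all add: free_mod_def)

context cring
begin

lemma free_mod_module: "module R (free_mod R X)"
proof (rule moduleI)
  show "abelian_group (free_mod R X)"
  proof (rule abelian_groupI)
    fix a b assume a: "a \<in> carrier (free_mod R X)" and b: "b \<in> carrier (free_mod R X)"
    note [simp] = free_mod_carrierD[OF a] free_mod_carrierD[OF b]
    have "finite {x. a x \<oplus> b x \<noteq> \<zero>}"
      by (rule finite_subset[OF _ finite_UnI[OF free_mod_carrierD(2)[OF a] free_mod_carrierD(2)[OF b]]])
        (auto simp del: Un_iff)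
    then show "a \<oplus>\<^bsub>free_mod R X\<^esub> b \<in> carrier (free_mod R X)"
      by (auto intro: free_mod_carrierI)
    show "a \<oplus>\<^bsub>free_mod R X\<^esub> b = b \<oplus>\<^bsub>free_mod R X\<^esub> a" by (auto simp: a_comm)
    have "\<exists>y\<in>carrier (free_mod R X). (\<lambda>x. y x \<oplus> a x) = (\<lambda>_. \<zero>)"
    proof (rule bexI[of _ "\<lambda>x. \<ominus> a x"])
      have "finite {x. \<ominus> a x \<noteq> \<zero>}"
        by (rule finite_subset[OF _ free_mod_carrierD(2)[OF a]]) auto
      then show "(\<lambda>x. \<ominus> a x) \<in> carrier (free_mod R X)"
        by (auto intro: free_mod_carrierI)
    qed (simp add: l_neg)
    then show "\<exists>y\<in>carrier (free_mod R X). y \<oplus>\<^bsub>free_mod R X\<^esub> a = \<zero>\<^bsub>free_mod R X\<^esub>" by simp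
    show "\<zero>\<^bsub>free_mod R X\<^esub> \<oplus>\<^bsub>free_mod R X\<^esub> a = a" by simp
    fix c assume c: "c \<in> carrier (free_mod R X)"
    show "a \<oplus>\<^bsub>free_mod R X\<^esub> b \<oplus>\<^bsub>free_mod R X\<^esub> c = a \<oplus>\<^bsub>free_mod R X\<^esub> (b \<oplus>\<^bsub>free_mod R X\<^esub> c)"
      using free_mod_carrierD(1)[OF c] by (simp add: a_assoc)
  qed (auto intro: free_mod_carrierI)
next
  fix a x assume a: "a \<in> carrier R" and x: "x \<in> carrier (free_mod R X)"
  note [simp] = free_mod_carrierD[OF x]
  have "finite {y. a \<otimes> x y \<noteq> \<zero>}" 
    by (rule finite_subset[OF _ free_mod_carrierD(2)[OF x]]) (auto simp: a)
  then show "a \<odot>\<^bsub>free_mod R X\<^esub> x \<in> carrier (free_mod R X)"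
    using a by (auto intro: free_mod_carrierI)
  fix b assume b: "b \<in> carrier R"
  show "(a \<oplus> b) \<odot>\<^bsub>free_mod R X\<^esub> x = a \<odot>\<^bsub>free_mod R X\<^esub> x \<oplus>\<^bsub>free_mod R X\<^esub> b \<odot>\<^bsub>free_mod R X\<^esub> x"
    using a b by (simp add: l_distr)
  show "(a \<otimes> b) \<odot>\<^bsub>free_mod R X\<^esub> x = a \<odot>\<^bsub>free_mod R X\<^esub> (b \<odot>\<^bsub>free_mod R X\<^esub> x)"
    using a b by (simp add: m_assoc)
next
  fix a x y assume a: "a \<in> carrier R" and x: "x \<in> carrier (free_mod R X)" and y: "y \<in> carrier (free_mod R X)"
  show "a \<odot>\<^bsub>free_mod R X\<^esub> (x \<oplus>\<^bsub>free_mod R X\<^esub> y) = a \<odot>\<^bsub>free_mod R X\<^esub> x \<oplus>\<^bsub>free_mod R X\<^esub> a \<odot>\<^bsub>free_mod R X\<^esub> y"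
    using a free_mod_carrierD(1)[OF x] free_mod_carrierD(1)[OF y] by (simp add: r_distr)
next
  fix x assume x: "x \<in> carrier (free_mod R X)"
  show "\<one> \<odot>\<^bsub>free_mod R X\<^esub> x = x" using free_mod_carrierD(1)[OF x] by simp
qed (rule is_cring)

lemma basis_carrier: "x \<in> X \<Longrightarrow> basis R x \<in> carrier (free_mod R X)"
  by (rule free_mod_carrierI) (auto simp: basis_def intro: finite_subset[of _ "{x}"])

text \<open>Induction on the support: one coefficient is split off and set to zero.\<close>

lemma free_mod_induct [consumes 1, case_names zero add]:
  assumes a: "a \<in> carrier (free_mod R X)"
    and zero: "P \<zero>\<^bsub>free_mod R X\<^esub>"
    and add: "\<And>c x a. \<lbrakk>c \<in> carrier R; x \<in> X; a \<in> carrier (free_mod R X); P a\<rbrakk> \<Longrightarrow>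
      P (c \<odot>\<^bsub>free_mod R X\<^esub> basis R x \<oplus>\<^bsub>free_mod R X\<^esub> a)"
  shows "P a"
proof -
  have "\<forall>a. a \<in> carrier (free_mod R X) \<longrightarrow> {x. a x \<noteq> \<zero>} = A \<longrightarrow> P a" if "finite A" for A
    using that
  proof (induction A)
    case empty
    show ?case using zero by (auto simp: fun_eq_iff[symmetric])
  next
    case (insert x A)
    show ?case
    proof (intro allI impI)
      fix a assume a: "a \<in> carrier (free_mod R X)" and supp: "{x. a x \<noteq> \<zero>} = insert x A"
      have xX: "x \<in> X" using free_mod_carrierD(3)[OF a] supp by blast
      define b where "b = a(x := \<zero>)"
      have supp_b: "{x. b x \<noteq> \<zero>} = A" using supp insert.hyps by (auto simp: b_def)
      have b: "b \<in> carrier (free_mod R X)"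
        using free_mod_carrierD[OF a] supp_b insert.hyps by (intro free_mod_carrierI) (auto simp: b_def)
      have "a = a x \<odot>\<^bsub>free_mod R X\<^esub> basis R x \<oplus>\<^bsub>free_mod R X\<^esub> b"
        using free_mod_carrierD(1)[OF a] by (auto simp: b_def basis_def)
      then show "P a" using add[OF free_mod_carrierD(1)[OF a] xX b] insert.IH b supp_b by metis
    qed
  qed
  then show ?thesis using a free_mod_carrierD(2) by blast
qed

lemma free_mod_linear_eq:
  assumes M: "abelian_group M" and f: "f \<in> linear_maps R (free_mod R X) M" and g: "g \<in> linear_maps R (free_mod R X) M"
    and eq: "\<And>x. x \<in> X \<Longrightarrow> f (basis R x) = g (basis R x)" and a: "a \<in> carrier (free_mod R X)"
  shows "f a = g a"
  using a
proof (induction rule: free_mod_induct)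
  case zero
  show ?case
    using linear_maps_hom(1)[OF module_abelian_group[OF free_mod_module] M] f g by metis
next
  case (add c x a)
  interpret F: module R "free_mod R X" by (rule free_mod_module)
  have cx: "c \<odot>\<^bsub>free_mod R X\<^esub> basis R x \<in> carrier (free_mod R X)"
    using F.smult_closed[OF add(1) basis_carrier[OF add(2)]] .
  show ?case
    using linear_mapsD(2)[OF f cx add(3)] linear_mapsD(2)[OF g cx add(3)]
      linear_mapsD(3)[OF f add(1) basis_carrier[OF add(2)]] linear_mapsD(3)[OF g add(1) basis_carrier[OF add(2)]]
      eq[OF add(2)] add(4) by simp
qed

lemma free_mod_submodule_all:
  assumes W: "submodule W R (free_mod R X)" and "\<And>x. x \<in> X \<Longrightarrow> basis R x \<in> W" and a: "a \<in> carrier (free_mod R X)"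
  shows "a \<in> W"
  using a
proof (induction rule: free_mod_induct)
  case (add c x a) 
  then show ?case using submoduleD(3)[OF W submoduleD(6)[OF W add(1)] add(4)] assms(2) by blast
qed (use submoduleD(2)[OF W] in simp)

lemma finsum_if_subset:
  assumes "finite A" "B \<subseteq> A" "f \<in> A \<rightarrow> carrier R" "\<And>x. x \<in> A \<Longrightarrow> x \<notin> B \<Longrightarrow> f x = \<zero>"
  shows "(\<Oplus>x\<in>B. f x) = (\<Oplus>x\<in>A. f x)"
  using assms by (intro add.finprod_mono_neutral_cong_left) auto

text \<open>The index set of the defining sum depends on the argument and on \<open>y\<close>.
  Summing over a fixed finite set that contains the support makes additivity and homogeneity
  termwise statements.\<close>

lemma free_map_eq:
  assumes a: "a \<in> carrier (free_mod R X)" and A: "finite A" "{x. a x \<noteq> \<zero>} \<subseteq> A"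
  shows "free_map R \<phi> a y = (\<Oplus>x\<in>A. if \<phi> x = y then a x else \<zero>)"
proof -
  note [simp] = free_mod_carrierD(1)[OF a]
  have "free_map R \<phi> a y = (\<Oplus>x\<in>{x. a x \<noteq> \<zero> \<and> \<phi> x = y}. if \<phi> x = y then a x else \<zero>)"
    unfolding free_map_def by (intro finsum_cong') auto
  also have "\<dots> = (\<Oplus>x\<in>A. if \<phi> x = y then a x else \<zero>)"
    using A by (intro finsum_if_subset) auto
  finally show ?thesis .
qed

lemma free_map_basis: "free_map R \<phi> (basis R x) = basis R (\<phi> x)"
proof
  fix y
  have "free_map R \<phi> (basis R x) y = (\<Oplus>z\<in>{x}. if \<phi> z = y then basis R x z else \<zero>)"
    by (rule free_map_eq[OF basis_carrier[of x "{x}"]]) (auto simp: basis_def)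
  then show "free_map R \<phi> (basis R x) y = basis R (\<phi> x) y" by (auto simp: basis_def)
qed

lemma free_map_linear:
  assumes \<phi>: "\<And>x. x \<in> X \<Longrightarrow> \<phi> x \<in> Y"
  shows "free_map R \<phi> \<in> linear_maps R (free_mod R X) (free_mod R Y)"
proof (rule linear_mapsI)
  fix a assume a: "a \<in> carrier (free_mod R X)"
  note [simp] = free_mod_carrierD(1)[OF a]
  note fa = free_map_eq[OF a free_mod_carrierD(2)[OF a] subset_refl]
  have z: "free_map R \<phi> a y = \<zero>" if "y \<notin> \<phi> ` {x. a x \<noteq> \<zero>}" for y
  proof -
    have "free_map R \<phi> a y = (\<Oplus>x\<in>{x. a x \<noteq> \<zero>}. \<zero>)" unfolding fa using that by (intro finsum_cong') auto
    then show ?thesis by simp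
  qed
  show "free_map R \<phi> a \<in> carrier (free_mod R Y)"
  proof (rule free_mod_carrierI)
    show "free_map R \<phi> a y \<in> carrier R" for y unfolding fa by (intro finsum_closed) auto
    show "finite {y. free_map R \<phi> a y \<noteq> \<zero>}"
      by (rule finite_subset[OF _ finite_imageI[OF free_mod_carrierD(2)[OF a], of \<phi>]]) (use z in blast)
    show "free_map R \<phi> a y = \<zero>" if "y \<notin> Y" for y
      using that \<phi> free_mod_carrierD(3)[OF a] by (intro z) blast
  qed
  show "free_map R \<phi> (c \<odot>\<^bsub>free_mod R X\<^esub> a) = c \<odot>\<^bsub>free_mod R Y\<^esub> free_map R \<phi> a" if c: "c \<in> carrier R" for c
  proof
    fix y
    interpret F: module R "free_mod R X" by (rule free_mod_module)
    have "free_map R \<phi> (c \<odot>\<^bsub>free_mod R X\<^esub> a) y = (\<Oplus>x\<in>{x. a x \<noteq> \<zero>}. if \<phi> x = y then c \<otimes> a x else \<zero>)"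
    proof -
      have "{x. (c \<odot>\<^bsub>free_mod R X\<^esub> a) x \<noteq> \<zero>} \<subseteq> {x. a x \<noteq> \<zero>}" using c by auto
      from free_map_eq[OF F.smult_closed[OF c a] free_mod_carrierD(2)[OF a] this, of \<phi> y]
      show ?thesis unfolding free_mod_simps .
    qed
    also have "\<dots> = (\<Oplus>x\<in>{x. a x \<noteq> \<zero>}. c \<otimes> (if \<phi> x = y then a x else \<zero>))"
      using c by (intro finsum_cong') auto
    also have "\<dots> = c \<otimes> free_map R \<phi> a y" unfolding fa
      using c free_mod_carrierD(2)[OF a] by (intro finsum_rdistr[symmetric]) auto
    finally show "free_map R \<phi> (c \<odot>\<^bsub>free_mod R X\<^esub> a) y = (c \<odot>\<^bsub>free_mod R Y\<^esub> free_map R \<phi> a) y" by simp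
  qed
  fix b assume b: "b \<in> carrier (free_mod R X)"
  note [simp] = free_mod_carrierD(1)[OF b]
  show "free_map R \<phi> (a \<oplus>\<^bsub>free_mod R X\<^esub> b) = free_map R \<phi> a \<oplus>\<^bsub>free_mod R Y\<^esub> free_map R \<phi> b"
  proof
    fix y
    interpret F: module R "free_mod R X" by (rule free_mod_module)
    let ?A = "{x. a x \<noteq> \<zero>} \<union> {x. b x \<noteq> \<zero>}"
    have A: "finite ?A" using free_mod_carrierD(2)[OF a] free_mod_carrierD(2)[OF b] by simp
    have "free_map R \<phi> (a \<oplus>\<^bsub>free_mod R X\<^esub> b) y = (\<Oplus>x\<in>?A. if \<phi> x = y then a x \<oplus> b x else \<zero>)"
    proof -
      have "{x. (a \<oplus>\<^bsub>free_mod R X\<^esub> b) x \<noteq> \<zero>} \<subseteq> ?A" by auto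
      from free_map_eq[OF F.a_closed[OF a b] A this, of \<phi> y]
      show ?thesis unfolding free_mod_simps .
    qed
    also have "\<dots> = (\<Oplus>x\<in>?A. (if \<phi> x = y then a x else \<zero>) \<oplus> (if \<phi> x = y then b x else \<zero>))"
      by (intro finsum_cong') auto
    also have "\<dots> = free_map R \<phi> a y \<oplus> free_map R \<phi> b y"
      unfolding free_map_eq[OF a A Un_upper1] free_map_eq[OF b A Un_upper2]
      by (intro finsum_addf) auto
    finally show "free_map R \<phi> (a \<oplus>\<^bsub>free_mod R X\<^esub> b) y = (free_map R \<phi> a \<oplus>\<^bsub>free_mod R Y\<^esub> free_map R \<phi> b) y" by simp
  qed
qed

lemma free_bimap_eq:
  assumes a: "a \<in> carrier (free_mod R X)" and A: "finite A" "{x. a x \<noteq> \<zero>} \<subseteq> A"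
    and b: "b \<in> carrier (free_mod R Y)" and B: "finite B" "{y. b y \<noteq> \<zero>} \<subseteq> B"
  shows "free_bimap R \<psi> a b z = (\<Oplus>p\<in>A\<times>B. if \<psi> (fst p) (snd p) = z then a (fst p) \<otimes> b (snd p) else \<zero>)"
proof -
  note [simp] = free_mod_carrierD(1)[OF a] free_mod_carrierD(1)[OF b]
  have "free_bimap R \<psi> a b z = (\<Oplus>p\<in>{(x, y). a x \<noteq> \<zero> \<and> b y \<noteq> \<zero> \<and> \<psi> x y = z}.
     if \<psi> (fst p) (snd p) = z then a (fst p) \<otimes> b (snd p) else \<zero>)"
    unfolding free_bimap_def by (intro finsum_cong') auto
  also have "\<dots> = (\<Oplus>p\<in>A\<times>B. if \<psi> (fst p) (snd p) = z then a (fst p) \<otimes> b (snd p) else \<zero>)"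
    using A B by (intro finsum_if_subset) auto
  finally show ?thesis .
qed

lemma free_bimap_closed:
  assumes \<psi>: "\<And>x y. \<lbrakk>x \<in> X; y \<in> Y\<rbrakk> \<Longrightarrow> \<psi> x y \<in> Z"
    and a: "a \<in> carrier (free_mod R X)" and b: "b \<in> carrier (free_mod R Y)"
  shows "free_bimap R \<psi> a b \<in> carrier (free_mod R Z)"
proof -
  note [simp] = free_mod_carrierD(1)[OF a] free_mod_carrierD(1)[OF b]
  let ?A = "{x. a x \<noteq> \<zero>}" and ?B = "{y. b y \<noteq> \<zero>}"
  note A = free_mod_carrierD(2)[OF a] and B = free_mod_carrierD(2)[OF b]
  note eq = free_bimap_eq[OF a A subset_refl b B subset_refl]
  have z: "free_bimap R \<psi> a b z = \<zero>" if "z \<notin> (\<lambda>p. \<psi> (fst p) (snd p)) ` (?A \<times> ?B)" for z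
  proof -
    have "free_bimap R \<psi> a b z = (\<Oplus>p\<in>?A\<times>?B. \<zero>)" unfolding eq
      using that by (intro finsum_cong') auto
    then show ?thesis by simp
  qed
  show ?thesis
  proof (rule free_mod_carrierI)
    show "free_bimap R \<psi> a b z \<in> carrier R" for z unfolding eq by (intro finsum_closed) auto
    show "finite {z. free_bimap R \<psi> a b z \<noteq> \<zero>}"
      by (rule finite_subset[OF _ finite_imageI[OF finite_cartesian_product[OF A B], of "\<lambda>p. \<psi> (fst p) (snd p)"]]) (use z in blast)
    show "free_bimap R \<psi> a b z = \<zero>" if "z \<notin> Z" for z
    proof (rule z)
      show "z \<notin> (\<lambda>p. \<psi> (fst p) (snd p)) ` (?A \<times> ?B)"
        using that \<psi> free_mod_carrierD(3)[OF a] free_mod_carrierD(3)[OF b] by fastforce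
    qed
  qed
qed

lemma free_bimap_linear_left:
  assumes \<psi>: "\<And>x y. \<lbrakk>x \<in> X; y \<in> Y\<rbrakk> \<Longrightarrow> \<psi> x y \<in> Z" and b: "b \<in> carrier (free_mod R Y)"
  shows "(\<lambda>a. free_bimap R \<psi> a b) \<in> linear_maps R (free_mod R X) (free_mod R Z)"
proof (rule linear_mapsI)
  interpret F: module R "free_mod R X" by (rule free_mod_module)
  let ?B = "{y. b y \<noteq> \<zero>}"
  note B = free_mod_carrierD(2)[OF b]
  note [simp] = free_mod_carrierD(1)[OF b]
  fix a assume a: "a \<in> carrier (free_mod R X)"
  note A = free_mod_carrierD(2)[OF a]
  note [simp] = free_mod_carrierD(1)[OF a]
  show "free_bimap R \<psi> a b \<in> carrier (free_mod R Z)" by (rule free_bimap_closed[OF \<psi> a b])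
  show "free_bimap R \<psi> (c \<odot>\<^bsub>free_mod R X\<^esub> a) b = c \<odot>\<^bsub>free_mod R Z\<^esub> free_bimap R \<psi> a b" if c: "c \<in> carrier R" for c
  proof
    fix z
    have "{x. (c \<odot>\<^bsub>free_mod R X\<^esub> a) x \<noteq> \<zero>} \<subseteq> {x. a x \<noteq> \<zero>}" using c by auto
    then have "free_bimap R \<psi> (c \<odot>\<^bsub>free_mod R X\<^esub> a) b z =
      (\<Oplus>p\<in>{x. a x \<noteq> \<zero>}\<times>?B. if \<psi> (fst p) (snd p) = z then c \<otimes> a (fst p) \<otimes> b (snd p) else \<zero>)"
      using free_bimap_eq[OF F.smult_closed[OF c a] A _ b B subset_refl, of \<psi> z] unfolding free_mod_simps by iprover
    also have "\<dots> = (\<Oplus>p\<in>{x. a x \<noteq> \<zero>}\<times>?B. c \<otimes> (if \<psi> (fst p) (snd p) = z then a (fst p) \<otimes> b (snd p) else \<zero>))"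
      using c by (intro finsum_cong') (auto simp: m_assoc)
    also have "\<dots> = c \<otimes> free_bimap R \<psi> a b z" unfolding free_bimap_eq[OF a A subset_refl b B subset_refl]
      using c A B by (intro finsum_rdistr[symmetric]) auto
    finally show "free_bimap R \<psi> (c \<odot>\<^bsub>free_mod R X\<^esub> a) b z = (c \<odot>\<^bsub>free_mod R Z\<^esub> free_bimap R \<psi> a b) z" by simp
  qed
  fix a' assume a': "a' \<in> carrier (free_mod R X)"
  note [simp] = free_mod_carrierD(1)[OF a']
  show "free_bimap R \<psi> (a \<oplus>\<^bsub>free_mod R X\<^esub> a') b = free_bimap R \<psi> a b \<oplus>\<^bsub>free_mod R Z\<^esub> free_bimap R \<psi> a' b"
  proof
    fix z
    let ?A = "{x. a x \<noteq> \<zero>} \<union> {x. a' x \<noteq> \<zero>}"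
    have A: "finite ?A" using free_mod_carrierD(2)[OF a] free_mod_carrierD(2)[OF a'] by simp
    have "{x. (a \<oplus>\<^bsub>free_mod R X\<^esub> a') x \<noteq> \<zero>} \<subseteq> ?A" by auto
    then have "free_bimap R \<psi> (a \<oplus>\<^bsub>free_mod R X\<^esub> a') b z =
      (\<Oplus>p\<in>?A\<times>?B. if \<psi> (fst p) (snd p) = z then (a (fst p) \<oplus> a' (fst p)) \<otimes> b (snd p) else \<zero>)"
      using free_bimap_eq[OF F.a_closed[OF a a'] A _ b B subset_refl, of \<psi> z] unfolding free_mod_simps by iprover
    also have "\<dots> = (\<Oplus>p\<in>?A\<times>?B. (if \<psi> (fst p) (snd p) = z then a (fst p) \<otimes> b (snd p) else \<zero>) \<oplus>
       (if \<psi> (fst p) (snd p) = z then a' (fst p) \<otimes> b (snd p) else \<zero>))"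
      by (intro finsum_cong') (auto simp: l_distr)
    also have "\<dots> = free_bimap R \<psi> a b z \<oplus> free_bimap R \<psi> a' b z"
      unfolding free_bimap_eq[OF a A Un_upper1 b B subset_refl] free_bimap_eq[OF a' A Un_upper2 b B subset_refl]
      by (intro finsum_addf) auto
    finally show "free_bimap R \<psi> (a \<oplus>\<^bsub>free_mod R X\<^esub> a') b z = (free_bimap R \<psi> a b \<oplus>\<^bsub>free_mod R Z\<^esub> free_bimap R \<psi> a' b) z" by simp
  qed
qed

text \<open>Exchanging the factors is harmless since the ground ring is commutative; linearity in
  the second argument thereby follows from linearity in the first.\<close>

lemma free_bimap_flip:
  assumes a: "a \<in> carrier (free_mod R X)" and b: "b \<in> carrier (free_mod R Y)"
  shows "free_bimap R \<psi> a b = free_bimap R (\<lambda>y x. \<psi> x y) b a"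
proof
  fix z
  note [simp] = free_mod_carrierD(1)[OF a] free_mod_carrierD(1)[OF b]
  let ?S = "{(x, y). a x \<noteq> \<zero> \<and> b y \<noteq> \<zero> \<and> \<psi> x y = z}" and ?T = "{(y, x). b y \<noteq> \<zero> \<and> a x \<noteq> \<zero> \<and> \<psi> x y = z}"
  have img: "?S = prod.swap ` ?T" by auto
  have "free_bimap R \<psi> a b z = (\<Oplus>p\<in>prod.swap ` ?T. a (fst p) \<otimes> b (snd p))"
    unfolding free_bimap_def img ..
  also have "\<dots> = (\<Oplus>p\<in>?T. a (fst (prod.swap p)) \<otimes> b (snd (prod.swap p)))"
    by (intro finsum_reindex) auto
  also have "\<dots> = free_bimap R (\<lambda>y x. \<psi> x y) b a z"
    unfolding free_bimap_def by (intro finsum_cong') (auto simp: m_comm)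
  finally show "free_bimap R \<psi> a b z = free_bimap R (\<lambda>y x. \<psi> x y) b a z" .
qed

lemma free_bimap_linear_right:
  assumes \<psi>: "\<And>x y. \<lbrakk>x \<in> X; y \<in> Y\<rbrakk> \<Longrightarrow> \<psi> x y \<in> Z" and a: "a \<in> carrier (free_mod R X)"
  shows "(\<lambda>b. free_bimap R \<psi> a b) \<in> linear_maps R (free_mod R Y) (free_mod R Z)"
proof -
  interpret F: module R "free_mod R Y" by (rule free_mod_module)
  have "(\<lambda>b. free_bimap R (\<lambda>y x. \<psi> x y) b a) \<in> linear_maps R (free_mod R Y) (free_mod R Z)"
    using \<psi> by (intro free_bimap_linear_left[OF _ a]) blast
  moreover have "free_bimap R \<psi> a b = free_bimap R (\<lambda>y x. \<psi> x y) b a" if "b \<in> carrier (free_mod R Y)" for b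
    by (rule free_bimap_flip[OF a that])
  ultimately show ?thesis
    unfolding linear_maps_def
    using F.add.m_closed F.smult_closed by (auto simp del: free_mod_simps)
qed

lemma free_bimap_basis: "free_bimap R \<psi> (basis R x) (basis R y) = basis R (\<psi> x y)"
proof
  fix z
  have "free_bimap R \<psi> (basis R x) (basis R y) z = (\<Oplus>p\<in>{x}\<times>{y}. if \<psi> (fst p) (snd p) = z then basis R x (fst p) \<otimes> basis R y (snd p) else \<zero>)"
    by (rule free_bimap_eq[OF basis_carrier[of x "{x}"] _ _ basis_carrier[of y "{y}"]]) (auto simp: basis_def)
  then show "free_bimap R \<psi> (basis R x) (basis R y) z = basis R (\<psi> x y) z"
    by (auto simp: basis_def)
qed

end

text \<open>The map out of a free module given by its universal property.\<close>

definition lift :: "('k, 'q) ring_scheme \<Rightarrow> ('k, 'v, 'm) module_scheme \<Rightarrow> ('x \<Rightarrow> 'v) \<Rightarrow> ('x \<Rightarrow> 'k) \<Rightarrow> 'v" where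
  "lift K M \<phi> a = (\<Oplus>\<^bsub>M\<^esub>x\<in>{x. a x \<noteq> \<zero>\<^bsub>K\<^esub>}. a x \<odot>\<^bsub>M\<^esub> \<phi> x)"

context module
begin

lemma lift_eq:
  assumes \<phi>: "\<And>x. x \<in> X \<Longrightarrow> \<phi> x \<in> carrier M" and a: "a \<in> carrier (free_mod R X)"
    and A: "finite A" "{x. a x \<noteq> \<zero>} \<subseteq> A" "A \<subseteq> X"
  shows "lift R M \<phi> a = (\<Oplus>\<^bsub>M\<^esub>x\<in>A. a x \<odot>\<^bsub>M\<^esub> \<phi> x)"
proof -
  have "a x \<odot>\<^bsub>M\<^esub> \<phi> x \<in> carrier M" if "x \<in> A" for x
    using that \<phi> A free_mod_carrierD(1)[OF a] by blast
  then show ?thesis unfolding lift_def using A \<phi>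
    by (intro M.add.finprod_mono_neutral_cong_left) auto
qed

lemma lift_linear:
  assumes \<phi>: "\<And>x. x \<in> X \<Longrightarrow> \<phi> x \<in> carrier M"
  shows "lift R M \<phi> \<in> linear_maps R (free_mod R X) M"
proof (rule linear_mapsI)
  interpret F: module R "free_mod R X" by (rule R.free_mod_module)
  fix a assume a: "a \<in> carrier (free_mod R X)"
  note [simp] = free_mod_carrierD(1)[OF a]
  note A = free_mod_carrierD(2)[OF a]
  have sub: "{x. a x \<noteq> \<zero>} \<subseteq> X" using free_mod_carrierD(3)[OF a] by blast
  have ac: "a x \<odot>\<^bsub>M\<^esub> \<phi> x \<in> carrier M" if "x \<in> X" for x
    using that \<phi> free_mod_carrierD(1)[OF a] by blast
  show "lift R M \<phi> a \<in> carrier M" unfolding lift_def using ac sub by (intro M.finsum_closed) auto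
  show "lift R M \<phi> (c \<odot>\<^bsub>free_mod R X\<^esub> a) = c \<odot>\<^bsub>M\<^esub> lift R M \<phi> a" if c: "c \<in> carrier R" for c
  proof -
    have s: "{x. (c \<odot>\<^bsub>free_mod R X\<^esub> a) x \<noteq> \<zero>} \<subseteq> {x. a x \<noteq> \<zero>}" using c by auto
    have "lift R M \<phi> (c \<odot>\<^bsub>free_mod R X\<^esub> a) = (\<Oplus>\<^bsub>M\<^esub>x\<in>{x. a x \<noteq> \<zero>}. (c \<otimes> a x) \<odot>\<^bsub>M\<^esub> \<phi> x)"
      using lift_eq[OF \<phi> F.smult_closed[OF c a] A s sub] unfolding free_mod_simps .
    also have "\<dots> = (\<Oplus>\<^bsub>M\<^esub>x\<in>{x. a x \<noteq> \<zero>}. c \<odot>\<^bsub>M\<^esub> (a x \<odot>\<^bsub>M\<^esub> \<phi> x))"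
      using c sub \<phi> ac by (intro M.finsum_cong') (auto simp: smult_assoc1)
    also have "\<dots> = c \<odot>\<^bsub>M\<^esub> lift R M \<phi> a" unfolding lift_def
      using c ac sub A by (intro finsum_smult_ldistr[symmetric]) auto
    finally show ?thesis .
  qed
  fix b assume b: "b \<in> carrier (free_mod R X)"
  note [simp] = free_mod_carrierD(1)[OF b]
  have bc: "b x \<odot>\<^bsub>M\<^esub> \<phi> x \<in> carrier M" if "x \<in> X" for x
    using that \<phi> free_mod_carrierD(1)[OF b] by blast
  show "lift R M \<phi> (a \<oplus>\<^bsub>free_mod R X\<^esub> b) = lift R M \<phi> a \<oplus>\<^bsub>M\<^esub> lift R M \<phi> b"
  proof -
    let ?A = "{x. a x \<noteq> \<zero>} \<union> {x. b x \<noteq> \<zero>}"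
    have A: "finite ?A" using free_mod_carrierD(2)[OF a] free_mod_carrierD(2)[OF b] by simp
    have s: "{x. (a \<oplus>\<^bsub>free_mod R X\<^esub> b) x \<noteq> \<zero>} \<subseteq> ?A" by auto
    have AX: "?A \<subseteq> X" using sub free_mod_carrierD(3)[OF b] by blast
    have "lift R M \<phi> (a \<oplus>\<^bsub>free_mod R X\<^esub> b) = (\<Oplus>\<^bsub>M\<^esub>x\<in>?A. (a x \<oplus> b x) \<odot>\<^bsub>M\<^esub> \<phi> x)"
      using lift_eq[OF \<phi> F.a_closed[OF a b] A s AX] unfolding free_mod_simps .
    also have "\<dots> = (\<Oplus>\<^bsub>M\<^esub>x\<in>?A. a x \<odot>\<^bsub>M\<^esub> \<phi> x \<oplus>\<^bsub>M\<^esub> b x \<odot>\<^bsub>M\<^esub> \<phi> x)"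
      using AX ac bc \<phi> by (intro M.finsum_cong') (auto simp: smult_l_distr)
    also have "\<dots> = (\<Oplus>\<^bsub>M\<^esub>x\<in>?A. a x \<odot>\<^bsub>M\<^esub> \<phi> x) \<oplus>\<^bsub>M\<^esub> (\<Oplus>\<^bsub>M\<^esub>x\<in>?A. b x \<odot>\<^bsub>M\<^esub> \<phi> x)"
      using AX ac bc by (intro M.finsum_addf) auto
    also have "\<dots> = lift R M \<phi> a \<oplus>\<^bsub>M\<^esub> lift R M \<phi> b"
      using lift_eq[OF \<phi> a A Un_upper1 AX] lift_eq[OF \<phi> b A Un_upper2 AX] by simp
    finally show ?thesis .
  qed
qed

lemma lift_basis:
  assumes "\<phi> x \<in> carrier M"
  shows "lift R M \<phi> (basis R x) = \<phi> x"
proof -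
  have "lift R M \<phi> (basis R x) = (\<Oplus>\<^bsub>M\<^esub>y\<in>{x}. basis R x y \<odot>\<^bsub>M\<^esub> \<phi> y)"
    using assms by (intro lift_eq[OF _ R.basis_carrier, where X="{x}"]) (auto simp: basis_def)
  then show ?thesis using assms by (simp add: basis_def)
qed

end

section \<open>Quotients\<close>

lemma submodule_abelian_subgroup:
  assumes M: "module K M" and W: "submodule W K M"
  shows "abelian_subgroup W M"
  by (rule abelian_subgroupI3)
    (use W M in \<open>auto simp: additive_subgroup_def submodule_def intro: module_abelian_group\<close>)

lemma quot_mod_carrier: "carrier (quot_mod M W) = (\<lambda>x. W +>\<^bsub>M\<^esub> x) ` carrier M"
  by (auto simp: quot_mod_def A_RCOSETS_def' )

lemma quot_mod_carrierI: "x \<in> carrier M \<Longrightarrow> W +>\<^bsub>M\<^esub> x \<in> carrier (quot_mod M W)"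
  by (simp add: quot_mod_carrier)

lemma quot_mod_zero: "\<zero>\<^bsub>quot_mod M W\<^esub> = W"
  by (simp add: quot_mod_def)

context
  fixes K :: "('k, 'q) ring_scheme" and M :: "('k, 'v, 'm) module_scheme" and W
  assumes M: "module K M" and W: "submodule W K M"
begin

interpretation module K M by (rule M)
interpretation abelian_subgroup W M by (rule submodule_abelian_subgroup[OF M W])

lemma coset_eq_iff:
  assumes x: "x \<in> carrier M" and y: "y \<in> carrier M"
  shows "W +>\<^bsub>M\<^esub> x = W +>\<^bsub>M\<^esub> y \<longleftrightarrow> x \<ominus>\<^bsub>M\<^esub> y \<in> W"
proof -
  have "W +>\<^bsub>M\<^esub> x = W +>\<^bsub>M\<^esub> y \<longleftrightarrow> x \<in> W +>\<^bsub>M\<^esub> y"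
    using a_repr_independence' a_rcos_self x y by metis
  also have "\<dots> \<longleftrightarrow> x \<ominus>\<^bsub>M\<^esub> y \<in> W"
    using a_rcos_module[OF y x] by (simp add: a_minus_def)
  finally show ?thesis .
qed

lemma coset_zero_iff:
  assumes x: "x \<in> carrier M"
  shows "W +>\<^bsub>M\<^esub> x = W \<longleftrightarrow> x \<in> W"
  using coset_eq_iff[OF x M.zero_closed] x submoduleD(1)[OF W] M.add.inv_one by (simp add: a_minus_def a_inv_def)

lemma mem_coset_iff:
  assumes y: "y \<in> carrier M"
  shows "x \<in> W +>\<^bsub>M\<^esub> y \<longleftrightarrow> x \<in> carrier M \<and> x \<ominus>\<^bsub>M\<^esub> y \<in> W"
  using a_rcos_module[OF y] a_r_coset_subset_G[OF submoduleD(1)[OF W] y]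
  by (auto simp: a_minus_def)

lemma quot_mod_add:
  "\<lbrakk>x \<in> carrier M; y \<in> carrier M\<rbrakk> \<Longrightarrow>
   (W +>\<^bsub>M\<^esub> x) \<oplus>\<^bsub>quot_mod M W\<^esub> (W +>\<^bsub>M\<^esub> y) = W +>\<^bsub>M\<^esub> (x \<oplus>\<^bsub>M\<^esub> y)"
  using a_rcos_sum by (simp add: quot_mod_def)

text \<open>Operations on quotients are defined as unions of cosets over all representatives. The
  members of such a union coincide, because representatives differ by elements of \<open>W\<close>
  and \<open>h\<close> sends these into \<open>V\<close>.\<close>

lemma coset_Union:
  assumes N: "module K' N" and V: "submodule V K' N"
    and h: "\<And>x. x \<in> carrier M \<Longrightarrow> h x \<in> carrier N"
      "\<And>x y. \<lbrakk>x \<in> carrier M; y \<in> carrier M\<rbrakk> \<Longrightarrow> h (x \<oplus>\<^bsub>M\<^esub> y) = h x \<oplus>\<^bsub>N\<^esub> h y"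
    and hW: "\<And>w. w \<in> W \<Longrightarrow> h w \<in> V" and x: "x \<in> carrier M"
  shows "(\<Union>z\<in>W +>\<^bsub>M\<^esub> x. V +>\<^bsub>N\<^esub> h z) = V +>\<^bsub>N\<^esub> h x"
proof -
  interpret N: module K' N by (rule N)
  interpret V: abelian_subgroup V N by (rule submodule_abelian_subgroup[OF N V])
  have "V +>\<^bsub>N\<^esub> h z = V +>\<^bsub>N\<^esub> h x" if z: "z \<in> W +>\<^bsub>M\<^esub> x" for z
  proof -
    have zc: "z \<in> carrier M" and "z \<ominus>\<^bsub>M\<^esub> x \<in> W" using z mem_coset_iff[OF x] by auto
    then have "h (z \<ominus>\<^bsub>M\<^esub> x) \<in> V" using hW by blast
    then have "h z \<ominus>\<^bsub>N\<^esub> h x \<in> V"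
      using abelian_group_add_hom(3)[OF M.abelian_group_axioms N.abelian_group_axioms h zc x] by simp
    then have "h z \<in> V +>\<^bsub>N\<^esub> h x"
      using V.a_rcos_module[OF h(1)[OF x] h(1)[OF zc]] by (simp add: a_minus_def)
    then show ?thesis using V.a_repr_independence' h(1)[OF x] by metis
  qed
  moreover have "x \<in> W +>\<^bsub>M\<^esub> x" using a_rcos_self x by blast
  ultimately show ?thesis by blast
qed

lemma quot_mod_smult:
  assumes a: "a \<in> carrier K" and x: "x \<in> carrier M"
  shows "a \<odot>\<^bsub>quot_mod M W\<^esub> (W +>\<^bsub>M\<^esub> x) = W +>\<^bsub>M\<^esub> (a \<odot>\<^bsub>M\<^esub> x)"
proof -
  have "(\<Union>z\<in>W +>\<^bsub>M\<^esub> x. W +>\<^bsub>M\<^esub> (a \<odot>\<^bsub>M\<^esub> z)) = W +>\<^bsub>M\<^esub> (a \<odot>\<^bsub>M\<^esub> x)"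
    by (rule coset_Union[OF M W]) (use a x in \<open>auto simp: smult_r_distr submoduleD(6)[OF W]\<close>)
  then show ?thesis by (simp add: quot_mod_def)
qed

lemma quot_mod_module: "module K (quot_mod M W)"
proof (rule moduleI)
  let ?Q = "quot_mod M W"
  show "abelian_group ?Q"
  proof (rule abelian_groupI)
    have W0: "W = W +>\<^bsub>M\<^esub> \<zero>\<^bsub>M\<^esub>" using coset_zero_iff[OF M.zero_closed] submoduleD(2)[OF W] by simp
    then show "\<zero>\<^bsub>?Q\<^esub> \<in> carrier ?Q" using quot_mod_carrierI[of "\<zero>\<^bsub>M\<^esub>" M W] by (simp add: quot_mod_zero)
    fix X assume "X \<in> carrier ?Q"
    then obtain x where x: "x \<in> carrier M" "X = W +>\<^bsub>M\<^esub> x" by (auto simp: quot_mod_carrier)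
    show "\<zero>\<^bsub>?Q\<^esub> \<oplus>\<^bsub>?Q\<^esub> X = X"
      using x quot_mod_add[OF M.zero_closed x(1)] W0 by (simp add: quot_mod_zero)
    have "(W +>\<^bsub>M\<^esub> (\<ominus>\<^bsub>M\<^esub> x)) \<oplus>\<^bsub>?Q\<^esub> X = \<zero>\<^bsub>?Q\<^esub>"
      using x quot_mod_add W0 by (simp add: quot_mod_zero M.l_neg)
    then show "\<exists>Y\<in>carrier ?Q. Y \<oplus>\<^bsub>?Q\<^esub> X = \<zero>\<^bsub>?Q\<^esub>" using x quot_mod_carrierI M.a_inv_closed by metis
    fix Y assume "Y \<in> carrier ?Q"
    then obtain y where y: "y \<in> carrier M" "Y = W +>\<^bsub>M\<^esub> y" by (auto simp: quot_mod_carrier)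
    show "X \<oplus>\<^bsub>?Q\<^esub> Y \<in> carrier ?Q" using x y by (simp add: quot_mod_add quot_mod_carrierI)
    show "X \<oplus>\<^bsub>?Q\<^esub> Y = Y \<oplus>\<^bsub>?Q\<^esub> X" using x y by (simp add: quot_mod_add M.a_comm)
    fix Z assume "Z \<in> carrier ?Q"
    then obtain z where z: "z \<in> carrier M" "Z = W +>\<^bsub>M\<^esub> z" by (auto simp: quot_mod_carrier)
    show "X \<oplus>\<^bsub>?Q\<^esub> Y \<oplus>\<^bsub>?Q\<^esub> Z = X \<oplus>\<^bsub>?Q\<^esub> (Y \<oplus>\<^bsub>?Q\<^esub> Z)" using x y z by (simp add: quot_mod_add M.a_assoc)
  qed
  fix a X assume a: "a \<in> carrier K" and "X \<in> carrier ?Q"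
  then obtain x where x: "x \<in> carrier M" "X = W +>\<^bsub>M\<^esub> x" by (auto simp: quot_mod_carrier)
  show "a \<odot>\<^bsub>?Q\<^esub> X \<in> carrier ?Q" using a x by (simp add: quot_mod_smult quot_mod_carrierI)
  fix b
  {
    assume b: "b \<in> carrier K"
    show "(a \<oplus>\<^bsub>K\<^esub> b) \<odot>\<^bsub>?Q\<^esub> X = a \<odot>\<^bsub>?Q\<^esub> X \<oplus>\<^bsub>?Q\<^esub> b \<odot>\<^bsub>?Q\<^esub> X"
      using a b x by (simp add: quot_mod_smult quot_mod_add smult_l_distr)
    show "(a \<otimes>\<^bsub>K\<^esub> b) \<odot>\<^bsub>?Q\<^esub> X = a \<odot>\<^bsub>?Q\<^esub> (b \<odot>\<^bsub>?Q\<^esub> X)"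
      using a b x by (simp add: quot_mod_smult smult_assoc1)
  }
  fix Y assume "Y \<in> carrier ?Q"
  then obtain y where y: "y \<in> carrier M" "Y = W +>\<^bsub>M\<^esub> y" by (auto simp: quot_mod_carrier)
  show "a \<odot>\<^bsub>?Q\<^esub> (X \<oplus>\<^bsub>?Q\<^esub> Y) = a \<odot>\<^bsub>?Q\<^esub> X \<oplus>\<^bsub>?Q\<^esub> a \<odot>\<^bsub>?Q\<^esub> Y"
    using a x y by (simp add: quot_mod_smult quot_mod_add smult_r_distr)
next
  fix X assume "X \<in> carrier (quot_mod M W)"
  then show "\<one>\<^bsub>K\<^esub> \<odot>\<^bsub>quot_mod M W\<^esub> X = X" by (auto simp: quot_mod_carrier quot_mod_smult)
qed (rule R.is_cring)

lemma quot_mod_linear: "(\<lambda>x. W +>\<^bsub>M\<^esub> x) \<in> linear_maps K M (quot_mod M W)"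
  by (rule linear_mapsI) (auto simp: quot_mod_carrierI quot_mod_add quot_mod_smult)

end

lemma linear_maps_quot:
  assumes M: "module K M" and W: "submodule W K M" and N: "module K N"
    and h: "\<And>x. x \<in> carrier M \<Longrightarrow> h (W +>\<^bsub>M\<^esub> x) = g x" and g: "g \<in> linear_maps K M N"
  shows "h \<in> linear_maps K (quot_mod M W) N"
proof (rule linear_mapsI)
  interpret module K M by (rule M)
  fix X assume "X \<in> carrier (quot_mod M W)"
  then obtain x where x: "x \<in> carrier M" "X = W +>\<^bsub>M\<^esub> x" by (auto simp: quot_mod_carrier)
  then show "h X \<in> carrier N" using h linear_mapsD[OF g] by simp
  show "h (a \<odot>\<^bsub>quot_mod M W\<^esub> X) = a \<odot>\<^bsub>N\<^esub> h X" if "a \<in> carrier K" for a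
    using that x by (simp add: quot_mod_smult[OF M W] h linear_mapsD[OF g])
  fix Y assume "Y \<in> carrier (quot_mod M W)"
  then obtain y where y: "y \<in> carrier M" "Y = W +>\<^bsub>M\<^esub> y" by (auto simp: quot_mod_carrier)
  then show "h (X \<oplus>\<^bsub>quot_mod M W\<^esub> Y) = h X \<oplus>\<^bsub>N\<^esub> h Y"
    using x by (simp add: quot_mod_add[OF M W] h linear_mapsD[OF g])
qed

section \<open>Modules over the categories\<close>

lemma is_cmodD:
  assumes "is_cmod K C M"
  shows "\<And>m. m \<ge> 1 \<Longrightarrow> module K (sp M m)"
    and "\<And>m l f. \<lbrakk>m \<ge> 1; l \<ge> 1; f \<in> Hom C m l\<rbrakk> \<Longrightarrow> act M m l f \<in> linear_maps K (sp M m) (sp M l)"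
    and "\<And>m x. \<lbrakk>m \<ge> 1; x \<in> carrier (sp M m)\<rbrakk> \<Longrightarrow> act M m m (idm m) x = x"
    and "\<And>m l p f g x. \<lbrakk>m \<ge> 1; l \<ge> 1; p \<ge> 1; f \<in> Hom C m l; g \<in> Hom C l p; x \<in> carrier (sp M m)\<rbrakk> \<Longrightarrow>
      act M m p (compose {1..m} g f) x = act M l p g (act M m l f x)"
  using assms unfolding is_cmod_def by blast+

lemma subcmodD:
  assumes "subcmod K C W M"
  shows "\<And>m. m \<ge> 1 \<Longrightarrow> submodule (W m) K (sp M m)"
    and "\<And>m l f x. \<lbrakk>m \<ge> 1; l \<ge> 1; f \<in> Hom C m l; x \<in> W m\<rbrakk> \<Longrightarrow> act M m l f x \<in> W l"
  using assms unfolding subcmod_def by blast+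

lemma quot_cmod_simps [simp]:
  "sp (quot_cmod M W) m = quot_mod (sp M m) (W m)"
  "act (quot_cmod M W) m l f X = (\<Union>x\<in>X. W l +>\<^bsub>sp M l\<^esub> act M m l f x)"
  by (simp_all add: quot_cmod_def)

lemma quot_cmod_act:
  assumes M: "is_cmod K C M" and W: "subcmod K C W M" and "m \<ge> 1" "l \<ge> 1" "f \<in> Hom C m l" "x \<in> carrier (sp M m)"
  shows "act (quot_cmod M W) m l f (W m +>\<^bsub>sp M m\<^esub> x) = W l +>\<^bsub>sp M l\<^esub> act M m l f x"
  using assms linear_mapsD[OF is_cmodD(2)[OF M]]
  by (simp, intro coset_Union[OF is_cmodD(1)[OF M] subcmodD(1)[OF W] is_cmodD(1)[OF M] subcmodD(1)[OF W]])
    (auto intro: subcmodD(2)[OF W])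

lemma quot_cmod_is_cmod:
  assumes M: "is_cmod K C M" and W: "subcmod K C W M"
  shows "is_cmod K C (quot_cmod M W)"
  unfolding is_cmod_def
proof (intro conjI allI impI ballI)
  fix m :: nat assume m: "m \<ge> 1"
  note Mm = is_cmodD(1)[OF M m] and Wm = subcmodD(1)[OF W m]
  show "module K (sp (quot_cmod M W) m)" using quot_mod_module[OF Mm Wm] by simp
  show "act (quot_cmod M W) m m (idm m) X = X" if "X \<in> carrier (sp (quot_cmod M W) m)" for X
    using that m quot_cmod_act[OF M W m m idm_Hom] is_cmodD(3)[OF M m]
    by (auto simp: quot_mod_carrier simp del: quot_cmod_simps(2))
  fix l :: nat and f assume l: "l \<ge> 1" and f: "f \<in> Hom C m l"
  note Ml = is_cmodD(1)[OF M l] and Wl = subcmodD(1)[OF W l]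
  have "act (quot_cmod M W) m l f \<in> linear_maps K (quot_mod (sp M m) (W m)) (quot_mod (sp M l) (W l))"
    using quot_cmod_act[OF M W m l f] linear_maps_comp[OF is_cmodD(2)[OF M m l f] quot_mod_linear[OF Ml Wl]]
    by (rule linear_maps_quot[OF Mm Wm quot_mod_module[OF Ml Wl]])
  then show "act (quot_cmod M W) m l f \<in> linear_maps K (sp (quot_cmod M W) m) (sp (quot_cmod M W) l)" by simp
  fix p :: nat and g X assume p: "p \<ge> 1" and g: "g \<in> Hom C l p" and "X \<in> carrier (sp (quot_cmod M W) m)"
  then obtain x where x: "x \<in> carrier (sp M m)" "X = W m +>\<^bsub>sp M m\<^esub> x" by (auto simp: quot_mod_carrier)
  show "act (quot_cmod M W) m p (compose {1..m} g f) X = act (quot_cmod M W) l p g (act (quot_cmod M W) m l f X)"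
    unfolding x(2) using quot_cmod_act[OF M W m p Hom_compose[OF f g] x(1)] quot_cmod_act[OF M W m l f x(1)]
      quot_cmod_act[OF M W l p g linear_mapsD(1)[OF is_cmodD(2)[OF M m l f] x(1)]] is_cmodD(4)[OF M m l p f g x(1)]
    by (simp del: quot_cmod_simps)
qed

lemma restrict_cmod_simps [simp]:
  "sp (restrict_cmod M W) m = (sp M m)\<lparr>carrier := W m\<rparr>"
  "act (restrict_cmod M W) = act M"
  by (simp_all add: restrict_cmod_def)

lemma restrict_cmod_is_cmod:
  assumes M: "is_cmod K C M" and W: "subcmod K C W M"
  shows "is_cmod K C (restrict_cmod M W)"
proof -
  have sub: "x \<in> carrier (sp M m)" if "m \<ge> 1" "x \<in> W m" for m x
    using that submoduleD(1)[OF subcmodD(1)[OF W that(1)]] by blast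
  show ?thesis
    unfolding is_cmod_def
  proof (intro conjI allI impI ballI)
    fix m :: nat assume m: "m \<ge> 1"
    show "module K (sp (restrict_cmod M W) m)"
      using submodule.submodule_is_module[OF subcmodD(1)[OF W m] is_cmodD(1)[OF M m]] by simp
    show "act (restrict_cmod M W) m m (idm m) x = x" if "x \<in> carrier (sp (restrict_cmod M W) m)" for x
      using that is_cmodD(3)[OF M m sub[OF m]] by simp
    fix l :: nat and f assume l: "l \<ge> 1" and f: "f \<in> Hom C m l"
    show "act (restrict_cmod M W) m l f \<in> linear_maps K (sp (restrict_cmod M W) m) (sp (restrict_cmod M W) l)"
      using linear_mapsD[OF is_cmodD(2)[OF M m l f]] sub[OF m] subcmodD(2)[OF W m l f]
      by (intro linear_mapsI) auto
    fix p :: nat and g x assume p: "p \<ge> 1" and g: "g \<in> Hom C l p" and "x \<in> carrier (sp (restrict_cmod M W) m)"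
    then show "act (restrict_cmod M W) m p (compose {1..m} g f) x =
      act (restrict_cmod M W) l p g (act (restrict_cmod M W) m l f x)"
      using is_cmodD(4)[OF M m l p f g sub[OF m]] by simp
  qed
qed

text \<open>Only negation needs care, being an inverse taken in the group with the given carrier.
  Uniqueness of inverses shows that the restricted module and \<open>M\<close> agree on it.\<close>

lemma submodule_restrict:
  assumes M: "module K M" and W: "submodule W K M"
  shows "submodule V K (M\<lparr>carrier := W\<rparr>) \<longleftrightarrow> submodule V K M \<and> V \<subseteq> W"
proof -
  interpret M: module K M by (rule M)
  interpret W: module K "M\<lparr>carrier := W\<rparr>" by (rule submodule.submodule_is_module[OF W M])
  have neg: "\<ominus>\<^bsub>M\<lparr>carrier := W\<rparr>\<^esub> x = \<ominus>\<^bsub>M\<^esub> x" if x: "x \<in> W" for x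
  proof (rule W.minus_equality[symmetric, THEN sym])
    show "\<ominus>\<^bsub>M\<^esub> x \<oplus>\<^bsub>M\<lparr>carrier := W\<rparr>\<^esub> x = \<zero>\<^bsub>M\<lparr>carrier := W\<rparr>\<^esub>"
      using x submoduleD(1)[OF W] by (auto simp: M.l_neg)
  qed (use x submoduleD[OF W] in auto)
  show ?thesis
  proof safe
    assume V: "submodule V K (M\<lparr>carrier := W\<rparr>)"
    note D = submoduleD[OF V]
    have VW: "V \<subseteq> W" using D(1) by simp
    then show "\<And>x. x \<in> V \<Longrightarrow> x \<in> W" by blast
    show "submodule V K M"
    proof (rule M.submoduleI)
      show "V \<subseteq> carrier M" using VW submoduleD(1)[OF W] by blast
      show "\<ominus>\<^bsub>M\<^esub> a \<in> V" if "a \<in> V" for a using D(4)[OF that] neg that VW by auto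
    qed (use D in auto)
  next
    assume V: "submodule V K M" and VW: "V \<subseteq> W"
    note D = submoduleD[OF V]
    show "submodule V K (M\<lparr>carrier := W\<rparr>)"
    proof (rule W.submoduleI)
      show "\<ominus>\<^bsub>M\<lparr>carrier := W\<rparr>\<^esub> a \<in> V" if "a \<in> V" for a using D(4)[OF that] neg that VW by auto
    qed (use D VW in auto)
  qed
qed

lemma subcmod_restrict:
  assumes M: "is_cmod K C M" and W: "subcmod K C W M"
  shows "subcmod K C V (restrict_cmod M W) \<longleftrightarrow> subcmod K C V M \<and> (\<forall>m\<ge>1. V m \<subseteq> W m)"
  using submodule_restrict[OF is_cmodD(1)[OF M] subcmodD(1)[OF W]] unfolding subcmod_def by auto

lemma subcmod_preimage:
  assumes M: "is_cmod K C M" and W: "subcmod K C W M" and V: "subcmod K C V (quot_cmod M W)"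
  shows "subcmod K C (\<lambda>m. {x \<in> carrier (sp M m). W m +>\<^bsub>sp M m\<^esub> x \<in> V m}) M"
  unfolding subcmod_def
proof (intro conjI allI impI ballI)
  fix m :: nat assume m: "m \<ge> 1"
  note Mm = is_cmodD(1)[OF M m] and Wm = subcmodD(1)[OF W m]
  show "submodule {x \<in> carrier (sp M m). W m +>\<^bsub>sp M m\<^esub> x \<in> V m} K (sp M m)"
    using submodule_preimage[OF Mm quot_mod_module[OF Mm Wm] quot_mod_linear[OF Mm Wm], of "V m"]
      subcmodD(1)[OF V m] by simp
  fix l :: nat and f x assume l: "l \<ge> 1" and f: "f \<in> Hom C m l"
    and x: "x \<in> {x \<in> carrier (sp M m). W m +>\<^bsub>sp M m\<^esub> x \<in> V m}"
  then show "act M m l f x \<in> {x \<in> carrier (sp M l). W l +>\<^bsub>sp M l\<^esub> x \<in> V l}"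
    using subcmodD(2)[OF V m l f, of "W m +>\<^bsub>sp M m\<^esub> x"] quot_cmod_act[OF M W m l f]
      linear_mapsD(1)[OF is_cmodD(2)[OF M m l f]] by (auto simp del: quot_cmod_simps)
qed

text \<open>The correspondence theorem: a submodule of the quotient is the image of its preimage,
  which lies between \<open>W\<close> and \<open>M\<close>.\<close>

lemma irreducible_quot_cmod:
  assumes M: "is_cmod K C M" and W: "subcmod K C W M"
    and ne: "\<exists>m\<ge>1. W m \<noteq> carrier (sp M m)"
    and max: "\<And>V. \<lbrakk>subcmod K C V M; \<And>m. m \<ge> 1 \<Longrightarrow> W m \<subseteq> V m\<rbrakk> \<Longrightarrow>
       (\<forall>m\<ge>1. V m = W m) \<or> (\<forall>m\<ge>1. V m = carrier (sp M m))"
  shows "irreducible_cmod K C (quot_cmod M W)"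
  unfolding irreducible_cmod_def
proof (intro conjI allI impI)
  show "is_cmod K C (quot_cmod M W)" by (rule quot_cmod_is_cmod[OF M W])
  obtain m x where m: "m \<ge> 1" and x: "x \<in> carrier (sp M m)" "x \<notin> W m"
    using ne submoduleD(1)[OF subcmodD(1)[OF W]] by blast
  have "W m +>\<^bsub>sp M m\<^esub> x \<noteq> W m" using coset_zero_iff[OF is_cmodD(1)[OF M m] subcmodD(1)[OF W m] x(1)] x(2) by simp
  then show "\<exists>m\<ge>1. carrier (sp (quot_cmod M W) m) \<noteq> {\<zero>\<^bsub>sp (quot_cmod M W) m\<^esub>}"
    using m x(1) by (auto simp: quot_mod_zero quot_mod_carrier intro!: exI[of _ m])
  fix V assume V: "subcmod K C V (quot_cmod M W)"
  define V' where "V' m = {x \<in> carrier (sp M m). W m +>\<^bsub>sp M m\<^esub> x \<in> V m}" for m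
  have V': "subcmod K C V' M" using subcmod_preimage[OF M W V] unfolding V'_def .
  have img: "V m = (\<lambda>x. W m +>\<^bsub>sp M m\<^esub> x) ` V' m" if "m \<ge> 1" for m
    using submoduleD(1)[OF subcmodD(1)[OF V that]] by (auto simp: V'_def quot_mod_carrier)
  have WV: "W m \<subseteq> V' m" if m: "m \<ge> 1" for m
  proof
    fix w assume w: "w \<in> W m"
    then have wc: "w \<in> carrier (sp M m)" using submoduleD(1)[OF subcmodD(1)[OF W m]] by blast
    then have "W m +>\<^bsub>sp M m\<^esub> w = W m" using coset_zero_iff[OF is_cmodD(1)[OF M m] subcmodD(1)[OF W m]] w by blast
    moreover have "W m \<in> V m" using submoduleD(2)[OF subcmodD(1)[OF V m]] by (simp add: quot_mod_zero)
    ultimately show "w \<in> V' m" using wc by (simp add: V'_def)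
  qed
  from max[OF V' WV]
  show "(\<forall>m\<ge>1. V m = {\<zero>\<^bsub>sp (quot_cmod M W) m\<^esub>}) \<or> (\<forall>m\<ge>1. V m = carrier (sp (quot_cmod M W) m))"
  proof
    assume eq: "\<forall>m\<ge>1. V' m = W m"
    have "V m = {W m}" if m: "m \<ge> 1" for m
    proof -
      have "W m +>\<^bsub>sp M m\<^esub> w = W m" if "w \<in> W m" for w
        using that coset_zero_iff[OF is_cmodD(1)[OF M m] subcmodD(1)[OF W m]]
          submoduleD(1)[OF subcmodD(1)[OF W m]] by blast
      then show ?thesis using img[OF m] eq m submoduleD(2)[OF subcmodD(1)[OF W m]] by auto
    qed
    then show ?thesis by (simp add: quot_mod_zero)
  next
    assume "\<forall>m\<ge>1. V' m = carrier (sp M m)"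
    then show ?thesis using img by (simp add: quot_mod_carrier)
  qed
qed

lemma irreducible_subquotient:
  assumes M: "is_cmod K C M" and W: "subcmod K C W M" and U: "subcmod K C U M"
    and sub: "\<And>m. m \<ge> 1 \<Longrightarrow> W m \<subseteq> U m" and ne: "\<exists>m\<ge>1. W m \<noteq> U m"
    and max: "\<And>V. \<lbrakk>subcmod K C V M; \<And>m. m \<ge> 1 \<Longrightarrow> W m \<subseteq> V m; \<And>m. m \<ge> 1 \<Longrightarrow> V m \<subseteq> U m\<rbrakk> \<Longrightarrow>
       (\<forall>m\<ge>1. V m = W m) \<or> (\<forall>m\<ge>1. V m = U m)"
  shows "irreducible_cmod K C (quot_cmod (restrict_cmod M U) W)"
proof (rule irreducible_quot_cmod)
  show "is_cmod K C (restrict_cmod M U)" by (rule restrict_cmod_is_cmod[OF M U])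
  show "subcmod K C W (restrict_cmod M U)" using W sub by (simp add: subcmod_restrict[OF M U])
  show "(\<forall>m\<ge>1. V m = W m) \<or> (\<forall>m\<ge>1. V m = carrier (sp (restrict_cmod M U) m))"
    if "subcmod K C V (restrict_cmod M U)" "\<And>m. m \<ge> 1 \<Longrightarrow> W m \<subseteq> V m" for V
    using that max by (simp add: subcmod_restrict[OF M U])
qed (use ne in simp)

text \<open>Tailored to the radical: \<open>max\<close> makes \<open>W\<close> the largest proper
  submodule and \<open>min\<close> makes it irreducible, so that 0, \<open>W\<close>,
  \<open>M\<close> is a composition series.\<close>

lemma has_length_2I:
  assumes M: "is_cmod K C M" and W: "subcmod K C W M"
    and ne0: "\<exists>m\<ge>1. W m \<noteq> {\<zero>\<^bsub>sp M m\<^esub>}" and ne1: "\<exists>m\<ge>1. W m \<noteq> carrier (sp M m)"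
    and max: "\<And>V. subcmod K C V M \<Longrightarrow> (\<forall>m\<ge>1. V m \<subseteq> W m) \<or> (\<forall>m\<ge>1. V m = carrier (sp M m))"
    and min: "\<And>V. \<lbrakk>subcmod K C V M; \<And>m. m \<ge> 1 \<Longrightarrow> V m \<subseteq> W m\<rbrakk> \<Longrightarrow>
      (\<forall>m\<ge>1. V m = {\<zero>\<^bsub>sp M m\<^esub>}) \<or> (\<forall>m\<ge>1. V m = W m)"
  shows "has_length K C M 2"
proof -
  let ?Z = "\<lambda>m. {\<zero>\<^bsub>sp M m\<^esub>}" and ?T = "\<lambda>m. carrier (sp M m)"
  have s0: "subcmod K C ?Z M"
    unfolding subcmod_def
  proof (intro conjI allI impI ballI)
    fix m l :: nat and f x assume "m \<ge> 1" "l \<ge> 1" "f \<in> Hom C m l" "x \<in> {\<zero>\<^bsub>sp M m\<^esub>}"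
    then show "act M m l f x \<in> {\<zero>\<^bsub>sp M l\<^esub>}"
      using linear_maps_hom(1)[OF module_abelian_group module_abelian_group is_cmodD(2)[OF M]]
        is_cmodD(1)[OF M] by (metis singletonD singletonI)
  qed (simp add: submodule_zero is_cmodD(1)[OF M])
  have s1: "subcmod K C ?T M"
    unfolding subcmod_def using is_cmodD(1)[OF M] linear_mapsD(1)[OF is_cmodD(2)[OF M]]
    by (auto simp: module.carrier_is_submodule)
  have W0: "?Z m \<subseteq> V m" if "subcmod K C V M" "m \<ge> 1" for V m
    using submoduleD(2)[OF subcmodD(1)[OF that]] by simp
  have W1: "V m \<subseteq> ?T m" if "subcmod K C V M" "m \<ge> 1" for V m
    by (rule submoduleD(1)[OF subcmodD(1)[OF that]])
  have i0: "irreducible_cmod K C (quot_cmod (restrict_cmod M W) ?Z)"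
    using ne0 min by (intro irreducible_subquotient[OF M s0 W W0[OF W]]) auto
  have i1: "irreducible_cmod K C (quot_cmod (restrict_cmod M ?T) W)"
  proof (rule irreducible_subquotient[OF M W s1 W1[OF W] ne1])
    fix V assume V: "subcmod K C V M" and WV: "\<And>m. m \<ge> 1 \<Longrightarrow> W m \<subseteq> V m"
    show "(\<forall>m\<ge>1. V m = W m) \<or> (\<forall>m\<ge>1. V m = carrier (sp M m))"
      using max[OF V] WV by (metis subset_antisym)
  qed
  let ?F = "\<lambda>i::nat. if i = 0 then ?Z else if i = 1 then W else ?T"
  show ?thesis unfolding has_length_def
  proof (intro conjI M exI[of _ ?F])
    show "\<forall>i\<le>2. subcmod K C (?F i) M" using s0 s1 W by simp
    show "\<forall>i<2. (\<forall>m\<ge>1. ?F i m \<subseteq> ?F (Suc i) m) \<and>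
       irreducible_cmod K C (quot_cmod (restrict_cmod M (?F (Suc i))) (?F i))"
      using W0[OF W] W1[OF W] i0 i1 by (auto simp: less_2_cases_iff One_nat_def)
  qed auto
qed

declare free_mod_simps [simp del]

text \<open>The map induced by \<open>h\<close> on a quotient, evaluated at an arbitrary element of the coset; meaningful if
  \<open>h\<close> vanishes on the submodule.\<close>

definition desc :: "('v \<Rightarrow> 'w) \<Rightarrow> 'v set \<Rightarrow> 'w" where
  "desc h X = h (SOME x. x \<in> X)"

lemma (in abelian_group) minus_eq_zero_iff:
  assumes "x \<in> carrier G" "y \<in> carrier G"
  shows "x \<ominus> y = \<zero> \<longleftrightarrow> x = y"
proof
  assume "x \<ominus> y = \<zero>"
  moreover have "x = (x \<ominus> y) \<oplus> y" using assms by (simp add: a_minus_def a_assoc l_neg)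
  ultimately show "x = y" using assms by simp
qed (use assms in \<open>simp add: a_minus_def r_neg\<close>)

lemma desc_coset:
  assumes M: "module K M" and W: "submodule W K M" and N: "module K N" and h: "h \<in> linear_maps K M N"
    and hW: "\<And>w. w \<in> W \<Longrightarrow> h w = \<zero>\<^bsub>N\<^esub>" and x: "x \<in> carrier M"
  shows "desc h (W +>\<^bsub>M\<^esub> x) = h x"
proof -
  interpret M: module K M by (rule M)
  interpret N: module K N by (rule N)
  define z where "z = (SOME z. z \<in> W +>\<^bsub>M\<^esub> x)"
  have "x \<in> W +>\<^bsub>M\<^esub> x"
    using mem_coset_iff[OF M W x] x submoduleD(2)[OF W] by (simp add: M.r_neg M.minus_eq)
  then have "z \<in> W +>\<^bsub>M\<^esub> x" unfolding z_def by (rule someI)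
  then have z: "z \<in> carrier M" "z \<ominus>\<^bsub>M\<^esub> x \<in> W" using mem_coset_iff[OF M W x] by auto
  then have "h z \<ominus>\<^bsub>N\<^esub> h x = \<zero>\<^bsub>N\<^esub>"
    using linear_maps_hom(3)[OF M.abelian_group_axioms N.abelian_group_axioms h z(1) x] hW by metis
  then have "h z = h x"
    using linear_mapsD(1)[OF h] z(1) x by (simp add: N.minus_eq_zero_iff)
  then show ?thesis by (simp add: desc_def z_def)
qed

lemma desc_linear:
  assumes M: "module K M" and W: "submodule W K M" and N: "module K N" and h: "h \<in> linear_maps K M N"
    and hW: "\<And>w. w \<in> W \<Longrightarrow> h w = \<zero>\<^bsub>N\<^esub>"
  shows "desc h \<in> linear_maps K (quot_mod M W) N"
  by (rule linear_maps_quot[OF M W N desc_coset[OF M W N h hW] h])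

lemma mspan_vanish:
  assumes M: "module K M" and N: "module K N" and h: "h \<in> linear_maps K M N" and S: "S \<subseteq> carrier M"
    and hS: "\<And>x. x \<in> S \<Longrightarrow> h x = \<zero>\<^bsub>N\<^esub>" and x: "x \<in> mspan K M S"
  shows "h x = \<zero>\<^bsub>N\<^esub>"
  using mspan_map[OF M N h submodule_zero[OF N] S _ x] hS by simp

lemma linear_maps_finsum:
  assumes M: "module K M" and N: "module K N" and A: "finite A" and h: "\<And>i. i \<in> A \<Longrightarrow> h i \<in> linear_maps K M N"
  shows "(\<lambda>x. \<Oplus>\<^bsub>N\<^esub>i\<in>A. h i x) \<in> linear_maps K M N"
proof -
  interpret N: module K N by (rule N)
  note D = linear_mapsD[OF h]
  show ?thesis
  proof (rule linear_mapsI)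
    fix x assume x: "x \<in> carrier M"
    show "(\<Oplus>\<^bsub>N\<^esub>i\<in>A. h i x) \<in> carrier N" using D(1) x by (intro N.finsum_closed) auto
    show "(\<Oplus>\<^bsub>N\<^esub>i\<in>A. h i (a \<odot>\<^bsub>M\<^esub> x)) = a \<odot>\<^bsub>N\<^esub> (\<Oplus>\<^bsub>N\<^esub>i\<in>A. h i x)" if a: "a \<in> carrier K" for a
    proof -
      have "(\<Oplus>\<^bsub>N\<^esub>i\<in>A. h i (a \<odot>\<^bsub>M\<^esub> x)) = (\<Oplus>\<^bsub>N\<^esub>i\<in>A. a \<odot>\<^bsub>N\<^esub> h i x)"
        using D a x by (intro N.finsum_cong') auto
      also have "\<dots> = a \<odot>\<^bsub>N\<^esub> (\<Oplus>\<^bsub>N\<^esub>i\<in>A. h i x)"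
        using D(1) a x A by (intro N.finsum_smult_ldistr[symmetric]) auto
      finally show ?thesis .
    qed
    fix y assume y: "y \<in> carrier M"
    have "(\<Oplus>\<^bsub>N\<^esub>i\<in>A. h i (x \<oplus>\<^bsub>M\<^esub> y)) = (\<Oplus>\<^bsub>N\<^esub>i\<in>A. h i x \<oplus>\<^bsub>N\<^esub> h i y)"
      using D x y by (intro N.finsum_cong') auto
    also have "\<dots> = (\<Oplus>\<^bsub>N\<^esub>i\<in>A. h i x) \<oplus>\<^bsub>N\<^esub> (\<Oplus>\<^bsub>N\<^esub>i\<in>A. h i y)"
      using D(1) x y by (intro N.finsum_addf) auto
    finally show "(\<Oplus>\<^bsub>N\<^esub>i\<in>A. h i (x \<oplus>\<^bsub>M\<^esub> y)) = (\<Oplus>\<^bsub>N\<^esub>i\<in>A. h i x) \<oplus>\<^bsub>N\<^esub> (\<Oplus>\<^bsub>N\<^esub>i\<in>A. h i y)" .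
  qed
qed

lemma (in abelian_monoid) finsum_single:
  assumes "finite A" "i \<in> A" "f \<in> A \<rightarrow> carrier G" "\<And>j. \<lbrakk>j \<in> A; j \<noteq> i\<rbrakk> \<Longrightarrow> f j = \<zero>"
  shows "(\<Oplus>j\<in>A. f j) = f i"
proof -
  have "(\<Oplus>j\<in>A. f j) = (\<Oplus>j\<in>A. if i = j then f j else \<zero>)"
    using assms by (intro finsum_cong') auto
  then show ?thesis using assms by (simp add: finsum_singleton)
qed

context cring
begin

lemma free_mod_bilinear_eq:
  assumes M: "abelian_group M"
    and "\<And>b. b \<in> carrier (free_mod R Y) \<Longrightarrow> (\<lambda>a. F a b) \<in> linear_maps R (free_mod R X) M"
      "\<And>b. b \<in> carrier (free_mod R Y) \<Longrightarrow> (\<lambda>a. G a b) \<in> linear_maps R (free_mod R X) M"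
      "\<And>x. x \<in> X \<Longrightarrow> F (basis R x) \<in> linear_maps R (free_mod R Y) M"
      "\<And>x. x \<in> X \<Longrightarrow> G (basis R x) \<in> linear_maps R (free_mod R Y) M"
    and eq: "\<And>x y. \<lbrakk>x \<in> X; y \<in> Y\<rbrakk> \<Longrightarrow> F (basis R x) (basis R y) = G (basis R x) (basis R y)"
    and a: "a \<in> carrier (free_mod R X)" and b: "b \<in> carrier (free_mod R Y)"
  shows "F a b = G a b"
  using free_mod_linear_eq[OF M assms(2,3)[OF b] _ a] free_mod_linear_eq[OF M assms(4,5) eq b] by blast

text \<open>Serves twice: for the representable functors, and for the free modules on pairs from
  which the tensor product is formed.\<close>

lemma free_cmod:
  assumes X: "\<And>m l f x. \<lbrakk>m \<ge> 1; l \<ge> 1; f \<in> Hom C m l; x \<in> X m\<rbrakk> \<Longrightarrow> F m l f x \<in> X l"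
    and id: "\<And>m x. \<lbrakk>m \<ge> 1; x \<in> X m\<rbrakk> \<Longrightarrow> F m m (idm m) x = x"
    and comp: "\<And>m l p f g x. \<lbrakk>m \<ge> 1; l \<ge> 1; p \<ge> 1; f \<in> Hom C m l; g \<in> Hom C l p; x \<in> X m\<rbrakk> \<Longrightarrow>
      F m p (compose {1..m} g f) x = F l p g (F m l f x)"
  shows "is_cmod R C \<lparr>sp = (\<lambda>m. free_mod R (X m)), act = (\<lambda>m l f. free_map R (F m l f))\<rparr>" (is "is_cmod R C ?M")
  unfolding is_cmod_def
proof (intro conjI allI impI ballI)
  note ab = module_abelian_group[OF free_mod_module]
  fix m :: nat assume m: "m \<ge> 1"
  show "module R (sp ?M m)" by (simp add: free_mod_module)
  show "act ?M m m (idm m) x = x" if "x \<in> carrier (sp ?M m)" for x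
  proof -
    have "free_map R (F m m (idm m)) x = (\<lambda>x. x) x"
    proof (rule free_mod_linear_eq[OF ab free_map_linear[OF X[OF m m idm_Hom]]])
      show "(\<lambda>x. x) \<in> linear_maps R (free_mod R (X m)) (free_mod R (X m))"
        by (intro linear_mapsI refl)
      show "free_map R (F m m (idm m)) (basis R x) = basis R x" if "x \<in> X m" for x
        using id[OF m that] by (simp add: free_map_basis)
      show "x \<in> carrier (free_mod R (X m))" using that by simp
    qed
    then show ?thesis by simp
  qed
  fix l :: nat and f assume l: "l \<ge> 1" and f: "f \<in> Hom C m l"
  show "act ?M m l f \<in> linear_maps R (sp ?M m) (sp ?M l)"
    using free_map_linear[of "X m" "F m l f" "X l", OF X[OF m l f]] by simp
  fix p :: nat and g x assume p: "p \<ge> 1" and g: "g \<in> Hom C l p" and x: "x \<in> carrier (sp ?M m)"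
  have "free_map R (F m p (compose {1..m} g f)) x = free_map R (F l p g) (free_map R (F m l f) x)"
  proof (rule free_mod_linear_eq[where X="X m" and f="free_map R (F m p (compose {1..m} g f))"
        and g="\<lambda>x. free_map R (F l p g) (free_map R (F m l f) x)"])
    show "abelian_group (free_mod R (X p))" by (rule ab)
    show "free_map R (F m p (compose {1..m} g f)) \<in> linear_maps R (free_mod R (X m)) (free_mod R (X p))"
      by (rule free_map_linear[OF X[OF m p Hom_compose[OF f g]]])
    show "(\<lambda>x. free_map R (F l p g) (free_map R (F m l f) x)) \<in> linear_maps R (free_mod R (X m)) (free_mod R (X p))"
      by (rule linear_maps_comp[OF free_map_linear[OF X[OF m l f]] free_map_linear[OF X[OF l p g]]])
    show "free_map R (F m p (compose {1..m} g f)) (basis R y) = free_map R (F l p g) (free_map R (F m l f) (basis R y))"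
      if "y \<in> X m" for y using comp[OF m l p f g that] by (simp only: free_map_basis)
    show "x \<in> carrier (free_mod R (X m))" using x by simp
  qed
  then show "act ?M m p (compose {1..m} g f) x = act ?M l p g (act ?M m l f x)" by simp
qed

section \<open>Standard modules\<close>

lemma P_mod_is_cmod: "is_cmod R C (P_mod R C n)"
  unfolding P_mod_def
proof (rule free_cmod)
  show "compose {1..n} f g \<in> Hom C n l" if "f \<in> Hom C m l" "g \<in> Hom C n m" for m l f g
    using that Hom_compose by blast
  show "compose {1..n} (idm m) g = g" if "g \<in> Hom C n m" for m g
    using that idm_compose Hom_all_maps by blast
  show "compose {1..n} (compose {1..m} g f) h = compose {1..n} g (compose {1..n} f h)"
    if "h \<in> Hom C n m" for m f g h
    using compose_assoc_maps[OF Hom_all_maps[OF that], of g f] by simp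
qed

lemma P_mod_simps:
  "sp (P_mod R C n) m = free_mod R (Hom C n m)"
  "act (P_mod R C n) m l f = free_map R (\<lambda>g. compose {1..n} f g)"
  by (simp_all add: P_mod_def)

lemma noninj_part_submodule: "submodule (noninj_part R C n m) R (free_mod R (Hom C n m))"
  unfolding noninj_part_def by (intro mspan_submodule free_mod_module) (auto intro: basis_carrier)

lemma noninj_part_basis: "\<lbrakk>g \<in> Hom C n m; \<not> inj_on g {1..n}\<rbrakk> \<Longrightarrow> basis R g \<in> noninj_part R C n m"
  unfolding noninj_part_def by (rule subsetD[OF mspan_superset]) blast

lemma noninj_part_map:
  assumes N: "module R N" and h: "h \<in> linear_maps R (free_mod R (Hom C n m)) N" and V: "submodule V R N"
    and "\<And>g. \<lbrakk>g \<in> Hom C n m; \<not> inj_on g {1..n}\<rbrakk> \<Longrightarrow> h (basis R g) \<in> V" and "x \<in> noninj_part R C n m"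
  shows "h x \<in> V"
  by (rule mspan_map[OF free_mod_module N h V _ _ assms(5)[unfolded noninj_part_def]])
    (use assms(4) basis_carrier in auto)

lemma not_inj_compose: "\<not> inj_on g {1..n} \<Longrightarrow> \<not> inj_on (compose {1..n} f g) {1..n}"
proof (erule contrapos_nn, rule inj_onI)
  fix x y assume inj: "inj_on (compose {1..n} f g) {1..n}" and xy: "x \<in> {1..n}" "y \<in> {1..n}" "g x = g y"
  then have "compose {1..n} f g x = compose {1..n} f g y" by (simp add: compose_eq)
  then show "x = y" using inj_onD[OF inj] xy by blast
qed

lemma noninj_part_subcmod: "subcmod R C (noninj_part R C n) (P_mod R C n)"
  unfolding subcmod_def
proof (intro conjI allI impI ballI)
  fix m l :: nat and f x assume "m \<ge> 1" "l \<ge> 1" and f: "f \<in> Hom C m l" and x: "x \<in> noninj_part R C n m"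
  have "free_map R (compose {1..n} f) \<in> linear_maps R (free_mod R (Hom C n m)) (free_mod R (Hom C n l))"
    using Hom_compose[OF _ f] by (rule free_map_linear)
  then show "act (P_mod R C n) m l f x \<in> noninj_part R C n l"
    unfolding P_mod_simps
    by (rule noninj_part_map[OF free_mod_module _ noninj_part_submodule])
      (use x Hom_compose[OF _ f] in \<open>auto simp: free_map_basis intro!: noninj_part_basis not_inj_compose\<close>)
qed (simp add: P_mod_simps noninj_part_submodule)

lemma Delta_is_cmod: "is_cmod R C (Delta R C n)"
  unfolding Delta_def by (rule quot_cmod_is_cmod[OF P_mod_is_cmod noninj_part_subcmod])

abbreviation Dcls :: "cat \<Rightarrow> nat \<Rightarrow> nat \<Rightarrow> ((nat \<Rightarrow> nat) \<Rightarrow> 'a) \<Rightarrow> ((nat \<Rightarrow> nat) \<Rightarrow> 'a) set" where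
  "Dcls C n m a \<equiv> noninj_part R C n m +>\<^bsub>free_mod R (Hom C n m)\<^esub> a"

lemma Delta_sp: "sp (Delta R C n) m = quot_mod (free_mod R (Hom C n m)) (noninj_part R C n m)"
  by (simp add: Delta_def P_mod_simps)

lemma Delta_carrier: "carrier (sp (Delta R C n) m) = Dcls C n m ` carrier (free_mod R (Hom C n m))"
  by (simp add: Delta_sp quot_mod_carrier)

lemma Dcls_linear: "Dcls C n m \<in> linear_maps R (free_mod R (Hom C n m)) (sp (Delta R C n) m)"
  unfolding Delta_sp by (rule quot_mod_linear[OF free_mod_module noninj_part_submodule])

lemma Delta_act:
  assumes "m \<ge> 1" "l \<ge> 1" "f \<in> Hom C m l" "a \<in> carrier (free_mod R (Hom C n m))"
  shows "act (Delta R C n) m l f (Dcls C n m a) = Dcls C n l (free_map R (compose {1..n} f) a)"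
  using quot_cmod_act[OF P_mod_is_cmod noninj_part_subcmod assms(1-3), of a n] assms(4)
  by (simp add: Delta_def P_mod_simps)

lemma Dcls_noninj:
  assumes "g \<in> Hom C n m" "\<not> inj_on g {1..n}"
  shows "Dcls C n m (basis R g) = \<zero>\<^bsub>sp (Delta R C n) m\<^esub>"
  unfolding Delta_sp quot_mod_zero
  by (rule coset_zero_iff[OF free_mod_module noninj_part_submodule basis_carrier[OF assms(1)], THEN iffD2])
    (rule noninj_part_basis[OF assms])

lemma Hom_compose_aut: "\<lbrakk>f \<in> Hom C n m; g \<in> aut C n\<rbrakk> \<Longrightarrow> compose {1..n} f g \<in> Hom C n m"
  using Hom_compose[OF aut_Hom] .

lemma ract_linear_left:
  "b \<in> carrier (free_mod R (aut C n)) \<Longrightarrow> (\<lambda>a. free_bimap R (compose {1..n}) a b) \<in>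
     linear_maps R (free_mod R (Hom C n m)) (free_mod R (Hom C n m))"
  by (rule free_bimap_linear_left[OF Hom_compose_aut])

lemma ract_linear_right:
  "a \<in> carrier (free_mod R (Hom C n m)) \<Longrightarrow> free_bimap R (compose {1..n}) a \<in>
     linear_maps R (free_mod R (aut C n)) (free_mod R (Hom C n m))"
  by (rule free_bimap_linear_right[OF Hom_compose_aut])

lemma not_inj_compose_aut:
  assumes h: "h \<in> aut C n" and g: "\<not> inj_on g {1..n}"
  shows "\<not> inj_on (compose {1..n} g h) {1..n}"
proof
  assume inj: "inj_on (compose {1..n} g h) {1..n}"
  have "inj_on g {1..n}"
  proof (rule inj_onI)
    fix x y assume xy: "x \<in> {1..n}" "y \<in> {1..n}" "g x = g y"
    then obtain x' y' where x': "x' \<in> {1..n}" "x = h x'" and y': "y' \<in> {1..n}" "y = h y'"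
      using aut_surj[OF h] by metis
    then have "compose {1..n} g h x' = compose {1..n} g h y'" using xy(3) by (simp add: compose_eq)
    then show "x = y" using inj_onD[OF inj] x' y' by blast
  qed
  with g show False by blast
qed

lemma ract_noninj:
  assumes b: "b \<in> carrier (free_mod R (aut C n))" and a: "a \<in> noninj_part R C n m"
  shows "free_bimap R (compose {1..n}) a b \<in> noninj_part R C n m"
proof (rule noninj_part_map[OF free_mod_module ract_linear_left[OF b] noninj_part_submodule _ a])
  fix g assume g: "g \<in> Hom C n m" "\<not> inj_on g {1..n}"
  have "b \<in> {b \<in> carrier (free_mod R (aut C n)). free_bimap R (compose {1..n}) (basis R g) b \<in> noninj_part R C n m}"
    by (rule free_mod_submodule_all[OF submodule_preimage[OF free_mod_module free_mod_module
          ract_linear_right[OF basis_carrier[OF g(1)]] noninj_part_submodule] _ b])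
      (use g not_inj_compose_aut Hom_compose[OF aut_Hom g(1)] in \<open>auto simp: free_bimap_basis intro!: basis_carrier noninj_part_basis\<close>)
  then show "free_bimap R (compose {1..n}) (basis R g) b \<in> noninj_part R C n m" by simp
qed

lemma Delta_ract_Dcls:
  assumes b: "b \<in> carrier (free_mod R (aut C n))" and a: "a \<in> carrier (free_mod R (Hom C n m))"
  shows "Delta_ract R C n m (Dcls C n m a) b = Dcls C n m (free_bimap R (compose {1..n}) a b)"
  unfolding Delta_ract_def
  using linear_mapsD(1,2)[OF ract_linear_left[OF b]] ract_noninj[OF b] a
  by (rule coset_Union[OF free_mod_module noninj_part_submodule free_mod_module noninj_part_submodule])

lemma Delta_ract_closed:
  assumes b: "b \<in> carrier (free_mod R (aut C n))" and X: "X \<in> carrier (sp (Delta R C n) m)"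
  shows "Delta_ract R C n m X b \<in> carrier (sp (Delta R C n) m)"
proof -
  obtain a where a: "a \<in> carrier (free_mod R (Hom C n m))" "X = Dcls C n m a" using X Delta_carrier by blast
  then show ?thesis using linear_mapsD(1)[OF Dcls_linear] linear_mapsD(1)[OF ract_linear_left[OF b]]
    by (simp add: Delta_ract_Dcls[OF b])
qed

text \<open>Postcomposition and precomposition commute by associativity of composition; bilinearity
  reduces the identity to basis elements.\<close>

lemma Delta_act_ract:
  assumes m: "m \<ge> 1" "l \<ge> 1" and f: "f \<in> Hom C m l" and b: "b \<in> carrier (free_mod R (aut C n))"
    and X: "X \<in> carrier (sp (Delta R C n) m)"
  shows "act (Delta R C n) m l f (Delta_ract R C n m X b) = Delta_ract R C n l (act (Delta R C n) m l f X) b"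
proof -
  obtain a where a: "a \<in> carrier (free_mod R (Hom C n m))" "X = Dcls C n m a" using X Delta_carrier by blast
  have fl: "free_map R (compose {1..n} f) \<in> linear_maps R (free_mod R (Hom C n m)) (free_mod R (Hom C n l))"
    using Hom_compose[OF _ f] by (rule free_map_linear)
  have "free_map R (compose {1..n} f) (free_bimap R (compose {1..n}) a b) =
    free_bimap R (compose {1..n}) (free_map R (compose {1..n} f) a) b"
  proof (rule free_mod_bilinear_eq[OF module_abelian_group[OF free_mod_module] _ _ _ _ _ a(1) b])
    show "(\<lambda>a. free_map R (compose {1..n} f) (free_bimap R (compose {1..n}) a b)) \<in>
        linear_maps R (free_mod R (Hom C n m)) (free_mod R (Hom C n l))"
      "(\<lambda>a. free_bimap R (compose {1..n}) (free_map R (compose {1..n} f) a) b) \<in>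
        linear_maps R (free_mod R (Hom C n m)) (free_mod R (Hom C n l))"
      if "b \<in> carrier (free_mod R (aut C n))" for b
      using linear_maps_comp[OF ract_linear_left[OF that] fl] linear_maps_comp[OF fl ract_linear_left[OF that]] .
    fix g assume g: "g \<in> Hom C n m"
    show "(\<lambda>b. free_map R (compose {1..n} f) (free_bimap R (compose {1..n}) (basis R g) b)) \<in>
        linear_maps R (free_mod R (aut C n)) (free_mod R (Hom C n l))"
      by (rule linear_maps_comp[OF ract_linear_right[OF basis_carrier[OF g]] fl])
    show "free_bimap R (compose {1..n}) (free_map R (compose {1..n} f) (basis R g)) \<in>
        linear_maps R (free_mod R (aut C n)) (free_mod R (Hom C n l))"
      unfolding free_map_basis by (rule ract_linear_right[OF basis_carrier[OF Hom_compose[OF g f]]])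
    fix h assume h: "h \<in> aut C n"
    show "free_map R (compose {1..n} f) (free_bimap R (compose {1..n}) (basis R g) (basis R h)) =
        free_bimap R (compose {1..n}) (free_map R (compose {1..n} f) (basis R g)) (basis R h)"
      using compose_assoc_maps[OF aut_all_maps[OF h], of f g] by (simp add: free_bimap_basis free_map_basis)
  qed
  then show ?thesis
    using a linear_mapsD(1)[OF ract_linear_left[OF b]] linear_mapsD(1)[OF fl]
    by (simp add: Delta_ract_Dcls[OF b] Delta_act[OF m f])
qed

end

lemma group_algebra_simps:
  "carrier (group_algebra K G) = carrier (free_mod K (carrier G))"
  "a \<otimes>\<^bsub>group_algebra K G\<^esub> b = free_bimap K (mult G) a b"
  "\<one>\<^bsub>group_algebra K G\<^esub> = basis K (one G)"
  "\<zero>\<^bsub>group_algebra K G\<^esub> = \<zero>\<^bsub>free_mod K (carrier G)\<^esub>"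
  "a \<oplus>\<^bsub>group_algebra K G\<^esub> b = a \<oplus>\<^bsub>free_mod K (carrier G)\<^esub> b"
  by (simp_all add: group_algebra_def)

section \<open>Modules over the group algebra\<close>

text \<open>The module \<open>L\<close> is kept general because the construction is applied both to
  \<lambda> and to the left ideal \<open>kGe\<close>.\<close>

locale kgmod =
  fixes K :: "('k, 'q) ring_scheme" and C :: cat and n :: nat
    and L :: "((nat \<Rightarrow> nat) \<Rightarrow> 'k, 'v) module"
  assumes field_K: "field K" and n1: "n \<ge> 1" and lmod: "lmodule (kG K C n) L"
begin

sublocale K: field K by (rule field_K)
sublocale L: lmodule "kG K C n" L by (rule lmod)

abbreviation "A \<equiv> kG K C n"
abbreviation "FG \<equiv> free_mod K (aut C n)"

sublocale FG: module K FG by (rule K.free_mod_module)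

lemma A_simps:
  "carrier A = carrier FG"
  "a \<otimes>\<^bsub>A\<^esub> b = free_bimap K (compose {1..n}) a b"
  "\<one>\<^bsub>A\<^esub> = basis K (idm n)"
  "\<zero>\<^bsub>A\<^esub> = \<zero>\<^bsub>FG\<^esub>"
  "a \<oplus>\<^bsub>A\<^esub> b = a \<oplus>\<^bsub>FG\<^esub> b"
  by (simp_all add: group_algebra_simps)

lemma A_linear_left: "b \<in> carrier FG \<Longrightarrow> (\<lambda>a. a \<otimes>\<^bsub>A\<^esub> b) \<in> linear_maps K FG FG"
  unfolding A_simps by (rule K.free_bimap_linear_left) (rule aut_compose)

lemma A_linear_right: "a \<in> carrier FG \<Longrightarrow> (\<lambda>b. a \<otimes>\<^bsub>A\<^esub> b) \<in> linear_maps K FG FG"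
  unfolding A_simps by (rule K.free_bimap_linear_right) (rule aut_compose)

lemma basis_A: "g \<in> aut C n \<Longrightarrow> basis K g \<in> carrier A"
  by (simp add: A_simps K.basis_carrier)

lemma basis_mult: "basis K g \<otimes>\<^bsub>A\<^esub> basis K h = basis K (compose {1..n} g h)"
  by (simp add: A_simps K.free_bimap_basis)

text \<open>The image of a scalar under \<open>K \<rightarrow> kG\<close>, through which
  \<open>K\<close> acts on a module over the group algebra.\<close>

definition sc :: "'k \<Rightarrow> (nat \<Rightarrow> nat) \<Rightarrow> 'k" where
  "sc c = c \<odot>\<^bsub>FG\<^esub> basis K (idm n)"

lemma sc_closed: "c \<in> carrier K \<Longrightarrow> sc c \<in> carrier A"
  unfolding sc_def A_simps by (intro FG.smult_closed K.basis_carrier idm_aut)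

lemma sc_mult:
  assumes c: "c \<in> carrier K" and a: "a \<in> carrier A"
  shows "sc c \<otimes>\<^bsub>A\<^esub> a = c \<odot>\<^bsub>FG\<^esub> a" "a \<otimes>\<^bsub>A\<^esub> sc c = c \<odot>\<^bsub>FG\<^esub> a"
proof -
  have a': "a \<in> carrier FG" using a by (simp add: A_simps)
  note i = K.basis_carrier[OF idm_aut]
  show "sc c \<otimes>\<^bsub>A\<^esub> a = c \<odot>\<^bsub>FG\<^esub> a"
    using linear_mapsD(3)[OF A_linear_left[OF a'] c i] L.R.l_one[OF a] by (simp add: sc_def A_simps(3))
  show "a \<otimes>\<^bsub>A\<^esub> sc c = c \<odot>\<^bsub>FG\<^esub> a"
    using linear_mapsD(3)[OF A_linear_right[OF a'] c i] L.R.r_one[OF a] by (simp add: sc_def A_simps(3))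
qed

text \<open>The restriction of \<open>L\<close> along \<open>K \<rightarrow> kG\<close>.\<close>

definition Lk :: "('k, 'v) module" where
  "Lk = \<lparr>carrier = carrier L, mult = undefined, one = undefined, zero = \<zero>\<^bsub>L\<^esub>, add = add L,
     smult = (\<lambda>c v. sc c \<odot>\<^bsub>L\<^esub> v)\<rparr>"

lemma Lk_simps:
  "carrier Lk = carrier L" "\<zero>\<^bsub>Lk\<^esub> = \<zero>\<^bsub>L\<^esub>" "v \<oplus>\<^bsub>Lk\<^esub> w = v \<oplus>\<^bsub>L\<^esub> w" "c \<odot>\<^bsub>Lk\<^esub> v = sc c \<odot>\<^bsub>L\<^esub> v"
  by (simp_all add: Lk_def)

sublocale Lk: module K Lk
proof (rule moduleI)
  show "abelian_group Lk"
  proof (rule abelian_groupI)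
    fix x assume "x \<in> carrier Lk"
    then show "\<exists>y\<in>carrier Lk. y \<oplus>\<^bsub>Lk\<^esub> x = \<zero>\<^bsub>Lk\<^esub>"
      by (intro bexI[of _ "\<ominus>\<^bsub>L\<^esub> x"]) (auto simp: Lk_simps L.M.l_neg)
  qed (auto simp: Lk_simps L.M.a_ac)
  fix a x assume a: "a \<in> carrier K" and x: "x \<in> carrier Lk"
  show "a \<odot>\<^bsub>Lk\<^esub> x \<in> carrier Lk" using a x by (simp add: Lk_simps L.lsmult_closed sc_closed)
  fix b
  {
    assume b: "b \<in> carrier K"
    have "sc (a \<oplus>\<^bsub>K\<^esub> b) = sc a \<oplus>\<^bsub>A\<^esub> sc b"
      using a b unfolding sc_def A_simps by (intro FG.smult_l_distr K.basis_carrier idm_aut)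
    then show "(a \<oplus>\<^bsub>K\<^esub> b) \<odot>\<^bsub>Lk\<^esub> x = a \<odot>\<^bsub>Lk\<^esub> x \<oplus>\<^bsub>Lk\<^esub> b \<odot>\<^bsub>Lk\<^esub> x"
      using a b x by (simp add: Lk_simps L.lsmult_l_distr sc_closed)
    have "sc (a \<otimes>\<^bsub>K\<^esub> b) = sc a \<otimes>\<^bsub>A\<^esub> sc b"
      unfolding sc_mult(1)[OF a sc_closed[OF b]] unfolding sc_def
      using a b by (intro FG.smult_assoc1 K.basis_carrier idm_aut)
    then show "(a \<otimes>\<^bsub>K\<^esub> b) \<odot>\<^bsub>Lk\<^esub> x = a \<odot>\<^bsub>Lk\<^esub> (b \<odot>\<^bsub>Lk\<^esub> x)"
      using a b x by (simp add: Lk_simps L.lsmult_assoc sc_closed)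
  }
  fix y assume y: "y \<in> carrier Lk"
  show "a \<odot>\<^bsub>Lk\<^esub> (x \<oplus>\<^bsub>Lk\<^esub> y) = a \<odot>\<^bsub>Lk\<^esub> x \<oplus>\<^bsub>Lk\<^esub> a \<odot>\<^bsub>Lk\<^esub> y"
    using a x y by (simp add: Lk_simps L.lsmult_r_distr sc_closed)
next
  fix x assume x: "x \<in> carrier Lk"
  have "sc \<one>\<^bsub>K\<^esub> = \<one>\<^bsub>A\<^esub>" unfolding sc_def A_simps by (intro FG.smult_one K.basis_carrier idm_aut)
  then show "\<one>\<^bsub>K\<^esub> \<odot>\<^bsub>Lk\<^esub> x = x" using x by (simp add: Lk_simps L.lsmult_one)
qed (rule K.is_cring)

lemma lsmult_linear_left: "v \<in> carrier L \<Longrightarrow> (\<lambda>a. a \<odot>\<^bsub>L\<^esub> v) \<in> linear_maps K FG Lk"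
proof (rule linear_mapsI)
  fix a assume v: "v \<in> carrier L" and a: "a \<in> carrier FG"
  then show "a \<odot>\<^bsub>L\<^esub> v \<in> carrier Lk" by (simp add: Lk_simps L.lsmult_closed A_simps)
  show "c \<odot>\<^bsub>FG\<^esub> a \<odot>\<^bsub>L\<^esub> v = c \<odot>\<^bsub>Lk\<^esub> (a \<odot>\<^bsub>L\<^esub> v)" if c: "c \<in> carrier K" for c
    using sc_mult(1)[OF c] L.lsmult_assoc[OF sc_closed[OF c] _ v] a by (simp add: Lk_simps A_simps(1))
  show "(a \<oplus>\<^bsub>FG\<^esub> b) \<odot>\<^bsub>L\<^esub> v = (a \<odot>\<^bsub>L\<^esub> v) \<oplus>\<^bsub>Lk\<^esub> (b \<odot>\<^bsub>L\<^esub> v)" if b: "b \<in> carrier FG" for b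
    using L.lsmult_l_distr[OF _ _ v] a b by (simp add: Lk_simps A_simps(1,5))
qed

lemma lsmult_linear_right:
  assumes a: "a \<in> carrier A"
  shows "(\<lambda>v. a \<odot>\<^bsub>L\<^esub> v) \<in> linear_maps K Lk Lk"
proof (rule linear_mapsI)
  fix v assume "v \<in> carrier Lk"
  then have v: "v \<in> carrier L" by (simp add: Lk_simps)
  show "a \<odot>\<^bsub>L\<^esub> v \<in> carrier Lk" using L.lsmult_closed[OF a v] by (simp add: Lk_simps)
  show "a \<odot>\<^bsub>L\<^esub> (v \<oplus>\<^bsub>Lk\<^esub> w) = (a \<odot>\<^bsub>L\<^esub> v) \<oplus>\<^bsub>Lk\<^esub> (a \<odot>\<^bsub>L\<^esub> w)" if "w \<in> carrier Lk" for w
    using L.lsmult_r_distr[OF a v] that by (simp add: Lk_simps)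
  show "a \<odot>\<^bsub>L\<^esub> (c \<odot>\<^bsub>Lk\<^esub> v) = c \<odot>\<^bsub>Lk\<^esub> (a \<odot>\<^bsub>L\<^esub> v)" if c: "c \<in> carrier K" for c
    using L.lsmult_assoc[OF a sc_closed[OF c] v] L.lsmult_assoc[OF sc_closed[OF c] a v] sc_mult[OF c a]
    by (simp add: Lk_simps)
qed

definition ga :: "(nat \<Rightarrow> nat) \<Rightarrow> 'v \<Rightarrow> 'v" where
  "ga g v = basis K g \<odot>\<^bsub>L\<^esub> v"

lemma ga_linear: "g \<in> aut C n \<Longrightarrow> ga g \<in> linear_maps K Lk Lk"
  using lsmult_linear_right[OF basis_A] unfolding ga_def[abs_def] .

lemma ga_closed: "\<lbrakk>g \<in> aut C n; v \<in> carrier Lk\<rbrakk> \<Longrightarrow> ga g v \<in> carrier Lk"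
  by (rule linear_mapsD(1)[OF ga_linear])

lemma ga_compose:
  "\<lbrakk>g \<in> aut C n; h \<in> aut C n; v \<in> carrier Lk\<rbrakk> \<Longrightarrow> ga (compose {1..n} g h) v = ga g (ga h v)"
  using L.lsmult_assoc[OF basis_A basis_A, of g h v] by (simp add: ga_def basis_mult Lk_simps(1))

lemma ga_idm: "v \<in> carrier Lk \<Longrightarrow> ga (idm n) v = v"
  using L.lsmult_one[of v] by (simp only: ga_def A_simps(3) Lk_simps(1))

lemma ga_zero: "g \<in> aut C n \<Longrightarrow> ga g \<zero>\<^bsub>Lk\<^esub> = \<zero>\<^bsub>Lk\<^esub>"
  by (rule linear_maps_hom(1)[OF Lk.M.abelian_group_axioms Lk.M.abelian_group_axioms ga_linear])

lemma smult_mem_submodule: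
  assumes U: "submodule U K Lk" and v: "v \<in> carrier Lk" "\<And>g. g \<in> aut C n \<Longrightarrow> ga g v \<in> U" and a: "a \<in> carrier A"
  shows "a \<odot>\<^bsub>L\<^esub> v \<in> U"
proof -
  have v': "v \<in> carrier L" using v(1) by (simp add: Lk_simps)
  have "a \<in> {a \<in> carrier FG. a \<odot>\<^bsub>L\<^esub> v \<in> U}"
  proof (rule K.free_mod_submodule_all[OF submodule_preimage[OF FG.module_axioms Lk.module_axioms lsmult_linear_left[OF v'] U]])
    show "basis K g \<in> {a \<in> carrier FG. a \<odot>\<^bsub>L\<^esub> v \<in> U}" if "g \<in> aut C n" for g
      using v(2)[OF that] K.basis_carrier[OF that] by (simp add: ga_def)
    show "a \<in> carrier FG" using a by (simp add: A_simps)
  qed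
  then show ?thesis by simp
qed

text \<open>The group algebra is spanned over \<open>K\<close> by the group, so stability under
  \<open>kG\<close> amounts to stability under scalars and group elements. This allows the later
  arguments to work with subspaces.\<close>

lemma submodule_A_iff:
  "submodule U A L \<longleftrightarrow> submodule U K Lk \<and> (\<forall>g\<in>aut C n. \<forall>v\<in>U. ga g v \<in> U)"
proof -
  have neg: "\<ominus>\<^bsub>Lk\<^esub> v = \<ominus>\<^bsub>L\<^esub> v" if "v \<in> carrier L" for v
    using that L.M.l_neg by (intro Lk.M.minus_equality[of _ v]) (auto simp: Lk_simps)
  show ?thesis
  proof safe
    assume U: "submodule U A L"
    note D = submoduleD[OF U]
    show "submodule U K Lk"
      by (rule Lk.submoduleI) (use D sc_closed neg in \<open>auto simp: Lk_simps\<close>)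
    show "ga g v \<in> U" if "g \<in> aut C n" "v \<in> U" for g v using D(6) that basis_A by (simp add: ga_def)
  next
    assume U: "submodule U K Lk" and g: "\<forall>g\<in>aut C n. \<forall>v\<in>U. ga g v \<in> U"
    note D = submoduleD[OF U]
    show "submodule U A L"
    proof (intro submodule.intro submodule_axioms.intro)
      show "subgroup U (add_monoid L)"
      proof (rule group.subgroupI[OF L.M.a_group])
        show "inv\<^bsub>add_monoid L\<^esub> a \<in> U" if "a \<in> U" for a
          using D(4)[OF that] D(1) that neg[of a] by (auto simp: Lk_simps a_inv_def)
      qed (use D in \<open>auto simp: Lk_simps\<close>)
      show "a \<odot>\<^bsub>L\<^esub> x \<in> U" if "a \<in> carrier A" "x \<in> U" for a x
        using smult_mem_submodule[OF U _ _ that(1)] D(1) g that by blast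
    qed
  qed
qed

section \<open>Coordinates on the tensor product\<close>

abbreviation "Dl m \<equiv> sp (Delta K C n) m"
abbreviation "TF m \<equiv> free_mod K (carrier (Dl m) \<times> carrier L)"
abbreviation "rels m \<equiv> tensor_relators K A (Dl m) (Delta_ract K C n m) L"
abbreviation "TR m \<equiv> mspan K (TF m) (rels m)"
abbreviation "T \<equiv> Delta_tensor K C n L"
abbreviation "PF m \<equiv> free_mod K (Hom C n m)"
abbreviation "Dc m \<equiv> K.Dcls C n m"

lemma TF_module: "module K (TF m)" by (rule K.free_mod_module)

lemma PF_module: "module K (PF m)" by (rule K.free_mod_module)

lemma Dl_module: "module K (Dl m)"
  unfolding K.Delta_sp by (rule quot_mod_module[OF K.free_mod_module K.noninj_part_submodule])

lemma rels_cases: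
  assumes "r \<in> rels m"
  obtains (add1) x y v where "x \<in> carrier (Dl m)" "y \<in> carrier (Dl m)" "v \<in> carrier L"
      "r = basis K (x \<oplus>\<^bsub>Dl m\<^esub> y, v) \<ominus>\<^bsub>TF m\<^esub> (basis K (x, v) \<oplus>\<^bsub>TF m\<^esub> basis K (y, v))"
  | (add2) x v w where "x \<in> carrier (Dl m)" "v \<in> carrier L" "w \<in> carrier L"
      "r = basis K (x, v \<oplus>\<^bsub>L\<^esub> w) \<ominus>\<^bsub>TF m\<^esub> (basis K (x, v) \<oplus>\<^bsub>TF m\<^esub> basis K (x, w))"
  | (smult) c x v where "c \<in> carrier K" "x \<in> carrier (Dl m)" "v \<in> carrier L"
      "r = basis K (c \<odot>\<^bsub>Dl m\<^esub> x, v) \<ominus>\<^bsub>TF m\<^esub> c \<odot>\<^bsub>TF m\<^esub> basis K (x, v)"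
  | (bal) x b v where "x \<in> carrier (Dl m)" "b \<in> carrier A" "v \<in> carrier L"
      "r = basis K (Delta_ract K C n m x b, v) \<ominus>\<^bsub>TF m\<^esub> basis K (x, b \<odot>\<^bsub>L\<^esub> v)"
  using assms unfolding tensor_relators_def Let_def
     apply (elim UnE CollectE exE conjE)
     apply (rule that(1); assumption)
    apply (rule that(2); assumption)
   apply (rule that(3); assumption)
  apply (rule that(4); assumption)
  done

lemma rels_intros:
  "\<lbrakk>x \<in> carrier (Dl m); y \<in> carrier (Dl m); v \<in> carrier L\<rbrakk> \<Longrightarrow>
     basis K (x \<oplus>\<^bsub>Dl m\<^esub> y, v) \<ominus>\<^bsub>TF m\<^esub> (basis K (x, v) \<oplus>\<^bsub>TF m\<^esub> basis K (y, v)) \<in> rels m"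
  "\<lbrakk>x \<in> carrier (Dl m); v \<in> carrier L; w \<in> carrier L\<rbrakk> \<Longrightarrow>
     basis K (x, v \<oplus>\<^bsub>L\<^esub> w) \<ominus>\<^bsub>TF m\<^esub> (basis K (x, v) \<oplus>\<^bsub>TF m\<^esub> basis K (x, w)) \<in> rels m"
  "\<lbrakk>c \<in> carrier K; x \<in> carrier (Dl m); v \<in> carrier L\<rbrakk> \<Longrightarrow>
     basis K (c \<odot>\<^bsub>Dl m\<^esub> x, v) \<ominus>\<^bsub>TF m\<^esub> c \<odot>\<^bsub>TF m\<^esub> basis K (x, v) \<in> rels m"
  "\<lbrakk>x \<in> carrier (Dl m); b \<in> carrier A; v \<in> carrier L\<rbrakk> \<Longrightarrow>
     basis K (Delta_ract K C n m x b, v) \<ominus>\<^bsub>TF m\<^esub> basis K (x, b \<odot>\<^bsub>L\<^esub> v) \<in> rels m"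
  unfolding tensor_relators_def Let_def
     apply (rule UnI1, rule UnI1, rule UnI1, intro CollectI exI conjI, rule refl, assumption+)
    apply (rule UnI1, rule UnI1, rule UnI2, intro CollectI exI conjI, rule refl, assumption+)
   apply (rule UnI1, rule UnI2, intro CollectI exI conjI, rule refl, assumption+)
  apply (rule UnI2, intro CollectI exI conjI, rule refl, assumption+)
  done

lemma TF_basis: "\<lbrakk>x \<in> carrier (Dl m); v \<in> carrier L\<rbrakk> \<Longrightarrow> basis K (x, v) \<in> carrier (TF m)"
  by (rule K.basis_carrier) simp

lemma ract_closed: "\<lbrakk>x \<in> carrier (Dl m); b \<in> carrier A\<rbrakk> \<Longrightarrow> Delta_ract K C n m x b \<in> carrier (Dl m)"
  using K.Delta_ract_closed by (simp add: A_simps)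

lemma rels_carrier: "rels m \<subseteq> carrier (TF m)"
proof
  interpret F: module K "TF m" by (rule TF_module)
  interpret D: module K "Dl m" by (rule Dl_module)
  fix r assume "r \<in> rels m"
  then show "r \<in> carrier (TF m)"
    by (cases rule: rels_cases)
      (auto intro!: F.minus_closed F.a_closed F.smult_closed TF_basis D.a_closed D.smult_closed
        L.M.a_closed L.lsmult_closed ract_closed)
qed

lemma TR_submodule: "submodule (TR m) K (TF m)"
  by (rule mspan_submodule[OF TF_module rels_carrier])

text \<open>The universal property of the tensor product: the linear extension of a balanced map
  \<open>\<phi>\<close> kills the relators. It gives both the functoriality of the tensor product
  and the coordinates on it.\<close>

lemma rels_vanish:
  assumes N: "module K N" and h: "h \<in> linear_maps K (TF m) N"
    and hb: "\<And>x v. \<lbrakk>x \<in> carrier (Dl m); v \<in> carrier L\<rbrakk> \<Longrightarrow> h (basis K (x, v)) = \<phi> x v"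
    and lin1: "\<And>v. v \<in> carrier L \<Longrightarrow> (\<lambda>x. \<phi> x v) \<in> linear_maps K (Dl m) N"
    and add2: "\<And>x v w. \<lbrakk>x \<in> carrier (Dl m); v \<in> carrier L; w \<in> carrier L\<rbrakk> \<Longrightarrow> \<phi> x (v \<oplus>\<^bsub>L\<^esub> w) = \<phi> x v \<oplus>\<^bsub>N\<^esub> \<phi> x w"
    and bal: "\<And>x b v. \<lbrakk>x \<in> carrier (Dl m); b \<in> carrier A; v \<in> carrier L\<rbrakk> \<Longrightarrow>
      \<phi> (Delta_ract K C n m x b) v = \<phi> x (b \<odot>\<^bsub>L\<^esub> v)"
    and r: "r \<in> TR m"
  shows "h r = \<zero>\<^bsub>N\<^esub>"
proof (rule mspan_vanish[OF TF_module N h rels_carrier _ r])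
  interpret F: module K "TF m" by (rule TF_module)
  interpret D: module K "Dl m" by (rule Dl_module)
  interpret N: module K N by (rule N)
  note hm = linear_maps_hom(3)[OF F.abelian_group_axioms N.abelian_group_axioms h] and D = linear_mapsD[OF h]
  have \<phi>: "\<phi> x v \<in> carrier N" if "x \<in> carrier (Dl m)" "v \<in> carrier L" for x v
    using linear_mapsD(1)[OF lin1] that by blast
  fix s assume "s \<in> rels m"
  then show "h s = \<zero>\<^bsub>N\<^esub>"
  proof (cases rule: rels_cases)
    case (add1 x y v)
    then have "h s = \<phi> (x \<oplus>\<^bsub>Dl m\<^esub> y) v \<ominus>\<^bsub>N\<^esub> (\<phi> x v \<oplus>\<^bsub>N\<^esub> \<phi> y v)"
      by (simp add: hm D TF_basis hb)
    then show ?thesis using add1 linear_mapsD(2)[OF lin1] \<phi> by (simp add: N.minus_eq_zero_iff)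
  next
    case (add2 x v w)
    then have "h s = \<phi> x (v \<oplus>\<^bsub>L\<^esub> w) \<ominus>\<^bsub>N\<^esub> (\<phi> x v \<oplus>\<^bsub>N\<^esub> \<phi> x w)"
      by (simp add: hm D TF_basis hb)
    then show ?thesis using add2 assms(5) \<phi> by (simp add: N.minus_eq_zero_iff)
  next
    case (smult c x v)
    then have "h s = \<phi> (c \<odot>\<^bsub>Dl m\<^esub> x) v \<ominus>\<^bsub>N\<^esub> c \<odot>\<^bsub>N\<^esub> \<phi> x v"
      by (simp add: hm D TF_basis hb)
    then show ?thesis using smult linear_mapsD(3)[OF lin1] \<phi> by (simp add: N.minus_eq_zero_iff)
  next
    case (bal x b v)
    then have "h s = \<phi> (Delta_ract K C n m x b) v \<ominus>\<^bsub>N\<^esub> \<phi> x (b \<odot>\<^bsub>L\<^esub> v)"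
      by (simp add: hm D TF_basis hb ract_closed L.lsmult_closed)
    then show ?thesis using bal assms(6) \<phi> by (simp add: N.minus_eq_zero_iff L.lsmult_closed)
  qed
qed

definition cls :: "nat \<Rightarrow> (((nat \<Rightarrow> nat) \<Rightarrow> 'k) set \<times> 'v \<Rightarrow> 'k) \<Rightarrow> (((nat \<Rightarrow> nat) \<Rightarrow> 'k) set \<times> 'v \<Rightarrow> 'k) set" where
  "cls m b = TR m +>\<^bsub>TF m\<^esub> b"

text \<open>The pure tensor \<open>x \<otimes> v\<close>.\<close>

definition tau :: "nat \<Rightarrow> ((nat \<Rightarrow> nat) \<Rightarrow> 'k) set \<Rightarrow> 'v \<Rightarrow> (((nat \<Rightarrow> nat) \<Rightarrow> 'k) set \<times> 'v \<Rightarrow> 'k) set" where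
  "tau m x v = cls m (basis K (x, v))"

lemma T_sp: "sp T m = quot_mod (TF m) (TR m)"
  by (simp add: Delta_tensor_def tensor_cmod_def)

lemma T_module: "module K (sp T m)"
  unfolding T_sp by (rule quot_mod_module[OF TF_module TR_submodule])

lemma cls_linear: "cls m \<in> linear_maps K (TF m) (sp T m)"
  unfolding T_sp cls_def[abs_def] by (rule quot_mod_linear[OF TF_module TR_submodule])

lemma T_carrier: "carrier (sp T m) = cls m ` carrier (TF m)"
  by (simp add: T_sp quot_mod_carrier cls_def)

lemma cls_eqI:
  "\<lbrakk>a \<in> carrier (TF m); b \<in> carrier (TF m); a \<ominus>\<^bsub>TF m\<^esub> b \<in> rels m\<rbrakk> \<Longrightarrow> cls m a = cls m b"
  unfolding cls_def
  by (rule coset_eq_iff[OF TF_module TR_submodule, THEN iffD2]) (auto intro: subsetD[OF mspan_superset])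

lemma tau_closed: "\<lbrakk>x \<in> carrier (Dl m); v \<in> carrier L\<rbrakk> \<Longrightarrow> tau m x v \<in> carrier (sp T m)"
  unfolding tau_def by (rule linear_mapsD(1)[OF cls_linear TF_basis])

lemma tau_linear1: "v \<in> carrier L \<Longrightarrow> (\<lambda>x. tau m x v) \<in> linear_maps K (Dl m) (sp T m)"
proof (rule linear_mapsI)
  interpret F: module K "TF m" by (rule TF_module)
  interpret D: module K "Dl m" by (rule Dl_module)
  fix x assume v: "v \<in> carrier L" and x: "x \<in> carrier (Dl m)"
  note b = TF_basis[OF x v]
  show "tau m x v \<in> carrier (sp T m)" by (rule tau_closed[OF x v])
  show "tau m (c \<odot>\<^bsub>Dl m\<^esub> x) v = c \<odot>\<^bsub>sp T m\<^esub> tau m x v" if c: "c \<in> carrier K" for c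
    unfolding tau_def linear_mapsD(3)[OF cls_linear c b, symmetric]
    by (rule cls_eqI[OF TF_basis[OF D.smult_closed[OF c x] v] F.smult_closed[OF c b] rels_intros(3)[OF c x v]])
  show "tau m (x \<oplus>\<^bsub>Dl m\<^esub> y) v = tau m x v \<oplus>\<^bsub>sp T m\<^esub> tau m y v" if y: "y \<in> carrier (Dl m)" for y
    unfolding tau_def linear_mapsD(2)[OF cls_linear b TF_basis[OF y v], symmetric]
    by (rule cls_eqI[OF TF_basis[OF D.a_closed[OF x y] v] F.a_closed[OF b TF_basis[OF y v]] rels_intros(1)[OF x y v]])
qed

lemma tau_add2:
  assumes x: "x \<in> carrier (Dl m)" and v: "v \<in> carrier L" and w: "w \<in> carrier L"
  shows "tau m x (v \<oplus>\<^bsub>L\<^esub> w) = tau m x v \<oplus>\<^bsub>sp T m\<^esub> tau m x w"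
proof -
  interpret F: module K "TF m" by (rule TF_module)
  note b = TF_basis[OF x v] TF_basis[OF x w]
  show ?thesis
    unfolding tau_def linear_mapsD(2)[OF cls_linear b, symmetric]
    by (rule cls_eqI[OF TF_basis[OF x L.M.a_closed[OF v w]] F.a_closed[OF b] rels_intros(2)[OF x v w]])
qed

lemma tau_bal:
  assumes x: "x \<in> carrier (Dl m)" and b: "b \<in> carrier A" and v: "v \<in> carrier L"
  shows "tau m (Delta_ract K C n m x b) v = tau m x (b \<odot>\<^bsub>L\<^esub> v)"
  unfolding tau_def
  by (rule cls_eqI[OF TF_basis[OF ract_closed[OF x b] v] TF_basis[OF x L.lsmult_closed[OF b v]] rels_intros(4)[OF x b v]])

text \<open>Homogeneity comes from balancedness: \<open>sc c\<close> crosses the tensor sign, and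
  its right action on the standard module is multiplication by \<open>c\<close>.\<close>

lemma tau_linear2:
  assumes x: "x \<in> carrier (Dl m)"
  shows "tau m x \<in> linear_maps K Lk (sp T m)"
proof (rule linear_mapsI)
  fix v assume "v \<in> carrier Lk"
  then have v: "v \<in> carrier L" by (simp add: Lk_simps)
  show "tau m x v \<in> carrier (sp T m)" by (rule tau_closed[OF x v])
  show "tau m x (v \<oplus>\<^bsub>Lk\<^esub> w) = tau m x v \<oplus>\<^bsub>sp T m\<^esub> tau m x w" if "w \<in> carrier Lk" for w
    using tau_add2[OF x v] that by (simp add: Lk_simps)
  fix c assume c: "c \<in> carrier K"
  obtain a where a: "a \<in> carrier (PF m)" "x = Dc m a" using x K.Delta_carrier by blast
  note i = K.basis_carrier[OF idm_aut[of n C]]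
  note lr = K.ract_linear_right[OF a(1)]
  have id: "free_bimap K (compose {1..n}) a (basis K (idm n)) = a"
  proof (rule K.free_mod_linear_eq[OF module_abelian_group[OF PF_module] K.ract_linear_left[OF i] _ _ a(1), where g="\<lambda>a. a"])
    show "(\<lambda>a. a) \<in> linear_maps K (PF m) (PF m)" by (intro linear_mapsI refl)
    show "free_bimap K (compose {1..n}) (basis K g) (basis K (idm n)) = basis K g" if "g \<in> Hom C n m" for g
      using compose_idm[OF Hom_all_maps[OF that]] by (simp add: K.free_bimap_basis)
  qed
  have "Delta_ract K C n m x (sc c) = Dc m (free_bimap K (compose {1..n}) a (c \<odot>\<^bsub>FG\<^esub> basis K (idm n)))"
    using K.Delta_ract_Dcls[OF _ a(1)] sc_closed[OF c] by (simp add: a(2) A_simps sc_def)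
  also have "\<dots> = Dc m (c \<odot>\<^bsub>PF m\<^esub> a)" using linear_mapsD(3)[OF lr c i] id by simp
  also have "\<dots> = c \<odot>\<^bsub>Dl m\<^esub> x" using linear_mapsD(3)[OF K.Dcls_linear c a(1)] by (simp add: a(2))
  finally show "tau m x (c \<odot>\<^bsub>Lk\<^esub> v) = c \<odot>\<^bsub>sp T m\<^esub> tau m x v"
    using tau_bal[OF x sc_closed[OF c] v] linear_mapsD(3)[OF tau_linear1[OF v] c x] by (simp add: Lk_simps)
qed

lemma Delta_act_closed:
  "\<lbrakk>m \<ge> 1; l \<ge> 1; f \<in> Hom C m l; x \<in> carrier (Dl m)\<rbrakk> \<Longrightarrow> act (Delta K C n) m l f x \<in> carrier (Dl l)"
  by (rule linear_mapsD(1)[OF is_cmodD(2)[OF K.Delta_is_cmod]])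

text \<open>The tensor product before division by the relators, as a functor of free
  modules.\<close>

definition pre :: "('k, ((nat \<Rightarrow> nat) \<Rightarrow> 'k) set \<times> 'v \<Rightarrow> 'k) cmod" where
  "pre = \<lparr>sp = (\<lambda>m. TF m), act = (\<lambda>m l f. free_map K (\<lambda>(x, v). (act (Delta K C n) m l f x, v)))\<rparr>"

lemma pre_simps:
  "sp pre m = TF m"
  "act pre m l f = free_map K (\<lambda>(x, v). (act (Delta K C n) m l f x, v))"
  by (simp_all add: pre_def)

lemma pre_is_cmod: "is_cmod K C pre"
  unfolding pre_def
proof (rule K.free_cmod[where X="\<lambda>m. carrier (Dl m) \<times> carrier L" and F="\<lambda>m l f. \<lambda>(x, v). (act (Delta K C n) m l f x, v)"])
  show "(case x of (x, v) \<Rightarrow> (act (Delta K C n) m l f x, v)) \<in> carrier (Dl l) \<times> carrier L"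
    if "m \<ge> 1" "l \<ge> 1" "f \<in> Hom C m l" "x \<in> carrier (Dl m) \<times> carrier L" for m l f x
    using that Delta_act_closed by (cases x) simp
  show "(case x of (x, v) \<Rightarrow> (act (Delta K C n) m m (idm m) x, v)) = x"
    if "m \<ge> 1" "x \<in> carrier (Dl m) \<times> carrier L" for m x
    using that is_cmodD(3)[OF K.Delta_is_cmod] by (cases x) simp
  show "(case x of (x, v) \<Rightarrow> (act (Delta K C n) m p (compose {1..m} g f) x, v)) =
      (case (case x of (x, v) \<Rightarrow> (act (Delta K C n) m l f x, v)) of (x, v) \<Rightarrow> (act (Delta K C n) l p g x, v))"
    if "m \<ge> 1" "l \<ge> 1" "p \<ge> 1" "f \<in> Hom C m l" "g \<in> Hom C l p" "x \<in> carrier (Dl m) \<times> carrier L" for m l p f g x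
    using that is_cmodD(4)[OF K.Delta_is_cmod that(1-5)] by (cases x) simp
qed

text \<open>Acting and then passing to classes comes from a balanced map of pairs, so it vanishes on
  the relators by \<open>rels_vanish\<close>; this avoids transporting the relators one by
  one.\<close>

lemma TR_subcmod: "subcmod K C (\<lambda>m. TR m) pre"
  unfolding subcmod_def
proof (intro conjI allI impI ballI)
  show "submodule (TR m) K (sp pre m)" for m unfolding pre_simps by (rule TR_submodule)
  fix m l :: nat and f r assume m: "m \<ge> 1" and l: "l \<ge> 1" and f: "f \<in> Hom C m l" and r: "r \<in> TR m"
  note ac = is_cmodD(2)[OF pre_is_cmod m l f, unfolded pre_simps(1)]
  have "cls l (act pre m l f r) = \<zero>\<^bsub>sp T l\<^esub>"
  proof (rule rels_vanish[OF T_module linear_maps_comp[OF ac cls_linear] _ _ _ _ r])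
    note da = Delta_act_closed[OF m l f]
    show "cls l (act pre m l f (basis K (x, v))) = tau l (act (Delta K C n) m l f x) v" for x v
      by (simp add: pre_simps K.free_map_basis tau_def)
    show "(\<lambda>x. tau l (act (Delta K C n) m l f x) v) \<in> linear_maps K (Dl m) (sp T l)" if "v \<in> carrier L" for v
      by (rule linear_maps_comp[OF is_cmodD(2)[OF K.Delta_is_cmod m l f] tau_linear1[OF that]])
    show "tau l (act (Delta K C n) m l f x) (v \<oplus>\<^bsub>L\<^esub> w) =
        tau l (act (Delta K C n) m l f x) v \<oplus>\<^bsub>sp T l\<^esub> tau l (act (Delta K C n) m l f x) w"
      if "x \<in> carrier (Dl m)" "v \<in> carrier L" "w \<in> carrier L" for x v w
      using that tau_add2 da by blast
    show "tau l (act (Delta K C n) m l f (Delta_ract K C n m x b)) v = tau l (act (Delta K C n) m l f x) (b \<odot>\<^bsub>L\<^esub> v)"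
      if "x \<in> carrier (Dl m)" "b \<in> carrier A" "v \<in> carrier L" for x b v
      using that K.Delta_act_ract[OF m l f, of b n x] tau_bal[OF da] by (simp add: A_simps)
  qed
  moreover have "r \<in> carrier (TF m)" using r submoduleD(1)[OF TR_submodule] by blast
  ultimately show "act pre m l f r \<in> TR l"
    using coset_zero_iff[OF TF_module TR_submodule linear_mapsD(1)[OF ac]]
    by (simp add: T_sp quot_mod_zero cls_def)
qed

lemma T_quot: "T = quot_cmod pre (\<lambda>m. TR m)"
  by (simp add: Delta_tensor_def tensor_cmod_def pre_def)

lemma T_is_cmod: "is_cmod K C T"
  unfolding T_quot by (rule quot_cmod_is_cmod[OF pre_is_cmod TR_subcmod])

lemma T_act_tau:
  assumes "m \<ge> 1" "l \<ge> 1" "f \<in> Hom C m l" "x \<in> carrier (Dl m)" "v \<in> carrier L"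
  shows "act T m l f (tau m x v) = tau l (act (Delta K C n) m l f x) v"
  using quot_cmod_act[OF pre_is_cmod TR_subcmod assms(1-3), of "basis K (x, v)"] TF_basis[OF assms(4,5)]
  unfolding T_quot[symmetric] by (simp add: pre_simps tau_def cls_def K.free_map_basis)

end

section \<open>The standard module as a free right module over the group algebra\<close>

lemma compose_SM_eq_iff:
  assumes f: "f \<in> Hom C n m" and i: "i \<in> SM n m" and g: "g \<in> aut C n"
  shows "compose {1..n} i g = f \<longleftrightarrow> inj_on f {1..n} \<and> sm C n f = i \<and> gp C n f = g"
proof
  assume eq: "compose {1..n} i g = f"
  have "inj_on f {1..n}"
    unfolding eq[symmetric] by (rule inj_on_compose[OF aut_all_maps[OF g] aut_inj[OF g] SM_inj[OF i]])
  then show "inj_on f {1..n} \<and> sm C n f = i \<and> gp C n f = g" using sm_gp_compose[OF i g] eq by simp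
next
  assume "inj_on f {1..n} \<and> sm C n f = i \<and> gp C n f = g"
  then show "compose {1..n} i g = f" using sm_gp(3)[OF f] by simp
qed

context kgmod
begin

text \<open>By unique factorization \<open>\<Delta>\<^sub>n[m]\<close> is a free right
  \<open>kG\<close>-module on the strictly increasing maps. This is the coefficient at the basis
  element \<open>i\<close>, an element of \<open>kG\<close>, before passing to the quotient.\<close>

definition chi0 :: "(nat \<Rightarrow> nat) \<Rightarrow> ((nat \<Rightarrow> nat) \<Rightarrow> 'k) \<Rightarrow> (nat \<Rightarrow> nat) \<Rightarrow> 'k" where
  "chi0 i a = (\<lambda>g. if g \<in> aut C n then a (compose {1..n} i g) else \<zero>\<^bsub>K\<^esub>)"

lemma chi0_linear: "chi0 i \<in> linear_maps K (PF m) FG"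
proof (rule linear_mapsI)
  fix a assume a: "a \<in> carrier (PF m)"
  have "finite {g. chi0 i a g \<noteq> \<zero>\<^bsub>K\<^esub>}"
    by (rule finite_subset[OF _ finite_aut[of C n]]) (auto simp: chi0_def)
  then show "chi0 i a \<in> carrier FG"
    using free_mod_carrierD(1)[OF a] by (intro free_mod_carrierI) (auto simp: chi0_def)
qed (auto simp: chi0_def free_mod_simps)

lemma chi0_basis:
  assumes f: "f \<in> Hom C n m" and i: "i \<in> SM n m"
  shows "chi0 i (basis K f) = (if inj_on f {1..n} \<and> sm C n f = i then basis K (gp C n f) else \<zero>\<^bsub>FG\<^esub>)"
proof
  fix g
  have "gp C n f \<in> aut C n" if "inj_on f {1..n}" using sm_gp(2)[OF f that] .
  then show "chi0 i (basis K f) g = (if inj_on f {1..n} \<and> sm C n f = i then basis K (gp C n f) else \<zero>\<^bsub>FG\<^esub>) g"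
    using compose_SM_eq_iff[OF f i, of g] by (auto simp: chi0_def basis_def free_mod_simps)
qed

lemma chi0_noninj:
  assumes i: "i \<in> SM n m" and a: "a \<in> noninj_part K C n m"
  shows "chi0 i a = \<zero>\<^bsub>FG\<^esub>"
  using K.noninj_part_map[OF FG.module_axioms chi0_linear submodule_zero[OF FG.module_axioms] _ a]
    chi0_basis[OF _ i] by simp

definition chi :: "(nat \<Rightarrow> nat) \<Rightarrow> ((nat \<Rightarrow> nat) \<Rightarrow> 'k) set \<Rightarrow> (nat \<Rightarrow> nat) \<Rightarrow> 'k" where
  "chi i = desc (chi0 i)"

lemma chi_linear: "i \<in> SM n m \<Longrightarrow> chi i \<in> linear_maps K (Dl m) FG"
  unfolding chi_def K.Delta_sp
  by (rule desc_linear[OF PF_module K.noninj_part_submodule FG.module_axioms chi0_linear chi0_noninj])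

lemma chi_Dcls: "\<lbrakk>i \<in> SM n m; a \<in> carrier (PF m)\<rbrakk> \<Longrightarrow> chi i (Dc m a) = chi0 i a"
  unfolding chi_def
  by (rule desc_coset[OF PF_module K.noninj_part_submodule FG.module_axioms chi0_linear chi0_noninj])

lemma chi_closed: "\<lbrakk>i \<in> SM n m; x \<in> carrier (Dl m)\<rbrakk> \<Longrightarrow> chi i x \<in> carrier A"
  using linear_mapsD(1)[OF chi_linear] by (simp add: A_simps(1))

lemma compose_aut_fits:
  assumes f: "f \<in> Hom C n m" and h: "h \<in> aut C n" and i: "i \<in> SM n m"
  shows "inj_on (compose {1..n} f h) {1..n} \<and> sm C n (compose {1..n} f h) = i \<longleftrightarrow> inj_on f {1..n} \<and> sm C n f = i"
    and "inj_on f {1..n} \<Longrightarrow> gp C n (compose {1..n} f h) = compose {1..n} (gp C n f) h"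
proof -
  have inj: "inj_on (compose {1..n} f h) {1..n} \<longleftrightarrow> inj_on f {1..n}"
    using K.not_inj_compose_aut[OF h] inj_on_compose[OF aut_all_maps[OF h] aut_inj[OF h]] by blast
  have *: "sm C n (compose {1..n} f h) = sm C n f \<and> gp C n (compose {1..n} f h) = compose {1..n} (gp C n f) h"
    if "inj_on f {1..n}"
  proof -
    note s = sm_gp[OF f that]
    have "compose {1..n} f h = compose {1..n} (sm C n f) (compose {1..n} (gp C n f) h)"
      using compose_assoc_maps[OF aut_all_maps[OF h], of "sm C n f" "gp C n f"] s(3) by simp
    then show ?thesis using sm_gp_compose[OF s(1) aut_compose[OF h s(2)]] by simp
  qed
  show "inj_on (compose {1..n} f h) {1..n} \<and> sm C n (compose {1..n} f h) = i \<longleftrightarrow> inj_on f {1..n} \<and> sm C n f = i"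
    using inj * by auto
  show "inj_on f {1..n} \<Longrightarrow> gp C n (compose {1..n} f h) = compose {1..n} (gp C n f) h" using * by blast
qed

text \<open>An automorphism applied first only multiplies the group part from the right. This right
  linearity is what makes the coordinate \<open>co0\<close> balanced.\<close>

lemma chi_ract:
  assumes i: "i \<in> SM n m" and x: "x \<in> carrier (Dl m)" and b: "b \<in> carrier A"
  shows "chi i (Delta_ract K C n m x b) = chi i x \<otimes>\<^bsub>A\<^esub> b"
proof -
  have b': "b \<in> carrier FG" using b by (simp add: A_simps)
  obtain a where a: "a \<in> carrier (PF m)" "x = Dc m a" using x K.Delta_carrier by blast
  have "chi0 i (free_bimap K (compose {1..n}) a b) = chi0 i a \<otimes>\<^bsub>A\<^esub> b"
  proof (rule K.free_mod_bilinear_eq[OF FG.M.abelian_group_axioms _ _ _ _ _ a(1) b'])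
    show "(\<lambda>a. chi0 i (free_bimap K (compose {1..n}) a b)) \<in> linear_maps K (PF m) FG" if "b \<in> carrier FG" for b
      by (rule linear_maps_comp[OF K.ract_linear_left[OF that] chi0_linear])
    show "(\<lambda>a. chi0 i a \<otimes>\<^bsub>A\<^esub> b) \<in> linear_maps K (PF m) FG" if "b \<in> carrier FG" for b
      by (rule linear_maps_comp[OF chi0_linear A_linear_left[OF that]])
    fix f assume f: "f \<in> Hom C n m"
    show "(\<lambda>b. chi0 i (free_bimap K (compose {1..n}) (basis K f) b)) \<in> linear_maps K FG FG"
      by (rule linear_maps_comp[OF K.ract_linear_right[OF K.basis_carrier[OF f]] chi0_linear])
    show "(\<lambda>b. chi0 i (basis K f) \<otimes>\<^bsub>A\<^esub> b) \<in> linear_maps K FG FG"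
      by (rule A_linear_right[OF linear_mapsD(1)[OF chi0_linear K.basis_carrier[OF f]]])
    fix h assume h: "h \<in> aut C n"
    show "chi0 i (free_bimap K (compose {1..n}) (basis K f) (basis K h)) = chi0 i (basis K f) \<otimes>\<^bsub>A\<^esub> basis K h"
      unfolding K.free_bimap_basis chi0_basis[OF K.Hom_compose_aut[OF f h] i] chi0_basis[OF f i]
        compose_aut_fits(1)[OF f h i]
      using compose_aut_fits(2)[OF f h i] L.R.l_null[OF basis_A[OF h]] by (simp add: basis_mult A_simps(4))
  qed
  then show ?thesis
    using K.Delta_ract_Dcls[OF b' a(1)] linear_mapsD(1)[OF K.ract_linear_left[OF b'] a(1)] a
    by (simp add: chi_Dcls[OF i])
qed

text \<open>The coordinate at a strictly increasing map \<open>i\<close>: it sends \<open>[i \<circ> g] \<otimes> v\<close> to \<open>g v\<close> and vanishes on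
  \<open>[f] \<otimes> v\<close> if the image of \<open>f\<close> is different from that of \<open>i\<close>.\<close>

definition co0 :: "(nat \<Rightarrow> nat) \<Rightarrow> (((nat \<Rightarrow> nat) \<Rightarrow> 'k) set \<times> 'v \<Rightarrow> 'k) \<Rightarrow> 'v" where
  "co0 i = lift K Lk (\<lambda>(x, v). chi i x \<odot>\<^bsub>L\<^esub> v)"

lemma co0_linear: "i \<in> SM n m \<Longrightarrow> co0 i \<in> linear_maps K (TF m) Lk"
  unfolding co0_def
  by (rule Lk.lift_linear) (auto simp: Lk_simps intro!: L.lsmult_closed chi_closed)

lemma co0_basis:
  "\<lbrakk>i \<in> SM n m; x \<in> carrier (Dl m); v \<in> carrier L\<rbrakk> \<Longrightarrow> co0 i (basis K (x, v)) = chi i x \<odot>\<^bsub>L\<^esub> v"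
  unfolding co0_def using Lk.lift_basis[of "\<lambda>(x, v). chi i x \<odot>\<^bsub>L\<^esub> v" "(x, v)"]
  by (simp add: Lk_simps L.lsmult_closed chi_closed)

lemma co0_vanish:
  assumes i: "i \<in> SM n m" and r: "r \<in> TR m"
  shows "co0 i r = \<zero>\<^bsub>Lk\<^esub>"
proof (rule rels_vanish[OF Lk.module_axioms co0_linear[OF i] co0_basis[OF i] _ _ _ r])
  show "(\<lambda>x. chi i x \<odot>\<^bsub>L\<^esub> v) \<in> linear_maps K (Dl m) Lk" if "v \<in> carrier L" for v
    by (rule linear_maps_comp[OF chi_linear[OF i] lsmult_linear_left[OF that]])
  show "chi i x \<odot>\<^bsub>L\<^esub> (v \<oplus>\<^bsub>L\<^esub> w) = (chi i x \<odot>\<^bsub>L\<^esub> v) \<oplus>\<^bsub>Lk\<^esub> (chi i x \<odot>\<^bsub>L\<^esub> w)"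
    if "x \<in> carrier (Dl m)" "v \<in> carrier L" "w \<in> carrier L" for x v w
    using L.lsmult_r_distr[OF chi_closed[OF i]] that by (simp add: Lk_simps)
  show "chi i (Delta_ract K C n m x b) \<odot>\<^bsub>L\<^esub> v = chi i x \<odot>\<^bsub>L\<^esub> (b \<odot>\<^bsub>L\<^esub> v)"
    if "x \<in> carrier (Dl m)" "b \<in> carrier A" "v \<in> carrier L" for x b v
    using L.lsmult_assoc[OF chi_closed[OF i]] chi_ract[OF i] that by simp
qed

definition co :: "(nat \<Rightarrow> nat) \<Rightarrow> (((nat \<Rightarrow> nat) \<Rightarrow> 'k) set \<times> 'v \<Rightarrow> 'k) set \<Rightarrow> 'v" where
  "co i = desc (co0 i)"

lemma co_linear: "i \<in> SM n m \<Longrightarrow> co i \<in> linear_maps K (sp T m) Lk"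
  unfolding co_def T_sp
  by (rule desc_linear[OF TF_module TR_submodule Lk.module_axioms co0_linear co0_vanish])

lemma co_tau:
  "\<lbrakk>i \<in> SM n m; x \<in> carrier (Dl m); v \<in> carrier L\<rbrakk> \<Longrightarrow> co i (tau m x v) = chi i x \<odot>\<^bsub>L\<^esub> v"
  unfolding co_def tau_def cls_def
  using desc_coset[OF TF_module TR_submodule Lk.module_axioms co0_linear co0_vanish TF_basis] co0_basis by metis

text \<open>The pure tensor \<open>[f] \<otimes> v\<close>.\<close>

definition bt :: "nat \<Rightarrow> (nat \<Rightarrow> nat) \<Rightarrow> 'v \<Rightarrow> (((nat \<Rightarrow> nat) \<Rightarrow> 'k) set \<times> 'v \<Rightarrow> 'k) set" where
  "bt m f v = tau m (Dc m (basis K f)) v"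

lemma Dc_basis: "f \<in> Hom C n m \<Longrightarrow> Dc m (basis K f) \<in> carrier (Dl m)"
  by (rule linear_mapsD(1)[OF K.Dcls_linear K.basis_carrier])

lemma bt_linear: "f \<in> Hom C n m \<Longrightarrow> bt m f \<in> linear_maps K Lk (sp T m)"
  unfolding bt_def[abs_def] by (rule tau_linear2[OF Dc_basis])

lemma bt_closed: "\<lbrakk>f \<in> Hom C n m; v \<in> carrier Lk\<rbrakk> \<Longrightarrow> bt m f v \<in> carrier (sp T m)"
  by (rule linear_mapsD(1)[OF bt_linear])

lemma bt_zero: "f \<in> Hom C n m \<Longrightarrow> bt m f \<zero>\<^bsub>Lk\<^esub> = \<zero>\<^bsub>sp T m\<^esub>"
  by (rule linear_maps_hom(1)[OF Lk.M.abelian_group_axioms module_abelian_group[OF T_module] bt_linear])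

lemma bt_noninj:
  assumes "f \<in> Hom C n m" "\<not> inj_on f {1..n}" "v \<in> carrier Lk"
  shows "bt m f v = \<zero>\<^bsub>sp T m\<^esub>"
proof -
  have v: "v \<in> carrier L" using assms(3) by (simp add: Lk_simps)
  show ?thesis
    unfolding bt_def K.Dcls_noninj[OF assms(1,2)]
    by (rule linear_maps_hom(1)[OF module_abelian_group[OF Dl_module] module_abelian_group[OF T_module] tau_linear1[OF v]])
qed

lemma bt_compose:
  assumes f: "f \<in> Hom C n m" and g: "g \<in> aut C n" and v: "v \<in> carrier Lk"
  shows "bt m (compose {1..n} f g) v = bt m f (ga g v)"
proof -
  have "Dc m (basis K (compose {1..n} f g)) = Delta_ract K C n m (Dc m (basis K f)) (basis K g)"
    using K.Delta_ract_Dcls[OF K.basis_carrier[OF g] K.basis_carrier[OF f]] by (simp add: K.free_bimap_basis)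
  then show ?thesis
    using tau_bal[OF Dc_basis[OF f] basis_A[OF g]] v by (simp add: bt_def ga_def Lk_simps)
qed

lemma act_bt:
  assumes "m \<ge> 1" "l \<ge> 1" "f \<in> Hom C m l" "g \<in> Hom C n m" "v \<in> carrier Lk"
  shows "act T m l f (bt m g v) = bt l (compose {1..n} f g) v"
  using T_act_tau[OF assms(1-3) Dc_basis[OF assms(4)]] K.Delta_act[OF assms(1-3) K.basis_carrier[OF assms(4)]] assms(5)
  by (simp add: bt_def K.free_map_basis Lk_simps)

lemma co_bt:
  assumes i: "i \<in> SM n m" and f: "f \<in> Hom C n m" and v: "v \<in> carrier Lk"
  shows "co i (bt m f v) = (if inj_on f {1..n} \<and> sm C n f = i then ga (gp C n f) v else \<zero>\<^bsub>Lk\<^esub>)"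
proof -
  have v': "v \<in> carrier L" using v by (simp add: Lk_simps)
  have "\<zero>\<^bsub>FG\<^esub> \<odot>\<^bsub>L\<^esub> v = \<zero>\<^bsub>Lk\<^esub>"
    by (rule linear_maps_hom(1)[OF FG.M.abelian_group_axioms Lk.M.abelian_group_axioms lsmult_linear_left[OF v']])
  then show ?thesis
    using chi_Dcls[OF i K.basis_carrier[OF f]] chi0_basis[OF f i]
    by (simp add: bt_def co_tau[OF i Dc_basis[OF f] v'] ga_def)
qed

lemma co_SM:
  assumes i: "i \<in> SM n m" and j: "j \<in> SM n m" and v: "v \<in> carrier Lk"
  shows "co i (bt m j v) = (if j = i then v else \<zero>\<^bsub>Lk\<^esub>)"
  using co_bt[OF i SM_Hom[OF j] v] SM_inj[OF j] sm_gp_SM[OF j, of C] ga_idm[OF v] by auto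

text \<open>The right-hand side is a linear map \<open>E\<close>, so it suffices to test it on
  tensors \<open>[f] \<otimes> v\<close>. For injective \<open>f\<close> the automorphism in its
  factorization crosses the tensor sign and leaves a strictly increasing map; for other
  \<open>f\<close> the tensor is zero.\<close>

lemma T_expand:
  assumes x: "x \<in> carrier (sp T m)"
  shows "x = (\<Oplus>\<^bsub>sp T m\<^esub>i\<in>SM n m. bt m i (co i x))"
proof -
  interpret T: module K "sp T m" by (rule T_module)
  define E where "E x = (\<Oplus>\<^bsub>sp T m\<^esub>i\<in>SM n m. bt m i (co i x))" for x
  have E: "E \<in> linear_maps K (sp T m) (sp T m)"
    unfolding E_def using linear_maps_comp[OF co_linear bt_linear[OF SM_Hom]]
    by (intro linear_maps_finsum[OF T_module T_module finite_SM]) 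
  have E_bt: "E (bt m i v) = bt m i v" if i: "i \<in> SM n m" and v: "v \<in> carrier Lk" for i v
  proof -
    have "E (bt m i v) = bt m i (co i (bt m i v))" unfolding E_def
    proof (rule T.finsum_single[OF finite_SM i])
      show "(\<lambda>j. bt m j (co j (bt m i v))) \<in> SM n m \<rightarrow> carrier (sp T m)"
        using linear_mapsD(1)[OF co_linear] bt_closed[OF SM_Hom] i v by blast
      show "bt m j (co j (bt m i v)) = \<zero>\<^bsub>sp T m\<^esub>" if "j \<in> SM n m" "j \<noteq> i" for j
        using that co_SM[OF that(1) i v] bt_zero[OF SM_Hom[OF that(1)]] by simp
    qed
    then show ?thesis using co_SM[OF i i v] by simp
  qed
  have E_f: "E (bt m f v) = bt m f v" if f: "f \<in> Hom C n m" and v: "v \<in> carrier Lk" for f v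
  proof (cases "inj_on f {1..n}")
    case True
    note s = sm_gp[OF f True]
    have "bt m f v = bt m (sm C n f) (ga (gp C n f) v)"
      using bt_compose[OF SM_Hom[OF s(1)] s(2) v] s(3) by simp
    then show ?thesis using E_bt[OF s(1) ga_closed[OF s(2) v]] by simp
  next
    case False
    then show ?thesis
      using bt_noninj[OF f False v] linear_maps_hom(1)[OF T.abelian_group_axioms T.abelian_group_axioms E] by simp
  qed
  have E_tau: "E (tau m (Dc m a) v) = tau m (Dc m a) v" if a: "a \<in> carrier (PF m)" and v: "v \<in> carrier L" for a v
  proof (rule K.free_mod_linear_eq[OF T.abelian_group_axioms _ _ _ a, where f="\<lambda>a. E (tau m (Dc m a) v)" and g="\<lambda>a. tau m (Dc m a) v"])
    show lin: "(\<lambda>a. tau m (Dc m a) v) \<in> linear_maps K (PF m) (sp T m)"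
      by (rule linear_maps_comp[OF K.Dcls_linear tau_linear1[OF v]])
    show "(\<lambda>a. E (tau m (Dc m a) v)) \<in> linear_maps K (PF m) (sp T m)"
      by (rule linear_maps_comp[OF lin E])
    show "E (tau m (Dc m (basis K f)) v) = tau m (Dc m (basis K f)) v" if "f \<in> Hom C n m" for f
      using E_f[OF that] v by (simp add: bt_def Lk_simps)
  qed
  obtain b where b: "b \<in> carrier (TF m)" "x = cls m b" using x T_carrier by blast
  have "E (cls m b) = cls m b"
  proof (rule K.free_mod_linear_eq[OF T.abelian_group_axioms linear_maps_comp[OF cls_linear E] cls_linear _ b(1)])
    fix p assume "p \<in> carrier (Dl m) \<times> carrier L"
    then obtain y v where p: "p = (y, v)" and y: "y \<in> carrier (Dl m)" and v: "v \<in> carrier L" by blast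
    obtain a where "a \<in> carrier (PF m)" "y = Dc m a" using y K.Delta_carrier by blast
    then show "E (cls m (basis K p)) = cls m (basis K p)" using E_tau v by (simp add: p tau_def)
  qed
  then show ?thesis using b by (simp add: E_def)
qed

lemma T_ext:
  assumes "x \<in> carrier (sp T m)" "y \<in> carrier (sp T m)" "\<And>i. i \<in> SM n m \<Longrightarrow> co i x = co i y"
  shows "x = y"
proof -
  interpret T: module K "sp T m" by (rule T_module)
  have "x = (\<Oplus>\<^bsub>sp T m\<^esub>i\<in>SM n m. bt m i (co i x))" by (rule T_expand[OF assms(1)])
  also have "\<dots> = (\<Oplus>\<^bsub>sp T m\<^esub>i\<in>SM n m. bt m i (co i y))"
    using assms(3) linear_mapsD(1)[OF co_linear assms(2)] bt_closed[OF SM_Hom] by (intro T.finsum_cong') auto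
  also have "\<dots> = y" by (rule T_expand[OF assms(2), symmetric])
  finally show ?thesis .
qed

text \<open>The element with prescribed coordinates, inverse to the family of all
  \<open>co i\<close>.\<close>

definition mk :: "nat \<Rightarrow> ((nat \<Rightarrow> nat) \<Rightarrow> 'v) \<Rightarrow> (((nat \<Rightarrow> nat) \<Rightarrow> 'k) set \<times> 'v \<Rightarrow> 'k) set" where
  "mk m u = (\<Oplus>\<^bsub>sp T m\<^esub>i\<in>SM n m. bt m i (u i))"

lemma mk:
  assumes u: "\<And>i. i \<in> SM n m \<Longrightarrow> u i \<in> carrier Lk"
  shows "mk m u \<in> carrier (sp T m)" and "i \<in> SM n m \<Longrightarrow> co i (mk m u) = u i"
proof -
  interpret T: module K "sp T m" by (rule T_module)
  have c: "(\<lambda>i. bt m i (u i)) \<in> SM n m \<rightarrow> carrier (sp T m)" using u bt_closed[OF SM_Hom] by blast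
  then show "mk m u \<in> carrier (sp T m)" unfolding mk_def by (rule T.finsum_closed)
  assume i: "i \<in> SM n m"
  have "co i (mk m u) = (\<Oplus>\<^bsub>Lk\<^esub>j\<in>SM n m. co i (bt m j (u j)))"
    unfolding mk_def by (rule linear_maps_hom(4)[OF T.abelian_group_axioms Lk.M.abelian_group_axioms co_linear[OF i] c])
  also have "\<dots> = co i (bt m i (u i))"
    using co_SM[OF i] u by (intro Lk.M.finsum_single[OF finite_SM i]) auto
  finally show "co i (mk m u) = u i" using co_SM[OF i i u[OF i]] by simp
qed

lemma co_act:
  assumes m: "m \<ge> 1" "l \<ge> 1" and f: "f \<in> Hom C m l" and x: "x \<in> carrier (sp T m)" and i: "i \<in> SM n l"
  shows "co i (act T m l f x) = (\<Oplus>\<^bsub>Lk\<^esub>j\<in>SM n m.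
    if inj_on (compose {1..n} f j) {1..n} \<and> sm C n (compose {1..n} f j) = i
    then ga (gp C n (compose {1..n} f j)) (co j x) else \<zero>\<^bsub>Lk\<^esub>)"
proof -
  note Ta = module_abelian_group[OF T_module]
  note al = is_cmodD(2)[OF T_is_cmod m f]
  have cx: "co j x \<in> carrier Lk" if "j \<in> SM n m" for j using linear_mapsD(1)[OF co_linear[OF that] x] .
  have "co i (act T m l f x) = co i (act T m l f (\<Oplus>\<^bsub>sp T m\<^esub>j\<in>SM n m. bt m j (co j x)))"
    by (rule arg_cong[OF T_expand[OF x]])
  also have "\<dots> = (\<Oplus>\<^bsub>Lk\<^esub>j\<in>SM n m. co i (act T m l f (bt m j (co j x))))"
    using bt_closed[OF SM_Hom] cx
    by (intro linear_maps_hom(4)[OF Ta Lk.M.abelian_group_axioms linear_maps_comp[OF al co_linear[OF i]]]) blast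
  also have "\<dots> = (\<Oplus>\<^bsub>Lk\<^esub>j\<in>SM n m.
    if inj_on (compose {1..n} f j) {1..n} \<and> sm C n (compose {1..n} f j) = i
    then ga (gp C n (compose {1..n} f j)) (co j x) else \<zero>\<^bsub>Lk\<^esub>)"
  proof (rule Lk.M.finsum_cong'[OF refl])
    fix j assume j: "j \<in> SM n m"
    have h: "compose {1..n} f j \<in> Hom C n l" by (rule Hom_compose[OF SM_Hom[OF j] f])
    show "co i (act T m l f (bt m j (co j x))) =
      (if inj_on (compose {1..n} f j) {1..n} \<and> sm C n (compose {1..n} f j) = i
       then ga (gp C n (compose {1..n} f j)) (co j x) else \<zero>\<^bsub>Lk\<^esub>)"
      using act_bt[OF m f SM_Hom[OF j] cx[OF j]] co_bt[OF i h cx[OF j]] by simp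
  next
    show "(\<lambda>j. if inj_on (compose {1..n} f j) {1..n} \<and> sm C n (compose {1..n} f j) = i
      then ga (gp C n (compose {1..n} f j)) (co j x) else \<zero>\<^bsub>Lk\<^esub>) \<in> SM n m \<rightarrow> carrier Lk"
    proof
      fix j assume j: "j \<in> SM n m"
      have h: "compose {1..n} f j \<in> Hom C n l" by (rule Hom_compose[OF SM_Hom[OF j] f])
      show "(if inj_on (compose {1..n} f j) {1..n} \<and> sm C n (compose {1..n} f j) = i
        then ga (gp C n (compose {1..n} f j)) (co j x) else \<zero>\<^bsub>Lk\<^esub>) \<in> carrier Lk"
        using ga_closed[OF sm_gp(2)[OF h] cx[OF j]] by simp
    qed
  qed
  finally show ?thesis .
qed

text \<open>If \<open>f\<close> is order-preserving, an injective composite with \<open>j\<close> is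
  again strictly increasing; its group part is trivial, and no group element acts.\<close>

lemma co_act_OA:
  assumes m: "m \<ge> 1" "l \<ge> 1" and f: "f \<in> OA_maps m l" and x: "x \<in> carrier (sp T m)" and i: "i \<in> SM n l"
  shows "co i (act T m l f x) = (\<Oplus>\<^bsub>Lk\<^esub>j\<in>SM n m. if compose {1..n} f j = i then co j x else \<zero>\<^bsub>Lk\<^esub>)"
  unfolding co_act[OF m OA_Hom[OF f] x i]
proof (rule Lk.M.finsum_cong'[OF refl])
  have cx: "co j x \<in> carrier Lk" if "j \<in> SM n m" for j using linear_mapsD(1)[OF co_linear[OF that] x] .
  then show "(\<lambda>j. if compose {1..n} f j = i then co j x else \<zero>\<^bsub>Lk\<^esub>) \<in> SM n m \<rightarrow> carrier Lk" by auto
  fix j assume j: "j \<in> SM n m"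
  have "compose {1..n} f j \<in> SM n l" if "inj_on (compose {1..n} f j) {1..n}"
    using OA_compose[OF SM_OA[OF j] f] that by (simp add: SM_def)
  then have 1: "sm C n (compose {1..n} f j) = compose {1..n} f j \<and> gp C n (compose {1..n} f j) = idm n"
    if "inj_on (compose {1..n} f j) {1..n}" using that sm_gp_SM by blast
  show "(if inj_on (compose {1..n} f j) {1..n} \<and> sm C n (compose {1..n} f j) = i
      then ga (gp C n (compose {1..n} f j)) (co j x) else \<zero>\<^bsub>Lk\<^esub>) = (if compose {1..n} f j = i then co j x else \<zero>\<^bsub>Lk\<^esub>)"
    using 1 SM_inj[OF i] ga_idm[OF cx[OF j]] by auto
qed

end

section \<open>The radical\<close>

lemma (in abelian_monoid) finsum_two:
  assumes "finite A" "i \<in> A" "j \<in> A" "i \<noteq> j" "f \<in> A \<rightarrow> carrier G"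
    "\<And>k. \<lbrakk>k \<in> A; k \<noteq> i; k \<noteq> j\<rbrakk> \<Longrightarrow> f k = \<zero>"
  shows "(\<Oplus>k\<in>A. f k) = f i \<oplus> f j"
proof -
  have "(\<Oplus>k\<in>A. f k) = (\<Oplus>k\<in>{i, j}. f k)"
    using assms by (intro add.finprod_mono_neutral_cong_right) auto
  then show ?thesis using assms by (auto simp: Pi_def)
qed

text \<open>A member of \<open>S\<close> with the largest sum of values is maximal for the pointwise
  order.\<close>

lemma maximal_SM:
  assumes S: "S \<subseteq> SM n m" "S \<noteq> {}"
  shows "\<exists>i\<in>S. \<forall>j\<in>S. (\<forall>k\<in>{1..n}. i k \<le> j k) \<longrightarrow> j = i"
proof -
  define w where "w i = (\<Sum>k\<in>{1..n}. i k)" for i :: "nat \<Rightarrow> nat"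
  have fin: "finite S" using S(1) finite_SM finite_subset by blast
  have "Max (w ` S) \<in> w ` S" using fin S(2) by (intro Max_in) auto
  then obtain i where i: "i \<in> S" "w i = Max (w ` S)" by auto
  have "j = i" if j: "j \<in> S" "\<forall>k\<in>{1..n}. i k \<le> j k" for j
  proof (rule ccontr)
    assume "j \<noteq> i"
    have "j \<in> SM n m" "i \<in> SM n m" using j(1) i(1) S(1) by auto
    from all_maps_eqI[OF SM_all_maps[OF this(1)] SM_all_maps[OF this(2)]] \<open>j \<noteq> i\<close>
    obtain k where "k \<in> {1..n}" "i k \<noteq> j k" by metis
    then have "w i < w j" unfolding w_def using j(2) by (intro sum_strict_mono_ex1) (auto simp: order_less_le)
    moreover have "w j \<le> w i" unfolding i(2) using fin j(1) by simp
    ultimately show False by simp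
  qed
  with i(1) show ?thesis by blast
qed

context kgmod
begin

lemmas Lk_ab = Lk.M.abelian_group_axioms

lemma T_ab: "abelian_group (sp T m)"
  by (rule module_abelian_group[OF T_module])

abbreviation "ac \<equiv> act T"

lemma ac_linear: "\<lbrakk>m \<ge> 1; l \<ge> 1; f \<in> Hom C m l\<rbrakk> \<Longrightarrow> ac m l f \<in> linear_maps K (sp T m) (sp T l)"
  by (rule is_cmodD(2)[OF T_is_cmod])

lemma ac_closed: "\<lbrakk>m \<ge> 1; l \<ge> 1; f \<in> Hom C m l; x \<in> carrier (sp T m)\<rbrakk> \<Longrightarrow> ac m l f x \<in> carrier (sp T l)"
  by (rule linear_mapsD(1)[OF ac_linear])

lemma co_closed: "\<lbrakk>i \<in> SM n m; x \<in> carrier (sp T m)\<rbrakk> \<Longrightarrow> co i x \<in> carrier Lk"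
  by (rule linear_mapsD(1)[OF co_linear])

lemma co_zero: "i \<in> SM n m \<Longrightarrow> co i \<zero>\<^bsub>sp T m\<^esub> = \<zero>\<^bsub>Lk\<^esub>"
  by (rule linear_maps_hom(1)[OF T_ab Lk_ab co_linear])

lemma T_zeroI: "\<lbrakk>x \<in> carrier (sp T m); \<And>i. i \<in> SM n m \<Longrightarrow> co i x = \<zero>\<^bsub>Lk\<^esub>\<rbrakk> \<Longrightarrow> x = \<zero>\<^bsub>sp T m\<^esub>"
proof -
  assume x: "x \<in> carrier (sp T m)" and co: "\<And>i. i \<in> SM n m \<Longrightarrow> co i x = \<zero>\<^bsub>Lk\<^esub>"
  interpret Tm: module K "sp T m" by (rule T_module)
  show ?thesis by (rule T_ext[OF x Tm.zero_closed]) (simp add: co co_zero)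
qed

text \<open>Multiplication by the sign \<open>(-1)^i\<close>.\<close>

definition sg :: "nat \<Rightarrow> 'v \<Rightarrow> 'v" where
  "sg i v = (if even i then v else \<ominus>\<^bsub>Lk\<^esub> v)"

lemma sg_linear: "sg i \<in> linear_maps K Lk Lk"
proof (cases "even i")
  case True
  then show ?thesis unfolding sg_def[abs_def] by (intro linear_mapsI) simp_all
next
  case False
  then show ?thesis unfolding sg_def[abs_def]
    by (intro linear_mapsI) (simp_all add: Lk.M.minus_add Lk.smult_r_minus)
qed

lemma sg_closed: "v \<in> carrier Lk \<Longrightarrow> sg i v \<in> carrier Lk"
  by (simp add: sg_def)

lemma sg_sg: "v \<in> carrier Lk \<Longrightarrow> sg i (sg j v) = sg (i + j) v"
  by (auto simp: sg_def)

lemma sg_even: "even i \<Longrightarrow> sg i v = v"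
  by (simp add: sg_def)

lemma sg_cancel: "v \<in> carrier Lk \<Longrightarrow> sg i (sg i v) = v"
  by (simp add: sg_sg sg_even)

lemma sg_parity: "even (i + j) \<Longrightarrow> sg i v = sg j v"
  by (auto simp: sg_def)

lemma sg_Suc: "v \<in> carrier Lk \<Longrightarrow> sg i v \<oplus>\<^bsub>Lk\<^esub> sg (i + 1) v = \<zero>\<^bsub>Lk\<^esub>"
  by (auto simp: sg_def Lk.M.r_neg Lk.M.l_neg)

lemma ga_sg:
  assumes "g \<in> aut C n" "v \<in> carrier Lk"
  shows "ga g (sg i v) = sg i (ga g v)"
  using linear_maps_hom(2)[OF Lk_ab Lk_ab ga_linear[OF assms(1)] assms(2)] by (simp add: sg_def)

lemma sg_submodule: "\<lbrakk>submodule U K Lk; v \<in> U\<rbrakk> \<Longrightarrow> sg i v \<in> U"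
  using submoduleD(4) by (auto simp: sg_def)

text \<open>Among the nonzero coordinates take a pointwise maximal \<open>i\<close>.  The map that is constant on the intervals
  between consecutive values of \<open>i\<close> detects exactly this coordinate.\<close>

lemma vanish_from_coords:
  assumes m: "m \<ge> 1" and x: "x \<in> carrier (sp T m)"
    and kill: "\<And>f. f \<in> OA_maps m n \<Longrightarrow> ac m n f x = \<zero>\<^bsub>sp T n\<^esub>"
    and co: "\<And>i. \<lbrakk>i \<in> SM n m; i 1 \<noteq> 1\<rbrakk> \<Longrightarrow> co i x = \<zero>\<^bsub>Lk\<^esub>"
  shows "x = \<zero>\<^bsub>sp T m\<^esub>"
proof (rule ccontr)
  assume ne: "x \<noteq> \<zero>\<^bsub>sp T m\<^esub>"
  let ?S = "{i \<in> SM n m. co i x \<noteq> \<zero>\<^bsub>Lk\<^esub>}"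
  have "?S \<noteq> {}" using T_zeroI[OF x] ne by blast
  then obtain i where i: "i \<in> ?S" and max: "\<And>j. j \<in> ?S \<Longrightarrow> (\<forall>k\<in>{1..n}. i k \<le> j k) \<Longrightarrow> j = i"
    using maximal_SM[of ?S n m] by auto
  have iS: "i \<in> SM n m" and i1: "i 1 = 1" using i co by auto
  define f where "f = (\<lambda>y\<in>{1..m}. max 1 (cnt n i y))"
  have f: "f \<in> OA_maps m n" unfolding f_def
  proof (rule OA_restrictI)
    show "max 1 (cnt n i y) \<in> {1..n}" for y using cnt_le[of n i y] n1 by simp
    show "max 1 (cnt n i y) \<le> max 1 (cnt n i z)" if "y \<le> z" for y z using cnt_mono[OF that, of n i] by simp
  qed
  have fi: "compose {1..n} f i = idm n"
  proof (rule extensionalityI[of _ "{1..n}"])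
    fix k assume k: "k \<in> {1..n}"
    then show "compose {1..n} f i k = idm n k"
      using SM_mem[OF iS k] cnt_self[OF iS k] by (simp add: compose_eq f_def idm_def)
  qed (auto simp: idm_def)
  \<comment> \<open>The other sections of \<open>f\<close> lie pointwise above \<open>i\<close>: at
    \<open>k > 1\<close> by the adjunction, and at 1 because \<open>i 1 = 1\<close>. By the choice
    of \<open>i\<close> their coordinates vanish, so \<open>f\<close> isolates the coordinate at
    \<open>i\<close>.\<close>
  have others: "co j x = \<zero>\<^bsub>Lk\<^esub>" if j: "j \<in> SM n m" "j \<noteq> i" and fj: "compose {1..n} f j = idm n" for j
  proof -
    have "i k \<le> j k" if k: "k \<in> {1..n}" for k
    proof (cases "k = 1")
      case True then show ?thesis using i1 SM_mem[OF j(1) k] by auto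
    next
      case False
      have "max 1 (cnt n i (j k)) = k"
        using fun_cong[OF fj, of k] k SM_mem[OF j(1) k] by (simp add: compose_eq f_def idm_def)
      then have "k \<le> cnt n i (j k)" using False k by (auto simp: max_def split: if_splits)
      then show ?thesis using le_cnt_iff[OF iS k] by blast
    qed
    then show ?thesis using max[of j] j by auto
  qed
  note cx = co_closed[OF _ x]
  have "co (idm n) (ac m n f x) = (if compose {1..n} f i = idm n then co i x else \<zero>\<^bsub>Lk\<^esub>)"
    unfolding co_act_OA[OF m n1 f x idm_SM]
    using others cx by (intro Lk.M.finsum_single[OF finite_SM iS]) auto
  then have "co (idm n) (ac m n f x) \<noteq> \<zero>\<^bsub>Lk\<^esub>" using fi i by simp
  then show False using kill[OF f] co_zero[OF idm_SM] by simp
qed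

text \<open>If \<open>i 1 \<noteq> 1\<close>, the points below \<open>i 1\<close> get a value of
  their own, which is why the target is \<open>[n+1]\<close>. Shifting the adjoint of
  \<open>i\<close> by one sends them to 1 and turns \<open>i\<close> into \<open>del n 1\<close>.
  Any other \<open>j\<close> that is turned into \<open>del n 1\<close> lies pointwise above
  \<open>i\<close>; hence also \<open>j 1 \<noteq> 1\<close>, and the maximality of \<open>i\<close>
  excludes it.\<close>

lemma nonzero_image:
  assumes m: "m \<ge> 1" and x: "x \<in> carrier (sp T m)"
    and kill: "\<And>f. f \<in> OA_maps m n \<Longrightarrow> ac m n f x = \<zero>\<^bsub>sp T n\<^esub>" and ne: "x \<noteq> \<zero>\<^bsub>sp T m\<^esub>"
  shows "\<exists>f\<in>OA_maps m (n+1). ac m (n+1) f x \<noteq> \<zero>\<^bsub>sp T (n+1)\<^esub>"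
proof -
  have n1': "n + 1 \<ge> 1" "(1::nat) \<in> {1..n}" using n1 by auto
  let ?S = "{i \<in> SM n m. i 1 \<noteq> 1 \<and> co i x \<noteq> \<zero>\<^bsub>Lk\<^esub>}"
  have "?S \<noteq> {}" using vanish_from_coords[OF m x kill] ne by blast
  then obtain i where i: "i \<in> ?S" and max: "\<And>j. j \<in> ?S \<Longrightarrow> (\<forall>k\<in>{1..n}. i k \<le> j k) \<Longrightarrow> j = i"
    using maximal_SM[of ?S n m] by auto
  have iS: "i \<in> SM n m" and i1: "i 1 \<noteq> 1" using i by auto
  define f where "f = (\<lambda>y\<in>{1..m}. 1 + cnt n i y)"
  have f: "f \<in> OA_maps m (n+1)" unfolding f_def
    by (rule OA_restrictI) (auto simp: cnt_le cnt_mono)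
  have fi: "compose {1..n} f i = del n 1"
  proof (rule extensionalityI[of _ "{1..n}"])
    fix k assume k: "k \<in> {1..n}"
    then show "compose {1..n} f i k = del n 1 k"
      using SM_mem[OF iS k] cnt_self[OF iS k] by (simp add: compose_eq f_def del_def)
  qed (auto simp: del_def)
  have others: "co j x = \<zero>\<^bsub>Lk\<^esub>" if j: "j \<in> SM n m" "j \<noteq> i" and fj: "compose {1..n} f j = del n 1" for j
  proof -
    have le: "i k \<le> j k" if k: "k \<in> {1..n}" for k
    proof -
      have "1 + cnt n i (j k) = k + 1"
        using fun_cong[OF fj, of k] k SM_mem[OF j(1) k] by (simp add: compose_eq f_def del_def)
      then show ?thesis using le_cnt_iff[OF iS k, of "j k"] by simp
    qed
    moreover have "j 1 \<noteq> 1" using le[OF n1'(2)] i1 SM_mem[OF iS n1'(2)] by auto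
    ultimately show ?thesis using max[of j] j by auto
  qed
  note cx = co_closed[OF _ x]
  have "co (del n 1) (ac m (n+1) f x) = (if compose {1..n} f i = del n 1 then co i x else \<zero>\<^bsub>Lk\<^esub>)"
    unfolding co_act_OA[OF m n1'(1) f x del_SM]
    using others cx by (intro Lk.M.finsum_single[OF finite_SM iS]) auto
  then have "co (del n 1) (ac m (n+1) f x) \<noteq> \<zero>\<^bsub>Lk\<^esub>" using fi i by simp
  then show ?thesis using co_zero[OF del_SM] f by metis
qed

section \<open>Alternating sums of cofaces\<close>

definition idx :: "(nat \<Rightarrow> nat) \<Rightarrow> nat" where
  "idx j = (THE i. i \<in> {1..n+1} \<and> del n i = j)"

lemma idx_del: "i \<in> {1..n+1} \<Longrightarrow> idx (del n i) = i"
  unfolding idx_def by (rule the_equality) (auto intro: del_inj)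

text \<open>\<open>D u\<close> is the alternating sum of the elements \<open>[del n i] \<otimes> u\<close>.\<close>

definition D :: "'v \<Rightarrow> (((nat \<Rightarrow> nat) \<Rightarrow> 'k) set \<times> 'v \<Rightarrow> 'k) set" where
  "D u = mk (n+1) (\<lambda>j. sg (idx j) u)"

lemma D:
  assumes u: "u \<in> carrier Lk"
  shows "D u \<in> carrier (sp T (n+1))" and "i \<in> {1..n+1} \<Longrightarrow> co (del n i) (D u) = sg i u"
  unfolding D_def using mk[of "n+1" "\<lambda>j. sg (idx j) u"] sg_closed[OF u] del_SM[of n i] idx_del[of i] by auto

lemma T_Suc_ext:
  assumes "x \<in> carrier (sp T (n+1))" "y \<in> carrier (sp T (n+1))"
    "\<And>i. i \<in> {1..n+1} \<Longrightarrow> co (del n i) x = co (del n i) y"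
  shows "x = y"
proof (rule T_ext[OF assms(1,2)])
  fix j assume "j \<in> SM n (n+1)"
  then have "j \<in> del n ` {1..n+1}" by (simp only: SM_Suc)
  then show "co j x = co j y" using assms(3) by blast
qed

lemma D_linear: "D \<in> linear_maps K Lk (sp T (n+1))"
proof (rule linear_mapsI)
  interpret Tm: module K "sp T (n+1)" by (rule T_module)
  fix u assume u: "u \<in> carrier Lk"
  show "D u \<in> carrier (sp T (n+1))" by (rule D(1)[OF u])
  show "D (c \<odot>\<^bsub>Lk\<^esub> u) = c \<odot>\<^bsub>sp T (n+1)\<^esub> D u" if c: "c \<in> carrier K" for c
    using D[OF u] D[OF Lk.smult_closed[OF c u]] c linear_mapsD(3)[OF co_linear[OF del_SM] c]
      linear_mapsD(3)[OF sg_linear c u] by (intro T_Suc_ext) auto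
  show "D (u \<oplus>\<^bsub>Lk\<^esub> v) = D u \<oplus>\<^bsub>sp T (n+1)\<^esub> D v" if v: "v \<in> carrier Lk" for v
    using D[OF u] D[OF v] D[OF Lk.M.a_closed[OF u v]] linear_mapsD(2)[OF co_linear[OF del_SM]]
      linear_mapsD(2)[OF sg_linear u v] by (intro T_Suc_ext) auto
qed

text \<open>The strictly increasing sections of \<open>sig n i\<close> are \<open>del n i\<close>
  and \<open>del n (i+1)\<close>, so an element killed by all codegeneracies has opposite
  coordinates at neighbouring cofaces.\<close>

lemma ex_D:
  assumes x: "x \<in> carrier (sp T (n+1))"
    and kill: "\<And>f. f \<in> OA_maps (n+1) n \<Longrightarrow> ac (n+1) n f x = \<zero>\<^bsub>sp T n\<^esub>"
  shows "\<exists>u\<in>carrier Lk. x = D u"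
proof -
  have n1': "n + 1 \<ge> 1" by simp
  note cx = co_closed[OF _ x]
  \<comment> \<open>The alternating sum starts with index 1; the sign makes the coordinate of
    \<open>D u\<close> at \<open>del n 1\<close> equal to that of \<open>x\<close>.\<close>
  define u where "u = sg 1 (co (del n 1) x)"
  have u: "u \<in> carrier Lk" unfolding u_def by (rule sg_closed[OF cx[OF del_SM]])
  have down: "co (del n (i+1)) x = \<ominus>\<^bsub>Lk\<^esub> co (del n i) x" if i: "i \<in> {1..n}" for i
  proof -
    have s: "sig n i \<in> OA_maps (n+1) n" by (rule sig_OA[OF i])
    have ne: "del n i \<noteq> del n (i+1)" using del_inj[of n i "i+1"] i by auto
    have "\<zero>\<^bsub>Lk\<^esub> = co (idm n) (ac (n+1) n (sig n i) x)" using kill[OF s] co_zero[OF idm_SM] by simp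
    also have "\<dots> = (if compose {1..n} (sig n i) (del n i) = idm n then co (del n i) x else \<zero>\<^bsub>Lk\<^esub>) \<oplus>\<^bsub>Lk\<^esub>
        (if compose {1..n} (sig n i) (del n (i+1)) = idm n then co (del n (i+1)) x else \<zero>\<^bsub>Lk\<^esub>)"
      unfolding co_act_OA[OF n1' n1 s x idm_SM]
      using cx sig_compose_eq_idm[OF i] by (intro Lk.M.finsum_two[OF finite_SM del_SM del_SM ne]) auto
    also have "\<dots> = co (del n i) x \<oplus>\<^bsub>Lk\<^esub> co (del n (i+1)) x" using sig_compose_eq_idm[OF i del_SM] by simp
    finally have "co (del n (i+1)) x \<oplus>\<^bsub>Lk\<^esub> co (del n i) x = \<zero>\<^bsub>Lk\<^esub>"
      using Lk.M.a_comm[OF cx[OF del_SM] cx[OF del_SM]] by simp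
    then show ?thesis using Lk.M.minus_equality[OF _ cx[OF del_SM] cx[OF del_SM]] by metis
  qed
  have "co (del n i) x = sg i u" if "i \<in> {1..n+1}" for i
  proof -
    have "1 \<le> i \<Longrightarrow> i \<le> n + 1 \<Longrightarrow> co (del n i) x = sg i u"
    proof (induction i rule: dec_induct)
      case base
      then show ?case unfolding u_def using sg_cancel[OF cx[OF del_SM]] by simp
    next
      case (step k)
      then have k: "k \<in> {1..n}" by auto
      have "co (del n (Suc k)) x = \<ominus>\<^bsub>Lk\<^esub> sg k u" using down[OF k] step(3) k by (simp add: Suc_eq_plus1)
      then show ?case using u by (auto simp: sg_def)
    qed
    then show ?thesis using that by auto
  qed
  then have "x = D u" using D[OF u] by (intro T_Suc_ext[OF x]) auto
  then show ?thesis using u by blast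
qed

text \<open>Such an \<open>f\<close> glues neighbours \<open>a\<close> and \<open>a + 1\<close>.
  Only the cofaces omitting one of them can stay injective; their composites with \<open>f\<close>
  agree and their signs are opposite.\<close>

lemma D_killed:
  assumes l: "l \<ge> 1" and f: "f \<in> OA_maps (n+1) l" and ni: "\<not> inj_on f {1..n+1}" and u: "u \<in> carrier Lk"
  shows "ac (n+1) l f (D u) = \<zero>\<^bsub>sp T l\<^esub>"
proof (rule T_zeroI)
  have n1': "n + 1 \<ge> 1" by simp
  show "ac (n+1) l f (D u) \<in> carrier (sp T l)" by (rule ac_closed[OF n1' l OA_Hom[OF f] D(1)[OF u]])
  fix i assume i: "i \<in> SM n l"
  obtain a where a: "a \<in> {1..n}" "f a = f (a+1)" using OA_not_inj_adjacent[OF f ni] by blast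
  have ne: "del n a \<noteq> del n (a+1)" using del_inj[of n a "a+1"] a by auto
  note cx = co_closed[OF _ D(1)[OF u]]
  have "j = del n a \<or> j = del n (a+1)" if "j \<in> SM n (n+1)" "compose {1..n} f j = i" for j
    using inj_compose_adjacent[of a n f j, OF a that(1)] that SM_inj[OF i] by simp
  then have "co i (ac (n+1) l f (D u)) =
      (if compose {1..n} f (del n a) = i then co (del n a) (D u) else \<zero>\<^bsub>Lk\<^esub>) \<oplus>\<^bsub>Lk\<^esub>
      (if compose {1..n} f (del n (a+1)) = i then co (del n (a+1)) (D u) else \<zero>\<^bsub>Lk\<^esub>)"
    unfolding co_act_OA[OF n1' l f D(1)[OF u] i]
    using cx by (intro Lk.M.finsum_two[OF finite_SM del_SM del_SM ne]) auto
  then show "co i (ac (n+1) l f (D u)) = \<zero>\<^bsub>Lk\<^esub>"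
    using del_adjacent[of a n f, OF a] D(2)[OF u, of a] D(2)[OF u, of "a+1"] sg_Suc[OF u] a by simp
qed

text \<open>If \<open>g \<circ> del n i = del n (g i) \<circ> h\<close>, then \<open>E g i\<close> is \<open>h\<close> up to the sign by which \<open>g\<close> changes the
  position of \<open>i\<close>; with this sign \<open>E\<close> is a cocycle, and \<open>g\<close> maps \<open>D u\<close> to some \<open>D w\<close> precisely if
  \<open>E g i u\<close> does not depend on \<open>i\<close>.\<close>

definition E :: "(nat \<Rightarrow> nat) \<Rightarrow> nat \<Rightarrow> 'v \<Rightarrow> 'v" where
  "E g i u = sg (i + g i) (ga (gp C n (compose {1..n} g (del n i))) u)"

lemma E_linear: "\<lbrakk>g \<in> aut C (n+1); i \<in> {1..n+1}\<rbrakk> \<Longrightarrow> E g i \<in> linear_maps K Lk Lk"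
  unfolding E_def[abs_def] by (rule linear_maps_comp[OF ga_linear[OF aut_del(4)] sg_linear])

text \<open>Automorphisms permute the cofaces up to automorphisms of \<open>[n]\<close>, so a single
  coordinate contributes.\<close>

lemma co_aut:
  assumes g: "g \<in> aut C (n+1)" and i: "i \<in> {1..n+1}" and x: "x \<in> carrier (sp T (n+1))"
  shows "co (del n (g i)) (ac (n+1) (n+1) g x) = ga (gp C n (compose {1..n} g (del n i))) (co (del n i) x)"
proof -
  have n1': "n + 1 \<ge> 1" by simp
  let ?F = "\<lambda>j. if inj_on (compose {1..n} g j) {1..n} \<and> sm C n (compose {1..n} g j) = del n (g i)
    then ga (gp C n (compose {1..n} g j)) (co j x) else \<zero>\<^bsub>Lk\<^esub>"
  note cx = co_closed[OF _ x]
  have "co (del n (g i)) (ac (n+1) (n+1) g x) = (\<Oplus>\<^bsub>Lk\<^esub>j\<in>SM n (n+1). ?F j)"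
    by (rule co_act[OF n1' n1' aut_Hom[OF g] x del_SM])
  also have "\<dots> = ?F (del n i)"
  proof (rule Lk.M.finsum_single[OF finite_SM del_SM])
    show "?F \<in> SM n (n+1) \<rightarrow> carrier Lk"
      using aut_del(4)[OF g] ga_closed cx SM_Suc del_SM by auto
    fix j assume "j \<in> SM n (n+1)" "j \<noteq> del n i"
    then obtain k where k: "k \<in> {1..n+1}" "j = del n k" "k \<noteq> i" unfolding SM_Suc by blast
    then have "g k \<noteq> g i" using inj_onD[OF aut_inj[OF g]] i by blast
    then have "del n (g k) \<noteq> del n (g i)" using del_inj aut_mem[OF g] k i by metis
    then show "?F j = \<zero>\<^bsub>Lk\<^esub>" using aut_del(3)[OF g k(1)] k(2) by simp
  qed
  finally show ?thesis using aut_del(2,3)[OF g i] by simp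
qed

lemma co_aut_D:
  assumes g: "g \<in> aut C (n+1)" and i: "i \<in> {1..n+1}" and u: "u \<in> carrier Lk"
  shows "co (del n (g i)) (ac (n+1) (n+1) g (D u)) = sg (g i) (E g i u)"
proof -
  note h = aut_del(4)[OF g i]
  have "sg (g i) (E g i u) = sg i (ga (gp C n (compose {1..n} g (del n i))) u)"
    unfolding E_def sg_sg[OF ga_closed[OF h u]] by (rule sg_parity) auto
  then show ?thesis using co_aut[OF g i D(1)[OF u]] D(2)[OF u i] ga_sg[OF h u] by simp
qed

definition ZL :: "'v set" where
  "ZL = {u \<in> carrier Lk. \<forall>g\<in>aut C (n+1). \<forall>i\<in>{1..n+1}. \<forall>j\<in>{1..n+1}. E g i u = E g j u}"

lemma ZL_I:
  "\<lbrakk>u \<in> carrier Lk; \<And>g i j. \<lbrakk>g \<in> aut C (n+1); i \<in> {1..n+1}; j \<in> {1..n+1}\<rbrakk> \<Longrightarrow> E g i u = E g j u\<rbrakk> \<Longrightarrow> u \<in> ZL"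
  unfolding ZL_def by (intro CollectI conjI ballI)

lemma ZL_eq: "\<lbrakk>u \<in> ZL; g \<in> aut C (n+1); i \<in> {1..n+1}; j \<in> {1..n+1}\<rbrakk> \<Longrightarrow> E g i u = E g j u"
  unfolding ZL_def mem_Collect_eq by (elim conjE) (drule bspec, assumption)+

text \<open>By \<open>co_aut_D\<close> the coordinates of the image are the vectors
  \<open>E g i u\<close> with alternating signs, and on \<open>ZL\<close> these vectors are the same
  for all \<open>i\<close>.\<close>

lemma ZL_D:
  assumes u: "u \<in> ZL" and g: "g \<in> aut C (n+1)"
  shows "ac (n+1) (n+1) g (D u) = D (E g 1 u)"
proof (rule T_Suc_ext)
  have n1': "n + 1 \<ge> 1" "(1::nat) \<in> {1..n+1}" by auto
  have u': "u \<in> carrier Lk" using u by (simp add: ZL_def)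
  have e: "E g 1 u \<in> carrier Lk" by (rule linear_mapsD(1)[OF E_linear[OF g n1'(2)] u'])
  show "ac (n+1) (n+1) g (D u) \<in> carrier (sp T (n+1))" by (rule ac_closed[OF n1'(1) n1'(1) aut_Hom[OF g] D(1)[OF u']])
  show "D (E g 1 u) \<in> carrier (sp T (n+1))" by (rule D(1)[OF e])
  fix j assume j: "j \<in> {1..n+1}"
  then obtain i where i: "i \<in> {1..n+1}" "j = g i" using aut_surj[OF g] by blast
  have "E g i u = E g 1 u" by (rule ZL_eq[OF u g i(1) n1'(2)])
  then show "co (del n j) (ac (n+1) (n+1) g (D u)) = co (del n j) (D (E g 1 u))"
    using co_aut_D[OF g i(1) u'] D(2)[OF e j] i(2) by simp
qed

text \<open>A general map is order-preserving after an automorphism. By \<open>ZL_D\<close> the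
  automorphism turns \<open>D u\<close> into another alternating sum; the order-preserving part is
  not injective, so \<open>D_killed\<close> applies.\<close>

lemma ZL_killed:
  assumes u: "u \<in> ZL" and l: "l \<ge> 1" and f: "f \<in> Hom C (n+1) l" and ni: "\<not> inj_on f {1..n+1}"
  shows "ac (n+1) l f (D u) = \<zero>\<^bsub>sp T l\<^esub>"
proof -
  have n1': "n + 1 \<ge> 1" "(1::nat) \<in> {1..n+1}" by auto
  have u': "u \<in> carrier Lk" using u by (simp add: ZL_def)
  obtain h s where h: "h \<in> OA_maps (n+1) l" and s: "s \<in> Hom C (n+1) (n+1)" "inj_on s {1..n+1}"
    and eq: "f = compose {1..n+1} h s" using Hom_factor[OF f] by blast
  have s': "s \<in> aut C (n+1)" using s by (simp add: aut_def)
  have "\<not> inj_on h {1..n+1}" using ni inj_on_compose[OF aut_all_maps[OF s'] s(2)] eq by blast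
  moreover have "E s 1 u \<in> carrier Lk" by (rule linear_mapsD(1)[OF E_linear[OF s' n1'(2)] u'])
  ultimately show ?thesis
    using is_cmodD(4)[OF T_is_cmod n1'(1) n1'(1) l s(1) OA_Hom[OF h] D(1)[OF u']] ZL_D[OF u s'] D_killed[OF l h]
    by (simp add: eq)
qed

text \<open>The group parts satisfy \<open>gp_del_compose\<close>, and the sign exponents
  \<open>i + k i\<close> and \<open>k i + g (k i)\<close> add up to \<open>i + g (k i)\<close>
  modulo 2.\<close>

lemma E_cocycle:
  assumes g: "g \<in> aut C (n+1)" and k: "k \<in> aut C (n+1)" and i: "i \<in> {1..n+1}" and u: "u \<in> carrier Lk"
  shows "E g (k i) (E k i u) = E (compose {1..n+1} g k) i u"
proof -
  note ki = aut_mem[OF k i]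
  let ?a = "gp C n (compose {1..n} g (del n (k i)))" and ?b = "gp C n (compose {1..n} k (del n i))"
  have a: "?a \<in> aut C n" and b: "?b \<in> aut C n" using aut_del(4)[OF g ki] aut_del(4)[OF k i] by auto
  have "E g (k i) (E k i u) = sg (k i + g (k i)) (sg (i + k i) (ga ?a (ga ?b u)))"
    unfolding E_def using ga_sg[OF a ga_closed[OF b u]] by simp
  also have "\<dots> = sg (i + g (k i)) (ga ?a (ga ?b u))"
    unfolding sg_sg[OF ga_closed[OF a ga_closed[OF b u]]] by (rule sg_parity) auto
  also have "ga ?a (ga ?b u) = ga (compose {1..n} ?a ?b) u" by (rule ga_compose[OF a b u, symmetric])
  finally show ?thesis unfolding E_def gp_del_compose[OF g k i] using i by (simp add: compose_eq)
qed

text \<open>Stability under \<open>h\<close> is the point. By \<open>aut_extend\<close>,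
  \<open>h\<close> acts on \<open>u\<close> as some \<open>E k l\<close> up to sign, and the cocycle
  rule turns the condition for \<open>g\<close> on \<open>E k l u\<close> into the condition for
  \<open>g\<close> after \<open>k\<close> on \<open>u\<close>.\<close>

lemma ZL_submodule: "submodule ZL A L"
  unfolding submodule_A_iff
proof (intro conjI ballI)
  have n1': "(1::nat) \<in> {1..n+1}" by auto
  show sub: "submodule ZL K Lk"
  proof (rule Lk.submoduleI)
    show "ZL \<subseteq> carrier Lk" by (auto simp: ZL_def)
    show "\<zero>\<^bsub>Lk\<^esub> \<in> ZL" using linear_maps_hom(1)[OF Lk_ab Lk_ab E_linear] by (simp add: ZL_def)
    fix a assume a: "a \<in> ZL"
    then have a': "a \<in> carrier Lk" by (simp add: ZL_def)
    show "\<ominus>\<^bsub>Lk\<^esub> a \<in> ZL"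
    proof (rule ZL_I)
      fix g i j assume g: "g \<in> aut C (n+1)" and i: "i \<in> {1..n+1}" and j: "j \<in> {1..n+1}"
      note neg = linear_maps_hom(2)[OF Lk_ab Lk_ab E_linear a']
      show "E g i (\<ominus>\<^bsub>Lk\<^esub> a) = E g j (\<ominus>\<^bsub>Lk\<^esub> a)"
        unfolding neg[OF g i] neg[OF g j] ZL_eq[OF a g i j] ..
    qed (use a' in simp)
    show "c \<odot>\<^bsub>Lk\<^esub> a \<in> ZL" if c: "c \<in> carrier K" for c
    proof (rule ZL_I)
      fix g i j assume g: "g \<in> aut C (n+1)" and i: "i \<in> {1..n+1}" and j: "j \<in> {1..n+1}"
      show "E g i (c \<odot>\<^bsub>Lk\<^esub> a) = E g j (c \<odot>\<^bsub>Lk\<^esub> a)"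
        unfolding linear_mapsD(3)[OF E_linear[OF g i] c a'] linear_mapsD(3)[OF E_linear[OF g j] c a']
          ZL_eq[OF a g i j] ..
    qed (use a' c in simp)
    fix b assume b: "b \<in> ZL"
    then have b': "b \<in> carrier Lk" by (simp add: ZL_def)
    show "a \<oplus>\<^bsub>Lk\<^esub> b \<in> ZL"
    proof (rule ZL_I)
      fix g i j assume g: "g \<in> aut C (n+1)" and i: "i \<in> {1..n+1}" and j: "j \<in> {1..n+1}"
      show "E g i (a \<oplus>\<^bsub>Lk\<^esub> b) = E g j (a \<oplus>\<^bsub>Lk\<^esub> b)"
        unfolding linear_mapsD(2)[OF E_linear[OF g i] a' b'] linear_mapsD(2)[OF E_linear[OF g j] a' b']
          ZL_eq[OF a g i j] ZL_eq[OF b g i j] ..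
    qed (use a' b' in simp)
  qed
  fix h u assume h: "h \<in> aut C n" and u: "u \<in> ZL"
  have u': "u \<in> carrier Lk" using u by (simp add: ZL_def)
  obtain k l where k: "k \<in> aut C (n+1)" and l: "l \<in> {1..n+1}" and gp: "gp C n (compose {1..n} k (del n l)) = h"
    using aut_extend[OF n1 h] by blast
  define w where "w = E k l u"
  have w: "w \<in> carrier Lk" unfolding w_def by (rule linear_mapsD(1)[OF E_linear[OF k l] u'])
  have hw: "ga h u = sg (l + k l) w"
    unfolding w_def E_def gp using sg_cancel[OF ga_closed[OF h u']] by simp
  have wE: "w = E k p u" if "p \<in> {1..n+1}" for p unfolding w_def by (rule ZL_eq[OF u k l that])
  have Ew: "E g i w = E g j w" if g: "g \<in> aut C (n+1)" and i: "i \<in> {1..n+1}" and j: "j \<in> {1..n+1}" for g i j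
  proof -
    obtain p q where p: "p \<in> {1..n+1}" "i = k p" and q: "q \<in> {1..n+1}" "j = k q" using aut_surj[OF k] i j by metis
    have "E g i w = E (compose {1..n+1} g k) p u" using E_cocycle[OF g k p(1) u'] wE[OF p(1)] p(2) by simp
    also have "\<dots> = E (compose {1..n+1} g k) q u"
      by (rule ZL_eq[OF u aut_compose[OF k g] p(1) q(1)])
    also have "\<dots> = E g j w" using E_cocycle[OF g k q(1) u'] wE[OF q(1)] q(2) by simp
    finally show ?thesis .
  qed
  have "w \<in> ZL" by (rule ZL_I[OF w Ew])
  then show "ga h u \<in> ZL" unfolding hw by (rule sg_submodule[OF sub])
qed

end

section \<open>Submodules of the tensor product and its length\<close>

context kgmod
begin

definition rad :: "nat \<Rightarrow> (((nat \<Rightarrow> nat) \<Rightarrow> 'k) set \<times> 'v \<Rightarrow> 'k) set set" where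
  "rad m = {x \<in> carrier (sp T m). \<forall>f\<in>Hom C m n. ac m n f x = \<zero>\<^bsub>sp T n\<^esub>}"

lemma rad_carrier: "x \<in> rad m \<Longrightarrow> x \<in> carrier (sp T m)"
  by (simp add: rad_def)

lemma rad_kill: "\<lbrakk>x \<in> rad m; f \<in> Hom C m n\<rbrakk> \<Longrightarrow> ac m n f x = \<zero>\<^bsub>sp T n\<^esub>"
  by (simp add: rad_def)

lemma radI: "\<lbrakk>x \<in> carrier (sp T m); \<And>f. f \<in> Hom C m n \<Longrightarrow> ac m n f x = \<zero>\<^bsub>sp T n\<^esub>\<rbrakk> \<Longrightarrow> x \<in> rad m"
  by (simp add: rad_def)

lemma rad_subcmod: "subcmod K C rad T"
  unfolding subcmod_def
proof (intro conjI allI impI ballI)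
  fix m :: nat assume m: "m \<ge> 1"
  interpret Tm: module K "sp T m" by (rule T_module)
  interpret Tn: module K "sp T n" by (rule T_module)
  note hom = linear_maps_hom[OF T_ab T_ab ac_linear[OF m n1]] and lin = linear_mapsD[OF ac_linear[OF m n1]]
  show "submodule (rad m) K (sp T m)"
  proof (rule Tm.submoduleI)
    show "rad m \<subseteq> carrier (sp T m)" using rad_carrier by blast
    show "\<zero>\<^bsub>sp T m\<^esub> \<in> rad m" by (rule radI) (simp_all add: hom(1))
    fix x assume x: "x \<in> rad m"
    note xc = rad_carrier[OF x]
    show "\<ominus>\<^bsub>sp T m\<^esub> x \<in> rad m"
    proof (rule radI)
      have "\<ominus>\<^bsub>sp T n\<^esub> \<zero>\<^bsub>sp T n\<^esub> = \<zero>\<^bsub>sp T n\<^esub>" by (rule Tn.minus_equality) simp_all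
      then show "ac m n f (\<ominus>\<^bsub>sp T m\<^esub> x) = \<zero>\<^bsub>sp T n\<^esub>" if "f \<in> Hom C m n" for f
        using hom(2)[OF that xc] rad_kill[OF x that] by simp
    qed (simp add: xc)
    show "c \<odot>\<^bsub>sp T m\<^esub> x \<in> rad m" if "c \<in> carrier K" for c
    proof (rule radI)
      show "ac m n f (c \<odot>\<^bsub>sp T m\<^esub> x) = \<zero>\<^bsub>sp T n\<^esub>" if f: "f \<in> Hom C m n" for f
        using lin(3)[OF f \<open>c \<in> carrier K\<close> xc] rad_kill[OF x f] \<open>c \<in> carrier K\<close> by simp
    qed (simp add: xc that)
    fix y assume y: "y \<in> rad m"
    show "x \<oplus>\<^bsub>sp T m\<^esub> y \<in> rad m"
    proof (rule radI)
      show "ac m n f (x \<oplus>\<^bsub>sp T m\<^esub> y) = \<zero>\<^bsub>sp T n\<^esub>" if f: "f \<in> Hom C m n" for f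
        using lin(2)[OF f xc rad_carrier[OF y]] rad_kill[OF x f] rad_kill[OF y f] by simp
    qed (simp add: xc rad_carrier[OF y])
  qed
  fix l :: nat and f x assume l: "l \<ge> 1" and f: "f \<in> Hom C m l" and x: "x \<in> rad m"
  show "ac m l f x \<in> rad l"
  proof (rule radI[OF ac_closed[OF m l f rad_carrier[OF x]]])
    fix g assume g: "g \<in> Hom C l n"
    show "ac l n g (ac m l f x) = \<zero>\<^bsub>sp T n\<^esub>"
      by (rule trans[OF is_cmodD(4)[OF T_is_cmod m l n1 f g rad_carrier[OF x], symmetric] rad_kill[OF x Hom_compose[OF f g]]])
  qed
qed

lemma rad_ex_D:
  assumes "x \<in> rad (n+1)"
  shows "\<exists>u\<in>carrier Lk. x = D u"
  using assms by (intro ex_D rad_carrier rad_kill OA_Hom)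

lemma D_inj: "\<lbrakk>u \<in> carrier Lk; v \<in> carrier Lk; D u = D v\<rbrakk> \<Longrightarrow> u = v"
proof -
  assume u: "u \<in> carrier Lk" and v: "v \<in> carrier Lk" and eq: "D u = D v"
  have 1: "(1::nat) \<in> {1..n+1}" by simp
  have "sg 1 u = sg 1 v" using D(2)[OF u 1] D(2)[OF v 1] eq by simp
  then have "sg 1 (sg 1 u) = sg 1 (sg 1 v)" by simp
  then show ?thesis using sg_cancel[OF u] sg_cancel[OF v] by simp
qed

lemma D_zero: "D \<zero>\<^bsub>Lk\<^esub> = \<zero>\<^bsub>sp T (n+1)\<^esub>"
  by (rule linear_maps_hom(1)[OF Lk_ab T_ab D_linear])

lemma not_inj_down: 
  assumes "f \<in> Hom C (n+1) n"
  shows "\<not> inj_on f {1..n+1}"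
proof
  assume "inj_on f {1..n+1}"
  moreover have "f ` {1..n+1} \<subseteq> {1..n}" using all_maps_mem[OF Hom_all_maps[OF assms]] by blast
  ultimately have "card {1..n+1} \<le> card {1..n}" by (rule card_inj_on_le) simp
  then show False by simp
qed

lemma ZL_rad: "u \<in> ZL \<Longrightarrow> D u \<in> rad (n+1)"
proof (rule radI)
  assume u: "u \<in> ZL"
  then show "D u \<in> carrier (sp T (n+1))" by (intro D(1)) (simp add: ZL_def)
  show "ac (n+1) n f (D u) = \<zero>\<^bsub>sp T n\<^esub>" if "f \<in> Hom C (n+1) n" for f
    by (rule ZL_killed[OF u n1 that not_inj_down[OF that]])
qed

text \<open>An element of the radical at \<open>[n+1]\<close> is an alternating sum
  \<open>D w\<close>, and any single coordinate determines \<open>w\<close>.\<close>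

lemma rad_ac_D:
  assumes u: "u \<in> carrier Lk" and g: "g \<in> aut C (n+1)" and i: "i \<in> {1..n+1}"
    and r: "ac (n+1) (n+1) g (D u) \<in> rad (n+1)"
  shows "ac (n+1) (n+1) g (D u) = D (E g i u)"
proof -
  obtain w where w: "w \<in> carrier Lk" "ac (n+1) (n+1) g (D u) = D w" using rad_ex_D[OF r] by blast
  have e: "E g i u \<in> carrier Lk" by (rule linear_mapsD(1)[OF E_linear[OF g i] u])
  have "sg (g i) w = sg (g i) (E g i u)"
    using co_aut_D[OF g i u] D(2)[OF w(1) aut_mem[OF g i]] w(2) by simp
  then have "sg (g i) (sg (g i) w) = sg (g i) (sg (g i) (E g i u))" by simp
  then show ?thesis using w sg_cancel[OF w(1)] sg_cancel[OF e] by simp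
qed

text \<open>The radical is stable under automorphisms, so \<open>g\<close> moves \<open>D u\<close>
  to an alternating sum; reading this sum at \<open>i\<close> and at \<open>j\<close> gives the same
  vector.\<close>

lemma rad_ZL:
  assumes u: "u \<in> carrier Lk" and r: "D u \<in> rad (n+1)"
  shows "u \<in> ZL"
proof (rule ZL_I[OF u])
  have n1': "n + 1 \<ge> 1" by simp
  fix g i j assume g: "g \<in> aut C (n+1)" and i: "i \<in> {1..n+1}" and j: "j \<in> {1..n+1}"
  have "ac (n+1) (n+1) g (D u) \<in> rad (n+1)" by (rule subcmodD(2)[OF rad_subcmod n1' n1' aut_Hom[OF g] r])
  then have "D (E g i u) = D (E g j u)" using rad_ac_D[OF u g i] rad_ac_D[OF u g j] by simp
  then show "E g i u = E g j u"
    by (rule D_inj[OF linear_mapsD(1)[OF E_linear[OF g i] u] linear_mapsD(1)[OF E_linear[OF g j] u]])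
qed

lemma bt_ac: "\<lbrakk>m \<ge> 1; i \<in> Hom C n m; v \<in> carrier Lk\<rbrakk> \<Longrightarrow> bt m i v = ac n m i (bt n (idm n) v)"
  using act_bt[OF n1 _ _ idm_Hom, of m i v] compose_idm[OF Hom_all_maps] by simp

lemma T_n_eq:
  assumes x: "x \<in> carrier (sp T n)"
  shows "x = bt n (idm n) (co (idm n) x)"
proof (rule T_ext[OF x bt_closed[OF idm_Hom co_closed[OF idm_SM x]]])
  fix i assume "i \<in> SM n n"
  then have "i = idm n" by (rule SM_self)
  then show "co i x = co i (bt n (idm n) (co (idm n) x))"
    using co_SM[OF idm_SM idm_SM co_closed[OF idm_SM x]] by simp
qed

text \<open>At \<open>[n]\<close> the tensor product is a copy of \<open>L\<close>, so a nonzero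
  submodule is everything there; at \<open>[m]\<close> each summand is the image of the value at
  \<open>[n]\<close> under a strictly increasing map.\<close>

lemma generated_in_n:
  assumes irr: "irreducible_lmodule A L" and W: "subcmod K C W T" and ne: "W n \<noteq> {\<zero>\<^bsub>sp T n\<^esub>}" and m: "m \<ge> 1"
  shows "W m = carrier (sp T m)"
proof -
  note Wn = subcmodD(1)[OF W n1] and Wm = subcmodD(1)[OF W m]
  define V where "V = {v \<in> carrier Lk. bt n (idm n) v \<in> W n}"
  have sub: "submodule V K Lk"
    unfolding V_def by (rule submodule_preimage[OF Lk.module_axioms T_module bt_linear[OF idm_Hom] Wn])
  have "submodule V A L" unfolding submodule_A_iff
  proof (intro conjI ballI sub)
    fix g v assume g: "g \<in> aut C n" and "v \<in> V"
    then have v: "v \<in> carrier Lk" and b: "bt n (idm n) v \<in> W n" by (auto simp: V_def)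
    have "bt n (idm n) (ga g v) = bt n (compose {1..n} (idm n) g) v" by (rule bt_compose[OF idm_Hom g v, symmetric])
    also have "\<dots> = ac n n g (bt n (idm n) v)"
      using bt_ac[OF n1 aut_Hom[OF g] v] idm_compose[OF aut_all_maps[OF g]] by simp
    finally have "bt n (idm n) (ga g v) \<in> W n" using subcmodD(2)[OF W n1 n1 aut_Hom[OF g] b] by simp
    then show "ga g v \<in> V" using ga_closed[OF g v] by (simp add: V_def)
  qed
  moreover have "V \<noteq> {\<zero>\<^bsub>L\<^esub>}"
  proof
    assume V0: "V = {\<zero>\<^bsub>L\<^esub>}"
    have "x = \<zero>\<^bsub>sp T n\<^esub>" if x: "x \<in> W n" for x
    proof -
      have xc: "x \<in> carrier (sp T n)" using x submoduleD(1)[OF Wn] by blast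
      then have "co (idm n) x \<in> V" using T_n_eq[OF xc] x co_closed[OF idm_SM xc] by (simp add: V_def)
      then have "co (idm n) x = \<zero>\<^bsub>Lk\<^esub>" using V0 by (simp add: Lk_simps)
      then show ?thesis using T_n_eq[OF xc] bt_zero[OF idm_Hom] by simp
    qed
    then show False using ne submoduleD(2)[OF Wn] by blast
  qed
  ultimately have V: "V = carrier L" using irr unfolding irreducible_lmodule_def by blast
  have "x \<in> W m" if x: "x \<in> carrier (sp T m)" for x
  proof -
    have "(\<Oplus>\<^bsub>sp T m\<^esub>i\<in>SM n m. bt m i (co i x)) \<in> W m"
    proof (rule submodule_finsum[OF T_ab Wm])
      fix i assume i: "i \<in> SM n m"
      note c = co_closed[OF i x]
      have "bt n (idm n) (co i x) \<in> W n" using V c by (auto simp: V_def Lk_simps)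
      then show "bt m i (co i x) \<in> W m"
        using subcmodD(2)[OF W n1 m SM_Hom[OF i]] bt_ac[OF m SM_Hom[OF i] c] by simp
    qed
    then show ?thesis using T_expand[OF x] by metis
  qed
  then show ?thesis using submoduleD(1)[OF Wm] by blast
qed

lemma subcmod_rad:
  assumes W: "subcmod K C W T" and W0: "W n = {\<zero>\<^bsub>sp T n\<^esub>}" and m: "m \<ge> 1"
  shows "W m \<subseteq> rad m"
proof
  fix x assume x: "x \<in> W m"
  show "x \<in> rad m"
  proof (rule radI)
    show "x \<in> carrier (sp T m)" using x submoduleD(1)[OF subcmodD(1)[OF W m]] by blast
    show "ac m n f x = \<zero>\<^bsub>sp T n\<^esub>" if "f \<in> Hom C m n" for f
      using subcmodD(2)[OF W m n1 that x] W0 by simp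
  qed
qed

text \<open>At \<open>[n+1]\<close> the submodule \<open>W\<close> corresponds to a submodule
  \<open>U\<close> of \<open>L\<close>, which is nonzero by \<open>nonzero_image\<close> and hence
  all of \<open>L\<close>. At \<open>[m]\<close> an element of the radical is matched with an
  element of \<open>W m\<close> that has the same coordinates wherever
  \<open>i 1 \<noteq> 1\<close>; by \<open>vanish_from_coords\<close> the two are equal.\<close>

lemma rad_irreducible:
  assumes irr: "irreducible_lmodule A L" and W: "subcmod K C W T" and sub: "\<And>m. m \<ge> 1 \<Longrightarrow> W m \<subseteq> rad m"
    and ne: "\<exists>m\<ge>1. W m \<noteq> {\<zero>\<^bsub>sp T m\<^esub>}" and m: "m \<ge> 1"
  shows "W m = rad m"
proof -
  have n1': "n + 1 \<ge> 1" by simp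
  note Wn = subcmodD(1)[OF W n1'] and Wm = subcmodD(1)[OF W m]
  define U where "U = {u \<in> carrier Lk. D u \<in> W (n+1)}"
  have U: "submodule U K Lk"
    unfolding U_def by (rule submodule_preimage[OF Lk.module_axioms T_module D_linear Wn])
  have "submodule U A L" unfolding submodule_A_iff
  proof (intro conjI ballI U)
    fix h u assume h: "h \<in> aut C n" and "u \<in> U"
    then have u: "u \<in> carrier Lk" and Du: "D u \<in> W (n+1)" by (auto simp: U_def)
    obtain k l where k: "k \<in> aut C (n+1)" and l: "l \<in> {1..n+1}" and gp: "gp C n (compose {1..n} k (del n l)) = h"
      using aut_extend[OF n1 h] by blast
    have "ac (n+1) (n+1) k (D u) \<in> W (n+1)" by (rule subcmodD(2)[OF W n1' n1' aut_Hom[OF k] Du])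
    moreover from this have "ac (n+1) (n+1) k (D u) = D (E k l u)" using sub[OF n1'] by (intro rad_ac_D[OF u k l]) blast
    ultimately have "E k l u \<in> U" using linear_mapsD(1)[OF E_linear[OF k l] u] by (simp add: U_def)
    then have "sg (l + k l) (E k l u) \<in> U" by (rule sg_submodule[OF U])
    then show "ga h u \<in> U" unfolding E_def gp using sg_cancel[OF ga_closed[OF h u]] by simp
  qed
  moreover have "U \<noteq> {\<zero>\<^bsub>L\<^esub>}"
  proof
    assume U0: "U = {\<zero>\<^bsub>L\<^esub>}"
    obtain p x where p: "p \<ge> 1" and x: "x \<in> W p" "x \<noteq> \<zero>\<^bsub>sp T p\<^esub>"
      using ne submoduleD(2)[OF subcmodD(1)[OF W]] by blast
    have xr: "x \<in> rad p" using sub[OF p] x(1) by blast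
    obtain f where f: "f \<in> OA_maps p (n+1)" "ac p (n+1) f x \<noteq> \<zero>\<^bsub>sp T (n+1)\<^esub>"
      using nonzero_image[OF p rad_carrier[OF xr] rad_kill[OF xr OA_Hom] x(2)] by blast
    have y: "ac p (n+1) f x \<in> W (n+1)" by (rule subcmodD(2)[OF W p n1' OA_Hom[OF f(1)] x(1)])
    then obtain u where u: "u \<in> carrier Lk" "ac p (n+1) f x = D u" using rad_ex_D sub[OF n1'] by blast
    then have "u \<in> U" using y by (simp add: U_def)
    then have "u = \<zero>\<^bsub>Lk\<^esub>" using U0 by (simp add: Lk_simps)
    then show False using f(2) u(2) D_zero by simp
  qed
  ultimately have "U = carrier L" using irr unfolding irreducible_lmodule_def by blast
  then have DW: "D u \<in> W (n+1)" if "u \<in> carrier Lk" for u using that by (auto simp: U_def Lk_simps)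
  have "x \<in> W m" if x: "x \<in> rad m" for x
  proof -
    interpret Tm: module K "sp T m" by (rule T_module)
    note xc = rad_carrier[OF x]
    have 1: "(1::nat) \<in> {1..n}" using n1 by simp
    \<comment> \<open>Prepending the value 1 to \<open>i\<close> gives a map with
      \<open>h i \<circ> del n 1 = i\<close>. All other cofaces fix the point 1, so their composites
      with \<open>h i\<close> send 1 to 1 and are invisible at the coordinates \<open>j\<close> with
      \<open>j 1 \<noteq> 1\<close>.\<close>
    define h where "h i = (\<lambda>j\<in>{1..n+1}. if j = 1 then 1 else i (j - 1))" for i :: "nat \<Rightarrow> nat"
    have h: "h i \<in> OA_maps (n+1) m" if i: "i \<in> SM n m" for i
      unfolding h_def
    proof (rule OA_restrictI)
      show "(if j = 1 then 1 else i (j - 1)) \<in> {1..m}" if "j \<in> {1..n+1}" for j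
      proof (cases "j = 1")
        case False
        then have "j - 1 \<in> {1..n}" using that by auto
        then show ?thesis using SM_mem[OF i] False by simp
      qed (use m in simp)
      show "(if j = 1 then 1 else i (j - 1)) \<le> (if k = 1 then 1 else i (k - 1))"
        if "j \<in> {1..n+1}" "k \<in> {1..n+1}" "j \<le> k" for j k
      proof (cases "j = 1")
        case True
        have "k \<noteq> 1 \<Longrightarrow> k - 1 \<in> {1..n}" using that by auto
        then show ?thesis using True SM_mem[OF i, of "k - 1"] by auto
      next
        case False
        then have "j - 1 \<in> {1..n}" "k - 1 \<in> {1..n}" "j - 1 \<le> k - 1" "k \<noteq> 1" using that by auto
        then show ?thesis using False OA_mono[OF SM_OA[OF i]] by simp
      qed
    qed
    have h1: "compose {1..n} (h i) (del n 1) = i" if i: "i \<in> SM n m" for i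
    proof (rule extensionalityI[of _ "{1..n}"])
      show "compose {1..n} (h i) (del n 1) k = i k" if "k \<in> {1..n}" for k
        using that by (simp add: compose_eq h_def del_def)
    qed (use all_maps_ext[OF SM_all_maps[OF i]] in auto)
    have co_h: "co j (ac (n+1) m (h i) (D u)) = (if j = i then sg 1 u else \<zero>\<^bsub>Lk\<^esub>)"
      if i: "i \<in> SM n m" and j: "j \<in> SM n m" "j 1 \<noteq> 1" and u: "u \<in> carrier Lk" for i j u
    proof -
      have n11: "(1::nat) \<in> {1..n+1}" by simp
      have "co j (ac (n+1) m (h i) (D u)) =
        (if compose {1..n} (h i) (del n 1) = j then co (del n 1) (D u) else \<zero>\<^bsub>Lk\<^esub>)"
        unfolding co_act_OA[OF n1' m h[OF i] D(1)[OF u] j(1)]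
      proof (rule Lk.M.finsum_single[OF finite_SM del_SM])
        show "(\<lambda>k. if compose {1..n} (h i) k = j then co k (D u) else \<zero>\<^bsub>Lk\<^esub>) \<in> SM n (n+1) \<rightarrow> carrier Lk"
          using co_closed[OF _ D(1)[OF u]] by auto
        fix k assume "k \<in> SM n (n+1)" "k \<noteq> del n 1"
        then obtain a where a: "a \<in> {1..n+1}" "k = del n a" "a \<noteq> 1" unfolding SM_Suc by blast
        then have "compose {1..n} (h i) k 1 = 1" using 1 by (auto simp: compose_eq h_def del_def)
        then have "compose {1..n} (h i) k \<noteq> j" using j(2) by auto
        then show "(if compose {1..n} (h i) k = j then co k (D u) else \<zero>\<^bsub>Lk\<^esub>) = \<zero>\<^bsub>Lk\<^esub>" by simp
      qed
      then show ?thesis using h1[OF i] D(2)[OF u n11] by auto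
    qed
    let ?I = "{i \<in> SM n m. i 1 \<noteq> 1}"
    \<comment> \<open>The inner sign cancels the sign of the alternating sum at
      \<open>del n 1\<close>, so \<open>z i\<close> has coordinate \<open>co i x\<close> at
      \<open>i\<close> and zero at the other \<open>j\<close> with
      \<open>j 1 \<noteq> 1\<close>.\<close>
    define z where "z i = ac (n+1) m (h i) (D (sg 1 (co i x)))" for i
    define y where "y = (\<Oplus>\<^bsub>sp T m\<^esub>i\<in>?I. z i)"
    have sx: "sg 1 (co i x) \<in> carrier Lk" if "i \<in> SM n m" for i by (rule sg_closed[OF co_closed[OF that xc]])
    have z: "z i \<in> W m" if i: "i \<in> SM n m" for i
      unfolding z_def by (rule subcmodD(2)[OF W n1' m OA_Hom[OF h[OF i]] DW[OF sx[OF i]]])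
    have y: "y \<in> W m" unfolding y_def using z by (intro submodule_finsum[OF T_ab Wm]) auto
    have yr: "y \<in> rad m" using y sub[OF m] by blast
    have zc: "z \<in> ?I \<rightarrow> carrier (sp T m)" using z submoduleD(1)[OF Wm] by auto
    have co_y: "co j y = co j x" if j: "j \<in> SM n m" "j 1 \<noteq> 1" for j
    proof -
      have "co j y = (\<Oplus>\<^bsub>Lk\<^esub>i\<in>?I. co j (z i))"
        unfolding y_def by (rule linear_maps_hom(4)[OF T_ab Lk_ab co_linear[OF j(1)] zc])
      also have "\<dots> = co j (z j)"
      proof (rule Lk.M.finsum_single)
        show "finite ?I" using finite_SM by simp
        show "j \<in> ?I" using j by simp
        show "(\<lambda>i. co j (z i)) \<in> ?I \<rightarrow> carrier Lk" using zc co_closed[OF j(1)] by blast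
        show "co j (z i) = \<zero>\<^bsub>Lk\<^esub>" if "i \<in> ?I" "i \<noteq> j" for i
          using that co_h[OF _ j sx, of i i] by (simp add: z_def)
      qed
      also have "\<dots> = co j x"
        using co_h[OF j(1) j sx[OF j(1)]] sg_cancel[OF co_closed[OF j(1) xc]] by (simp add: z_def)
      finally show ?thesis .
    qed
    have d: "x \<ominus>\<^bsub>sp T m\<^esub> y \<in> rad m" by (rule submoduleD(5)[OF subcmodD(1)[OF rad_subcmod m] x yr])
    have "x \<ominus>\<^bsub>sp T m\<^esub> y = \<zero>\<^bsub>sp T m\<^esub>"
    proof (rule vanish_from_coords[OF m rad_carrier[OF d] rad_kill[OF d OA_Hom]])
      fix i assume i: "i \<in> SM n m" "i 1 \<noteq> 1"
      have "co i (x \<ominus>\<^bsub>sp T m\<^esub> y) = co i x \<ominus>\<^bsub>Lk\<^esub> co i y"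
        by (rule linear_maps_hom(3)[OF T_ab Lk_ab co_linear[OF i(1)] xc rad_carrier[OF yr]])
      then show "co i (x \<ominus>\<^bsub>sp T m\<^esub> y) = \<zero>\<^bsub>Lk\<^esub>"
        using co_y[OF i] co_closed[OF i(1) xc] by (simp add: Lk.M.minus_eq_zero_iff)
    qed
    then show ?thesis using Tm.M.minus_eq_zero_iff[OF xc rad_carrier[OF yr]] y by simp
  qed
  then show ?thesis using sub[OF m] by blast
qed

lemma T_n_nonzero:
  assumes irr: "irreducible_lmodule A L"
  shows "carrier (sp T n) \<noteq> {\<zero>\<^bsub>sp T n\<^esub>}"
proof -
  obtain v where v: "v \<in> carrier Lk" "v \<noteq> \<zero>\<^bsub>Lk\<^esub>"
    using irr L.M.zero_closed unfolding irreducible_lmodule_def by (auto simp: Lk_simps)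
  have "co (idm n) (bt n (idm n) v) = v" using co_SM[OF idm_SM idm_SM v(1)] by simp
  then have "bt n (idm n) v \<noteq> \<zero>\<^bsub>sp T n\<^esub>" using co_zero[OF idm_SM] v(2) by metis
  then show ?thesis using bt_closed[OF idm_Hom v(1)] by blast
qed

lemma rad_n: "rad n = {\<zero>\<^bsub>sp T n\<^esub>}"
proof -
  have "x = \<zero>\<^bsub>sp T n\<^esub>" if x: "x \<in> rad n" for x
    using rad_kill[OF x idm_Hom] is_cmodD(3)[OF T_is_cmod n1 rad_carrier[OF x]] by simp
  then show ?thesis using submoduleD(2)[OF subcmodD(1)[OF rad_subcmod n1]] by blast
qed

lemma ZL_zero_mem: "\<zero>\<^bsub>L\<^esub> \<in> ZL"
  using submoduleD(2)[OF ZL_submodule] .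

text \<open>A nonzero radical is visible at \<open>[n+1]\<close> by \<open>nonzero_image\<close>,
  and there it consists of the \<open>D u\<close> with \<open>u\<close> in \<open>ZL\<close>; so it
  vanishes together with \<open>ZL\<close>.\<close>

lemma length_dichotomy:
  assumes irr: "irreducible_lmodule A L"
  shows "ZL = {\<zero>\<^bsub>L\<^esub>} \<Longrightarrow> irreducible_cmod K C T"
    and "ZL \<noteq> {\<zero>\<^bsub>L\<^esub>} \<Longrightarrow> has_length K C T 2"
proof -
  have n1': "n + 1 \<ge> 1" by simp
  assume Z: "ZL = {\<zero>\<^bsub>L\<^esub>}"
  have rad0: "rad m = {\<zero>\<^bsub>sp T m\<^esub>}" if m: "m \<ge> 1" for m
  proof -
    have "x = \<zero>\<^bsub>sp T m\<^esub>" if x: "x \<in> rad m" for x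
    proof (rule ccontr)
      assume "x \<noteq> \<zero>\<^bsub>sp T m\<^esub>"
      then obtain f where f: "f \<in> OA_maps m (n+1)" "ac m (n+1) f x \<noteq> \<zero>\<^bsub>sp T (n+1)\<^esub>"
        using nonzero_image[OF m rad_carrier[OF x] rad_kill[OF x OA_Hom]] by blast
      have r: "ac m (n+1) f x \<in> rad (n+1)" by (rule subcmodD(2)[OF rad_subcmod m n1' OA_Hom[OF f(1)] x])
      then obtain u where u: "u \<in> carrier Lk" "ac m (n+1) f x = D u" using rad_ex_D by blast
      then have "u \<in> ZL" using rad_ZL r by simp
      then show False using Z f(2) u(2) D_zero by (simp add: Lk_simps)
    qed
    then show ?thesis using submoduleD(2)[OF subcmodD(1)[OF rad_subcmod m]] by blast
  qed
  show "irreducible_cmod K C T"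
    unfolding irreducible_cmod_def
  proof (intro conjI allI impI T_is_cmod)
    show "\<exists>m\<ge>1. carrier (sp T m) \<noteq> {\<zero>\<^bsub>sp T m\<^esub>}" using n1 T_n_nonzero[OF irr] by blast
    fix W assume W: "subcmod K C W T"
    show "(\<forall>m\<ge>1. W m = {\<zero>\<^bsub>sp T m\<^esub>}) \<or> (\<forall>m\<ge>1. W m = carrier (sp T m))"
    proof (cases "W n = {\<zero>\<^bsub>sp T n\<^esub>}")
      case True
      have "W m = {\<zero>\<^bsub>sp T m\<^esub>}" if m: "m \<ge> 1" for m
        using subcmod_rad[OF W True m] rad0[OF m] submoduleD(2)[OF subcmodD(1)[OF W m]] by auto
      then show ?thesis by blast
    next
      case False
      then show ?thesis using generated_in_n[OF irr W] by blast
    qed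
  qed
next
  have n1': "n + 1 \<ge> 1" by simp
  assume Z: "ZL \<noteq> {\<zero>\<^bsub>L\<^esub>}"
  then obtain u where u: "u \<in> ZL" "u \<noteq> \<zero>\<^bsub>Lk\<^esub>" using ZL_zero_mem by (auto simp: Lk_simps)
  have uc: "u \<in> carrier Lk" using u by (simp add: ZL_def)
  have "D u \<noteq> \<zero>\<^bsub>sp T (n+1)\<^esub>" using D_inj[OF uc Lk.M.zero_closed] D_zero u(2) by auto
  then have ne0: "rad (n+1) \<noteq> {\<zero>\<^bsub>sp T (n+1)\<^esub>}" using ZL_rad[OF u(1)] by auto
  show "has_length K C T 2"
  proof (rule has_length_2I[OF T_is_cmod rad_subcmod])
    show "\<exists>m\<ge>1. rad m \<noteq> {\<zero>\<^bsub>sp T m\<^esub>}" using ne0 n1' by blast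
    show "\<exists>m\<ge>1. rad m \<noteq> carrier (sp T m)" using rad_n T_n_nonzero[OF irr] n1 by metis
    fix W assume W: "subcmod K C W T"
    show "(\<forall>m\<ge>1. W m \<subseteq> rad m) \<or> (\<forall>m\<ge>1. W m = carrier (sp T m))"
      using subcmod_rad[OF W] generated_in_n[OF irr W] by blast
    assume "\<And>m. m \<ge> 1 \<Longrightarrow> W m \<subseteq> rad m"
    then show "(\<forall>m\<ge>1. W m = {\<zero>\<^bsub>sp T m\<^esub>}) \<or> (\<forall>m\<ge>1. W m = rad m)"
      using rad_irreducible[OF irr W] by blast
  qed
qed

end

section \<open>Homomorphisms out of the next standard module\<close>

context kgmod
begin

text \<open>The Yoneda lemma for a quotient of a representable functor: a homomorphism is determined
  by the image \<open>y\<close> of the class of the identity of \<open>[n+1]\<close>, and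
  \<open>y\<close> is killed by all non-injective maps. Such \<open>y\<close> are the
  \<open>D u\<close> with \<open>u\<close> in \<open>ZL\<close>.\<close>

lemma hom_from_Delta_Suc:
  "(\<exists>\<phi>\<in>cmod_homs K C (Delta K C (n+1)) T. \<exists>m\<ge>1. \<exists>x\<in>carrier (sp (Delta K C (n+1)) m). \<phi> m x \<noteq> \<zero>\<^bsub>sp T m\<^esub>)
   \<longleftrightarrow> ZL \<noteq> {\<zero>\<^bsub>L\<^esub>}"
proof -
  have n1': "n + 1 \<ge> 1" by simp
  let ?P = "\<lambda>m. free_mod K (Hom C (n+1) m)" and ?c = "\<lambda>m. K.Dcls C (n+1) m" and ?D = "Delta K C (n+1)"
  let ?id = "?c (n+1) (basis K (idm (n+1)))"
  have idc: "basis K (idm (n+1)) \<in> carrier (?P (n+1))" by (rule K.basis_carrier[OF idm_Hom])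
  have act_id: "act ?D (n+1) m f ?id = ?c m (basis K f)" if m: "m \<ge> 1" and f: "f \<in> Hom C (n+1) m" for m f
    using K.Delta_act[OF n1' m f idc] compose_idm[OF Hom_all_maps[OF f]] by (simp add: K.free_map_basis)
  show ?thesis
  proof
    assume "\<exists>\<phi>\<in>cmod_homs K C ?D T. \<exists>m\<ge>1. \<exists>x\<in>carrier (sp ?D m). \<phi> m x \<noteq> \<zero>\<^bsub>sp T m\<^esub>"
    then obtain \<phi> m x where \<phi>: "\<phi> \<in> cmod_homs K C ?D T" and m: "m \<ge> 1"
      and x: "x \<in> carrier (sp ?D m)" "\<phi> m x \<noteq> \<zero>\<^bsub>sp T m\<^esub>" by blast
    have \<phi>l: "\<phi> m \<in> linear_maps K (sp ?D m) (sp T m)" if "m \<ge> 1" for m using \<phi> that by (simp add: cmod_homs_def)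
    have \<phi>n: "\<phi> l (act ?D m l f x) = ac m l f (\<phi> m x)"
      if "m \<ge> 1" "l \<ge> 1" "f \<in> Hom C m l" "x \<in> carrier (sp ?D m)" for m l f x
      using \<phi> that by (simp add: cmod_homs_def)
    have Dab: "abelian_group (sp ?D m)" if "m \<ge> 1" for m
      by (rule module_abelian_group[OF is_cmodD(1)[OF K.Delta_is_cmod that]])
    note idD = linear_mapsD(1)[OF K.Dcls_linear idc]
    define y where "y = \<phi> (n+1) ?id"
    have y: "y \<in> carrier (sp T (n+1))" unfolding y_def by (rule linear_mapsD(1)[OF \<phi>l[OF n1'] idD])
    have \<phi>f: "\<phi> m (?c m (basis K f)) = ac (n+1) m f y" if "m \<ge> 1" "f \<in> Hom C (n+1) m" for m f
      unfolding y_def using \<phi>n[OF n1' that idD] act_id[OF that] by simp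
    \<comment> \<open>No map from \<open>[n+1]\<close> to \<open>[n]\<close> is injective, so each
      of them has class zero in the standard module.\<close>
    have yr: "y \<in> rad (n+1)"
    proof (rule radI[OF y])
      fix f assume f: "f \<in> Hom C (n+1) n"
      show "ac (n+1) n f y = \<zero>\<^bsub>sp T n\<^esub>"
        using \<phi>f[OF n1 f] K.Dcls_noninj[OF f not_inj_down[OF f]] linear_maps_hom(1)[OF Dab[OF n1] T_ab \<phi>l[OF n1]] by simp
    qed
    then obtain u where u: "u \<in> carrier Lk" "y = D u" using rad_ex_D by blast
    then have uZ: "u \<in> ZL" using rad_ZL yr by simp
    show "ZL \<noteq> {\<zero>\<^bsub>L\<^esub>}"
    proof
      assume "ZL = {\<zero>\<^bsub>L\<^esub>}"
      then have y0: "y = \<zero>\<^bsub>sp T (n+1)\<^esub>" using uZ u(2) D_zero by (simp add: Lk_simps)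
      obtain a where a: "a \<in> carrier (?P m)" "x = ?c m a" using x(1) K.Delta_carrier by blast
      have zl: "(\<lambda>_. \<zero>\<^bsub>sp T m\<^esub>) \<in> linear_maps K (?P m) (sp T m)"
      proof -
        interpret Tm: module K "sp T m" by (rule T_module)
        show ?thesis by (rule linear_mapsI) auto
      qed
      have "\<phi> m (?c m a) = \<zero>\<^bsub>sp T m\<^esub>"
      proof (rule K.free_mod_linear_eq[OF T_ab linear_maps_comp[OF K.Dcls_linear \<phi>l[OF m]] zl _ a(1)])
        show "\<phi> m (?c m (basis K f)) = \<zero>\<^bsub>sp T m\<^esub>" if "f \<in> Hom C (n+1) m" for f
          using \<phi>f[OF m that] y0 linear_maps_hom(1)[OF T_ab T_ab ac_linear[OF n1' m that]] by simp
      qed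
      then show False using x(2) a(2) by simp
    qed
  next
    assume "ZL \<noteq> {\<zero>\<^bsub>L\<^esub>}"
    then obtain u where u: "u \<in> ZL" "u \<noteq> \<zero>\<^bsub>Lk\<^esub>" using ZL_zero_mem by (auto simp: Lk_simps)
    have uc: "u \<in> carrier Lk" using u by (simp add: ZL_def)
    note Du = D(1)[OF uc]
    \<comment> \<open>The homomorphism out of the representable functor that sends the identity to
      \<open>D u\<close>; it descends to the standard module by \<open>ZL_killed\<close>.\<close>
    define h where "h m = lift K (sp T m) (\<lambda>g. ac (n+1) m g (D u))" for m
    have hl: "h m \<in> linear_maps K (?P m) (sp T m)" if m: "m \<ge> 1" for m
      unfolding h_def by (rule module.lift_linear[OF T_module ac_closed[OF n1' m _ Du]])
    have hb: "h m (basis K g) = ac (n+1) m g (D u)" if m: "m \<ge> 1" and g: "g \<in> Hom C (n+1) m" for m g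
      unfolding h_def by (rule module.lift_basis[OF T_module, where \<phi>="\<lambda>g. ac (n+1) m g (D u)"]) (rule ac_closed[OF n1' m g Du])
    have h0: "h m a = \<zero>\<^bsub>sp T m\<^esub>" if m: "m \<ge> 1" and a: "a \<in> noninj_part K C (n+1) m" for m a
      using K.noninj_part_map[OF T_module hl[OF m] submodule_zero[OF T_module] _ a] hb[OF m] ZL_killed[OF u(1) m]
      by simp
    define \<phi> where "\<phi> m = desc (h m)" for m
    have \<phi>c: "\<phi> m (?c m a) = h m a" if "m \<ge> 1" "a \<in> carrier (?P m)" for m a
      unfolding \<phi>_def
      by (rule desc_coset[OF K.free_mod_module K.noninj_part_submodule T_module hl[OF that(1)] h0[OF that(1)] that(2)])
    have "\<phi> \<in> cmod_homs K C ?D T"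
      unfolding cmod_homs_def
    proof (intro CollectI conjI allI impI ballI)
      fix m :: nat assume m: "m \<ge> 1"
      show "\<phi> m \<in> linear_maps K (sp ?D m) (sp T m)"
        unfolding \<phi>_def K.Delta_sp
        by (rule desc_linear[OF K.free_mod_module K.noninj_part_submodule T_module hl[OF m] h0[OF m]])
      fix l :: nat and f x assume l: "l \<ge> 1" and f: "f \<in> Hom C m l" and "x \<in> carrier (sp ?D m)"
      then obtain a where a: "a \<in> carrier (?P m)" "x = ?c m a" using K.Delta_carrier by blast
      have fm: "free_map K (compose {1..n+1} f) \<in> linear_maps K (?P m) (?P l)"
        using Hom_compose[OF _ f] by (rule K.free_map_linear)
      have "h l (free_map K (compose {1..n+1} f) a) = ac m l f (h m a)"
      proof (rule K.free_mod_linear_eq[OF T_ab linear_maps_comp[OF fm hl[OF l]] linear_maps_comp[OF hl[OF m] ac_linear[OF m l f]] _ a(1)])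
        fix g assume g: "g \<in> Hom C (n+1) m"
        show "h l (free_map K (compose {1..n+1} f) (basis K g)) = ac m l f (h m (basis K g))"
          using hb[OF m g] hb[OF l Hom_compose[OF g f]] is_cmodD(4)[OF T_is_cmod n1' m l g f Du]
          by (simp add: K.free_map_basis)
      qed
      then show "\<phi> l (act ?D m l f x) = ac m l f (\<phi> m x)"
        unfolding a(2) K.Delta_act[OF m l f a(1)] \<phi>c[OF m a(1)] \<phi>c[OF l linear_mapsD(1)[OF fm a(1)]] .
    qed
    moreover have "\<phi> (n+1) ?id \<noteq> \<zero>\<^bsub>sp T (n+1)\<^esub>"
    proof -
      have "\<phi> (n+1) ?id = D u"
        using \<phi>c[OF n1' idc] hb[OF n1' idm_Hom] is_cmodD(3)[OF T_is_cmod n1' Du] by simp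
      then show ?thesis using D_inj[OF uc Lk.M.zero_closed] D_zero u(2) by auto
    qed
    moreover have "?id \<in> carrier (sp ?D (n+1))" by (rule linear_mapsD(1)[OF K.Dcls_linear idc])
    ultimately show "\<exists>\<phi>\<in>cmod_homs K C ?D T. \<exists>m\<ge>1. \<exists>x\<in>carrier (sp ?D m). \<phi> m x \<noteq> \<zero>\<^bsub>sp T m\<^esub>"
      using n1' by blast
  qed
qed

end

section \<open>The vectors \<open>ZL\<close> in a projective cover\<close>

lemma aut_assoc:
  "\<lbrakk>x \<in> aut C n; y \<in> aut C n; z \<in> aut C n\<rbrakk> \<Longrightarrow>
   compose {1..n} (compose {1..n} x y) z = compose {1..n} x (compose {1..n} y z)"
  using group.is_monoid[OF Aut_grp_group, THEN monoid.m_assoc, of x C n y z] by simp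

lemma aut_idm:
  assumes "x \<in> aut C n"
  shows "compose {1..n} x (idm n) = x" "compose {1..n} (idm n) x = x"
  using compose_idm idm_compose aut_all_maps[OF assms] by auto

definition ainv :: "cat \<Rightarrow> nat \<Rightarrow> (nat \<Rightarrow> nat) \<Rightarrow> nat \<Rightarrow> nat" where
  "ainv C n g = inv\<^bsub>Aut_grp C n\<^esub> g"

lemma ainv:
  assumes "g \<in> aut C n"
  shows "ainv C n g \<in> aut C n" "compose {1..n} g (ainv C n g) = idm n" "compose {1..n} (ainv C n g) g = idm n"
  using group.inv_closed[OF Aut_grp_group, of g C n] group.r_inv[OF Aut_grp_group, of g C n]
    group.l_inv[OF Aut_grp_group, of g C n] assms by (auto simp: ainv_def)

lemma ainv_cancel:
  assumes "g \<in> aut C n" "x \<in> aut C n"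
  shows "compose {1..n} g (compose {1..n} (ainv C n g) x) = x"
    "compose {1..n} (ainv C n g) (compose {1..n} g x) = x"
    "compose {1..n} (compose {1..n} x g) (ainv C n g) = x"
    "compose {1..n} (compose {1..n} x (ainv C n g)) g = x"
  using aut_assoc[OF assms(1) ainv(1)[OF assms(1)] assms(2)] aut_assoc[OF ainv(1)[OF assms(1)] assms(1) assms(2)]
    aut_assoc[OF assms(2,1) ainv(1)[OF assms(1)]] aut_assoc[OF assms(2) ainv(1)[OF assms(1)] assms(1)]
    ainv[OF assms(1)] aut_idm[OF assms(2)] by auto

lemma basis_apply: "basis K x y = (if y = x then \<one>\<^bsub>K\<^esub> else \<zero>\<^bsub>K\<^esub>)"
  by (simp add: basis_def)

section \<open>The trace form of the group algebra\<close>

context kgmod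
begin

text \<open>The field as a module over itself: with this target, taking a coefficient is a linear
  map, and identities between coefficients can be tested on basis elements.\<close>

definition Kmod :: "('k, 'k) module" where
  "Kmod = \<lparr>carrier = carrier K, mult = undefined, one = undefined, zero = \<zero>\<^bsub>K\<^esub>, add = add K, smult = mult K\<rparr>"

lemma Kmod_simps:
  "carrier Kmod = carrier K" "\<zero>\<^bsub>Kmod\<^esub> = \<zero>\<^bsub>K\<^esub>" "v \<oplus>\<^bsub>Kmod\<^esub> w = v \<oplus>\<^bsub>K\<^esub> w" "c \<odot>\<^bsub>Kmod\<^esub> v = c \<otimes>\<^bsub>K\<^esub> v"
  by (simp_all add: Kmod_def)

lemma Kmod_ab: "abelian_group Kmod"
proof (rule abelian_groupI)
  fix x assume "x \<in> carrier Kmod"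
  then show "\<exists>y\<in>carrier Kmod. y \<oplus>\<^bsub>Kmod\<^esub> x = \<zero>\<^bsub>Kmod\<^esub>"
    by (intro bexI[of _ "\<ominus>\<^bsub>K\<^esub> x"]) (auto simp: Kmod_simps K.l_neg)
qed (auto simp: Kmod_simps K.a_ac)

lemma eval_linear: "(\<lambda>a. a z) \<in> linear_maps K (free_mod K X) Kmod"
  by (rule linear_mapsI) (auto simp: Kmod_simps free_mod_simps free_mod_carrierD(1))

lemma basis_mult_eval:
  assumes g: "g \<in> aut C n" and w: "w \<in> aut C n" and a: "a \<in> carrier A"
  shows "(basis K g \<otimes>\<^bsub>A\<^esub> a) (compose {1..n} g w) = a w"
    and "(a \<otimes>\<^bsub>A\<^esub> basis K g) (compose {1..n} w g) = a w"
proof -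
  have a': "a \<in> carrier FG" and g': "basis K g \<in> carrier FG" using a K.basis_carrier[OF g] by (auto simp: A_simps)
  have eq: "compose {1..n} g w = compose {1..n} g y \<longleftrightarrow> w = y" "compose {1..n} w g = compose {1..n} y g \<longleftrightarrow> w = y"
    if y: "y \<in> aut C n" for y
    using arg_cong[of "compose {1..n} g w" "compose {1..n} g y" "compose {1..n} (ainv C n g)"]
      arg_cong[of "compose {1..n} w g" "compose {1..n} y g" "\<lambda>x. compose {1..n} x (ainv C n g)"]
      ainv_cancel(2,3)[OF g y] ainv_cancel(2,3)[OF g w] by auto
  show "(basis K g \<otimes>\<^bsub>A\<^esub> a) (compose {1..n} g w) = a w"
  proof (rule K.free_mod_linear_eq[OF Kmod_ab linear_maps_comp[OF A_linear_right[OF g'] eval_linear] eval_linear _ a'])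
    show "(basis K g \<otimes>\<^bsub>A\<^esub> basis K y) (compose {1..n} g w) = basis K y w" if "y \<in> aut C n" for y
      unfolding basis_mult basis_apply eq(1)[OF that] ..
  qed
  show "(a \<otimes>\<^bsub>A\<^esub> basis K g) (compose {1..n} w g) = a w"
  proof (rule K.free_mod_linear_eq[OF Kmod_ab linear_maps_comp[OF A_linear_left[OF g'] eval_linear] eval_linear _ a'])
    show "(basis K y \<otimes>\<^bsub>A\<^esub> basis K g) (compose {1..n} w g) = basis K y w" if "y \<in> aut C n" for y
      unfolding basis_mult basis_apply eq(2)[OF that] ..
  qed
qed

text \<open>In a group a one-sided inverse is two-sided, which settles the case of basis elements;
  bilinearity gives the rest.\<close>

lemma trace_comm:
  assumes a: "a \<in> carrier A" and b: "b \<in> carrier A"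
  shows "(a \<otimes>\<^bsub>A\<^esub> b) (idm n) = (b \<otimes>\<^bsub>A\<^esub> a) (idm n)"
proof -
  have a': "a \<in> carrier FG" and b': "b \<in> carrier FG" using a b by (auto simp: A_simps)
  have half: "compose {1..n} y x = idm n" if x: "x \<in> aut C n" and y: "y \<in> aut C n" and "compose {1..n} x y = idm n" for x y
  proof -
    have "y = compose {1..n} (ainv C n x) (compose {1..n} x y)" by (rule ainv_cancel(2)[OF x y, symmetric])
    also have "\<dots> = ainv C n x" unfolding that(3) by (rule aut_idm(1)[OF ainv(1)[OF x]])
    finally show ?thesis using ainv(3)[OF x] by simp
  qed
  have eq: "idm n = compose {1..n} x y \<longleftrightarrow> idm n = compose {1..n} y x" if "x \<in> aut C n" "y \<in> aut C n" for x y
    using half[OF that] half[OF that(2,1)] by auto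
  show ?thesis
  proof (rule K.free_mod_bilinear_eq[OF Kmod_ab _ _ _ _ _ a' b', where F="\<lambda>a b. (a \<otimes>\<^bsub>A\<^esub> b) (idm n)" and G="\<lambda>a b. (b \<otimes>\<^bsub>A\<^esub> a) (idm n)"])
    show "(\<lambda>a. (a \<otimes>\<^bsub>A\<^esub> b) (idm n)) \<in> linear_maps K FG Kmod" if "b \<in> carrier FG" for b
      by (rule linear_maps_comp[OF A_linear_left[OF that] eval_linear])
    show "(\<lambda>a. (b \<otimes>\<^bsub>A\<^esub> a) (idm n)) \<in> linear_maps K FG Kmod" if "b \<in> carrier FG" for b
      by (rule linear_maps_comp[OF A_linear_right[OF that] eval_linear])
    show "(\<lambda>b. (basis K x \<otimes>\<^bsub>A\<^esub> b) (idm n)) \<in> linear_maps K FG Kmod" if "x \<in> aut C n" for x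
      by (rule linear_maps_comp[OF A_linear_right[OF K.basis_carrier[OF that]] eval_linear])
    show "(\<lambda>b. (b \<otimes>\<^bsub>A\<^esub> basis K x) (idm n)) \<in> linear_maps K FG Kmod" if "x \<in> aut C n" for x
      by (rule linear_maps_comp[OF A_linear_left[OF K.basis_carrier[OF that]] eval_linear])
    show "(basis K x \<otimes>\<^bsub>A\<^esub> basis K y) (idm n) = (basis K y \<otimes>\<^bsub>A\<^esub> basis K x) (idm n)"
      if "x \<in> aut C n" "y \<in> aut C n" for x y
      unfolding basis_mult basis_apply eq[OF that] ..
  qed
qed

definition sgn1 :: "nat \<Rightarrow> 'k" where
  "sgn1 i = (if even i then \<one>\<^bsub>K\<^esub> else \<ominus>\<^bsub>K\<^esub> \<one>\<^bsub>K\<^esub>)"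

lemma sgn1_closed: "sgn1 i \<in> carrier K"
  by (simp add: sgn1_def)

lemma sgn1_square: "sgn1 i \<otimes>\<^bsub>K\<^esub> sgn1 i = \<one>\<^bsub>K\<^esub>"
  by (simp add: sgn1_def K.l_minus K.r_minus)

text \<open>The operator \<open>E g i\<close> as an element of \<open>kG\<close>. It does not depend
  on \<open>L\<close>, which allows \<open>ZL\<close> to be compared for different modules.\<close>

definition eps :: "(nat \<Rightarrow> nat) \<Rightarrow> nat \<Rightarrow> (nat \<Rightarrow> nat) \<Rightarrow> 'k" where
  "eps g i = sgn1 (i + g i) \<odot>\<^bsub>FG\<^esub> basis K (gp C n (compose {1..n} g (del n i)))"

lemma eps_closed: "\<lbrakk>g \<in> aut C (n+1); i \<in> {1..n+1}\<rbrakk> \<Longrightarrow> eps g i \<in> carrier A"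
  unfolding eps_def A_simps by (intro FG.smult_closed sgn1_closed K.basis_carrier aut_del)

lemma scaled_basis_smult:
  assumes "c \<in> carrier K" "h \<in> aut C n" "u \<in> carrier L"
  shows "(c \<odot>\<^bsub>FG\<^esub> basis K h) \<odot>\<^bsub>L\<^esub> u = c \<odot>\<^bsub>Lk\<^esub> ga h u"
  using linear_mapsD(3)[OF lsmult_linear_left[OF assms(3)] assms(1) K.basis_carrier[OF assms(2)]] by (simp add: ga_def)

lemma E_eq_eps:
  assumes g: "g \<in> aut C (n+1)" and i: "i \<in> {1..n+1}" and u: "u \<in> carrier L"
  shows "E g i u = eps g i \<odot>\<^bsub>L\<^esub> u"
proof -
  note h = aut_del(4)[OF g i]
  have u': "u \<in> carrier Lk" using u by (simp add: Lk_simps)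
  show ?thesis
    unfolding eps_def scaled_basis_smult[OF sgn1_closed h u] E_def
    using ga_closed[OF h u'] by (simp add: sg_def sgn1_def Lk.smult_l_minus)
qed

lemma ZL_iff:
  "u \<in> ZL \<longleftrightarrow> u \<in> carrier L \<and>
    (\<forall>g\<in>aut C (n+1). \<forall>i\<in>{1..n+1}. \<forall>j\<in>{1..n+1}. eps g i \<odot>\<^bsub>L\<^esub> u = eps g j \<odot>\<^bsub>L\<^esub> u)"
proof
  assume u: "u \<in> ZL"
  then have u': "u \<in> carrier L" by (simp add: ZL_def Lk_simps)
  then show "u \<in> carrier L \<and>
    (\<forall>g\<in>aut C (n+1). \<forall>i\<in>{1..n+1}. \<forall>j\<in>{1..n+1}. eps g i \<odot>\<^bsub>L\<^esub> u = eps g j \<odot>\<^bsub>L\<^esub> u)"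
    using ZL_eq[OF u] E_eq_eps[OF _ _ u'] by (metis (no_types))
next
  assume *: "u \<in> carrier L \<and>
    (\<forall>g\<in>aut C (n+1). \<forall>i\<in>{1..n+1}. \<forall>j\<in>{1..n+1}. eps g i \<odot>\<^bsub>L\<^esub> u = eps g j \<odot>\<^bsub>L\<^esub> u)"
  show "u \<in> ZL"
  proof (rule ZL_I)
    show "u \<in> carrier Lk" using * by (simp add: Lk_simps)
    fix g i j assume "g \<in> aut C (n+1)" "i \<in> {1..n+1}" "j \<in> {1..n+1}"
    then show "E g i u = E g j u" using * E_eq_eps by metis
  qed
qed

text \<open>\<open>Nk\<close> consists of the automorphisms that act on \<open>L\<close> by a scalar, and \<open>chr\<close> is the resulting character;
  if \<open>ZL\<close> is all of \<open>L\<close>, then the quotients of the elements \<open>E g i\<close> lie in \<open>Nk\<close>.\<close>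

definition Nk :: "(nat \<Rightarrow> nat) set" where
  "Nk = {h \<in> aut C n. \<exists>c\<in>carrier K. \<forall>v\<in>carrier Lk. ga h v = c \<odot>\<^bsub>Lk\<^esub> v}"

definition chr :: "(nat \<Rightarrow> nat) \<Rightarrow> 'k" where
  "chr h = (SOME c. c \<in> carrier K \<and> (\<forall>v\<in>carrier Lk. ga h v = c \<odot>\<^bsub>Lk\<^esub> v))"

lemma chr:
  assumes "h \<in> Nk"
  shows "chr h \<in> carrier K" "v \<in> carrier Lk \<Longrightarrow> ga h v = chr h \<odot>\<^bsub>Lk\<^esub> v"
proof -
  have "\<exists>c. c \<in> carrier K \<and> (\<forall>v\<in>carrier Lk. ga h v = c \<odot>\<^bsub>Lk\<^esub> v)" using assms unfolding Nk_def by blast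
  from someI_ex[OF this] show "chr h \<in> carrier K" "v \<in> carrier Lk \<Longrightarrow> ga h v = chr h \<odot>\<^bsub>Lk\<^esub> v"
    unfolding chr_def by auto
qed

lemma Nk_aut: "h \<in> Nk \<Longrightarrow> h \<in> aut C n"
  by (simp add: Nk_def)

lemma NkI: "\<lbrakk>h \<in> aut C n; c \<in> carrier K; \<And>v. v \<in> carrier Lk \<Longrightarrow> ga h v = c \<odot>\<^bsub>Lk\<^esub> v\<rbrakk> \<Longrightarrow> h \<in> Nk"
  unfolding Nk_def by (intro CollectI conjI bexI[of _ c] ballI)

lemma chr_nonzero_scalar:
  assumes v: "v \<in> carrier Lk" "v \<noteq> \<zero>\<^bsub>Lk\<^esub>" and c: "c \<in> carrier K" "c \<odot>\<^bsub>Lk\<^esub> v = \<zero>\<^bsub>Lk\<^esub>"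
  shows "c = \<zero>\<^bsub>K\<^esub>"
proof (rule ccontr)
  assume "c \<noteq> \<zero>\<^bsub>K\<^esub>"
  then have u: "c \<in> Units K" using c K.field_Units by blast
  have "v = (inv\<^bsub>K\<^esub> c \<otimes>\<^bsub>K\<^esub> c) \<odot>\<^bsub>Lk\<^esub> v" using K.Units_l_inv[OF u] v(1) by simp
  also have "\<dots> = inv\<^bsub>K\<^esub> c \<odot>\<^bsub>Lk\<^esub> (c \<odot>\<^bsub>Lk\<^esub> v)" using K.Units_inv_closed[OF u] c(1) v(1) by (rule Lk.smult_assoc1)
  also have "\<dots> = \<zero>\<^bsub>Lk\<^esub>" using c(2) K.Units_inv_closed[OF u] by simp
  finally show False using v(2) by simp
qed

lemma scalar_unique:
  assumes v: "v \<in> carrier Lk" "v \<noteq> \<zero>\<^bsub>Lk\<^esub>" and c: "c \<in> carrier K" "d \<in> carrier K" "c \<odot>\<^bsub>Lk\<^esub> v = d \<odot>\<^bsub>Lk\<^esub> v"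
  shows "c = d"
proof -
  have "(c \<ominus>\<^bsub>K\<^esub> d) \<odot>\<^bsub>Lk\<^esub> v = (c \<odot>\<^bsub>Lk\<^esub> v) \<ominus>\<^bsub>Lk\<^esub> (d \<odot>\<^bsub>Lk\<^esub> v)"
    using c v(1) by (simp add: a_minus_def Lk.smult_l_distr Lk.smult_l_minus)
  then have "(c \<ominus>\<^bsub>K\<^esub> d) \<odot>\<^bsub>Lk\<^esub> v = \<zero>\<^bsub>Lk\<^esub>" using c v(1) by (simp add: Lk.M.minus_eq_zero_iff)
  then have "c \<ominus>\<^bsub>K\<^esub> d = \<zero>\<^bsub>K\<^esub>" using chr_nonzero_scalar[OF v] c by simp
  then show ?thesis using c by (simp add: K.minus_eq_zero_iff)
qed

end

lemma lmodule_left_ideal: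
  assumes R: "ring R" and e: "e \<in> carrier R"
  shows "lmodule R (left_ideal R e)"
proof -
  interpret R: ring R by (rule R)
  have car: "carrier (left_ideal R e) \<subseteq> carrier R" using e by (auto simp: left_ideal_def)
  have mem: "a \<otimes>\<^bsub>R\<^esub> e \<in> carrier (left_ideal R e)" if "a \<in> carrier R" for a
    using that by (auto simp: left_ideal_def)
  have ops: "\<zero>\<^bsub>left_ideal R e\<^esub> = \<zero>\<^bsub>R\<^esub>" "\<And>x y. x \<oplus>\<^bsub>left_ideal R e\<^esub> y = x \<oplus>\<^bsub>R\<^esub> y"
    "\<And>a x. a \<odot>\<^bsub>left_ideal R e\<^esub> x = a \<otimes>\<^bsub>R\<^esub> x"
    by (auto simp: left_ideal_def)
  have rep: "\<exists>a\<in>carrier R. x = a \<otimes>\<^bsub>R\<^esub> e" if "x \<in> carrier (left_ideal R e)" for x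
    using that by (auto simp: left_ideal_def)
  show ?thesis
  proof (intro lmodule.intro lmodule_axioms.intro R)
    show "abelian_group (left_ideal R e)"
    proof (rule abelian_groupI)
      fix x assume x: "x \<in> carrier (left_ideal R e)"
      then obtain a where a: "a \<in> carrier R" "x = a \<otimes>\<^bsub>R\<^esub> e" using rep by blast
      show "\<exists>y\<in>carrier (left_ideal R e). y \<oplus>\<^bsub>left_ideal R e\<^esub> x = \<zero>\<^bsub>left_ideal R e\<^esub>"
        using mem[of "\<ominus>\<^bsub>R\<^esub> a"] a e by (intro bexI[of _ "(\<ominus>\<^bsub>R\<^esub> a) \<otimes>\<^bsub>R\<^esub> e"]) (auto simp: ops R.l_minus R.l_neg)
      fix y assume y: "y \<in> carrier (left_ideal R e)"
      then obtain b where b: "b \<in> carrier R" "y = b \<otimes>\<^bsub>R\<^esub> e" using rep by blast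
      show "x \<oplus>\<^bsub>left_ideal R e\<^esub> y \<in> carrier (left_ideal R e)"
        using mem[of "a \<oplus>\<^bsub>R\<^esub> b"] a b e by (simp add: ops R.l_distr)
      show "x \<oplus>\<^bsub>left_ideal R e\<^esub> y = y \<oplus>\<^bsub>left_ideal R e\<^esub> x"
        using R.a_comm[OF subsetD[OF car x] subsetD[OF car y]] by (simp add: ops)
      fix z assume z: "z \<in> carrier (left_ideal R e)"
      show "x \<oplus>\<^bsub>left_ideal R e\<^esub> y \<oplus>\<^bsub>left_ideal R e\<^esub> z = x \<oplus>\<^bsub>left_ideal R e\<^esub> (y \<oplus>\<^bsub>left_ideal R e\<^esub> z)"
        using R.a_assoc[OF subsetD[OF car x] subsetD[OF car y] subsetD[OF car z]] by (simp add: ops)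
    next
      show "\<zero>\<^bsub>left_ideal R e\<^esub> \<in> carrier (left_ideal R e)" using mem[OF R.zero_closed] e by (simp add: ops)
      show "\<zero>\<^bsub>left_ideal R e\<^esub> \<oplus>\<^bsub>left_ideal R e\<^esub> x = x" if "x \<in> carrier (left_ideal R e)" for x
        using that car by (auto simp: ops)
    qed
    show "\<one>\<^bsub>R\<^esub> \<odot>\<^bsub>left_ideal R e\<^esub> y = y" if "y \<in> carrier (left_ideal R e)" for y
      using subsetD[OF car that] by (simp add: ops)
    fix a x assume a: "a \<in> carrier R" and x: "x \<in> carrier (left_ideal R e)"
    then obtain b where b: "b \<in> carrier R" "x = b \<otimes>\<^bsub>R\<^esub> e" using rep by blast
    show "a \<odot>\<^bsub>left_ideal R e\<^esub> x \<in> carrier (left_ideal R e)"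
      using mem[of "a \<otimes>\<^bsub>R\<^esub> b"] a b e by (simp add: ops R.m_assoc)
    note xR = subsetD[OF car x]
    show "a \<odot>\<^bsub>left_ideal R e\<^esub> (x \<oplus>\<^bsub>left_ideal R e\<^esub> y) =
        a \<odot>\<^bsub>left_ideal R e\<^esub> x \<oplus>\<^bsub>left_ideal R e\<^esub> a \<odot>\<^bsub>left_ideal R e\<^esub> y"
      if "y \<in> carrier (left_ideal R e)" for y
      using R.r_distr[OF xR subsetD[OF car that] a] by (simp add: ops)
    fix c assume c: "c \<in> carrier R"
    show "(a \<oplus>\<^bsub>R\<^esub> c) \<odot>\<^bsub>left_ideal R e\<^esub> x =
        a \<odot>\<^bsub>left_ideal R e\<^esub> x \<oplus>\<^bsub>left_ideal R e\<^esub> c \<odot>\<^bsub>left_ideal R e\<^esub> x"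
      using R.l_distr[OF a c xR] by (simp add: ops)
    show "(a \<otimes>\<^bsub>R\<^esub> c) \<odot>\<^bsub>left_ideal R e\<^esub> x = a \<odot>\<^bsub>left_ideal R e\<^esub> (c \<odot>\<^bsub>left_ideal R e\<^esub> x)"
      using R.m_assoc[OF a c xR] by (simp add: ops)
  qed
qed

section \<open>The group acting by scalars and its character sum\<close>

context kgmod
begin

lemma Nk_compose:
  assumes h: "h \<in> Nk" and k: "k \<in> Nk"
  shows "compose {1..n} h k \<in> Nk"
proof (rule NkI[OF aut_compose[OF Nk_aut[OF k] Nk_aut[OF h]]])
  show "chr k \<otimes>\<^bsub>K\<^esub> chr h \<in> carrier K" using chr(1) h k by simp
  show "ga (compose {1..n} h k) v = chr k \<otimes>\<^bsub>K\<^esub> chr h \<odot>\<^bsub>Lk\<^esub> v" if v: "v \<in> carrier Lk" for v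
    using ga_compose[OF Nk_aut[OF h] Nk_aut[OF k] v] chr[OF h] chr[OF k] v
      linear_mapsD(3)[OF ga_linear[OF Nk_aut[OF h]] chr(1)[OF k] v] by (simp add: Lk.smult_assoc1)
qed

context
  fixes v0 assumes v0: "v0 \<in> carrier Lk" "v0 \<noteq> \<zero>\<^bsub>Lk\<^esub>"
begin

text \<open>The nonzero vector \<open>v0\<close> determines the scalar by which an element of
  \<open>Nk\<close> acts; this makes \<open>chr\<close> multiplicative with values in the
  units.\<close>

lemma chr_eqI: "\<lbrakk>h \<in> Nk; c \<in> carrier K; ga h v0 = c \<odot>\<^bsub>Lk\<^esub> v0\<rbrakk> \<Longrightarrow> chr h = c"
  using scalar_unique[OF v0, of "chr h" c] chr(1)[of h] chr(2)[of h v0] v0(1) by simp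

lemma chr_compose:
  assumes h: "h \<in> Nk" and k: "k \<in> Nk"
  shows "chr (compose {1..n} h k) = chr h \<otimes>\<^bsub>K\<^esub> chr k"
proof (rule chr_eqI[OF Nk_compose[OF h k]])
  show "chr h \<otimes>\<^bsub>K\<^esub> chr k \<in> carrier K" using chr(1) h k by simp
  have "ga (compose {1..n} h k) v0 = chr k \<odot>\<^bsub>Lk\<^esub> (chr h \<odot>\<^bsub>Lk\<^esub> v0)"
    using ga_compose[OF Nk_aut[OF h] Nk_aut[OF k] v0(1)] chr[OF h] chr[OF k] v0(1)
      linear_mapsD(3)[OF ga_linear[OF Nk_aut[OF h]] chr(1)[OF k] v0(1)] by simp
  also have "\<dots> = chr h \<otimes>\<^bsub>K\<^esub> chr k \<odot>\<^bsub>Lk\<^esub> v0"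
    using chr(1)[OF h] chr(1)[OF k] v0(1) by (simp add: Lk.smult_assoc1[symmetric] K.m_comm)
  finally show "ga (compose {1..n} h k) v0 = chr h \<otimes>\<^bsub>K\<^esub> chr k \<odot>\<^bsub>Lk\<^esub> v0" .
qed

lemma idm_Nk: "idm n \<in> Nk" "chr (idm n) = \<one>\<^bsub>K\<^esub>"
proof -
  show "idm n \<in> Nk" by (rule NkI[OF idm_aut K.one_closed]) (simp add: ga_idm)
  then show "chr (idm n) = \<one>\<^bsub>K\<^esub>" by (rule chr_eqI) (simp_all add: ga_idm v0(1))
qed

lemma chr_Unit: assumes h: "h \<in> Nk" shows "chr h \<in> Units K"
proof -
  have "chr h \<noteq> \<zero>\<^bsub>K\<^esub>"
  proof
    assume "chr h = \<zero>\<^bsub>K\<^esub>"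
    then have "ga h v0 = \<zero>\<^bsub>Lk\<^esub>" using chr(2)[OF h v0(1)] v0(1) by simp
    then have "ga (ainv C n h) (ga h v0) = \<zero>\<^bsub>Lk\<^esub>" using ga_zero[OF ainv(1)[OF Nk_aut[OF h]]] by simp
    moreover have "ga (ainv C n h) (ga h v0) = v0"
      using ga_compose[OF ainv(1)[OF Nk_aut[OF h]] Nk_aut[OF h] v0(1)] ainv(3)[OF Nk_aut[OF h]] ga_idm[OF v0(1)] by simp
    ultimately show False using v0(2) by simp
  qed
  then show ?thesis using chr(1)[OF h] K.field_Units by blast
qed

lemma ainv_Nk: assumes h: "h \<in> Nk" shows "ainv C n h \<in> Nk"
proof (rule NkI[OF ainv(1)[OF Nk_aut[OF h]]])
  note U = chr_Unit[OF h]
  show "inv\<^bsub>K\<^esub> chr h \<in> carrier K" using K.Units_inv_closed[OF U] .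
  fix v assume v: "v \<in> carrier Lk"
  note i = ainv(1)[OF Nk_aut[OF h]]
  have "inv\<^bsub>K\<^esub> chr h \<odot>\<^bsub>Lk\<^esub> v = inv\<^bsub>K\<^esub> chr h \<odot>\<^bsub>Lk\<^esub> ga (ainv C n h) (ga h v)"
    using ga_compose[OF i Nk_aut[OF h] v] ainv(3)[OF Nk_aut[OF h]] ga_idm[OF v] by simp
  also have "\<dots> = inv\<^bsub>K\<^esub> chr h \<odot>\<^bsub>Lk\<^esub> (chr h \<odot>\<^bsub>Lk\<^esub> ga (ainv C n h) v)"
    using chr[OF h] v linear_mapsD(3)[OF ga_linear[OF i] chr(1)[OF h] v] by simp
  also have "\<dots> = ga (ainv C n h) v"
    using Lk.smult_assoc1[OF K.Units_inv_closed[OF U] chr(1)[OF h] ga_closed[OF i v]] K.Units_l_inv[OF U] ga_closed[OF i v]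
    by simp
  finally show "ga (ainv C n h) v = inv\<^bsub>K\<^esub> chr h \<odot>\<^bsub>Lk\<^esub> v" by simp
qed

text \<open>The element \<open>s\<close> of the overview as a coefficient function. It is built to
  be an eigenvector of \<open>Nk\<close> with character \<open>chr\<close> from both sides.\<close>

definition chs :: "(nat \<Rightarrow> nat) \<Rightarrow> 'k" where
  "chs h = (if h \<in> Nk then inv\<^bsub>K\<^esub> chr h else \<zero>\<^bsub>K\<^esub>)"

lemma chs_closed: "chs \<in> carrier A"
proof -
  have "finite {h. chs h \<noteq> \<zero>\<^bsub>K\<^esub>}"
    by (rule finite_subset[OF _ finite_aut[of C n]]) (auto simp: chs_def Nk_aut)
  then show ?thesis unfolding A_simps
    using K.Units_inv_closed[OF chr_Unit] by (intro free_mod_carrierI) (auto simp: chs_def Nk_aut)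
qed

lemma Nk_compose_iff:
  assumes h: "h \<in> Nk" and w: "w \<in> aut C n"
  shows "compose {1..n} h w \<in> Nk \<longleftrightarrow> w \<in> Nk" "compose {1..n} w h \<in> Nk \<longleftrightarrow> w \<in> Nk"
proof -
  note c = ainv_cancel[OF Nk_aut[OF h] w]
  show "compose {1..n} h w \<in> Nk \<longleftrightarrow> w \<in> Nk"
    using Nk_compose[OF h, of w] Nk_compose[OF ainv_Nk[OF h], of "compose {1..n} h w"] c(2) by metis
  show "compose {1..n} w h \<in> Nk \<longleftrightarrow> w \<in> Nk"
    using Nk_compose[OF _ h, of w] Nk_compose[OF _ ainv_Nk[OF h], of "compose {1..n} w h"] c(3) by metis
qed

lemma inv_chr_compose:
  assumes h: "h \<in> Nk" and w: "w \<in> Nk"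
  shows "chr h \<otimes>\<^bsub>K\<^esub> inv\<^bsub>K\<^esub> (chr h \<otimes>\<^bsub>K\<^esub> chr w) = inv\<^bsub>K\<^esub> chr w"
proof -
  note U = chr_Unit[OF h] chr_Unit[OF w]
  have c: "chr h \<in> carrier K" "chr w \<in> carrier K" "inv\<^bsub>K\<^esub> chr h \<in> carrier K" "inv\<^bsub>K\<^esub> chr w \<in> carrier K"
    using K.Units_closed U K.Units_inv_closed by auto
  have "(chr h \<otimes>\<^bsub>K\<^esub> chr w) \<otimes>\<^bsub>K\<^esub> (inv\<^bsub>K\<^esub> chr h \<otimes>\<^bsub>K\<^esub> inv\<^bsub>K\<^esub> chr w) =
    (chr h \<otimes>\<^bsub>K\<^esub> inv\<^bsub>K\<^esub> chr h) \<otimes>\<^bsub>K\<^esub> (chr w \<otimes>\<^bsub>K\<^esub> inv\<^bsub>K\<^esub> chr w)"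
    using c by (simp add: K.m_ac)
  then have "(chr h \<otimes>\<^bsub>K\<^esub> chr w) \<otimes>\<^bsub>K\<^esub> (inv\<^bsub>K\<^esub> chr h \<otimes>\<^bsub>K\<^esub> inv\<^bsub>K\<^esub> chr w) = \<one>\<^bsub>K\<^esub>"
    using U by simp
  then have "inv\<^bsub>K\<^esub> (chr h \<otimes>\<^bsub>K\<^esub> chr w) = inv\<^bsub>K\<^esub> chr h \<otimes>\<^bsub>K\<^esub> inv\<^bsub>K\<^esub> chr w"
    using c by (intro K.comm_inv_char) auto
  then show ?thesis using c U by (simp add: K.m_assoc[symmetric])
qed

text \<open>Multiplication by \<open>h\<close> permutes the terms of the sum over the group
  \<open>Nk\<close>, and multiplicativity of \<open>chr\<close> turns the shift into the factor
  \<open>chr h\<close>.\<close>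

lemma chs_mult:
  assumes h: "h \<in> Nk"
  shows "basis K h \<otimes>\<^bsub>A\<^esub> chs = chr h \<odot>\<^bsub>FG\<^esub> chs" "chs \<otimes>\<^bsub>A\<^esub> basis K h = chr h \<odot>\<^bsub>FG\<^esub> chs"
proof -
  note ha = Nk_aut[OF h]
  have m: "basis K h \<otimes>\<^bsub>A\<^esub> chs \<in> carrier FG" "chs \<otimes>\<^bsub>A\<^esub> basis K h \<in> carrier FG" "chr h \<odot>\<^bsub>FG\<^esub> chs \<in> carrier FG"
    using L.R.m_closed[OF basis_A[OF ha] chs_closed] L.R.m_closed[OF chs_closed basis_A[OF ha]]
      FG.smult_closed[OF chr(1)[OF h]] chs_closed by (auto simp: A_simps(1))
  have 1: "chr h \<otimes>\<^bsub>K\<^esub> chs (compose {1..n} h w) = chs w" "chr h \<otimes>\<^bsub>K\<^esub> chs (compose {1..n} w h) = chs w"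
    if "w \<in> aut C n" for w
    using Nk_compose_iff[OF h that] chr(1)[OF h] inv_chr_compose[OF h] chr_compose[OF h] chr_compose[OF _ h]
      K.m_comm[OF chr(1)[OF h] chr(1)] by (auto simp: chs_def)
  show "basis K h \<otimes>\<^bsub>A\<^esub> chs = chr h \<odot>\<^bsub>FG\<^esub> chs"
  proof
    fix y
    show "(basis K h \<otimes>\<^bsub>A\<^esub> chs) y = (chr h \<odot>\<^bsub>FG\<^esub> chs) y"
    proof (cases "y \<in> aut C n")
      case True
      define w where "w = compose {1..n} (ainv C n h) y"
      have w: "w \<in> aut C n" "y = compose {1..n} h w"
        unfolding w_def using aut_compose[OF True ainv(1)[OF ha]] ainv_cancel(1)[OF ha True] by auto
      show ?thesis unfolding w(2) basis_mult_eval(1)[OF ha w(1) chs_closed] free_mod_simps using 1(1)[OF w(1)] by simp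
    qed (use free_mod_carrierD(3) m in metis)
  qed
  show "chs \<otimes>\<^bsub>A\<^esub> basis K h = chr h \<odot>\<^bsub>FG\<^esub> chs"
  proof
    fix y
    show "(chs \<otimes>\<^bsub>A\<^esub> basis K h) y = (chr h \<odot>\<^bsub>FG\<^esub> chs) y"
    proof (cases "y \<in> aut C n")
      case True
      define w where "w = compose {1..n} y (ainv C n h)"
      have w: "w \<in> aut C n" "y = compose {1..n} w h"
        unfolding w_def using aut_compose[OF ainv(1)[OF ha] True] ainv_cancel(4)[OF ha True] by auto
      show ?thesis unfolding w(2) basis_mult_eval(2)[OF ha w(1) chs_closed] free_mod_simps using 1(2)[OF w(1)] by simp
    qed (use free_mod_carrierD(3) m in metis)
  qed
qed

text \<open>If \<open>eps g i\<close> and \<open>eps g j\<close> act equally on all of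
  \<open>L\<close>, their group parts differ by an element \<open>k\<close> that acts by the product
  of the two signs. So \<open>k\<close> is in \<open>Nk\<close>, and \<open>chs\<close> absorbs it
  at the cost of that scalar, which restores the sign of \<open>eps g j\<close>.\<close>

lemma chs_eps:
  assumes Z: "ZL = carrier L" and g: "g \<in> aut C (n+1)" and i: "i \<in> {1..n+1}" and j: "j \<in> {1..n+1}"
  shows "eps g i \<otimes>\<^bsub>A\<^esub> chs = eps g j \<otimes>\<^bsub>A\<^esub> chs"
proof -
  define a b hi hj where "a = sgn1 (i + g i)" and "b = sgn1 (j + g j)"
    and "hi = gp C n (compose {1..n} g (del n i))" and "hj = gp C n (compose {1..n} g (del n j))"
  have hi: "hi \<in> aut C n" and hj: "hj \<in> aut C n" unfolding hi_def hj_def using aut_del(4)[OF g] i j by auto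
  have a: "a \<in> carrier K" "a \<otimes>\<^bsub>K\<^esub> a = \<one>\<^bsub>K\<^esub>" and b: "b \<in> carrier K"
    unfolding a_def b_def by (simp_all add: sgn1_closed sgn1_square)
  have rel: "a \<odot>\<^bsub>Lk\<^esub> ga hi v = b \<odot>\<^bsub>Lk\<^esub> ga hj v" if v: "v \<in> carrier Lk" for v
  proof -
    have v': "v \<in> carrier L" using v by (simp add: Lk_simps)
    then have "v \<in> ZL" using Z by simp
    then have "eps g i \<odot>\<^bsub>L\<^esub> v = eps g j \<odot>\<^bsub>L\<^esub> v" using g i j unfolding ZL_iff by blast
    then show ?thesis
      unfolding eps_def a_def[symmetric] b_def[symmetric] hi_def[symmetric] hj_def[symmetric]
        scaled_basis_smult[OF a(1) hi v'] scaled_basis_smult[OF b hj v'] .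
  qed
  define k where "k = compose {1..n} (ainv C n hj) hi"
  have k: "k \<in> aut C n" and hik: "hi = compose {1..n} hj k"
    unfolding k_def using aut_compose[OF hi ainv(1)[OF hj]] ainv_cancel(1)[OF hj hi] by auto
  have gak: "ga k v = a \<otimes>\<^bsub>K\<^esub> b \<odot>\<^bsub>Lk\<^esub> v" if v: "v \<in> carrier Lk" for v
  proof -
    note c = ga_closed[OF hi v] ga_closed[OF hj v]
    have "ga hi v = a \<odot>\<^bsub>Lk\<^esub> (a \<odot>\<^bsub>Lk\<^esub> ga hi v)" using a c by (simp add: Lk.smult_assoc1[symmetric])
    also have "\<dots> = a \<otimes>\<^bsub>K\<^esub> b \<odot>\<^bsub>Lk\<^esub> ga hj v" using a b c rel[OF v] by (simp add: Lk.smult_assoc1)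
    finally have "ga k v = ga (ainv C n hj) (a \<otimes>\<^bsub>K\<^esub> b \<odot>\<^bsub>Lk\<^esub> ga hj v)"
      unfolding k_def using ga_compose[OF ainv(1)[OF hj] hi v] by simp
    also have "\<dots> = a \<otimes>\<^bsub>K\<^esub> b \<odot>\<^bsub>Lk\<^esub> ga (ainv C n hj) (ga hj v)"
      using linear_mapsD(3)[OF ga_linear[OF ainv(1)[OF hj]] _ c(2)] a b by simp
    also have "ga (ainv C n hj) (ga hj v) = v"
      using ga_compose[OF ainv(1)[OF hj] hj v] ainv(3)[OF hj] ga_idm[OF v] by simp
    finally show ?thesis .
  qed
  have ab: "a \<otimes>\<^bsub>K\<^esub> b \<in> carrier K" using a b by simp
  have kN: "k \<in> Nk" by (rule NkI[OF k ab gak])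
  have ck: "chr k = a \<otimes>\<^bsub>K\<^esub> b" by (rule chr_eqI[OF kN ab gak[OF v0(1)]])
  have cF: "chs \<in> carrier FG" using chs_closed by (simp add: A_simps)
  note bi = K.basis_carrier[OF hi] and bj = K.basis_carrier[OF hj]
  have bc: "basis K hj \<otimes>\<^bsub>A\<^esub> chs \<in> carrier FG"
    using L.R.m_closed[OF basis_A[OF hj] chs_closed] by (simp add: A_simps(1))
  have "eps g i \<otimes>\<^bsub>A\<^esub> chs = a \<odot>\<^bsub>FG\<^esub> (basis K hi \<otimes>\<^bsub>A\<^esub> chs)"
    unfolding eps_def a_def[symmetric] hi_def[symmetric] by (rule linear_mapsD(3)[OF A_linear_left[OF cF] a(1) bi])
  also have "basis K hi \<otimes>\<^bsub>A\<^esub> chs = basis K hj \<otimes>\<^bsub>A\<^esub> (basis K k \<otimes>\<^bsub>A\<^esub> chs)"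
    unfolding hik basis_mult[symmetric] by (rule L.R.m_assoc[OF basis_A[OF hj] basis_A[OF k] chs_closed])
  also have "\<dots> = a \<otimes>\<^bsub>K\<^esub> b \<odot>\<^bsub>FG\<^esub> (basis K hj \<otimes>\<^bsub>A\<^esub> chs)"
    unfolding chs_mult(1)[OF kN] ck by (rule linear_mapsD(3)[OF A_linear_right[OF bj] ab cF])
  also have "a \<odot>\<^bsub>FG\<^esub> (a \<otimes>\<^bsub>K\<^esub> b \<odot>\<^bsub>FG\<^esub> (basis K hj \<otimes>\<^bsub>A\<^esub> chs)) = b \<odot>\<^bsub>FG\<^esub> (basis K hj \<otimes>\<^bsub>A\<^esub> chs)"
    using a b ab bc by (simp add: FG.smult_assoc1[symmetric] K.m_assoc[symmetric])
  also have "\<dots> = eps g j \<otimes>\<^bsub>A\<^esub> chs"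
    unfolding eps_def b_def[symmetric] hj_def[symmetric] by (rule linear_mapsD(3)[OF A_linear_left[OF cF] b bj, symmetric])
  finally show ?thesis .
qed

definition coset :: "(nat \<Rightarrow> nat) \<Rightarrow> (nat \<Rightarrow> nat) set" where
  "coset w = (\<lambda>k. compose {1..n} k w) ` Nk"

text \<open>Chosen from the coset alone, so that all elements of a coset share one
  representative.\<close>

definition rp :: "(nat \<Rightarrow> nat) \<Rightarrow> nat \<Rightarrow> nat" where
  "rp y = (SOME w. w \<in> coset y)"

lemma coset_compose:
  assumes k: "k \<in> Nk" and y: "y \<in> aut C n"
  shows "coset (compose {1..n} k y) = coset y"
proof -
  have "compose {1..n} h (compose {1..n} k y) \<in> coset y" if h: "h \<in> Nk" for h
    unfolding coset_def aut_assoc[OF Nk_aut[OF h] Nk_aut[OF k] y, symmetric] using Nk_compose[OF h k] by blast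
  moreover have "compose {1..n} h y \<in> coset (compose {1..n} k y)" if h: "h \<in> Nk" for h
  proof -
    have "compose {1..n} h y = compose {1..n} (compose {1..n} h (ainv C n k)) (compose {1..n} k y)"
      using aut_assoc[OF Nk_aut[OF h] ainv(1)[OF Nk_aut[OF k]] aut_compose[OF y Nk_aut[OF k]]]
        ainv_cancel(2)[OF Nk_aut[OF k] y] by simp
    then show ?thesis unfolding coset_def using Nk_compose[OF h ainv_Nk[OF k]] by blast
  qed
  ultimately show ?thesis unfolding coset_def by blast
qed

lemma rp:
  assumes y: "y \<in> aut C n"
  shows "rp y \<in> aut C n" "coset (rp y) = coset y" "rp (rp y) = rp y" "\<exists>k\<in>Nk. y = compose {1..n} k (rp y)"
proof -
  have "compose {1..n} (idm n) y \<in> coset y" unfolding coset_def using idm_Nk(1) by blast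
  then have "rp y \<in> coset y" unfolding rp_def by (rule someI[of "\<lambda>w. w \<in> coset y"])
  then obtain k where k: "k \<in> Nk" "rp y = compose {1..n} k y" unfolding coset_def by blast
  show "rp y \<in> aut C n" unfolding k(2) by (rule aut_compose[OF y Nk_aut[OF k(1)]])
  show co: "coset (rp y) = coset y" unfolding k(2) by (rule coset_compose[OF k(1) y])
  have "rp z = rp y" if "coset z = coset y" for z unfolding rp_def that ..
  then show "rp (rp y) = rp y" using co by blast
  show "\<exists>k\<in>Nk. y = compose {1..n} k (rp y)"
  proof (rule bexI)
    show "y = compose {1..n} (ainv C n k) (rp y)" using ainv_cancel(2)[OF Nk_aut[OF k(1)] y] k(2) by simp
  qed (rule ainv_Nk[OF k(1)])
qed

lemma rp_unique:
  assumes y: "y \<in> rp ` aut C n" and z: "z \<in> rp ` aut C n" and k: "k \<in> Nk" "z = compose {1..n} k y"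
  shows "z = y"
proof -
  have ya: "y \<in> aut C n" and ry: "rp y = y" using y rp(1,3) by auto
  have rz: "rp z = z" using z rp(3) by auto
  have "coset z = coset y" unfolding k(2) by (rule coset_compose[OF k(1) ya])
  then show ?thesis using ry rz unfolding rp_def by metis
qed

text \<open>If \<open>chs \<otimes> a = 0\<close> then \<open>a\<close> acts as zero: both sides are unchanged when \<open>a\<close> is rewritten as a
  combination of representatives of the cosets of \<open>Nk\<close>, and for such \<open>a\<close> the coefficients of \<open>a\<close>
  can be read off from \<open>chs \<otimes> a\<close>.\<close>

lemma chs_mult_nonzero:
  assumes a: "a \<in> carrier A" and v: "v \<in> carrier L" and ne: "a \<odot>\<^bsub>L\<^esub> v \<noteq> \<zero>\<^bsub>L\<^esub>"
  shows "chs \<otimes>\<^bsub>A\<^esub> a \<noteq> \<zero>\<^bsub>A\<^esub>"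
proof
  assume z: "chs \<otimes>\<^bsub>A\<^esub> a = \<zero>\<^bsub>A\<^esub>"
  let ?X = "rp ` aut C n"
  let ?F = "free_mod K ?X"
  interpret F: module K ?F by (rule K.free_mod_module)
  have aF: "a \<in> carrier FG" and cF: "chs \<in> carrier FG" using a chs_closed by (auto simp: A_simps)
  have v': "v \<in> carrier Lk" using v by (simp add: Lk_simps)
  have incl: "b \<in> carrier FG" if "b \<in> carrier ?F" for b
  proof (rule free_mod_carrierI)
    show "b w = \<zero>\<^bsub>K\<^esub>" if "w \<notin> aut C n" for w
      using that rp(1) by (intro free_mod_carrierD(3)[OF \<open>b \<in> carrier ?F\<close>]) blast
  qed (rule free_mod_carrierD[OF that])+
  have incl_lin: "(\<lambda>b. b) \<in> linear_maps K ?F FG"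
    by (rule linear_mapsI) (auto simp: incl free_mod_simps)
  define ky where "ky y = (SOME k. k \<in> Nk \<and> y = compose {1..n} k (rp y))" for y
  have ky: "ky y \<in> Nk" "y = compose {1..n} (ky y) (rp y)" if y: "y \<in> aut C n" for y
  proof -
    have "\<exists>k. k \<in> Nk \<and> y = compose {1..n} k (rp y)" using rp(4)[OF y] by blast
    from someI_ex[OF this] show "ky y \<in> Nk" "y = compose {1..n} (ky y) (rp y)" unfolding ky_def by blast+
  qed
  \<comment> \<open>Write \<open>y\<close> as \<open>k\<close> after its representative. Both in the
    action on \<open>L\<close> and behind \<open>chs\<close>, the factor \<open>k\<close> may be
    replaced by the scalar \<open>chr k\<close>; \<open>\<phi>\<close> performs this replacement and
    \<open>\<rho>\<close> extends it linearly.\<close>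
  define \<phi> where "\<phi> y = chr (ky y) \<odot>\<^bsub>?F\<^esub> basis K (rp y)" for y
  have \<phi>: "\<phi> y \<in> carrier ?F" if "y \<in> aut C n" for y
    unfolding \<phi>_def using chr(1)[OF ky(1)[OF that]] that by (intro F.smult_closed K.basis_carrier) auto
  have \<phi>_eq: "\<phi> y = chr (ky y) \<odot>\<^bsub>FG\<^esub> basis K (rp y)" for y by (simp add: \<phi>_def free_mod_simps)
  define \<rho> where "\<rho> = lift K ?F \<phi>"
  have \<rho>: "\<rho> \<in> linear_maps K FG ?F" unfolding \<rho>_def by (rule F.lift_linear[OF \<phi>])
  have \<rho>': "\<rho> \<in> linear_maps K FG FG" using linear_maps_comp[OF \<rho> incl_lin] .
  have \<rho>b: "\<rho> (basis K y) = \<phi> y" if "y \<in> aut C n" for y unfolding \<rho>_def by (rule F.lift_basis[of \<phi>, OF \<phi>[OF that]])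
  have 1: "\<rho> a \<odot>\<^bsub>L\<^esub> v = a \<odot>\<^bsub>L\<^esub> v"
  proof (rule K.free_mod_linear_eq[OF Lk_ab linear_maps_comp[OF \<rho>' lsmult_linear_left[OF v]] lsmult_linear_left[OF v] _ aF])
    fix y assume y: "y \<in> aut C n"
    note r = rp(1)[OF y]
    have "\<rho> (basis K y) \<odot>\<^bsub>L\<^esub> v = chr (ky y) \<odot>\<^bsub>Lk\<^esub> ga (rp y) v"
      unfolding \<rho>b[OF y] \<phi>_eq by (rule scaled_basis_smult[OF chr(1)[OF ky(1)[OF y]] r v])
    also have "\<dots> = ga (ky y) (ga (rp y) v)" by (rule chr(2)[OF ky(1)[OF y] ga_closed[OF r v'], symmetric])
    also have "\<dots> = ga (compose {1..n} (ky y) (rp y)) v" by (rule ga_compose[OF Nk_aut[OF ky(1)[OF y]] r v', symmetric])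
    also have "\<dots> = ga y v" using ky(2)[OF y] by simp
    finally show "\<rho> (basis K y) \<odot>\<^bsub>L\<^esub> v = basis K y \<odot>\<^bsub>L\<^esub> v" by (simp add: ga_def)
  qed
  have 2: "chs \<otimes>\<^bsub>A\<^esub> \<rho> a = chs \<otimes>\<^bsub>A\<^esub> a"
  proof (rule K.free_mod_linear_eq[OF FG.M.abelian_group_axioms linear_maps_comp[OF \<rho>' A_linear_right[OF cF]] A_linear_right[OF cF] _ aF])
    fix y assume y: "y \<in> aut C n"
    note r = rp(1)[OF y] and k = ky(1)[OF y]
    have "chs \<otimes>\<^bsub>A\<^esub> basis K y = chs \<otimes>\<^bsub>A\<^esub> (basis K (ky y) \<otimes>\<^bsub>A\<^esub> basis K (rp y))"
      unfolding basis_mult ky(2)[OF y, symmetric] ..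
    also have "\<dots> = (chs \<otimes>\<^bsub>A\<^esub> basis K (ky y)) \<otimes>\<^bsub>A\<^esub> basis K (rp y)"
      by (rule L.R.m_assoc[OF chs_closed basis_A[OF Nk_aut[OF k]] basis_A[OF r], symmetric])
    also have "\<dots> = chr (ky y) \<odot>\<^bsub>FG\<^esub> (chs \<otimes>\<^bsub>A\<^esub> basis K (rp y))"
      unfolding chs_mult(2)[OF k] by (rule linear_mapsD(3)[OF A_linear_left[OF K.basis_carrier[OF r]] chr(1)[OF k] cF])
    also have "\<dots> = chs \<otimes>\<^bsub>A\<^esub> \<rho> (basis K y)"
      unfolding \<rho>b[OF y] \<phi>_eq by (rule linear_mapsD(3)[OF A_linear_right[OF cF] chr(1)[OF k] K.basis_carrier[OF r], symmetric])
    finally show "chs \<otimes>\<^bsub>A\<^esub> \<rho> (basis K y) = chs \<otimes>\<^bsub>A\<^esub> basis K y" by simp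
  qed
  \<comment> \<open>Distinct representatives do not differ by an element of \<open>Nk\<close>, and
    \<open>chs\<close> has coefficient 1 at the identity. So multiplication by \<open>chs\<close>
    keeps the coefficients at the representatives.\<close>
  have 3: "(chs \<otimes>\<^bsub>A\<^esub> b) w = b w" if b: "b \<in> carrier ?F" and w: "w \<in> ?X" for b w
  proof (rule K.free_mod_linear_eq[OF Kmod_ab linear_maps_comp[OF incl_lin linear_maps_comp[OF A_linear_right[OF cF] eval_linear]] eval_linear _ b])
    fix y assume y: "y \<in> ?X"
    have ya: "y \<in> aut C n" and wa: "w \<in> aut C n" using y w rp(1) by auto
    define u where "u = compose {1..n} w (ainv C n y)"
    have u: "u \<in> aut C n" "w = compose {1..n} u y"
      unfolding u_def using aut_compose[OF ainv(1)[OF ya] wa] ainv_cancel(4)[OF ya wa] by auto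
    have "(chs \<otimes>\<^bsub>A\<^esub> basis K y) w = chs u" unfolding u(2) by (rule basis_mult_eval(2)[OF ya u(1) chs_closed])
    also have "\<dots> = (if w = y then \<one>\<^bsub>K\<^esub> else \<zero>\<^bsub>K\<^esub>)"
    proof (cases "w = y")
      case True
      then have "u = idm n" unfolding u_def using ainv(2)[OF ya] by simp
      then show ?thesis using True idm_Nk by (simp add: chs_def)
    next
      case False
      then have "u \<notin> Nk" using rp_unique[OF y w _ u(2)] by blast
      then show ?thesis using False by (simp add: chs_def)
    qed
    finally show "(chs \<otimes>\<^bsub>A\<^esub> basis K y) w = basis K y w" unfolding basis_apply .
  qed
  have r: "\<rho> a \<in> carrier ?F" by (rule linear_mapsD(1)[OF \<rho> aF])
  have "\<rho> a w = \<zero>\<^bsub>K\<^esub>" for w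
  proof (cases "w \<in> ?X")
    case True
    then show ?thesis using 3[OF r True] 2 z by (simp add: A_simps(4) free_mod_simps)
  next
    case False
    then show ?thesis by (rule free_mod_carrierD(3)[OF r])
  qed
  then have "\<rho> a = \<zero>\<^bsub>FG\<^esub>" by (auto simp: free_mod_simps)
  then have "\<rho> a \<odot>\<^bsub>L\<^esub> v = \<zero>\<^bsub>L\<^esub>"
    using linear_maps_hom(1)[OF FG.M.abelian_group_axioms Lk_ab lsmult_linear_left[OF v]] by (simp add: Lk_simps)
  then show False using 1 ne by simp
qed

end

end

section \<open>The projective cover compared with \<lambda>\<close>

context kgmod
begin

lemma ZL_left_ideal_iff:
  assumes irr: "irreducible_lmodule A L" and e: "e \<in> carrier A" "e \<otimes>\<^bsub>A\<^esub> e = e"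
    and p: "p \<in> linear_maps A (left_ideal A e) L" "p ` carrier (left_ideal A e) = carrier L"
    and superfluous: "\<And>U. \<lbrakk>submodule U A (left_ideal A e);
      U <+>\<^bsub>left_ideal A e\<^esub> a_kernel (left_ideal A e) L p = carrier (left_ideal A e)\<rbrakk> \<Longrightarrow> U = carrier (left_ideal A e)"
  shows "kgmod.ZL K C n (left_ideal A e) \<noteq> {\<zero>\<^bsub>left_ideal A e\<^esub>} \<longleftrightarrow> ZL \<noteq> {\<zero>\<^bsub>L\<^esub>}"
proof -
  let ?P = "left_ideal A e"
  interpret P: kgmod K C n ?P
    by (rule kgmod.intro[OF field_K n1 lmodule_left_ideal[OF L.R.ring_axioms e(1)]])
  have ops: "\<zero>\<^bsub>?P\<^esub> = \<zero>\<^bsub>A\<^esub>" "\<And>x y. x \<oplus>\<^bsub>?P\<^esub> y = x \<oplus>\<^bsub>A\<^esub> y" "\<And>a x. a \<odot>\<^bsub>?P\<^esub> x = a \<otimes>\<^bsub>A\<^esub> x"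
    by (auto simp: left_ideal_def)
  have mem: "a \<otimes>\<^bsub>A\<^esub> e \<in> carrier ?P" if "a \<in> carrier A" for a using that by (auto simp: left_ideal_def)
  have PA: "x \<in> carrier A" and Pe: "x \<otimes>\<^bsub>A\<^esub> e = x" if x: "x \<in> carrier ?P" for x
  proof -
    obtain a where a: "a \<in> carrier A" "x = a \<otimes>\<^bsub>A\<^esub> e" using x by (auto simp: left_ideal_def)
    show "x \<in> carrier A" using a e(1) by simp
    show "x \<otimes>\<^bsub>A\<^esub> e = x" using L.R.m_assoc[OF a(1) e(1) e(1)] e(2) a(2) by simp
  qed
  have eP: "e \<in> carrier ?P" using mem[OF e(1)] e(2) by simp
  note p_hom = linear_maps_hom[OF P.L.M.abelian_group_axioms L.M.abelian_group_axioms p(1)] and pD = linear_mapsD[OF p(1)]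
  show ?thesis
  proof
    assume "P.ZL \<noteq> {\<zero>\<^bsub>?P\<^esub>}"
    then obtain x where x: "x \<in> P.ZL" "x \<noteq> \<zero>\<^bsub>A\<^esub>" using P.ZL_zero_mem by (auto simp: ops)
    have xP: "x \<in> carrier ?P" using x(1) by (simp add: P.ZL_iff)
    note xA = PA[OF xP]
    have xF: "x \<in> carrier FG" using xA by (simp add: A_simps)
    obtain h where h: "x h \<noteq> \<zero>\<^bsub>K\<^esub>" using x(2) by (auto simp: A_simps(4) free_mod_simps)
    have ha: "h \<in> aut C n" using free_mod_carrierD(3)[OF xF] h by blast
    note hi = ainv[OF ha]
    \<comment> \<open>Translating by the inverse of \<open>h\<close> moves a nonzero coefficient of
      \<open>x\<close> to the identity. Since \<open>y e = y\<close>, symmetry of the trace form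
      gives \<open>e y\<close> the same coefficient there.\<close>
    define y where "y = basis K (ainv C n h) \<otimes>\<^bsub>A\<^esub> x"
    have yZ: "y \<in> P.ZL"
      using submoduleD(6)[OF P.ZL_submodule basis_A[OF hi(1)] x(1)] by (simp add: y_def ops)
    then have yP: "y \<in> carrier ?P" by (simp add: P.ZL_iff)
    have "y (idm n) = x h"
      using basis_mult_eval(1)[OF hi(1) ha xA] hi(3) by (simp add: y_def)
    moreover have "(e \<otimes>\<^bsub>A\<^esub> y) (idm n) = y (idm n)"
      using trace_comm[OF e(1) PA[OF yP]] Pe[OF yP] by simp
    ultimately have ey: "e \<otimes>\<^bsub>A\<^esub> y \<noteq> \<zero>\<^bsub>A\<^esub>" using h by (auto simp: A_simps(4) free_mod_simps)
    define Q where "Q = {z \<in> carrier ?P. z \<otimes>\<^bsub>A\<^esub> y = \<zero>\<^bsub>A\<^esub>}"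
    have Q: "submodule Q A ?P"
    proof (intro submodule.intro submodule_axioms.intro)
      show "subgroup Q (add_monoid ?P)"
      proof (rule group.subgroupI[OF P.L.M.a_group])
        show "Q \<subseteq> carrier (add_monoid ?P)" by (auto simp: Q_def)
        show "Q \<noteq> {}" using P.L.M.zero_closed PA[OF yP] by (auto simp: Q_def ops)
        fix a assume a: "a \<in> Q"
        then have aP: "a \<in> carrier ?P" and ay: "a \<otimes>\<^bsub>A\<^esub> y = \<zero>\<^bsub>A\<^esub>" by (auto simp: Q_def)
        have neg: "\<ominus>\<^bsub>?P\<^esub> a = \<ominus>\<^bsub>A\<^esub> a"
        proof (rule L.R.minus_equality[symmetric])
          show "\<ominus>\<^bsub>?P\<^esub> a \<oplus>\<^bsub>A\<^esub> a = \<zero>\<^bsub>A\<^esub>" using P.L.M.l_neg[OF aP] by (simp add: ops)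
        qed (use aP PA in auto)
        have "\<ominus>\<^bsub>?P\<^esub> a \<in> Q"
          using P.L.M.a_inv_closed[OF aP] L.R.l_minus[OF PA[OF aP] PA[OF yP]] ay by (simp add: Q_def neg)
        then show "inv\<^bsub>add_monoid ?P\<^esub> a \<in> Q" by (simp add: a_inv_def)
        fix b assume b: "b \<in> Q"
        then have bP: "b \<in> carrier ?P" and b_y: "b \<otimes>\<^bsub>A\<^esub> y = \<zero>\<^bsub>A\<^esub>" by (auto simp: Q_def)
        have "a \<oplus>\<^bsub>?P\<^esub> b \<in> Q"
          using P.L.M.a_closed[OF aP bP] L.R.l_distr[OF PA[OF aP] PA[OF bP] PA[OF yP]] ay b_y by (simp add: Q_def ops)
        then show "a \<otimes>\<^bsub>add_monoid ?P\<^esub> b \<in> Q" by simp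
      qed
      show "a \<odot>\<^bsub>?P\<^esub> z \<in> Q" if a: "a \<in> carrier A" and z: "z \<in> Q" for a z
      proof -
        have zP: "z \<in> carrier ?P" and zy: "z \<otimes>\<^bsub>A\<^esub> y = \<zero>\<^bsub>A\<^esub>" using z by (auto simp: Q_def)
        show ?thesis
          using P.L.lsmult_closed[OF a zP] L.R.m_assoc[OF a PA[OF zP] PA[OF yP]] zy a by (simp add: Q_def ops)
      qed
    qed
    have Q_ne: "Q \<noteq> carrier ?P" using eP ey by (auto simp: Q_def)
    have pQ: "p z = \<zero>\<^bsub>L\<^esub>" if z: "z \<in> Q" for z
    proof (rule ccontr)
      assume nz: "p z \<noteq> \<zero>\<^bsub>L\<^esub>"
      note QD = submoduleD[OF Q]
      have "submodule (p ` Q) A L"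
      proof (intro submodule.intro submodule_axioms.intro)
        show "subgroup (p ` Q) (add_monoid L)"
        proof (rule group.subgroupI[OF L.M.a_group])
          show "p ` Q \<subseteq> carrier (add_monoid L)" using pD(1) QD(1) by auto
          show "p ` Q \<noteq> {}" using QD(2) by blast
          fix a assume "a \<in> p ` Q"
          then obtain q where q: "q \<in> Q" "a = p q" by blast
          have "\<ominus>\<^bsub>L\<^esub> a = p (\<ominus>\<^bsub>?P\<^esub> q)" using p_hom(2) q QD(1) by auto
          then have "\<ominus>\<^bsub>L\<^esub> a \<in> p ` Q" using QD(4)[OF q(1)] by blast
          then show "inv\<^bsub>add_monoid L\<^esub> a \<in> p ` Q" by (simp add: a_inv_def)
          fix b assume "b \<in> p ` Q"
          then obtain r where r: "r \<in> Q" "b = p r" by blast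
          have "a \<oplus>\<^bsub>L\<^esub> b = p (q \<oplus>\<^bsub>?P\<^esub> r)" using pD(2)[OF subsetD[OF QD(1) q(1)] subsetD[OF QD(1) r(1)]] q r by simp
          then have "a \<oplus>\<^bsub>L\<^esub> b \<in> p ` Q" using QD(3)[OF q(1) r(1)] by blast
          then show "a \<otimes>\<^bsub>add_monoid L\<^esub> b \<in> p ` Q" by simp
        qed
        show "a \<odot>\<^bsub>L\<^esub> b \<in> p ` Q" if a: "a \<in> carrier A" and b: "b \<in> p ` Q" for a b
        proof -
          obtain q where q: "q \<in> Q" "b = p q" using b by blast
          have "a \<odot>\<^bsub>L\<^esub> b = p (a \<odot>\<^bsub>?P\<^esub> q)" using pD(3)[OF a] q QD(1) by auto
          then show ?thesis using QD(6)[OF a q(1)] by blast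
        qed
      qed
      then have full: "p ` Q = carrier L" using irr z nz unfolding irreducible_lmodule_def by blast
      have "Q <+>\<^bsub>?P\<^esub> a_kernel ?P L p = carrier ?P"
      proof
        show "Q <+>\<^bsub>?P\<^esub> a_kernel ?P L p \<subseteq> carrier ?P"
          using QD(1) P.L.M.a_closed by (auto simp: set_add_def' a_kernel_def')
        show "carrier ?P \<subseteq> Q <+>\<^bsub>?P\<^esub> a_kernel ?P L p"
        proof
          fix w assume w: "w \<in> carrier ?P"
          then obtain q where q: "q \<in> Q" "p q = p w" using full pD(1)[OF w] by (metis imageE)
          have qP: "q \<in> carrier ?P" using q(1) QD(1) by blast
          have "p (w \<ominus>\<^bsub>?P\<^esub> q) = \<zero>\<^bsub>L\<^esub>" using p_hom(3)[OF w qP] q(2) pD(1)[OF w] by (simp add: L.M.minus_eq_zero_iff)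
          then have k: "w \<ominus>\<^bsub>?P\<^esub> q \<in> a_kernel ?P L p" using w qP by (simp add: a_kernel_def')
          have "w = q \<oplus>\<^bsub>?P\<^esub> (w \<ominus>\<^bsub>?P\<^esub> q)"
            using w qP P.L.M.a_lcomm[of q w "\<ominus>\<^bsub>?P\<^esub> q"] by (simp add: a_minus_def P.L.M.r_neg)
          then show "w \<in> Q <+>\<^bsub>?P\<^esub> a_kernel ?P L p" using q(1) k unfolding set_add_def' by blast
        qed
      qed
      then show False using superfluous[OF Q] Q_ne by blast
    qed
    have "carrier L \<subseteq> ZL"
    proof
      fix v assume v: "v \<in> carrier L"
      then obtain z where z: "z \<in> carrier ?P" "v = p z" using p(2) by blast
      note zA = PA[OF z(1)]
      have zyZ: "z \<otimes>\<^bsub>A\<^esub> y \<in> P.ZL" using submoduleD(6)[OF P.ZL_submodule zA yZ] by (simp add: ops)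
      show "v \<in> ZL" unfolding ZL_iff
      proof (intro conjI v ballI)
        fix g i j assume g: "g \<in> aut C (n+1)" and i: "i \<in> {1..n+1}" and j: "j \<in> {1..n+1}"
        note ei = eps_closed[OF g i] and ej = eps_closed[OF g j]
        note c = P.L.lsmult_closed[OF ei z(1)] P.L.lsmult_closed[OF ej z(1)]
        have eq: "eps g i \<otimes>\<^bsub>A\<^esub> (z \<otimes>\<^bsub>A\<^esub> y) = eps g j \<otimes>\<^bsub>A\<^esub> (z \<otimes>\<^bsub>A\<^esub> y)"
          using zyZ g i j unfolding P.ZL_iff ops by blast
        have neg: "\<ominus>\<^bsub>?P\<^esub> (eps g j \<odot>\<^bsub>?P\<^esub> z) \<oplus>\<^bsub>A\<^esub> (eps g j \<otimes>\<^bsub>A\<^esub> z) = \<zero>\<^bsub>A\<^esub>"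
          using P.L.M.l_neg[OF c(2)] by (simp add: ops)
        \<comment> \<open>The product \<open>z y\<close> lies in \<open>ZL\<close> of
          \<open>kGe\<close>, so \<open>eps g i\<close> and \<open>eps g j\<close> agree on it.
          Hence \<open>d y = 0\<close>, that is, \<open>d\<close> is in \<open>Q\<close> and is
          killed by \<open>p\<close>.\<close>
        define d where "d = (eps g i \<odot>\<^bsub>?P\<^esub> z) \<ominus>\<^bsub>?P\<^esub> (eps g j \<odot>\<^bsub>?P\<^esub> z)"
        have dP: "d \<in> carrier ?P" unfolding d_def by (rule P.L.M.minus_closed[OF c])
        have "d \<oplus>\<^bsub>A\<^esub> (eps g j \<otimes>\<^bsub>A\<^esub> z) = eps g i \<otimes>\<^bsub>A\<^esub> z"
          using P.L.M.a_assoc[OF c(1) P.L.M.a_inv_closed[OF c(2)] c(2)] P.L.M.l_neg[OF c(2)] P.L.M.r_zero[OF c(1)]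
          by (simp add: d_def a_minus_def ops)
        then have "(d \<otimes>\<^bsub>A\<^esub> y) \<oplus>\<^bsub>A\<^esub> (eps g j \<otimes>\<^bsub>A\<^esub> (z \<otimes>\<^bsub>A\<^esub> y)) = eps g j \<otimes>\<^bsub>A\<^esub> (z \<otimes>\<^bsub>A\<^esub> y)"
          using L.R.l_distr[OF PA[OF dP] _ PA[OF yP], of "eps g j \<otimes>\<^bsub>A\<^esub> z"]
            L.R.m_assoc[OF ei zA PA[OF yP]] L.R.m_assoc[OF ej zA PA[OF yP]] eq ej zA by simp
        then have "d \<otimes>\<^bsub>A\<^esub> y = \<zero>\<^bsub>A\<^esub>"
          using PA[OF dP] PA[OF yP] ej zA by (simp add: L.R.add.l_cancel_one)
        then have "d \<in> Q" using dP by (simp add: Q_def)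
        then have "p d = \<zero>\<^bsub>L\<^esub>" by (rule pQ)
        then have "p (eps g i \<odot>\<^bsub>?P\<^esub> z) = p (eps g j \<odot>\<^bsub>?P\<^esub> z)"
          unfolding d_def using p_hom(3)[OF c] pD(1)[OF c(1)] pD(1)[OF c(2)] by (simp add: L.M.minus_eq_zero_iff)
        then show "eps g i \<odot>\<^bsub>L\<^esub> v = eps g j \<odot>\<^bsub>L\<^esub> v" using pD(3)[OF ei z(1)] pD(3)[OF ej z(1)] z(2) by simp
      qed
    qed
    then show "ZL \<noteq> {\<zero>\<^bsub>L\<^esub>}" using irr L.M.zero_closed unfolding irreducible_lmodule_def by blast
  next
    assume "ZL \<noteq> {\<zero>\<^bsub>L\<^esub>}"
    then have Z: "ZL = carrier L" using irr ZL_submodule unfolding irreducible_lmodule_def by blast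
    obtain v0 where v0: "v0 \<in> carrier Lk" "v0 \<noteq> \<zero>\<^bsub>Lk\<^esub>"
      using irr L.M.zero_closed unfolding irreducible_lmodule_def by (auto simp: Lk_simps)
    \<comment> \<open>Elements of \<open>kGe\<close> satisfy \<open>w = w e\<close>, so
      \<open>p w\<close> is \<open>w\<close> applied to \<open>p e\<close>. As \<open>p\<close> is
      onto, \<open>p e\<close> is nonzero, and \<open>e\<close> fixes it; this shows that
      \<open>e\<close> does not annihilate \<open>L\<close>.\<close>
    have pe: "p e \<in> carrier L" by (rule pD(1)[OF eP])
    have "e \<odot>\<^bsub>L\<^esub> p e = p e" using pD(3)[OF e(1) eP] e(2) by (simp add: ops)
    moreover have "p e \<noteq> \<zero>\<^bsub>L\<^esub>"
    proof
      assume p0: "p e = \<zero>\<^bsub>L\<^esub>"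
      obtain w where w: "w \<in> carrier ?P" "p w = v0" using p(2) v0(1) by (metis Lk_simps(1) imageE)
      have "p w = w \<odot>\<^bsub>L\<^esub> p e" using pD(3)[OF PA[OF w(1)] eP] Pe[OF w(1)] by (simp add: ops)
      also have "\<dots> = \<zero>\<^bsub>L\<^esub>"
        using linear_maps_hom(1)[OF Lk_ab Lk_ab lsmult_linear_right[OF PA[OF w(1)]]] p0 by (simp add: Lk_simps)
      finally show False using w(2) v0(2) by (simp add: Lk_simps)
    qed
    ultimately have ne: "chs \<otimes>\<^bsub>A\<^esub> e \<noteq> \<zero>\<^bsub>A\<^esub>" using chs_mult_nonzero[OF v0 e(1) pe] by simp
    note cA = chs_closed[OF v0]
    have "chs \<otimes>\<^bsub>A\<^esub> e \<in> P.ZL" unfolding P.ZL_iff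
    proof (intro conjI ballI)
      show "chs \<otimes>\<^bsub>A\<^esub> e \<in> carrier ?P" by (rule mem[OF cA])
      fix g i j assume g: "g \<in> aut C (n+1)" and i: "i \<in> {1..n+1}" and j: "j \<in> {1..n+1}"
      show "eps g i \<odot>\<^bsub>?P\<^esub> (chs \<otimes>\<^bsub>A\<^esub> e) = eps g j \<odot>\<^bsub>?P\<^esub> (chs \<otimes>\<^bsub>A\<^esub> e)"
        using L.R.m_assoc[OF eps_closed[OF g i] cA e(1)] L.R.m_assoc[OF eps_closed[OF g j] cA e(1)]
          chs_eps[OF v0 Z g i j] by (simp add: ops)
    qed
    then show "P.ZL \<noteq> {\<zero>\<^bsub>?P\<^esub>}" using ne by (auto simp: ops)
  qed
qed

end

theorem theorem1p7:
  fixes K :: "'k ring" and C :: cat and n :: nat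
    and lam :: "((nat \<Rightarrow> nat) \<Rightarrow> 'k, 'v) module" and e :: "(nat \<Rightarrow> nat) \<Rightarrow> 'k"
  assumes "field K" and "n \<ge> 1"
    and "irreducible_lmodule (kG K C n) lam"
    and "is_e_lambda K C n lam e"
  shows "(regular K C n e \<longrightarrow> irreducible_cmod K C (Delta_tensor K C n lam)) \<and>
         (singular K C n e \<longrightarrow> has_length K C (Delta_tensor K C n lam) 2)"
proof -
  let ?A = "kG K C n"
  let ?P = "left_ideal ?A e"
  interpret V: kgmod K C n lam
    using assms(1-3) by (intro kgmod.intro) (auto simp: irreducible_lmodule_def)
  have e: "e \<in> carrier ?A" "e \<otimes>\<^bsub>?A\<^esub> e = e"
    using assms(4) unfolding is_e_lambda_def primitive_idempotent_def by blast+
  obtain p where p: "p \<in> linear_maps ?A ?P lam" "p ` carrier ?P = carrier lam"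
    and superfluous: "\<And>U. \<lbrakk>submodule U ?A ?P; U <+>\<^bsub>?P\<^esub> a_kernel ?P lam p = carrier ?P\<rbrakk> \<Longrightarrow> U = carrier ?P"
    using assms(4) unfolding is_e_lambda_def projective_cover_def by blast
  interpret P: kgmod K C n ?P
    using assms(1,2) by (intro kgmod.intro) (auto intro: lmodule_left_ideal V.L.R.ring_axioms e(1))
  \<comment> \<open>The criterion for homomorphisms is applied to \<open>kGe\<close> and the length
    computation to \<lambda>; the comparison of the two \<open>ZL\<close> connects them.\<close>
  have "singular K C n e \<longleftrightarrow> P.ZL \<noteq> {\<zero>\<^bsub>?P\<^esub>}"
    unfolding singular_def by (rule P.hom_from_Delta_Suc)
  also have "\<dots> \<longleftrightarrow> V.ZL \<noteq> {\<zero>\<^bsub>lam\<^esub>}"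
    by (rule V.ZL_left_ideal_iff[OF assms(3) e p superfluous])
  finally show ?thesis using V.length_dichotomy[OF assms(3)] by blast
qed

end
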